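(* Let $\Phi$ be an irreducible crystallographic root system in $V=\mathbb{R}^\ell$ with exponents $e_1,\dots,e_\ell$, Coxeter number $h$, and a fixed positive system $\Phi^+$. Then: (1) for every integer $m\ge0$ the cone $\mathbf{c}\mathcal{A}(\Phi^+)^{[-m,m]}$ is free with exponents $(1,e_1+mh,e_2+mh,\dots,e_\ell+mh)$; (2) for every integer $m\ge1$ the cone $\mathbf{c}\mathcal{A}(\Phi^+)^{[1-m,m]}$ is free with exponents $(1,mh,mh,\dots,mh)$.
   Context: For $\alpha\in\Phi^+$ and $k\in\mathbb{Z}$, $H_{\alpha,k}=\{v\in V:\alpha(v)=k\}$. For integers $p\le q$, $[p,q]=\{p,p+1,\dots,q\}$, and $\mathcal{A}(\Phi^+)^{[p,q]}=\{H_{\alpha,k}:\alpha\in\Phi^+,k\in[p,q]\}$ is an affine arrangement in $V$. Its cone $\mathbf{c}\mathcal{A}(\Phi^+)^{[p,q]}$ is the central arrangement in $\mathbb{R}\times V$ (coordinates $(x_0,x_1,\dots,x_\ell)$) consisting of the hyperplanes $\{\alpha-kx_0=0\}$ for $\alpha\in\Phi^+$, $k\in[p,q]$, together with $H_\infty=\{x_0=0\}$. A central arrangement $\mathcal{B}$ in $\mathbb{R}^{n}$ is free with exponents $(d_1,\dots,d_n)$ if $D(\mathcal{B})=\{\delta\in\mathrm{Der}:\delta(\alpha_H)\in\alpha_HS\ \forall H\in\mathcal{B}\}$ ($S$ the polynomial ring, $\alpha_H$ a defining form of $H$) is a free $S$-module with homogeneous basis of polynomial degrees $d_1,\dots,d_n$.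 *)

theory Defs
  imports "HOL-Analysis.Analysis" "HOL-Library.Multiset"
begin

section \<open>Root systems (V = real^'n, alpha(v) read as the inner product alpha \<bullet> v)\<close>

definition root_system :: "(real^'n) set \<Rightarrow> bool" where
  "root_system \<Phi> \<longleftrightarrow> finite \<Phi> \<and> 0 \<notin> \<Phi> \<and> span \<Phi> = UNIV
     \<and> (\<forall>\<alpha>\<in>\<Phi>. \<forall>\<beta>\<in>\<Phi>. \<beta> - (2 * (\<beta> \<bullet> \<alpha>) / (\<alpha> \<bullet> \<alpha>)) *\<^sub>R \<alpha> \<in> \<Phi>)
     \<and> (\<forall>\<alpha>\<in>\<Phi>. \<forall>c::real. c *\<^sub>R \<alpha> \<in> \<Phi> \<longrightarrow> c = 1 \<or> c = -1)
     \<and> (\<forall>\<alpha>\<in>\<Phi>. \<forall>\<beta>\<in>\<Phi>. 2 * (\<beta> \<bullet> \<alpha>) / (\<alpha> \<bullet> \<alpha>) \<in> \<int>)"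

definition irreducible_rs :: "(real^'n) set \<Rightarrow> bool" where
  "irreducible_rs \<Phi> \<longleftrightarrow> \<not> (\<exists>A B. A \<noteq> {} \<and> B \<noteq> {} \<and> A \<union> B = \<Phi> \<and> A \<inter> B = {}
      \<and> (\<forall>a\<in>A. \<forall>b\<in>B. a \<bullet> b = 0))"

definition positive_system :: "(real^'n) set \<Rightarrow> (real^'n) set \<Rightarrow> bool" where
  "positive_system \<Phi> P \<longleftrightarrow> (\<exists>v. (\<forall>\<alpha>\<in>\<Phi>. \<alpha> \<bullet> v \<noteq> 0) \<and> P = {\<alpha>\<in>\<Phi>. \<alpha> \<bullet> v > 0})"

definition simple_system :: "(real^'n) set \<Rightarrow> (real^'n) set \<Rightarrow> (real^'n) set \<Rightarrow> bool" where
  "simple_system \<Phi> P \<Delta> \<longleftrightarrow> \<Delta> \<subseteq> P \<and> independent \<Delta>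
     \<and> (\<forall>\<alpha>\<in>\<Phi>. \<exists>c. \<alpha> = (\<Sum>\<beta>\<in>\<Delta>. c \<beta> *\<^sub>R \<beta>)
            \<and> ((\<forall>\<beta>\<in>\<Delta>. c \<beta> \<ge> 0) \<or> (\<forall>\<beta>\<in>\<Delta>. c \<beta> \<le> 0)))"

definition refl_mat :: "real^'n \<Rightarrow> real^'n^'n" where
  "refl_mat \<alpha> = (\<chi> i j. (if i = j then 1 else 0) - 2 * (\<alpha>$i) * (\<alpha>$j) / (\<alpha> \<bullet> \<alpha>))"

definition coxeter_element :: "(real^'n) set \<Rightarrow> (real^'n) set \<Rightarrow> real^'n^'n \<Rightarrow> bool" where
  "coxeter_element \<Phi> P C \<longleftrightarrow> (\<exists>\<Delta> L. simple_system \<Phi> P \<Delta> \<and> distinct L \<and> set L = \<Delta>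
      \<and> C = foldr (\<lambda>\<alpha> M. refl_mat \<alpha> ** M) L (mat 1))"

definition mat_pow :: "'a::comm_ring_1^'n^'n \<Rightarrow> nat \<Rightarrow> 'a^'n^'n" where
  "mat_pow M k = ((\<lambda>N. M ** N) ^^ k) (mat 1)"

definition coxeter_number :: "(real^'n) set \<Rightarrow> (real^'n) set \<Rightarrow> nat \<Rightarrow> bool" where
  "coxeter_number \<Phi> P h \<longleftrightarrow> (\<exists>C. coxeter_element \<Phi> P C \<and> 0 < h \<and> mat_pow C h = mat 1
      \<and> (\<forall>k. 0 < k \<and> k < h \<longrightarrow> mat_pow C k \<noteq> mat 1))"

definition rs_exponents :: "(real^'n) set \<Rightarrow> (real^'n) set \<Rightarrow> nat multiset \<Rightarrow> bool" where
  "rs_exponents \<Phi> P E \<longleftrightarrow> (\<exists>C h. coxeter_element \<Phi> P C \<and> 0 < h \<and> mat_pow C h = mat 1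
      \<and> (\<forall>k. 0 < k \<and> k < h \<longrightarrow> mat_pow C k \<noteq> mat 1)
      \<and> size E = CARD('n) \<and> (\<forall>e\<in>#E. e < h)
      \<and> (\<forall>z::complex. det (mat z - (\<chi> i j. complex_of_real (C$i$j)))
            = (\<Prod>e\<in>#E. z - exp (2 * of_real pi * \<i> * of_nat e / of_nat h))))"

section \<open>Polynomials on real^'k as polynomial functions (faithful since the field is infinite)\<close>

definition monomial_fun :: "('k::finite \<Rightarrow> nat) \<Rightarrow> real^'k \<Rightarrow> real" where
  "monomial_fun m x = (\<Prod>i\<in>UNIV. (x$i) ^ m i)"

definition is_poly :: "(real^'k::finite \<Rightarrow> real) \<Rightarrow> bool" where
  "is_poly p \<longleftrightarrow> (\<exists>M c. finite M \<and> p = (\<lambda>x. \<Sum>m\<in>M. c m * monomial_fun m x))"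

definition homog_poly :: "nat \<Rightarrow> (real^'k::finite \<Rightarrow> real) \<Rightarrow> bool" where
  "homog_poly d p \<longleftrightarrow> (\<exists>M c. finite M \<and> (\<forall>m\<in>M. sum m UNIV = d)
      \<and> p = (\<lambda>x. \<Sum>m\<in>M. c m * monomial_fun m x))"

text \<open>A derivation theta = sum_i theta_i d/dx_i is given by its coefficient polynomials;
  applied to the linear form x \<mapsto> a \<bullet> x it gives sum_i a_i theta_i.\<close>
definition deriv_apply :: "('k \<Rightarrow> real^'k::finite \<Rightarrow> real) \<Rightarrow> real^'k \<Rightarrow> real^'k \<Rightarrow> real" where
  "deriv_apply \<theta> a = (\<lambda>x. \<Sum>i\<in>UNIV. a$i * \<theta> i x)"

text \<open>Central arrangement given by its set of defining forms (normal vectors).\<close>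
definition der_module :: "(real^'k::finite) set \<Rightarrow> ('k \<Rightarrow> real^'k \<Rightarrow> real) set" where
  "der_module B = {\<theta>. (\<forall>i. is_poly (\<theta> i))
      \<and> (\<forall>a\<in>B. \<exists>g. is_poly g \<and> (\<forall>x. deriv_apply \<theta> a x = (a \<bullet> x) * g x))}"

definition free_with_exponents :: "(real^'k::finite) set \<Rightarrow> nat multiset \<Rightarrow> bool" where
  "free_with_exponents B ds \<longleftrightarrow> (\<exists>(\<beta> :: 'k \<Rightarrow> 'k \<Rightarrow> real^'k \<Rightarrow> real) deg.
      (\<forall>j. \<beta> j \<in> der_module B \<and> (\<forall>i. homog_poly (deg j) (\<beta> j i)))
      \<and> image_mset deg (mset_set UNIV) = ds
      \<and> (\<forall>\<delta>\<in>der_module B. \<exists>!f. (\<forall>j. is_poly (f j))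
            \<and> \<delta> = (\<lambda>i x. \<Sum>j\<in>UNIV. f j x * \<beta> j i x)))"

text \<open>Cone of A(Phi+)^[p,q] in R x V, coordinates indexed by 'n option (None = x_0):
  forms alpha - k x_0 and x_0.\<close>
definition cone_arr :: "(real^'n) set \<Rightarrow> int \<Rightarrow> int \<Rightarrow> (real^('n option)) set" where
  "cone_arr P p q =
     {(\<chi> i. case i of None \<Rightarrow> - of_int k | Some j \<Rightarrow> \<alpha>$j) | \<alpha> k. \<alpha> \<in> P \<and> k \<in> {p..q}}
     \<union> {(\<chi> i. if i = None then 1 else 0)}"

end

theory Submission
 imports Defs "HOL-Computational_Algebra.Polynomial" "HOL-Computational_Algebra.Primes"
begin

text \<open>Start from the empty arrangement and add hyperplanes one height at a time, passing alternately from the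
  Shi arrangement \<open>[1 - m, m]\<close> to the Catalan arrangement \<open>[-m, m]\<close> and on to \<open>[-m, m + 1]\<close>. Restricted to the new
 hyperplane, every derivation of the old arrangement is divisible by a form whose degree is a count over rank two
 subsystems; so only basis elements of one degree obstruct, and that degree rises by one for as many of them as there
 are roots of the given height. In the second passage a degeneration would produce a derivation with multiplicity
 \<open>2m + 1\<close> of too low degree, which is excluded by differentiating along the primitive vector field \<open>eta / Q\<close>. The exponents
 are read off at a regular eigenvector of a Coxeter element, which diagonalises it on an invariant basis.\<close>

section \<open>Polynomial functions on Euclidean spaces\<close>

text \<open>The divisibility count alone does not show that enough basis elements of the critical
  degree restrict nontrivially. In the first passage a point decides it: some point lies on all
  hyperplanes of the current height and on none of those already present, and roots of one height
  are independent. In the second passage there are as many critical basis elements as new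
  hyperplanes, so injectivity suffices; this equality of numbers is the symmetry between
  \<open>d\<close> and \<open>h - d\<close> of the exponents. The critical degrees are
  \<open>m * hh + ht - 1\<close> and \<open>(m + 1) * hh - ht\<close> with
  \<open>hh = 2 |P| / n\<close>, so heights rise in the first passage and fall in the second. At
  first \<open>hh\<close> is only a real number. It is identified with the order of a Coxeter
  element by means of the Catalan case m = 0, which is reached without knowing \<open>h\<close>: its
  basis, averaged over the Weyl group, takes values at the regular eigenvector that diagonalise the
  element. The eigenvalue found there need not be exp(2 pi i / h); congruences of traces modulo
  large primes act as the Galois automorphism that corrects this.\<close>

abbreviation rp :: "('a::euclidean_space => real) => bool" where
 "rp \<equiv> real_polynomial_function"

lemmas rp_intros = real_polynomial_function.intros

lemma rp_inner [intro]: "rp (%x. a \<bullet> x)"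
 by (rule rp_intros(1)) (rule bounded_linear_inner_right)

lemma rp_inner' [intro]: "rp (%x. x \<bullet> a)"
 by (rule rp_intros(1)) (rule bounded_linear_inner_left)

lemma rp_cmult: "rp p ==> rp (%x. c * p x)"
 by (intro rp_intros(2,4))

lemma rp_linear_compose:
 fixes f :: "'b::euclidean_space => 'a::euclidean_space"
 assumes "rp p" "linear f"
 shows "rp (%x. p (f x))"
 using assms(1)
proof induction
 case (linear g)
 then show ?case
  using assms(2) bounded_linear_compose[OF linear, of f]
  by (intro rp_intros(1)) (simp add: linear_conv_bounded_linear)
qed auto

lemma rp_line: "rp p ==> \<exists>u::real poly. \<forall>t. p (a + t *\<^sub>R b) = poly u t"
proof (induction rule: real_polynomial_function.induct)
 case (linear f)
 then have "f (a + t *\<^sub>R b) = poly [:f a, f b:] t" for t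
  by (simp add: linear_simps)
 then show ?case by blast
next
 case (const c)
 have "\<forall>t. c = poly [:c:] t" by simp
 then show ?case by blast
next
 case (add f g)
 then obtain u v where "\<forall>t. f (a + t *\<^sub>R b) = poly u t" "\<forall>t. g (a + t *\<^sub>R b) = poly v t" by blast
 then have "\<forall>t. f (a + t *\<^sub>R b) + g (a + t *\<^sub>R b) = poly (u + v) t" by simp
 then show ?case by blast
next
 case (mult f g)
 then obtain u v where "\<forall>t. f (a + t *\<^sub>R b) = poly u t" "\<forall>t. g (a + t *\<^sub>R b) = poly v t" by blast
 then have "\<forall>t. f (a + t *\<^sub>R b) * g (a + t *\<^sub>R b) = poly (u * v) t" by simp
 then show ?case by blast
qed

text \<open>The line joining a point with p nonzero to a point with q nonzero stays in the subspace,
  and along it both factors are univariate polynomials, which have no zero divisors. On a hyperplane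
  this says that its linear form is prime.\<close>

lemma rp_mult_eq_0_subspace:
 assumes S: "subspace S" and "rp p" "rp q" and z: "!!x. x \<in> S ==> p x * q x = 0"
 shows "(\<forall>x\<in>S. p x = 0) | (\<forall>x\<in>S. q x = 0)"
proof (rule ccontr)
 assume "\<not> ?thesis"
 then obtain x y where xy: "x \<in> S" "p x ~= 0" "y \<in> S" "q y ~= 0" by blast
 obtain u where u: "!!t. p (x + t *\<^sub>R (y - x)) = poly u t" using rp_line[OF assms(2)] by blast
 obtain v where v: "!!t. q (x + t *\<^sub>R (y - x)) = poly v t" using rp_line[OF assms(3)] by blast
 have "x + t *\<^sub>R (y - x) \<in> S" for t
  using S xy by (simp add: subspace_add subspace_diff subspace_scale)
 then have "poly (u * v) t = 0" for t using z u v by (metis poly_mult)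
 then have "u * v = 0" using poly_all_0_iff_0 by blast
 then have "u = 0 | v = 0" by simp
 moreover have "poly u 0 ~= 0" using u[of 0] xy by simp
 moreover have "poly v 1 ~= 0" using v[of 1] xy by simp
 ultimately show False by auto
qed

lemma rp_mult_eq_0:
 assumes "rp p" "rp q" "!!x. p x * q x = 0" "\<exists>x. q x ~= 0"
 shows "p x = 0"
 using rp_mult_eq_0_subspace[OF subspace_UNIV assms(1,2)] assms(3,4) by auto

lemma rp_cancel:
 assumes "rp p" "rp q" "rp c" "!!x. c x * p x = c x * q x" "\<exists>x. c x ~= 0"
 shows "p x = q x"
proof -
 have "p x - q x = 0"
  by (rule rp_mult_eq_0[of "%x. p x - q x" c]) (use assms in \<open>auto simp: algebra_simps\<close>)
 then show ?thesis by simp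
qed

lemma rp_prod_nonzero_subspace:
 assumes S: "subspace S" and "finite I" and "!!i. i \<in> I ==> rp (f i)" and "!!i. i \<in> I ==> \<exists>x\<in>S. f i x ~= 0"
 shows "\<exists>x\<in>S. (\<Prod>i\<in>I. f i x) ~= 0"
 using assms(2-)
proof (induction I)
 case empty
 then show ?case using subspace_0[OF S] by auto
next
 case (insert i I)
 have 1: "rp (%x. \<Prod>i\<in>I. f i x)" "rp (f i)" using insert by auto
 show ?case
 proof (rule ccontr)
  assume "\<not> ?thesis"
  then have "f i x * (\<Prod>i\<in>I. f i x) = 0" if "x \<in> S" for x using insert that by auto
  from rp_mult_eq_0_subspace[OF S 1(2,1) this] insert show False by blast
 qed
qed

text \<open>Division with remainder by a linear form, by induction on the construction of p because
  polynomial functions carry no coefficients. With \<open>a \<bullet> e = 1\<close> the remainder is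
  the restriction of p to the hyperplane, composed with a projection.\<close>

lemma rp_hyperplane_split:
 assumes "rp p"
 shows "\<exists>g. rp g & (\<forall>x. p x = p (x - (a \<bullet> x) *\<^sub>R e) + (a \<bullet> x) * g x)"
 using assms
proof induction
 case (linear f)
 have "f x = f (x - (a \<bullet> x) *\<^sub>R e) + (a \<bullet> x) * f e" for x
  using linear by (simp add: linear_simps)
 then show ?case by blast
next
 case (const c)
 have "\<forall>x. c = c + (a \<bullet> x) * 0" by simp
 then show ?case by blast
next
 case (add f g)
 then obtain u v where u: "rp u" "!!x. f x = f (x - (a \<bullet> x) *\<^sub>R e) + (a \<bullet> x) * u x"
  and v: "rp v" "!!x. g x = g (x - (a \<bullet> x) *\<^sub>R e) + (a \<bullet> x) * v x" by blast
 have "\<forall>x. f x + g x = f (x - (a \<bullet> x) *\<^sub>R e) + g (x - (a \<bullet> x) *\<^sub>R e) + (a \<bullet> x) * (u x + v x)"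
 proof
  fix x
  show "f x + g x = f (x - (a \<bullet> x) *\<^sub>R e) + g (x - (a \<bullet> x) *\<^sub>R e) + (a \<bullet> x) * (u x + v x)"
   using u(2)[of x] v(2)[of x] by (simp add: distrib_left)
 qed
 moreover have "rp (%x. u x + v x)" using u v by auto
 ultimately show ?case by blast
next
 case (mult f g)
 then obtain u v where u: "rp u" "!!x. f x = f (x - (a \<bullet> x) *\<^sub>R e) + (a \<bullet> x) * u x"
  and v: "rp v" "!!x. g x = g (x - (a \<bullet> x) *\<^sub>R e) + (a \<bullet> x) * v x" by blast
 have lin: "linear (%x. x - (a \<bullet> x) *\<^sub>R e)"
  by (rule linearI) (auto simp: algebra_simps)
 let ?w = "%x. u x * g x + f (x - (a \<bullet> x) *\<^sub>R e) * v x"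
 have "f x * g x = f (x - (a \<bullet> x) *\<^sub>R e) * g (x - (a \<bullet> x) *\<^sub>R e) + (a \<bullet> x) * ?w x" for x
 proof -
  have "fx * gx = F * G + A * (U * gx + F * V)" if "fx = F + A * U" "gx = G + A * V" for fx gx F G A U V :: real
   using that by (simp add: algebra_simps)
  from this[OF u(2) v(2)] show ?thesis .
 qed
 moreover have "rp ?w"
  by (intro rp_intros(3,4) u(1) v(1) mult(2) rp_linear_compose[OF mult(1) lin])
 ultimately show ?case by blast
qed

section \<open>Divisibility by linear forms\<close>

definition pdvd :: "('a::euclidean_space => real) => ('a => real) => bool" where
 "pdvd q p \<longleftrightarrow> (\<exists>g. rp g & (\<forall>x. p x = q x * g x))"

lemma pdvdI: "rp g ==> (!!x. p x = q x * g x) ==> pdvd q p"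
 unfolding pdvd_def by blast

lemma pdvdE: assumes "pdvd q p" obtains g where "rp g" "!!x. p x = q x * g x"
 using assms unfolding pdvd_def by blast

lemma pdvd_linear:
 assumes "rp p" "a ~= 0" and "!!x. a \<bullet> x = 0 ==> p x = 0"
 shows "pdvd (%x. a \<bullet> x) p"
proof -
 obtain g where g: "rp g" "!!x. p x = p (x - (a \<bullet> x) *\<^sub>R (a /\<^sub>R (a \<bullet> a))) + (a \<bullet> x) * g x"
  using rp_hyperplane_split[OF assms(1)] by blast
 have "p (x - (a \<bullet> x) *\<^sub>R (a /\<^sub>R (a \<bullet> a))) = 0" for x
  by (rule assms(3)) (use assms(2) in \<open>simp add: inner_diff_right\<close>)
 then have "!!x. p x = (a \<bullet> x) * g x" using g(2) by (metis add_0)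
 with g(1) show ?thesis by (rule pdvdI)
qed

lemma subspace_hyperplane_inner: "subspace {x. a \<bullet> x = (0::real)}"
 by (simp add: subspace_hyperplane)

text \<open>\<open>c\<close> does not vanish identically on the hyperplane, so it is coprime to the
  form; the factors pass from the product to \<open>g\<close> one at a time.\<close>

lemma pdvd_linear_power_cancel:
 assumes "a ~= 0" "rp c" "\<exists>x. a \<bullet> x = 0 & c x ~= 0" "rp g" "pdvd (%x. (a \<bullet> x) ^ k) (%x. c x * g x)"
 shows "pdvd (%x. (a \<bullet> x) ^ k) g"
 using assms(4,5)
proof (induction k arbitrary: g)
 case 0
 then show ?case by (auto intro: pdvdI[of g])
next
 case (Suc k)
 obtain w where w: "rp w" "!!x. c x * g x = (a \<bullet> x) ^ Suc k * w x" using Suc.prems by (auto elim: pdvdE)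
 have "(\<forall>x\<in>{x. a \<bullet> x = 0}. c x = 0) | (\<forall>x\<in>{x. a \<bullet> x = 0}. g x = 0)"
  by (rule rp_mult_eq_0_subspace[OF subspace_hyperplane_inner assms(2) Suc.prems(1)]) (simp add: w)
 then have "pdvd (%x. a \<bullet> x) g"
  by (intro pdvd_linear) (use assms Suc in auto)
 then obtain g' where g': "rp g'" "!!x. g x = (a \<bullet> x) * g' x" by (auto elim: pdvdE)
 have "c x * g' x = (a \<bullet> x) ^ k * w x" for x
  by (rule rp_cancel[where c = "%x. a \<bullet> x"])
   (use assms(1,2) g' w in \<open>auto simp: mult_ac intro!: exI[of _ a] rp_intros(4)\<close>)
 with w(1) have "pdvd (%x. (a \<bullet> x) ^ k) (%x. c x * g' x)" by (rule pdvdI)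
 from Suc.IH[OF g'(1) this] obtain g'' where "rp g''" "!!x. g' x = (a \<bullet> x) ^ k * g'' x" by (auto elim: pdvdE)
 then show ?case by (intro pdvdI[of g'']) (auto simp: g' mult_ac)
qed

lemma nonparallel_hyperplane_point:
 fixes a b :: "'a::euclidean_space"
 assumes "b ~: span {a}" shows "\<exists>x. a \<bullet> x = 0 & b \<bullet> x ~= 0"
proof (rule ccontr)
 assume n: "\<not> ?thesis"
 show False
 proof (cases "a = 0")
  case True
  then have "b \<bullet> b = 0" using n by (metis inner_zero_left)
  then show False using assms True by (simp add: span_0)
 next
  case False
  let ?x = "b - ((a \<bullet> b) / (a \<bullet> a)) *\<^sub>R a"
  have 0: "a \<bullet> ?x = 0" using False by (simp add: inner_diff_right)
  then have "b \<bullet> ?x = 0" using n by blast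
  with 0 have "?x \<bullet> ?x = 0" by (simp add: inner_diff_left inner_commute)
  then have "?x = 0" using inner_eq_zero_iff by blast
  then have "b = ((a \<bullet> b) / (a \<bullet> a)) *\<^sub>R a" by simp
  then show False using assms by (metis span_base insertI1 span_scale)
 qed
qed

text \<open>Non-proportional forms are coprime: on the hyperplane of a new form the product of the
  earlier ones is nonzero somewhere, so the new power has to divide the cofactor.\<close>

lemma pdvd_prod_linear_powers:
 assumes "finite I" "rp p" "!!i. i \<in> I ==> u i ~= 0"
  and "!!i j. i \<in> I ==> j \<in> I ==> i ~= j ==> u i ~: span {u j}"
  and "!!i. i \<in> I ==> pdvd (%x. (u i \<bullet> x) ^ k i) p"
 shows "pdvd (%x. \<Prod>i\<in>I. (u i \<bullet> x) ^ k i) p"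
 using assms(1,3-)
proof (induction I)
 case empty
 then show ?case using assms(2) by (auto intro: pdvdI[of p])
next
 case (insert i I)
 then have "pdvd (%x. \<Prod>i\<in>I. (u i \<bullet> x) ^ k i) p" by auto
 then obtain g where g: "rp g" "!!x. p x = (\<Prod>i\<in>I. (u i \<bullet> x) ^ k i) * g x" by (auto elim: pdvdE)
 have r: "rp (%x. \<Prod>i\<in>I. (u i \<bullet> x) ^ k i)"
  by (intro real_polynomial_function_prod[OF insert.hyps(1)] real_polynomial_function_power rp_inner)
 have "\<exists>x\<in>{x. u i \<bullet> x = 0}. (\<Prod>i\<in>I. (u i \<bullet> x) ^ k i) ~= 0"
 proof (rule rp_prod_nonzero_subspace[OF subspace_hyperplane_inner insert.hyps(1)])
  fix j assume j: "j \<in> I"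
  show "rp (%x. (u j \<bullet> x) ^ k j)" by auto
  have "u j ~: span {u i}" using insert j by auto
  then show "\<exists>x\<in>{x. u i \<bullet> x = 0}. (u j \<bullet> x) ^ k j ~= 0"
   using nonparallel_hyperplane_point by fastforce
 qed
 then have "pdvd (%x. (u i \<bullet> x) ^ k i) g"
  using insert.prems(3)[of i] g insert.prems(1)[of i] r
  by (intro pdvd_linear_power_cancel[of "u i" "%x. \<Prod>i\<in>I. (u i \<bullet> x) ^ k i" g]) (auto simp: pdvd_def)
 then obtain w where "rp w" "!!x. g x = (u i \<bullet> x) ^ k i * w x" by (auto elim: pdvdE)
 then show ?case using insert g by (intro pdvdI[of w]) (auto simp: mult_ac)
qed

lemma pdvd_prod_linear:
 assumes "finite I" "rp p" "!!i. i \<in> I ==> u i ~= 0"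
  and "!!i j. i \<in> I ==> j \<in> I ==> i ~= j ==> u i ~: span {u j}"
  and "!!i x. i \<in> I ==> u i \<bullet> x = 0 ==> p x = 0"
 shows "pdvd (%x. \<Prod>i\<in>I. u i \<bullet> x) p"
 using pdvd_prod_linear_powers[of I p u "%_. 1"] assms pdvd_linear[of p] by auto

subsection \<open>Homogeneous polynomial functions\<close>

definition hom :: "nat => ('a::euclidean_space => real) => bool" where
 "hom d p \<longleftrightarrow> rp p & (\<forall>c x. p (c *\<^sub>R x) = c ^ d * p x)"

lemma hom_rp: "hom d p ==> rp p" by (simp add: hom_def)
lemma hom_scale: "hom d p ==> p (c *\<^sub>R x) = c ^ d * p x" by (simp add: hom_def)
lemma hom_mult: "hom d p ==> hom e q ==> hom (d + e) (%x. p x * q x)"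
 by (auto simp: hom_def power_add)
lemma hom_add: "hom d p ==> hom d q ==> hom d (%x. p x + q x)"
 by (auto simp: hom_def algebra_simps)
lemma hom_cmult: "hom d p ==> hom d (%x. c * p x)"
 by (auto simp: hom_def rp_cmult)
lemma hom_inner: "hom 1 (%x. a \<bullet> x)" by (auto simp: hom_def)
lemma hom_zero: "hom d (%x. 0)" by (auto simp: hom_def)
lemma hom_const: "hom 0 (%x. c)" by (auto simp: hom_def)
lemma hom_sum: "finite I ==> (!!i. i \<in> I ==> hom d (f i)) ==> hom d (%x. \<Sum>i\<in>I. f i x)"
 by (induction I rule: finite_induct) (auto simp: hom_zero hom_add)
lemma hom_prod: "finite I ==> (!!i. i \<in> I ==> hom (d i) (f i)) ==> hom (\<Sum>i\<in>I. d i) (%x. \<Prod>i\<in>I. f i x)"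
 by (induction I rule: finite_induct) (auto simp: hom_const hom_mult)
lemma hom_power: "hom d f ==> hom (k * d) (%x. f x ^ k)"
 by (auto simp: hom_def power_mult_distrib power_mult[symmetric] mult.commute)
lemma hom_prod_linear: "finite I ==> hom (card I) (%x. \<Prod>i\<in>I. u i \<bullet> x)"
 using hom_prod[of I "%_. 1" "%i x. u i \<bullet> x", OF _ hom_inner] by simp

lemma hom_0_const: "hom 0 p ==> p x = p 0"
 using hom_scale[of 0 p 0 x] by simp

lemma rp_continuous: "rp p ==> continuous_on UNIV p"
 by (simp add: continuous_on_polymonial_function real_polynomial_function_eq)

lemma rp_isCont: "rp p ==> isCont p x"
 using rp_continuous continuous_on_eq_continuous_at open_UNIV by blast

lemma hom_quotient_scale:
 assumes "hom d p" "hom e q" "\<exists>x. q x ~= 0" "rp g" "!!x. p x = q x * g x"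
 shows "c ^ e * g (c *\<^sub>R x) = c ^ d * g x"
proof -
 have lin: "linear (%x::'a. c *\<^sub>R x)" by (simp add: linear_scale_self linearI algebra_simps)
 have "q x * (c ^ e * g (c *\<^sub>R x)) = q x * (c ^ d * g x)" for x
  using assms(1,2,5) hom_scale[OF assms(1), of c x] hom_scale[OF assms(2), of c x] by (simp add: mult_ac)
 then show ?thesis
  by (intro rp_cancel[of "%x. c ^ e * g (c *\<^sub>R x)" "%x. c ^ d * g x" q])
   (use assms rp_linear_compose[OF assms(4) lin] hom_rp[OF assms(2)] in \<open>auto intro!: rp_cmult\<close>)
qed

lemma tendsto_scale_0:
 assumes "rp g" shows "((%c. g (c *\<^sub>R x)) \<longlongrightarrow> g 0) (at (0::real))"
proof -
 have "((%c. c *\<^sub>R x) \<longlongrightarrow> 0 *\<^sub>R x) (at (0::real))" by (intro tendsto_intros)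
 then have "((%c. c *\<^sub>R x) \<longlongrightarrow> 0) (at (0::real))" by simp
 with rp_isCont[OF assms, of 0] show ?thesis by (rule isCont_tendsto_compose)
qed

text \<open>For nonzero scalars the degree of the quotient is read off the scaling identity; the
  scalar 0 is reached by continuity. If the divisor has the larger degree, the same limit forces the
  quotient to vanish, and this is how arguments by too small degree end.\<close>

lemma hom_quotient:
 assumes "hom d p" "hom e q" "\<exists>x. q x ~= 0" "rp g" "!!x. p x = q x * g x"
 shows "e <= d ==> hom (d - e) g" and "d < e ==> g x = 0"
proof -
 note s = hom_quotient_scale[OF assms]
 { assume ed: "e <= d"
  have nz: "g (c *\<^sub>R x) = c ^ (d - e) * g x" if "c ~= 0" for c x
   using s[of c x] that ed by (simp add: power_diff field_simps)
  have "g (0 *\<^sub>R x) = 0 ^ (d - e) * g x" for x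
  proof -
   have "((%c. c ^ (d - e) * g x) \<longlongrightarrow> g 0) (at 0)"
    using tendsto_scale_0[OF assms(4), of x]
    by (rule tendsto_cong[THEN iffD1, rotated]) (auto simp: eventually_at_filter nz)
   moreover have "((%c::real. c ^ (d - e) * g x) \<longlongrightarrow> 0 ^ (d - e) * g x) (at 0)"
    by (intro tendsto_intros)
   ultimately show ?thesis using tendsto_unique[of "at (0::real)"] by fastforce
  qed
  with nz show "hom (d - e) g" using assms(4) unfolding hom_def by metis }
 { assume de: "d < e"
  have "c ^ (e - d) * g (c *\<^sub>R x) = g x" if "c ~= 0" for c
   using s[of c x] that de by (simp add: power_diff field_simps)
  moreover have "((%c::real. c ^ (e - d) * g (c *\<^sub>R x)) \<longlongrightarrow> 0 ^ (e - d) * g 0) (at 0)"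
   by (intro tendsto_intros tendsto_scale_0 assms(4))
  ultimately have "((%c::real. g x) \<longlongrightarrow> 0 ^ (e - d) * g 0) (at 0)"
   by (rule_tac tendsto_cong[THEN iffD1, rotated]) (auto simp: eventually_at_filter)
  then show "g x = 0" using de by (simp add: tendsto_const_iff) }
qed

subsection \<open>Polynomial vector fields\<close>

definition vp :: "('a::euclidean_space => real^'n) => bool" where
 "vp \<theta> \<longleftrightarrow> (\<forall>i. rp (%x. \<theta> x $ i))"

definition vhom :: "nat => ('a::euclidean_space => real^'n) => bool" where
 "vhom d \<theta> \<longleftrightarrow> vp \<theta> & (\<forall>c x. \<theta> (c *\<^sub>R x) = c ^ d *\<^sub>R \<theta> x)"

lemma vp_inner: "vp \<theta> ==> rp (%x. u \<bullet> \<theta> x)"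
 unfolding inner_vec_def vp_def by (auto intro!: rp_cmult)

lemma vp_diff: "vp \<theta> ==> vp \<psi> ==> vp (%x. \<theta> x - \<psi> x)" by (auto simp: vp_def)
lemma vp_scale: "rp p ==> vp \<theta> ==> vp (%x. p x *\<^sub>R \<theta> x)" by (auto simp: vp_def)
lemma vp_const: "vp (%x. c)" by (auto simp: vp_def)
lemma vp_sum: "finite I ==> (!!i. i \<in> I ==> vp (f i)) ==> vp (%x. \<Sum>i\<in>I. f i x)"
 by (auto simp: vp_def)
lemma vhom_vp: "vhom d \<theta> ==> vp \<theta>" by (simp add: vhom_def)
lemma vhom_inner: "vhom d \<theta> ==> hom d (%x. u \<bullet> \<theta> x)"
 by (auto simp: hom_def vhom_def vp_inner)
lemma vhom_iff: "vhom d \<theta> \<longleftrightarrow> (\<forall>i. hom d (%x. \<theta> x $ i))"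
 by (auto simp: hom_def vhom_def vp_def vec_eq_iff)
lemma vhom_scale: "hom e p ==> vhom d \<theta> ==> vhom (e + d) (%x. p x *\<^sub>R \<theta> x)"
 by (auto simp: vhom_iff hom_mult)
lemma vhom_add: "vhom d \<theta> ==> vhom d \<psi> ==> vhom d (%x. \<theta> x + \<psi> x)"
 by (auto simp: vhom_iff hom_add)
lemma vhom_cmult: "vhom d \<theta> ==> vhom d (%x. c *\<^sub>R \<theta> x)"
 by (auto simp: vhom_iff hom_cmult)
lemma vhom_diff: "vhom d \<theta> ==> vhom d \<psi> ==> vhom d (%x. \<theta> x - \<psi> x)"
 using vhom_add[of d \<theta> "%x. (-1) *\<^sub>R \<psi> x"] vhom_cmult[of d \<psi> "-1"] by simp
lemma vhom_sum: "finite I ==> (!!i. i \<in> I ==> vhom d (f i)) ==> vhom d (%x. \<Sum>i\<in>I. f i x)"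
 by (auto simp: vhom_iff intro!: hom_sum)

lemma rp_det:
 fixes \<theta> :: "'n::finite => 'a::euclidean_space => real^'n"
 assumes "!!i. vp (\<theta> i)"
 shows "rp (%x. det (\<chi> i. \<theta> i x))"
 unfolding det_def using assms by (auto simp: vp_def intro!: rp_cmult real_polynomial_function_sum)

lemma hom_det:
 fixes \<theta> :: "'n::finite => 'a::euclidean_space => real^'n"
 assumes "!!i. vhom (d i) (\<theta> i)"
 shows "hom (\<Sum>i\<in>UNIV. d i) (%x. det (\<chi> i. \<theta> i x))"
 unfolding det_def using assms
 by (auto simp: vhom_iff intro!: hom_cmult hom_sum hom_prod)

lemma det_eq_0_orthogonal:
 fixes A :: "real^'n^'n"
 assumes "!!i. \<beta> \<bullet> A $ i = 0" "\<beta> ~= 0"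
 shows "det A = 0"
proof -
 have "A *v \<beta> = 0" using assms(1) by (simp add: matrix_vector_mul_component vec_eq_iff inner_commute)
 then have "\<not> invertible A" using assms(2)
  by (metis invertible_def matrix_vector_mul_assoc matrix_vector_mul_lid matrix_vector_mult_0_right)
 then show ?thesis using invertible_det_nz by blast
qed

text \<open>Where \<open>u j\<close> vanishes, all rows are orthogonal to the fixed vector
  \<open>r j\<close>, so the determinant vanishes. The two vectors differ for a coned hyperplane:
  its normal lies in \<open>real \<times> V\<close>, while the fields take values in V.\<close>

lemma det_pdvd:
 fixes \<theta> :: "'n::finite => 'a::euclidean_space => real^'n"
 assumes "finite A" "!!i. vp (\<theta> i)" "!!j. j \<in> A ==> u j ~= 0" "!!j. j \<in> A ==> r j ~= 0"
  and "!!i j. i \<in> A ==> j \<in> A ==> i ~= j ==> u i ~: span {u j}"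
  and "!!i j x. j \<in> A ==> u j \<bullet> x = 0 ==> r j \<bullet> \<theta> i x = 0"
 shows "pdvd (%x. \<Prod>j\<in>A. u j \<bullet> x) (%x. det (\<chi> i. \<theta> i x))"
proof (rule pdvd_prod_linear[OF assms(1) rp_det])
 fix j x assume "j \<in> A" "u j \<bullet> x = 0"
 then show "det (\<chi> i. \<theta> i x) = 0"
  using assms(4,6) by (intro det_eq_0_orthogonal[of "r j"]) auto
qed (use assms in auto)

lemma cramer_expand:
 fixes A :: "real^'n^'n"
 assumes "det A ~= 0"
 shows "det A *\<^sub>R \<delta> = (\<Sum>i\<in>UNIV. det (\<chi> k. if k = i then \<delta> else A $ k) *\<^sub>R A $ i)"
proof -
 have "invertible A" using assms by (simp add: invertible_det_nz)
 then obtain B where B: "B ** A = mat 1" "A ** B = mat 1" by (auto simp: invertible_def)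
 define c where "c = \<delta> v* B"
 have "\<delta> = c v* A" unfolding c_def by (simp add: vector_matrix_mul_assoc B)
 then have d: "\<delta> = (\<Sum>i\<in>UNIV. c $ i *s A $ i)"
  by (simp add: vec_eq_iff vector_matrix_mult_def mult.commute)
 have r: "row k A = A $ k" for k by (simp add: row_def)
 have "det (\<chi> k. if k = i then \<delta> else A $ k) = c $ i * det A" for i
  using cramer_lemma_transpose[where A=A and x=c and k=i] unfolding r d[symmetric] .
 then show ?thesis by (subst d) (simp add: scaleR_sum_right scalar_mult_eq_scaleR mult.commute)
qed

subsection \<open>Gradients\<close>

definition grad :: "('a::euclidean_space => real) => 'a => 'a" where
 "grad p x = (\<Sum>b\<in>Basis. frechet_derivative p (at x) b *\<^sub>R b)"

lemma grad_unique:
 assumes "(p has_derivative (%h. G \<bullet> h)) (at x)" shows "grad p x = G"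
proof -
 have "frechet_derivative p (at x) = (%h. G \<bullet> h)" using frechet_derivative_at[OF assms] by simp
 then show ?thesis unfolding grad_def by (simp add: euclidean_representation)
qed

lemma rp_grad_ex:
 "rp p ==> \<exists>G. (\<forall>u. rp (%x. u \<bullet> G x)) & (\<forall>x. (p has_derivative (%h. G x \<bullet> h)) (at x))"
proof (induction rule: real_polynomial_function.induct)
 case (linear f)
 let ?g = "\<Sum>b\<in>Basis. f b *\<^sub>R b"
 have "f h = ?g \<bullet> h" for h
 proof -
  have "f h = f (\<Sum>b\<in>Basis. (h \<bullet> b) *\<^sub>R b)" by (simp add: euclidean_representation)
  also have "\<dots> = (\<Sum>b\<in>Basis. (h \<bullet> b) * f b)"
   using linear by (simp add: bounded_linear.linear linear_sum linear_cmul)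
  finally show ?thesis by (simp add: inner_sum_left mult.commute inner_commute[of h])
 qed
 then have e: "f = (%h. ?g \<bullet> h)" by blast
 have "\<forall>x. (f has_derivative (%h. ?g \<bullet> h)) (at x)"
  using bounded_linear_imp_has_derivative[OF linear] e by metis
 then show ?case by (intro exI[of _ "%x. ?g"]) auto
next
 case (const c)
 show ?case by (rule exI[of _ "%x. 0"]) (auto intro!: derivative_eq_intros)
next
 case (add f g)
 then obtain F G where "\<forall>u. rp (%x. u \<bullet> F x)" "\<forall>u. rp (%x. u \<bullet> G x)"
  "\<forall>x. (f has_derivative (%h. F x \<bullet> h)) (at x)" "\<forall>x. (g has_derivative (%h. G x \<bullet> h)) (at x)" by blast
 then show ?case
  by (intro exI[of _ "%x. F x + G x"])
   (auto simp: inner_add_right inner_add_left intro!: has_derivative_add)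
next
 case (mult f g)
 then obtain F G where "\<forall>u. rp (%x. u \<bullet> F x)" "\<forall>u. rp (%x. u \<bullet> G x)"
  "!!x. (f has_derivative (%h. F x \<bullet> h)) (at x)" "!!x. (g has_derivative (%h. G x \<bullet> h)) (at x)" by blast
 note H = this
 have "((%x. f x * g x) has_derivative (%h. (f x *\<^sub>R G x + g x *\<^sub>R F x) \<bullet> h)) (at x)" for x
  using has_derivative_mult[OF H(3) H(4), of x] by (simp add: inner_add_left mult.commute)
 then show ?case using H(1,2) mult.hyps
  by (intro exI[of _ "%x. f x *\<^sub>R G x + g x *\<^sub>R F x"])
   (auto simp: inner_add_right intro!: rp_intros(3,4))
qed

lemma has_derivative_grad: "rp p ==> (p has_derivative (%h. grad p x \<bullet> h)) (at x)"
 using rp_grad_ex[of p] grad_unique by metis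

lemma rp_grad: assumes "rp p" shows "rp (%x. u \<bullet> grad p x)"
proof -
 obtain G where G: "\<forall>u. rp (%x. u \<bullet> G x)" "\<forall>x. (p has_derivative (%h. G x \<bullet> h)) (at x)"
  using rp_grad_ex[OF assms] by blast
 then have "grad p = G" using grad_unique by blast
 then show ?thesis using G by simp
qed

lemma grad_mult: "rp p ==> rp q ==> grad (%x. p x * q x) x = p x *\<^sub>R grad q x + q x *\<^sub>R grad p x"
 using has_derivative_mult[OF has_derivative_grad[of p x] has_derivative_grad[of q x]]
 by (intro grad_unique) (simp add: inner_add_left mult.commute)

lemma grad_inner: "grad (%x. a \<bullet> x) x = a"
 by (intro grad_unique) (auto intro!: derivative_eq_intros)

lemma grad_power: "rp p ==> grad (%x. p x ^ k) x = (real k * p x ^ (k - 1)) *\<^sub>R grad p x"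
 using has_derivative_power[OF has_derivative_grad[of p x], of k]
 by (intro grad_unique) (auto simp: mult_ac)

lemma grad_linear_compose:
 assumes "rp p" "linear f"
 shows "grad (%x. p (f x)) x \<bullet> h = grad p (f x) \<bullet> f h"
proof -
 have "((%x. p (f x)) has_derivative (%h. grad p (f x) \<bullet> f h)) (at x)"
  by (rule has_derivative_compose[OF _ has_derivative_grad[OF assms(1)]])
   (simp add: assms(2) linear_imp_has_derivative)
 moreover have "((%x. p (f x)) has_derivative (%h. grad (%x. p (f x)) x \<bullet> h)) (at x)"
  by (rule has_derivative_grad) (use rp_linear_compose[OF assms] in simp)
 ultimately show ?thesis using has_derivative_unique by metis
qed

lemma euler_homogeneous:
 assumes "hom d p" shows "x \<bullet> grad p x = real d * p x"
proof -
 have "((%c. p (c *\<^sub>R x)) has_derivative (%h. grad p (1 *\<^sub>R x) \<bullet> (h *\<^sub>R x))) (at 1)"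
  by (rule has_derivative_compose[OF _ has_derivative_grad[OF hom_rp[OF assms]]])
   (auto intro!: derivative_eq_intros)
 then have "((%c. c ^ d * p x) has_derivative (%h. h * (x \<bullet> grad p x))) (at (1::real))"
  using assms by (simp add: hom_def inner_commute)
 moreover have "((%c. c ^ d * p x) has_derivative (%h. h * (real d * p x))) (at (1::real))"
  by (auto intro!: derivative_eq_intros)
 ultimately have "(%h::real. h * (x \<bullet> grad p x)) = (%h. h * (real d * p x))"
  using has_derivative_unique by blast
 from fun_cong[OF this, of 1] show ?thesis by simp
qed

context notes split_paired_All [simp del] split_paired_Ex [simp del] begin

section \<open>Derivations killing the coning variable\<close>

text \<open>An affine hyperplane \<open>\<beta> = k\<close> is encoded by the pair \<open>(\<beta>, k)\<close>; its cone has the normal vector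
 \<open>frm (\<beta>, k)\<close> in \<open>real \<times> V\<close>, where the first coordinate is the coning variable. The Euler derivation splits
 off a free summand, so only derivations without a component along that variable are kept.\<close>

definition frm :: "(real^'n) \<times> int => real \<times> (real^'n)" where
 "frm l = (- of_int (snd l), fst l)"

lemma frm_inner: "frm (\<beta>, k) \<bullet> (x0, x) = \<beta> \<bullet> x - of_int k * x0"
 by (simp add: frm_def)

lemma frm_inner': "frm l \<bullet> x = fst l \<bullet> snd x - of_int (snd l) * fst x"
 by (cases x) (simp add: frm_def)

text \<open>Divisibility by the form is expressed as vanishing on the hyperplane, which amounts to
  the same by \<open>pdvd_linear\<close>. As there is no component along the coning variable, only
  \<open>fst l\<close> is paired with the value of \<theta>.\<close>

definition D0 :: "((real^'n) \<times> int) set => (real \<times> (real^'n) => real^'n) set" where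
 "D0 A = {\<theta>. vp \<theta> & (\<forall>l\<in>A. \<forall>x. frm l \<bullet> x = 0 --> fst l \<bullet> \<theta> x = 0)}"

definition npar :: "(real^'n) set => bool" where
 "npar P \<longleftrightarrow> (\<forall>\<beta>\<in>P. \<beta> ~= 0 & (\<forall>\<gamma>\<in>P. \<beta> \<in> span {\<gamma>} --> \<beta> = \<gamma>))"

definition Qf :: "((real^'n) \<times> int) set => real \<times> (real^'n) => real" where
 "Qf A x = (\<Prod>l\<in>A. frm l \<bullet> x)"

text \<open>Saito's criterion taken as the notion of a homogeneous basis. That such a family
  generates the module is derived in \<open>FB_generates\<close>.\<close>

definition FB :: "((real^'n) \<times> int) set => ('n => real \<times> (real^'n) => real^'n) => ('n => nat) => bool" where
 "FB A \<theta> d \<longleftrightarrow> (\<forall>i. \<theta> i \<in> D0 A & vhom (d i) (\<theta> i)) & (\<exists>x. det (\<chi> i. \<theta> i x) ~= 0) & sum d UNIV = card A"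

lemma D0_vp: "\<theta> \<in> D0 A ==> vp \<theta>" by (simp add: D0_def)

lemma D0_mono: "A <= B ==> D0 B <= D0 A" by (auto simp: D0_def)

lemma D0_Un: "D0 (A \<union> B) = D0 A \<inter> D0 B" by (auto simp: D0_def)

lemma D0_insert: "\<theta> \<in> D0 (insert l A) \<longleftrightarrow> \<theta> \<in> D0 A & (\<forall>x. frm l \<bullet> x = 0 --> fst l \<bullet> \<theta> x = 0)"
 by (auto simp: D0_def)

lemma D0_scale: "\<theta> \<in> D0 A ==> rp p ==> (%x. p x *\<^sub>R \<theta> x) \<in> D0 A"
 by (auto simp: D0_def vp_scale)

lemma D0_diff: "\<theta> \<in> D0 A ==> \<psi> \<in> D0 A ==> (%x. \<theta> x - \<psi> x) \<in> D0 A"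
 by (auto simp: D0_def vp_diff inner_diff_right)

lemma D0_sum: "finite I ==> (!!i. i \<in> I ==> f i \<in> D0 A) ==> (%x. \<Sum>i\<in>I. f i x) \<in> D0 A"
 by (auto simp: D0_def vp_sum inner_sum_right)

lemma frm_nonzero: "npar P ==> fst l \<in> P ==> frm l ~= 0"
 by (auto simp: npar_def frm_def zero_prod_def)

lemma frm_nonparallel:
 assumes "npar P" "fst l \<in> P" "fst l' \<in> P" "l ~= l'"
 shows "frm l ~: span {frm l'}"
proof
 assume "frm l \<in> span {frm l'}"
 then obtain c where c: "frm l = c *\<^sub>R frm l'" by (auto simp: span_singleton)
 then have 1: "fst l = c *\<^sub>R fst l'" "of_int (snd l) = c * of_int (snd l')" by (auto simp: frm_def)
 then have "fst l \<in> span {fst l'}" by (simp add: span_scale span_base)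
 then have 2: "fst l = fst l'" "fst l' ~= 0" using assms by (auto simp: npar_def)
 with 1 have "c = 1" by (metis scaleR_cancel_right scaleR_one)
 with 1 2 assms(4) show False by (simp add: prod_eq_iff)
qed

lemma det_D0_pdvd:
 assumes "npar P" "finite A" "fst ` A <= P" "!!i. \<theta> i \<in> D0 A"
 shows "pdvd (Qf A) (%x. det (\<chi> i. \<theta> i x))"
proof -
 have "pdvd (%x. \<Prod>l\<in>A. frm l \<bullet> x) (%x. det (\<chi> i. \<theta> i x))"
 proof (rule det_pdvd[OF assms(2), where r = fst])
  show "!!i. vp (\<theta> i)" using assms(4) D0_vp by blast
 next
  fix l assume "l \<in> A"
  then have l: "fst l \<in> P" using assms(3) by blast
  then show "frm l ~= 0" "fst l ~= 0" using assms(1) frm_nonzero[OF assms(1) l] by (auto simp: npar_def)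
 next
  fix l l' assume "l \<in> A" "l' \<in> A" "l ~= l'" then show "frm l ~: span {frm l'}"
   using assms(3) by (intro frm_nonparallel[OF assms(1)]) auto
 qed (use assms(4) in \<open>auto simp: D0_def\<close>)
 then show ?thesis by (simp add: Qf_def[abs_def])
qed

lemma hom_Qf: "finite A ==> hom (card A) (Qf A)"
 unfolding Qf_def[abs_def] by (rule hom_prod_linear)

lemma Qf_nonzero:
 assumes "npar P" "finite A" "fst ` A <= P" shows "\<exists>x. Qf A x ~= 0"
proof -
 have "\<exists>x\<in>UNIV. (\<Prod>l\<in>A. frm l \<bullet> x) ~= 0"
 proof (rule rp_prod_nonzero_subspace[OF subspace_UNIV assms(2)])
  fix l assume l: "l \<in> A"
  then show "\<exists>x\<in>UNIV. frm l \<bullet> x ~= 0"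
   using assms frm_nonzero[of P l] by (intro bexI[of _ "frm l"]) auto
 qed auto
 then show ?thesis by (simp add: Qf_def)
qed

text \<open>The determinant and the product of the forms both have degree \<open>card A\<close>, so
  their quotient is a constant.\<close>

lemma FB_det:
 assumes "npar P" "finite A" "fst ` A <= P" "FB A \<theta> d"
 shows "\<exists>c. c ~= 0 & (\<forall>x. det (\<chi> i. \<theta> i x) = c * Qf A x)"
proof -
 obtain g where g: "rp g" "!!x. det (\<chi> i. \<theta> i x) = Qf A x * g x"
  using det_D0_pdvd[OF assms(1-3), of \<theta>] assms(4) by (auto simp: FB_def elim: pdvdE)
 have "hom (card A) (%x. det (\<chi> i. \<theta> i x))"
  using hom_det[of d \<theta>] assms(4) by (auto simp: FB_def)
 then have "hom (card A - card A) g"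
  using g hom_Qf[OF assms(2)] Qf_nonzero[OF assms(1-3)] by (intro hom_quotient(1)[where q = "Qf A"]) auto
 then have "g x = g 0" for x using hom_0_const[of g x] by simp
 moreover have "g 0 ~= 0"
 proof
  assume "g 0 = 0"
  then have "det (\<chi> i. \<theta> i x) = 0" for x using g(2)[of x] calculation[of x] by simp
  then show False using assms(4) by (auto simp: FB_def)
 qed
 ultimately show ?thesis using g(2) by (intro exI[of _ "g 0"]) (metis mult.commute)
qed

text \<open>In Cramer's rule one row of the determinant is replaced by \<delta>, which satisfies the
  same vanishing conditions; so the numerators are divisible by the defining polynomial too, and the
  coefficients are polynomials. Separate \<open>u\<close> and \<open>r\<close> let it serve both the
  cone (\<open>D0\<close>) and the mirrors in V (\<open>D1\<close>).\<close>

lemma cramer_module: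
 fixes \<theta> :: "'n::finite => 'a::euclidean_space => real^'n"
 assumes "finite A" "!!i. vp (\<theta> i)" "vp \<delta>" "!!j. j \<in> A ==> u j ~= 0" "!!j. j \<in> A ==> r j ~= 0"
  and "!!i j. i \<in> A ==> j \<in> A ==> i ~= j ==> u i ~: span {u j}"
  and "!!i j x. j \<in> A ==> u j \<bullet> x = 0 ==> r j \<bullet> \<theta> i x = 0"
  and "!!j x. j \<in> A ==> u j \<bullet> x = 0 ==> r j \<bullet> \<delta> x = 0"
  and "c ~= 0" and det: "!!x. det (\<chi> i. \<theta> i x) = c * (\<Prod>j\<in>A. u j \<bullet> x)"
 shows "\<exists>f. (\<forall>i. rp (f i)) & (\<forall>x. \<delta> x = (\<Sum>i\<in>UNIV. f i x *\<^sub>R \<theta> i x))"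
proof -
 let ?q = "%x. \<Prod>j\<in>A. u j \<bullet> x"
 have "\<exists>g. rp g & (\<forall>x. det (\<chi> k. if k = i then \<delta> x else \<theta> k x) = ?q x * g x)" for i
 proof -
  have "pdvd ?q (%x. det (\<chi> k. (if k = i then \<delta> else \<theta> k) x))"
   by (rule det_pdvd[where r = r]) (use assms in auto)
  moreover have "(\<chi> k. (if k = i then \<delta> else \<theta> k) x) = (\<chi> k. if k = i then \<delta> x else \<theta> k x)" for x
   by (simp add: vec_eq_iff)
  ultimately show ?thesis by (simp add: pdvd_def)
 qed
 then obtain g where g: "!!i. rp (g i)" "!!i x. det (\<chi> k. if k = i then \<delta> x else \<theta> k x) = ?q x * g i x" by metis
 have rq: "rp ?q" by (intro real_polynomial_function_prod assms(1) rp_inner)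
 have "\<exists>x\<in>UNIV. ?q x ~= 0"
 proof (rule rp_prod_nonzero_subspace[OF subspace_UNIV assms(1)])
  fix j assume "j \<in> A"
  then show "\<exists>x\<in>UNIV. u j \<bullet> x ~= 0" using assms(4) by (intro bexI[of _ "u j"]) auto
 qed auto
 then have nz: "\<exists>x. ?q x ~= 0" by blast
 have "\<delta> x $ k = (\<Sum>i\<in>UNIV. (g i x / c) *\<^sub>R \<theta> i x) $ k" for x k
 proof (rule rp_cancel[OF _ _ rq _ nz])
  show "rp (%x. \<delta> x $ k)" using assms(3) by (simp add: vp_def)
  have "rp (%x. \<theta> i x $ k)" for i using assms(2) by (simp add: vp_def)
  then show "rp (%x. (\<Sum>i\<in>UNIV. (g i x / c) *\<^sub>R \<theta> i x) $ k)"
   using g(1) by (auto intro!: rp_intros(4) real_polynomial_function_sum)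
  fix x
  show "?q x * \<delta> x $ k = ?q x * (\<Sum>i\<in>UNIV. (g i x / c) *\<^sub>R \<theta> i x) $ k"
  proof (cases "?q x = 0")
   case False
   then have "det (\<chi> i. \<theta> i x) ~= 0" using det assms(9) by simp
   from cramer_expand[OF this, of "\<delta> x"]
   moreover have "(\<chi> k. if k = i then \<delta> x else (\<chi> i. \<theta> i x) $ k) = (\<chi> k. if k = i then \<delta> x else \<theta> k x)" for i
    by (simp add: vec_eq_iff)
   ultimately have "(c * ?q x) *\<^sub>R \<delta> x = (\<Sum>i\<in>UNIV. (?q x * g i x) *\<^sub>R \<theta> i x)"
    by (simp add: g det)
   then have "c * ?q x * \<delta> x $ k = ?q x * (\<Sum>i\<in>UNIV. g i x * \<theta> i x $ k)"
    by (auto simp: vec_eq_iff sum_distrib_left mult.assoc)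
   then show ?thesis using assms(9) by (simp add: field_simps sum_divide_distrib[symmetric])
  next
   case True then show ?thesis by simp
  qed
 qed
 then have "\<delta> x = (\<Sum>i\<in>UNIV. (g i x / c) *\<^sub>R \<theta> i x)" for x by (simp add: vec_eq_iff)
 with g(1) show ?thesis by (intro exI[of _ "%i x. g i x / c"]) auto
qed

lemma FB_generates:
 assumes "npar P" "finite A" "fst ` A <= P" "FB A \<theta> d" "\<delta> \<in> D0 A"
 shows "\<exists>f. (\<forall>i. rp (f i)) & (\<forall>x. \<delta> x = (\<Sum>i\<in>UNIV. f i x *\<^sub>R \<theta> i x))"
proof -
 obtain c where c: "c ~= 0" "!!x. det (\<chi> i. \<theta> i x) = c * Qf A x" using FB_det[OF assms(1-4)] by blast
 have th: "\<theta> i \<in> D0 A" for i using assms(4) by (auto simp: FB_def)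
 have P: "fst l \<in> P" if "l \<in> A" for l using assms(3) that by blast
 show ?thesis
 proof (rule cramer_module[where A = A and u = frm and r = fst and c = c])
  show "det (\<chi> i. \<theta> i x) = c * (\<Prod>l\<in>A. frm l \<bullet> x)" for x using c(2) by (simp add: Qf_def)
  fix l l' i x assume l: "l \<in> A"
  show "frm l ~= 0" using frm_nonzero[OF assms(1) P[OF l]] .
  show "fst l ~= 0" using assms(1) P[OF l] by (simp add: npar_def)
  show "frm l ~: span {frm l'}" if "l' \<in> A" "l ~= l'"
   using frm_nonparallel[OF assms(1) P[OF l] P[OF that(1)] that(2)] .
  show "fst l \<bullet> \<theta> i x = 0" if "frm l \<bullet> x = 0" using th[of i] l that unfolding D0_def by blast
  show "fst l \<bullet> \<delta> x = 0" if "frm l \<bullet> x = 0" using assms(5) l that unfolding D0_def by blast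
 qed (use assms(2,5) c(1) th D0_vp in blast)+
qed

section \<open>Adding hyperplanes\<close>

text \<open>\<open>B\<close> stands for a form of degree \<open>D\<close> dividing all restrictions
  of \<open>fst h \<bullet> \<delta>\<close> to the hyperplane of \<open>h\<close>; its degree
  enters only through the two clauses. Basis elements of degree below \<open>D\<close> are therefore
  harmless, and those of degree \<open>D\<close> restrict to constant multiples of
  \<open>B\<close>.\<close>

definition obst :: "((real^'n) \<times> int) set => (real^'n) \<times> int => nat => (real \<times> (real^'n) => real) => bool" where
 "obst A h D B \<longleftrightarrow> (\<forall>\<delta>\<in>D0 A. \<forall>e. vhom e \<delta> -->
   (e < D --> (\<forall>x. frm h \<bullet> x = 0 --> fst h \<bullet> \<delta> x = 0)) \<and>
   (D <= e --> (\<exists>g. hom (e - D) g & (\<forall>x. frm h \<bullet> x = 0 --> fst h \<bullet> \<delta> x = g x * B x))))"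

lemma obst_mono: "obst A h D B ==> A <= A' ==> obst A' h D B"
 unfolding obst_def using D0_mono by blast

lemma obst_low: "obst A h D B ==> \<delta> \<in> D0 A ==> vhom e \<delta> ==> e < D ==> \<delta> \<in> D0 (insert h A)"
 unfolding obst_def D0_insert by blast

lemma obst_exact:
 assumes "obst A h D B" "\<delta> \<in> D0 A" "vhom D \<delta>"
 shows "\<exists>c. \<forall>x. frm h \<bullet> x = 0 --> fst h \<bullet> \<delta> x = c * B x"
proof -
 obtain g where "hom 0 g" "\<forall>x. frm h \<bullet> x = 0 --> fst h \<bullet> \<delta> x = g x * B x"
  using assms unfolding obst_def by (metis diff_self_eq_0 order_refl)
 then show ?thesis using hom_0_const by metis
qed

lemma det_rows_add_multiple:
 fixes R :: "'n::finite => real^'n"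
 assumes "finite S" "p ~: S"
 shows "det (\<chi> i. if i \<in> S then R i + q i *\<^sub>R R p else R i) = det (\<chi> i. R i)"
 using assms
proof (induction S)
 case (insert k S)
 let ?M = "\<chi> i. if i \<in> S then R i + q i *\<^sub>R R p else R i"
 have "(\<chi> i. if i \<in> insert k S then R i + q i *\<^sub>R R p else R i) = (\<chi> i. if i = k then row k ?M + q k *s row p ?M else row i ?M)"
  using insert by (auto simp: vec_eq_iff row_def)
 moreover have "det \<dots> = det ?M"
  using insert.prems by (intro det_row_operation) auto
 ultimately show ?case using insert by simp
qed simp

lemma det_pivot:
 fixes R :: "'n::finite => real^'n"
 shows "det (\<chi> i. if i = p then a *\<^sub>R R p else R i - q i *\<^sub>R R p) = a * det (\<chi> i. R i)"
proof -
 have "(\<chi> i. if i = p then a *\<^sub>R R p else R i - q i *\<^sub>R R p) =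
  (\<chi> i. if i = p then a *s R p else R i - q i *\<^sub>R R p)" by (simp add: vec_eq_iff)
 also have "det \<dots> = a * det (\<chi> i. if i = p then R p else R i - q i *\<^sub>R R p)"
  by (rule det_row_mul)
 also have "(\<chi> i. if i = p then R p else R i - q i *\<^sub>R R p) =
  (\<chi> i. if i \<in> - {p} then R i + (- q i) *\<^sub>R R p else R i)" by (simp add: vec_eq_iff)
 also have "det \<dots> = det (\<chi> i. R i)" by (rule det_rows_add_multiple) auto
 finally show ?thesis .
qed

text \<open>Elimination with a pivot of degree exactly D: it restricts to a nonzero multiple of B,
  so polynomial multiples of it clear the restrictions of the other elements without changing their
  degrees, and the pivot itself is multiplied by the new form. The determinant gains just this form.
  Other elements of degree D change by constant multiples of the pivot, which the batch version
  relies on.\<close>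

lemma FB_add_hyperplane:
 assumes FB: "FB A \<theta> d" and A: "finite A" "h ~: A" and ob: "obst A h D B" and p: "d p = D"
  and piv: "\<exists>x. frm h \<bullet> x = 0 & fst h \<bullet> \<theta> p x ~= 0" and h: "frm h ~= 0"
 shows "\<exists>\<theta>'. FB (insert h A) \<theta>' (d(p := Suc D)) & (\<forall>i. i ~= p & d i = D --> (\<exists>c. \<forall>x. \<theta>' i x = \<theta> i x - c *\<^sub>R \<theta> p x))"
proof -
 have th: "\<theta> i \<in> D0 A" "vhom (d i) (\<theta> i)" for i using FB by (auto simp: FB_def)
 obtain c where c: "!!x. frm h \<bullet> x = 0 ==> fst h \<bullet> \<theta> p x = c * B x"
  using obst_exact[OF ob th(1)[of p]] th(2)[of p] p by auto
 have c0: "c ~= 0" using piv c by auto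
 have "\<exists>q. rp q & (d i < D --> q = (%x. 0)) & (D <= d i --> hom (d i - D) q) \<and>
  (\<forall>x. frm h \<bullet> x = 0 --> fst h \<bullet> (\<theta> i x - q x *\<^sub>R \<theta> p x) = 0)" for i
 proof (cases "d i < D")
  case True
  then show ?thesis using ob th[of i] unfolding obst_def by (intro exI[of _ "%x. 0"]) auto
 next
  case False
  then obtain g where g: "hom (d i - D) g" "\<forall>x. frm h \<bullet> x = 0 --> fst h \<bullet> \<theta> i x = g x * B x"
   using ob th[of i] unfolding obst_def by (meson not_less)
  have "hom (d i - D) (%x. (1 / c) * g x)" by (rule hom_cmult[OF g(1)])
  moreover have "fst h \<bullet> (\<theta> i x - ((1 / c) * g x) *\<^sub>R \<theta> p x) = 0" if "frm h \<bullet> x = 0" for x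
   using g(2) c[OF that] c0 that by (simp add: inner_diff_right)
  ultimately show ?thesis using False by (intro exI[of _ "%x. (1 / c) * g x"] conjI) (auto intro: hom_rp)
 qed
 then obtain q where q: "!!i. rp (q i)" "!!i. d i < D ==> q i = (%x. 0)" "!!i. D <= d i ==> hom (d i - D) (q i)"
  "!!i x. frm h \<bullet> x = 0 ==> fst h \<bullet> (\<theta> i x - q i x *\<^sub>R \<theta> p x) = 0" by metis
 define \<theta>' where "\<theta>' i = (if i = p then (%x. (frm h \<bullet> x) *\<^sub>R \<theta> p x) else (%x. \<theta> i x - q i x *\<^sub>R \<theta> p x))" for i
 have vh: "vhom ((d(p := Suc D)) i) (\<theta>' i)" for i
 proof (cases "i = p")
  case True
  then show ?thesis using vhom_scale[OF hom_inner th(2)[of p], of "frm h"] p by (simp add: \<theta>'_def)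
 next
  case False
  show ?thesis
  proof (cases "d i < D")
   case True
   then show ?thesis using False th(2)[of i] q(2) by (simp add: \<theta>'_def)
  next
   case F2: False
   then have "vhom (d i) (%x. q i x *\<^sub>R \<theta> p x)" using vhom_scale[OF q(3) th(2)[of p], of i] p by simp
   then show ?thesis using False vhom_diff[OF th(2)[of i]] by (simp add: \<theta>'_def)
  qed
 qed
 have mem: "\<theta>' i \<in> D0 (insert h A)" for i
  unfolding D0_insert using th(1) q(1,4) by (auto simp: \<theta>'_def intro!: D0_diff D0_scale)
 have dt: "det (\<chi> i. \<theta>' i x) = (frm h \<bullet> x) * det (\<chi> i. \<theta> i x)" for x
 proof -
  have "(\<chi> i. \<theta>' i x) = (\<chi> i. if i = p then (frm h \<bullet> x) *\<^sub>R \<theta> p x else \<theta> i x - q i x *\<^sub>R \<theta> p x)"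
   by (simp add: vec_eq_iff \<theta>'_def)
  then show ?thesis by (simp only: det_pivot[where R = "%i. \<theta> i x" and q = "%i. q i x"])
 qed
 have "\<exists>x. det (\<chi> i. \<theta>' i x) ~= 0"
 proof (rule ccontr)
  assume "\<not> ?thesis"
  then have z: "(frm h \<bullet> x) * det (\<chi> i. \<theta> i x) = 0" for x using dt by simp
  have "frm h \<bullet> x = 0" for x
   by (rule rp_mult_eq_0[OF rp_inner rp_det[OF vhom_vp[OF th(2)]]]) (use z FB in \<open>auto simp: FB_def\<close>)
  then show False using h inner_eq_zero_iff by blast
 qed
 moreover have "sum (d(p := Suc D)) UNIV = Suc (sum d UNIV)"
 proof -
  have "sum (d(p := Suc D)) UNIV = Suc D + sum d (UNIV - {p})"
   by (subst sum.remove[of _ p]) (auto intro!: sum.cong)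
  moreover have "sum d UNIV = D + sum d (UNIV - {p})" using p by (subst sum.remove[of _ p]) auto
  ultimately show ?thesis by simp
 qed
 ultimately have "FB (insert h A) \<theta>' (d(p := Suc D))" using vh mem FB A by (auto simp: FB_def)
 moreover have "\<exists>c. \<forall>x. \<theta>' i x = \<theta> i x - c *\<^sub>R \<theta> p x" if "i ~= p" "d i = D" for i
  using q(3)[of i] that hom_0_const[of "q i"] by (intro exI[of _ "q i 0"]) (auto simp: \<theta>'_def)
 ultimately show ?thesis by blast
qed

text \<open>Surjectivity onto the values \<open>y\<close> survives each addition: prescribing the
  value 0 at the hyperplane just added eliminates the pivot, and the rest of K has changed by
  multiples of the pivot only. R collects the pivots.\<close>

lemma FB_add_batch:
 assumes "finite G" "FB A \<theta> d" "finite A" "G \<inter> A = {}" "!!h. h \<in> G ==> frm h ~= 0"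
  "!!h. h \<in> G ==> obst A h D (B h)" "!!h. h \<in> G ==> \<exists>x. frm h \<bullet> x = 0 & B h x ~= 0" "!!i. i \<in> K ==> d i = D"
  "!!y. \<exists>t. \<forall>h\<in>G. \<forall>x. frm h \<bullet> x = 0 --> fst h \<bullet> (\<Sum>i\<in>K. t i *\<^sub>R \<theta> i x) = y h * B h x"
 shows "\<exists>\<theta>' R. R <= K & card R = card G & FB (A \<union> G) \<theta>' (%i. if i \<in> R then Suc (d i) else d i)"
 using assms
proof (induction G arbitrary: A \<theta> d K rule: finite_induct)
 case empty
 then show ?case by (intro exI[of _ \<theta>] exI[of _ "{}"]) auto
next
 case (insert h G)
 note FB = insert.prems(1) and dK = insert.prems(7) and surj = insert.prems(8)
 have finK: "finite K" by simp
 have th: "\<theta> i \<in> D0 A" "vhom (d i) (\<theta> i)" for i using FB by (auto simp: FB_def)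
 obtain x0 where x0: "frm h \<bullet> x0 = 0" "B h x0 ~= 0" using insert.prems(6)[of h] by auto
 obtain p where p: "p \<in> K" "\<exists>x. frm h \<bullet> x = 0 & fst h \<bullet> \<theta> p x ~= 0"
 proof -
  obtain t where t: "fst h \<bullet> (\<Sum>i\<in>K. t i *\<^sub>R \<theta> i x0) = 1 * B h x0"
   using surj[of "%_. 1"] x0(1) by (meson insertI1)
  then have "(\<Sum>i\<in>K. t i * (fst h \<bullet> \<theta> i x0)) ~= 0" using x0 by (simp add: inner_sum_right)
  then obtain i where "i \<in> K" "fst h \<bullet> \<theta> i x0 ~= 0" by (metis (mono_tags, lifting) mult_zero_right sum.neutral)
  then show thesis using that x0 by blast
 qed
 obtain \<theta>' where \<theta>': "FB (insert h A) \<theta>' (d(p := Suc D))"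
  "!!i. i ~= p ==> d i = D ==> \<exists>c. \<forall>x. \<theta>' i x = \<theta> i x - c *\<^sub>R \<theta> p x"
 proof -
  have "h ~: A" "frm h ~= 0" using insert.prems(3,4) by auto
  from FB_add_hyperplane[OF FB insert.prems(2) this(1) insert.prems(5)[OF insertI1] dK[OF p(1)] p(2) this(2)]
  show thesis using that by metis
 qed
 have "\<exists>c. i \<in> K - {p} --> (\<forall>x. \<theta>' i x = \<theta> i x - c *\<^sub>R \<theta> p x)" for i
  using \<theta>'(2) dK by blast
 then obtain c where c: "!!i x. i \<in> K - {p} ==> \<theta>' i x = \<theta> i x - c i *\<^sub>R \<theta> p x" by metis
 have th': "\<theta>' i \<in> D0 (insert h A)" for i using \<theta>' by (auto simp: FB_def)
 obtain xp where xp: "frm h \<bullet> xp = 0" "fst h \<bullet> \<theta> p xp ~= 0" using p by blast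
 have "\<exists>t. \<forall>h'\<in>G. \<forall>x. frm h' \<bullet> x = 0 --> fst h' \<bullet> (\<Sum>i\<in>K - {p}. t i *\<^sub>R \<theta>' i x) = y h' * B h' x" for y
 proof -
  obtain t where t: "!!h' x. h' \<in> insert h G ==> frm h' \<bullet> x = 0 ==>
   fst h' \<bullet> (\<Sum>i\<in>K. t i *\<^sub>R \<theta> i x) = (y(h := 0)) h' * B h' x" using surj[of "y(h := 0)"] by blast
  \<comment> \<open>The total coefficient of the pivot after \<theta> has been rewritten through
    \<theta>'. It is 0, as one sees at a point of the hyperplane of \<open>h\<close> where the pivot
    does not vanish.\<close>
  define s where "s = t p + (\<Sum>i\<in>K - {p}. t i * c i)"
  have e: "(\<Sum>i\<in>K. t i *\<^sub>R \<theta> i x) = (\<Sum>i\<in>K - {p}. t i *\<^sub>R \<theta>' i x) + s *\<^sub>R \<theta> p x" for x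
  proof -
   have "(\<Sum>i\<in>K - {p}. t i *\<^sub>R \<theta>' i x) = (\<Sum>i\<in>K - {p}. t i *\<^sub>R \<theta> i x - (t i * c i) *\<^sub>R \<theta> p x)"
    using c by (intro sum.cong refl) (simp add: scaleR_diff_right)
   then show ?thesis unfolding s_def using p(1)
    by (subst sum.remove[of K p]) (auto simp: sum_subtractf scaleR_sum_left algebra_simps)
  qed
  have "fst h \<bullet> (\<Sum>i\<in>K - {p}. t i *\<^sub>R \<theta>' i xp) = 0"
   using th' xp(1) unfolding D0_insert by (simp add: inner_sum_right)
  moreover have "fst h \<bullet> (\<Sum>i\<in>K. t i *\<^sub>R \<theta> i xp) = 0" using t[of h xp] xp by simp
  ultimately have "s * (fst h \<bullet> \<theta> p xp) = 0" using e[of xp] by (simp add: inner_add_right)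
  then have "s = 0" using xp by simp
  then show ?thesis using t e insert.hyps(2) by (intro exI[of _ t]) (auto split: if_splits)
 qed
 then have "\<exists>\<theta>'' R. R <= K - {p} & card R = card G \<and>
  FB (insert h A \<union> G) \<theta>'' (%i. if i \<in> R then Suc ((d(p := Suc D)) i) else (d(p := Suc D)) i)"
  using insert.prems insert.hyps
  by (intro insert.IH[OF \<theta>'(1)]) (auto intro: obst_mono[OF _ subset_insertI])
 then obtain \<theta>'' R where R: "R <= K - {p}" "card R = card G"
  "FB (insert h A \<union> G) \<theta>'' (%i. if i \<in> R then Suc ((d(p := Suc D)) i) else (d(p := Suc D)) i)" by blast
 have "(%i. if i \<in> R then Suc ((d(p := Suc D)) i) else (d(p := Suc D)) i) = (%i. if i \<in> insert p R then Suc (d i) else d i)"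
  using R(1) dK[OF p(1)] by (auto simp: fun_eq_iff)
 moreover have "card (insert p R) = card (insert h G)"
  using R(1,2) insert.hyps finite_subset[OF R(1)] by (subst card_insert_disjoint) auto
 ultimately show ?case using R p(1)
  by (intro exI[of _ \<theta>''] exI[of _ "insert p R"]) auto
qed

section \<open>Terao's polynomial\<close>

lemma common_zero_span:
 fixes a b c :: "'a::euclidean_space"
 assumes "!!x. a \<bullet> x = 0 ==> b \<bullet> x = 0 ==> c \<bullet> x = 0"
 shows "\<exists>s t. c = s *\<^sub>R a + t *\<^sub>R b"
proof -
 obtain y z where yz: "y \<in> span {a, b}" "!!w. w \<in> span {a, b} ==> orthogonal z w" "c = y + z"
  using orthogonal_subspace_decomp_exists[of "{a, b}" c] by metis
 have "a \<bullet> z = 0" "b \<bullet> z = 0"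
  using yz(2)[of a] yz(2)[of b] by (auto simp: span_base orthogonal_def inner_commute)
 then have "c \<bullet> z = 0" by (rule assms)
 moreover have "y \<bullet> z = 0" using yz(2)[OF yz(1)] by (simp add: orthogonal_def inner_commute)
 ultimately have "z \<bullet> z = 0" using yz(3) by (simp add: inner_add_left)
 then have "c \<in> span {a, b}" using yz by simp
 then obtain s where "c - s *\<^sub>R a \<in> span {b}" by (auto simp: span_breakdown_eq)
 then obtain t where "c - s *\<^sub>R a = t *\<^sub>R b" by (auto simp: span_singleton)
 then show ?thesis by (metis add.commute diff_add_cancel)
qed

text \<open>On the hyperplane \<open>a = 0\<close>, the polynomial \<open>b\<^sub>0 f - a g\<^sub>0\<close> with \<open>f = \<delta>(a)\<close> and \<open>g\<^sub>0 = \<delta>(b\<^sub>0)\<close>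
 reduces to \<open>b\<^sub>0 f\<close>, while on the whole space it is divisible by every form through the flat.\<close>

lemma flat_divides:
 assumes P: "npar P" "fst h \<in> P" and cl: "finite cl" "fst ` cl <= P" "h ~: cl" "l0 \<in> cl"
  and par: "!!l. l \<in> cl ==> \<exists>s. s ~= 0 & (\<exists>c. frm l = s *\<^sub>R frm l0 + c *\<^sub>R frm h)"
  and \<delta>: "\<delta> \<in> D0 cl"
 shows "\<exists>g. rp g & (\<forall>x. frm h \<bullet> x = 0 --> fst h \<bullet> \<delta> x = (\<Prod>l\<in>cl - {l0}. frm l \<bullet> x) * g x)"
proof -
 let ?X = "%x. (frm l0 \<bullet> x) * (fst h \<bullet> \<delta> x) - (frm h \<bullet> x) * (fst l0 \<bullet> \<delta> x)"
 have vd: "vp \<delta>" using \<delta> D0_vp by blast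
 have rX: "rp ?X" by (intro real_polynomial_function_diff rp_intros(4) rp_inner vp_inner vd)
 have clP: "fst l \<in> P" if "l \<in> cl" for l using cl(2) that by blast
 have "pdvd (%x. \<Prod>l\<in>cl. frm l \<bullet> x) ?X"
 proof (rule pdvd_prod_linear[OF cl(1) rX])
  fix l x assume l: "l \<in> cl" and z: "frm l \<bullet> x = 0"
  obtain s c where sc: "s ~= 0" "frm l = s *\<^sub>R frm l0 + c *\<^sub>R frm h" using par[OF l] by blast
  then have f: "fst l = s *\<^sub>R fst l0 + c *\<^sub>R fst h" by (simp add: frm_def)
  have 1: "s * (frm l0 \<bullet> x) = - c * (frm h \<bullet> x)" using z sc(2) by (simp add: inner_add_left)
  have "fst l \<bullet> \<delta> x = 0" using \<delta> l z unfolding D0_def by blast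
  then have 2: "s * (fst l0 \<bullet> \<delta> x) = - c * (fst h \<bullet> \<delta> x)" using f by (simp add: inner_add_left)
  have "s * ?X x = (s * (frm l0 \<bullet> x)) * (fst h \<bullet> \<delta> x) - (frm h \<bullet> x) * (s * (fst l0 \<bullet> \<delta> x))"
   by (simp add: algebra_simps)
  also have "\<dots> = 0" unfolding 1 2 by simp
  finally show "?X x = 0" using sc by simp
 next
  fix l l' assume "l \<in> cl" "l' \<in> cl" "l ~= l'"
  then show "frm l ~: span {frm l'}" using frm_nonparallel[OF P(1) clP clP] by blast
 qed (use frm_nonzero[OF P(1) clP] in blast)
 then obtain g where g: "rp g" "!!x. ?X x = (\<Prod>l\<in>cl. frm l \<bullet> x) * g x" by (auto elim: pdvdE)
 let ?pr = "%x. \<Prod>l\<in>cl - {l0}. frm l \<bullet> x"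
 have rpr: "rp ?pr" using cl(1) by (intro real_polynomial_function_prod rp_inner) auto
 have "(frm l0 \<bullet> x) * (fst h \<bullet> \<delta> x - ?pr x * g x) = 0" if "x \<in> {x. frm h \<bullet> x = 0}" for x
  using g(2)[of x] that cl(1,4) by (simp add: prod.remove[of cl l0] algebra_simps)
 moreover have "rp (%x. fst h \<bullet> \<delta> x - ?pr x * g x)"
  by (intro real_polynomial_function_diff rp_intros(4) vp_inner vd rpr g(1))
 ultimately have "(\<forall>x\<in>{x. frm h \<bullet> x = 0}. frm l0 \<bullet> x = 0) | (\<forall>x\<in>{x. frm h \<bullet> x = 0}. fst h \<bullet> \<delta> x - ?pr x * g x = 0)"
  by (intro rp_mult_eq_0_subspace[OF subspace_hyperplane_inner rp_inner]) auto
 moreover have "frm l0 ~: span {frm h}" using frm_nonparallel[OF P(1) clP[OF cl(4)] P(2)] cl by blast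
 then have "\<exists>x. frm h \<bullet> x = 0 & frm l0 \<bullet> x ~= 0" by (rule nonparallel_hyperplane_point)
 ultimately show ?thesis using g(1) by (intro exI[of _ g]) auto
qed

definition flt :: "(real^'n) \<times> int => (real^'n) \<times> int => (real \<times> (real^'n)) set" where
 "flt h l = {x. frm h \<bullet> x = 0 & frm l \<bullet> x = 0}"

lemma flt_eq_imp:
 assumes P: "npar P" "fst h \<in> P" "fst l \<in> P" "l ~= h" and e: "flt h l = flt h l0"
 shows "\<exists>s. s ~= 0 & (\<exists>c. frm l = s *\<^sub>R frm l0 + c *\<^sub>R frm h)"
proof -
 have "frm l0 \<bullet> x = 0 ==> frm h \<bullet> x = 0 ==> frm l \<bullet> x = 0" for x using e unfolding flt_def by blast
 then obtain s c where sc: "frm l = s *\<^sub>R frm l0 + c *\<^sub>R frm h" using common_zero_span by blast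
 moreover have "s ~= 0"
 proof
  assume "s = 0"
  then have "frm l \<in> span {frm h}" using sc by (simp add: span_base span_scale)
  then show False using frm_nonparallel[OF P(1) P(3,2,4)] by blast
 qed
 ultimately show ?thesis by blast
qed

text \<open>The flat at infinity of \<open>h\<close> carries one factor of the coning variable for each hyperplane parallel to \<open>h\<close>.\<close>

lemma terao_polynomial:
 assumes P: "npar P" "fst h \<in> P" and A: "finite A" "fst ` A <= P" "h ~: A"
  and L: "L = {l \<in> A. fst l ~= fst h}" and r: "r = card {l \<in> A. fst l = fst h}"
  and D: "r <= D" "D + card (flt h ` L) <= r + card L"
 shows "\<exists>B. obst A h D B & (\<forall>x. frm h \<bullet> x = 0 & fst x ~= 0 & (\<forall>l\<in>A. frm l \<bullet> x ~= 0) --> B x ~= 0)"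
proof -
 define a where "a = frm h"
 have a0: "a ~= 0" unfolding a_def using frm_nonzero[OF P] .
 \<comment> \<open>Orthogonal projection onto the hyperplane of \<open>h\<close>. Composing with it
   turns divisibility of restrictions into divisibility of polynomials on the whole space.\<close>
 define \<sigma> where "\<sigma> x = x - ((a \<bullet> x) / (a \<bullet> a)) *\<^sub>R a" for x :: "real \<times> (real^'a)"
 have lin: "linear \<sigma>" unfolding \<sigma>_def by (rule linearI) (auto simp: algebra_simps add_divide_distrib)
 have s0: "a \<bullet> \<sigma> x = 0" for x using a0 by (simp add: \<sigma>_def inner_diff_right)
 have sid: "\<sigma> x = x" if "a \<bullet> x = 0" for x using that by (simp add: \<sigma>_def)
 have sym: "y \<bullet> \<sigma> x = \<sigma> y \<bullet> x" for x y by (simp add: \<sigma>_def algebra_simps inner_commute)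
 have LA: "L <= A" "finite L" using L A by auto
 have LP: "fst l \<in> P" if "l \<in> L" for l using A(2) LA that by blast
 have lh: "l ~= h" if "l \<in> L" for l using that L by auto
 have hL: "h ~: L" using lh by blast
 define \<rho> where "\<rho> = inv_into L (flt h)"
 have rho: "\<rho> \<phi> \<in> L" "flt h (\<rho> \<phi>) = \<phi>" if "\<phi> \<in> flt h ` L" for \<phi>
  using that unfolding \<rho>_def by (auto simp: inv_into_into f_inv_into_f)
 \<comment> \<open>One representative per flat is set aside, because \<open>flat_divides\<close>
   loses one factor. The counting hypothesis leaves at least D - r hyperplanes; any M of that size
   gives B the degree D.\<close>
 define R where "R = \<rho> ` flt h ` L"
 have R: "R <= L" "card R = card (flt h ` L)"
  unfolding R_def using rho by (auto intro!: card_image inj_on_inverseI[of _ "flt h"])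
 have "D - r <= card (L - R)" using D R LA by (simp add: card_Diff_subset finite_subset)
 then obtain M where M: "M <= L - R" "card M = D - r" "finite M" by (rule obtain_subset_with_card_n)
 define B where "B x = fst x ^ r * (\<Prod>l\<in>M. frm l \<bullet> x)" for x :: "real \<times> (real^'a)"
 \<comment> \<open>Traces on the hyperplane of \<open>h\<close>: one per flat, and
   \<open>None\<close> for the flat at infinity. Up to a constant, B composed with the projection is
   the product of the forms \<open>u\<close> to the powers \<open>k\<close>, and divisibility can be
   tested form by form.\<close>
 define I where "I = insert None (Some ` flt h ` L)"
 define u where "u o' = (case o' of None => \<sigma> (1, 0) | Some \<phi> => \<sigma> (frm (\<rho> \<phi>)))" for o'
 define k where "k o' = (case o' of None => r | Some \<phi> => card {l \<in> M. flt h l = \<phi>})" for o'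
 have finI: "finite I" using LA by (simp add: I_def)
 have "\<exists>s. l \<in> L --> s ~= 0 & (\<forall>x. frm l \<bullet> \<sigma> x = s * (u (Some (flt h l)) \<bullet> x))" for l
 proof (cases "l \<in> L")
  case True
  have "flt h l = flt h (\<rho> (flt h l))" using rho(2)[of "flt h l"] True by simp
  then obtain s c where "s ~= 0" "frm l = s *\<^sub>R frm (\<rho> (flt h l)) + c *\<^sub>R frm h"
   using flt_eq_imp[OF P LP[OF True] lh[OF True]] by blast
  then show ?thesis using s0 unfolding a_def
   by (intro exI[of _ s]) (simp add: u_def sym[symmetric] inner_add_left)
 qed auto
 then obtain s where s: "!!l. l \<in> L ==> s l ~= 0" "!!l x. l \<in> L ==> frm l \<bullet> \<sigma> x = s l * (u (Some (flt h l)) \<bullet> x)" by metis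
 have fsig: "fst (\<sigma> x) = u None \<bullet> x" for x
  using sym[of "(1, 0)" x] by (cases "\<sigma> x") (simp add: u_def)
 have fold_M: "(\<Prod>l\<in>M. f (flt h l)) = (\<Prod>\<phi>\<in>flt h ` L. f \<phi> ^ card {l \<in> M. flt h l = \<phi>})" for f :: "_ => real"
 proof -
  have "(\<Prod>l\<in>M. f (flt h l)) = (\<Prod>\<phi>\<in>flt h ` L. \<Prod>l\<in>{l \<in> M. flt h l = \<phi>}. f (flt h l))"
   using M LA by (intro prod.group[symmetric]) auto
  also have "\<dots> = (\<Prod>\<phi>\<in>flt h ` L. f \<phi> ^ card {l \<in> M. flt h l = \<phi>})" by (intro prod.cong) auto
  finally show ?thesis .
 qed
 define S where "S = (\<Prod>l\<in>M. s l)"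
 have S0: "S ~= 0" using s M by (auto simp: S_def)
 have Bs: "B (\<sigma> x) = S * (\<Prod>i\<in>I. (u i \<bullet> x) ^ k i)" for x
 proof -
  have "(\<Prod>l\<in>M. frm l \<bullet> \<sigma> x) = (\<Prod>l\<in>M. s l * (u (Some (flt h l)) \<bullet> x))"
  proof (intro prod.cong refl)
   fix l assume "l \<in> M"
   then have "l \<in> L" using M(1) by blast
   then show "frm l \<bullet> \<sigma> x = s l * (u (Some (flt h l)) \<bullet> x)" by (rule s(2))
  qed
  also have "\<dots> = S * (\<Prod>\<phi>\<in>flt h ` L. (u (Some \<phi>) \<bullet> x) ^ card {l \<in> M. flt h l = \<phi>})"
   using fold_M[of "%\<phi>. u (Some \<phi>) \<bullet> x"] by (simp add: prod.distrib S_def)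
  finally show ?thesis using LA unfolding B_def I_def
   by (subst prod.insert) (auto simp: prod.reindex k_def fsig mult_ac)
 qed
 have homB: "hom D (%x. B (\<sigma> x))"
 proof -
  have "hom (r * 1 + card M) B"
   unfolding B_def[abs_def] using M hom_inner[of "(1::real, 0::real^'a)"]
   by (intro hom_mult hom_power hom_prod_linear) (auto simp: inner_prod_def hom_def)
  then have "hom D B" using M D by simp
  then show ?thesis using rp_linear_compose[OF hom_rp lin] lin by (auto simp: hom_def linear_cmul)
 qed
 have u0: "u i ~= 0" if "i \<in> I" for i
 proof
  assume z: "u i = 0"
  have "\<exists>y. y ~: span {a} & \<sigma> y = 0"
  proof (cases i)
   case None
   have "(1, 0) ~: span {a}" using P by (auto simp: span_singleton a_def frm_def npar_def)
   then show ?thesis using z None by (auto simp: u_def)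
  next
   case (Some \<phi>)
   then have "\<rho> \<phi> \<in> L" using that rho by (auto simp: I_def)
   then have "frm (\<rho> \<phi>) ~: span {a}" unfolding a_def using frm_nonparallel[OF P(1) LP P(2)] lh by blast
   then show ?thesis using z Some by (auto simp: u_def)
  qed
  then obtain y where y: "y ~: span {a}" "\<sigma> y = 0" by blast
  then have "y = ((a \<bullet> y) / (a \<bullet> a)) *\<^sub>R a" by (simp add: \<sigma>_def)
  then show False using y by (metis span_base span_scale insertI1)
 qed
 have unp: "u i ~: span {u j}" if ij: "i \<in> I" "j \<in> I" "i ~= j" for i j
 proof
  assume "u i \<in> span {u j}"
  then obtain c where c: "u i = c *\<^sub>R u j" by (auto simp: span_singleton)
  then have c0: "c ~= 0" using u0[OF ij(1)] by auto
  have eqv: "u i \<bullet> x = 0 \<longleftrightarrow> u j \<bullet> x = 0" for x using c c0 by simp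
  have uS: "x \<in> \<phi> \<longleftrightarrow> a \<bullet> x = 0 & u (Some \<phi>) \<bullet> x = 0" if "\<phi> \<in> flt h ` L" for \<phi> x
  proof -
   have "\<phi> = flt h (\<rho> \<phi>)" using rho that by simp
   then have "x \<in> \<phi> \<longleftrightarrow> a \<bullet> x = 0 & frm (\<rho> \<phi>) \<bullet> x = 0" unfolding flt_def a_def by blast
   moreover have "frm (\<rho> \<phi>) \<bullet> x = u (Some \<phi>) \<bullet> x" if "a \<bullet> x = 0"
    using sym[of "frm (\<rho> \<phi>)" x] sid[OF that] by (simp add: u_def)
   ultimately show ?thesis by metis
  qed
  \<comment> \<open>If a flat had the same trace as the flat at infinity, its root would be
    proportional to that of \<open>h\<close>, but L contains nothing parallel to
    \<open>h\<close>.\<close>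
  have inf: False if ph: "\<phi> \<in> flt h ` L" and eq: "!!x. u None \<bullet> x = 0 \<longleftrightarrow> u (Some \<phi>) \<bullet> x = 0" for \<phi>
  proof -
   let ?l = "\<rho> \<phi>"
   have l: "?l \<in> L" "flt h ?l = \<phi>" using rho ph by auto
   have "fst ?l \<bullet> y = 0" if y: "fst h \<bullet> y = 0" for y
   proof -
    have ay: "a \<bullet> (0, y) = 0" using y by (simp add: a_def frm_def)
    then have "u None \<bullet> (0, y) = 0" using fsig[of "(0,y)"] sid by simp
    then have "(0, y) \<in> \<phi>" using uS[OF ph] eq ay by blast
    then have "frm ?l \<bullet> (0, y) = 0" using l(2) unfolding flt_def by blast
    then show ?thesis by (simp add: frm_def)
   qed
   then have "fst ?l \<in> span {fst h}" using nonparallel_hyperplane_point[of "fst ?l" "fst h"] by blast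
   then show False using P LP[OF l(1)] l(1) L unfolding npar_def by blast
  qed
  show False
  proof (cases i; cases j)
   fix \<phi> \<psi> assume "i = Some \<phi>" "j = Some \<psi>"
   moreover from this have "\<phi> \<in> flt h ` L" "\<psi> \<in> flt h ` L" using ij by (auto simp: I_def)
   ultimately have "\<phi> = \<psi>" using uS eqv by (intro set_eqI) simp
   then show False using ij \<open>i = Some \<phi>\<close> \<open>j = Some \<psi>\<close> by simp
  next
   fix \<phi> assume "i = None" "j = Some \<phi>"
   then show False using inf[of \<phi>] eqv ij by (auto simp: I_def)
  next
   fix \<phi> assume "j = None" "i = Some \<phi>"
   then show False using inf[of \<phi>] eqv ij by (auto simp: I_def)
  qed (use ij in auto)
 qed
 have main: "\<exists>G. rp G & (\<forall>x. fst h \<bullet> \<delta> (\<sigma> x) = B (\<sigma> x) * G x)" if \<delta>: "\<delta> \<in> D0 A" for \<delta>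
 proof -
  let ?f = "%x. fst h \<bullet> \<delta> x"
  have rf: "rp ?f" using vp_inner[OF D0_vp[OF \<delta>]] .
  have rF: "rp (%x. ?f (\<sigma> x))" using rp_linear_compose[OF rf lin] .
  have "pdvd (%x. \<Prod>i\<in>I. (u i \<bullet> x) ^ k i) (%x. ?f (\<sigma> x))"
  proof (rule pdvd_prod_linear_powers[OF finI rF u0 unp])
   fix i assume i: "i \<in> I"
   show "pdvd (%x. (u i \<bullet> x) ^ k i) (%x. ?f (\<sigma> x))"
   proof (cases i)
    case None
    let ?Pr = "{l \<in> A. fst l = fst h}"
    have "pdvd (%x. \<Prod>l\<in>?Pr. frm l \<bullet> x) ?f"
    proof (rule pdvd_prod_linear[OF _ rf])
     fix l x assume "l \<in> ?Pr" "frm l \<bullet> x = 0"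
     then show "?f x = 0" using \<delta> unfolding D0_def by fastforce
    next
     fix l assume "l \<in> ?Pr" then show "frm l ~= 0" using frm_nonzero[OF P(1), of l] P(2) by auto
    next
     fix l l' assume "l \<in> ?Pr" "l' \<in> ?Pr" "l ~= l'"
     then show "frm l ~: span {frm l'}" using frm_nonparallel[OF P(1), of l l'] P(2) by auto
    qed (use A in auto)
    then obtain g where g: "rp g" "!!x. ?f x = (\<Prod>l\<in>?Pr. frm l \<bullet> x) * g x" by (auto elim: pdvdE)
    have "frm l \<bullet> \<sigma> x = of_int (snd h - snd l) * (u None \<bullet> x)" if "l \<in> ?Pr" for l x
     using that s0[of x] fsig[of x] by (simp add: frm_inner' a_def algebra_simps)
    then have "(\<Prod>l\<in>?Pr. frm l \<bullet> \<sigma> x) = (\<Prod>l\<in>?Pr. of_int (snd h - snd l)) * (u None \<bullet> x) ^ r" for x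
     using r by (simp add: prod.distrib)
    then show ?thesis using None g rp_linear_compose[OF g(1) lin]
     by (intro pdvdI[of "%x. (\<Prod>l\<in>?Pr. of_int (snd h - snd l)) * g (\<sigma> x)"]) (auto simp: k_def mult_ac intro!: rp_cmult)
   next
    case (Some \<phi>)
    then have ph: "\<phi> \<in> flt h ` L" using i by (auto simp: I_def)
    let ?cl = "{l \<in> L. flt h l = \<phi>}" and ?l0 = "\<rho> \<phi>"
    have l0: "?l0 \<in> ?cl" using rho ph by auto
    have "\<exists>g. rp g & (\<forall>x. frm h \<bullet> x = 0 --> ?f x = (\<Prod>l\<in>?cl - {?l0}. frm l \<bullet> x) * g x)"
    proof (rule flat_divides[OF P])
     show "\<delta> \<in> D0 ?cl" using \<delta> D0_mono[of ?cl A] LA by blast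
     fix l assume l: "l \<in> ?cl"
     then have "l \<in> L" "flt h l = flt h ?l0" using l0 by auto
     then show "\<exists>s. s ~= 0 & (\<exists>c. frm l = s *\<^sub>R frm ?l0 + c *\<^sub>R frm h)"
      using flt_eq_imp[OF P LP lh] by blast
    qed (use LA LP hL l0 in auto)
    then obtain g where g: "rp g" "!!x. a \<bullet> x = 0 ==> ?f x = (\<Prod>l\<in>?cl - {?l0}. frm l \<bullet> x) * g x"
     unfolding a_def by blast
    let ?M = "{l \<in> M. flt h l = \<phi>}"
    have "?l0 ~: M" using M(1) ph unfolding R_def by blast
    then have sub: "?M <= ?cl - {?l0}" using M(1) by auto
    let ?w = "%x. (\<Prod>l\<in>?M. s l) * ((\<Prod>l\<in>?cl - {?l0} - ?M. frm l \<bullet> \<sigma> x) * g (\<sigma> x))"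
    have "?f (\<sigma> x) = (u i \<bullet> x) ^ k i * ?w x" for x
    proof -
     have "(\<Prod>l\<in>?cl - {?l0}. frm l \<bullet> \<sigma> x) = (\<Prod>l\<in>?cl - {?l0} - ?M. frm l \<bullet> \<sigma> x) * (\<Prod>l\<in>?M. frm l \<bullet> \<sigma> x)"
      using sub LA by (intro prod.subset_diff) auto
     also have "(\<Prod>l\<in>?M. frm l \<bullet> \<sigma> x) = (\<Prod>l\<in>?M. s l * (u (Some \<phi>) \<bullet> x))"
     proof (intro prod.cong refl)
      fix l assume "l \<in> ?M"
      then have "l \<in> L" "flt h l = \<phi>" using M(1) by blast+
      then show "frm l \<bullet> \<sigma> x = s l * (u (Some \<phi>) \<bullet> x)" using s(2)[of l x] by simp
     qed
     also have "\<dots> = (\<Prod>l\<in>?M. s l) * (u i \<bullet> x) ^ k i" using Some by (simp add: prod.distrib k_def)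
     finally show ?thesis using g(2)[OF s0, of x] by (simp add: mult_ac)
    qed
    moreover have "rp (%x. frm l \<bullet> \<sigma> x)" for l using rp_linear_compose[OF rp_inner lin] .
    then have "rp ?w" using rp_linear_compose[OF g(1) lin] LA
     by (intro rp_cmult rp_intros(4) real_polynomial_function_prod) auto
    ultimately show ?thesis by (intro pdvdI[of ?w]) auto
   qed
  qed
  then obtain G where G: "rp G" "!!x. ?f (\<sigma> x) = (\<Prod>i\<in>I. (u i \<bullet> x) ^ k i) * G x" by (auto elim: pdvdE)
  then show ?thesis using S0 Bs by (intro exI[of _ "%x. (1 / S) * G x"]) (auto intro!: rp_cmult)
 qed
 have Bnz: "\<exists>x. B (\<sigma> x) ~= 0"
 proof -
  have "\<exists>x\<in>UNIV. (\<Prod>i\<in>I. (u i \<bullet> x) ^ k i) ~= 0"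
  proof (rule rp_prod_nonzero_subspace[OF subspace_UNIV finI])
   fix i assume "i \<in> I"
   then show "\<exists>x\<in>UNIV. (u i \<bullet> x) ^ k i ~= 0" using u0 by (intro bexI[of _ "u i"]) auto
  qed auto
  then show ?thesis using Bs S0 by auto
 qed
 have "obst A h D B"
  unfolding obst_def
 proof (intro ballI allI impI)
  fix \<delta> e assume \<delta>: "\<delta> \<in> D0 A" "vhom e \<delta>"
  obtain G where G: "rp G" "!!x. fst h \<bullet> \<delta> (\<sigma> x) = B (\<sigma> x) * G x" using main[OF \<delta>(1)] by blast
  have he: "hom e (%x. fst h \<bullet> \<delta> (\<sigma> x))"
   using vhom_inner[OF \<delta>(2), of "fst h"] rp_linear_compose[OF vp_inner[OF vhom_vp[OF \<delta>(2)]] lin] lin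
   by (auto simp: hom_def linear_cmul)
  show "(e < D --> (\<forall>x. frm h \<bullet> x = 0 --> fst h \<bullet> \<delta> x = 0)) \<and>
   (D <= e --> (\<exists>g. hom (e - D) g & (\<forall>x. frm h \<bullet> x = 0 --> fst h \<bullet> \<delta> x = g x * B x)))"
  proof (intro conjI impI)
   assume "e < D"
   then have "G x = 0" for x using hom_quotient(2)[OF he homB Bnz G] by blast
   then show "\<forall>x. frm h \<bullet> x = 0 --> fst h \<bullet> \<delta> x = 0" using G(2) sid unfolding a_def by (metis mult_zero_right)
  next
   assume "D <= e"
   then have "hom (e - D) G" using hom_quotient(1)[OF he homB Bnz G] by blast
   then show "\<exists>g. hom (e - D) g & (\<forall>x. frm h \<bullet> x = 0 --> fst h \<bullet> \<delta> x = g x * B x)"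
    using G(2) sid unfolding a_def by (metis mult.commute)
  qed
 qed
 moreover have "B x ~= 0" if "fst x ~= 0" "\<forall>l\<in>A. frm l \<bullet> x ~= 0" for x
  using that M LA by (auto simp: B_def)
 ultimately show ?thesis by blast
qed

end

section \<open>Root systems\<close>

definition cart :: "real^'n => real^'n => real" where
 "cart x \<alpha> = 2 * (x \<bullet> \<alpha>) / (\<alpha> \<bullet> \<alpha>)"

definition rfl :: "real^'n => real^'n => real^'n" where
 "rfl \<alpha> x = x - cart x \<alpha> *\<^sub>R \<alpha>"

lemma cart_add: "cart (x + y) \<alpha> = cart x \<alpha> + cart y \<alpha>"
 and cart_diff: "cart (x - y) \<alpha> = cart x \<alpha> - cart y \<alpha>"
 and cart_scale: "cart (c *\<^sub>R x) \<alpha> = c * cart x \<alpha>"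
 and cart_uminus: "cart (- x) \<alpha> = - cart x \<alpha>"
 and cart_uminus2: "cart x (- \<alpha>) = - cart x \<alpha>"
 by (auto simp: cart_def inner_add_left inner_diff_left add_divide_distrib diff_divide_distrib distrib_left right_diff_distrib)

lemma linear_cart: "linear (%x. cart x \<alpha>)" by (rule linearI) (auto simp: cart_add cart_scale)

lemma linear_rfl: "linear (rfl \<alpha>)"
 by (rule linearI) (auto simp: rfl_def cart_add cart_scale algebra_simps)

lemma cart_self: "\<alpha> ~= 0 ==> cart \<alpha> \<alpha> = 2" by (simp add: cart_def)
lemma rfl_self: "rfl \<alpha> \<alpha> = - \<alpha>" by (cases "\<alpha> = 0") (auto simp: rfl_def cart_self scaleR_2)
lemma rfl_rfl: "rfl \<alpha> (rfl \<alpha> x) = x"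
 by (cases "\<alpha> = 0") (auto simp: rfl_def cart_diff cart_scale cart_self algebra_simps)
lemma rfl_inner: "rfl \<alpha> x \<bullet> rfl \<alpha> y = x \<bullet> y"
 by (cases "\<alpha> = 0") (auto simp: rfl_def cart_def inner_diff_left inner_diff_right field_simps inner_commute)
lemma rfl_inner_swap: "rfl \<alpha> x \<bullet> y = x \<bullet> rfl \<alpha> y"
 by (metis rfl_inner rfl_rfl)
lemma cart_rfl: "cart (rfl \<alpha> x) (rfl \<alpha> y) = cart x y" by (simp add: cart_def rfl_inner)
lemma rfl_uminus: "rfl (- \<alpha>) = rfl \<alpha>" by (auto simp: rfl_def cart_uminus2 fun_eq_iff)
lemma rfl_fixed: "\<alpha> \<bullet> x = 0 ==> rfl \<alpha> x = x" by (simp add: rfl_def cart_def inner_commute)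
lemma rfl_anti: "rfl \<alpha> y = - y ==> y = (cart y \<alpha> / 2) *\<^sub>R \<alpha>"
proof -
 assume "rfl \<alpha> y = - y"
 then have "2 *\<^sub>R y = cart y \<alpha> *\<^sub>R \<alpha>" by (simp add: rfl_def scaleR_2 algebra_simps)
 then have "(1/2) *\<^sub>R (2 *\<^sub>R y) = (1/2) *\<^sub>R (cart y \<alpha> *\<^sub>R \<alpha>)" by simp
 then show ?thesis by simp
qed

text \<open>Separate the positive from the negative coefficients of a relation: this gives two equal
  vectors with nonpositive inner product, hence zero, and pairing them with \<open>w\<close> kills
  every coefficient.\<close>

lemma obtuse_independent:
 fixes S :: "(real^'n) set"
 assumes "finite S" "!!s. s \<in> S ==> s \<bullet> w > 0" "!!s t. s \<in> S ==> t \<in> S ==> s ~= t ==> s \<bullet> t <= 0"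
 shows "independent S"
proof
 assume "dependent S"
 then obtain c where c: "\<exists>v\<in>S. c v ~= 0" "(\<Sum>v\<in>S. c v *\<^sub>R v) = 0" using dependent_finite[OF assms(1)] by auto
 define u where "u = (\<Sum>v\<in>{v\<in>S. c v > 0}. c v *\<^sub>R v)"
 define u' where "u' = (\<Sum>v\<in>{v\<in>S. c v < 0}. (- c v) *\<^sub>R v)"
 have "(\<Sum>v\<in>S. c v *\<^sub>R v) = (\<Sum>v\<in>{v\<in>S. c v > 0}. c v *\<^sub>R v) + (\<Sum>v\<in>{v\<in>S. \<not> c v > 0}. c v *\<^sub>R v)"
  by (subst sum.union_disjoint[symmetric]) (auto simp: assms(1) intro!: sum.cong)
 also have "(\<Sum>v\<in>{v\<in>S. \<not> c v > 0}. c v *\<^sub>R v) = (\<Sum>v\<in>{v\<in>S. c v < 0}. c v *\<^sub>R v)"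
  by (intro sum.mono_neutral_right) (auto simp: assms(1))
 finally have uu: "u = u'" using c(2) by (simp add: u_def u'_def sum_negf add_eq_0_iff)
 have "u \<bullet> u' <= 0"
  unfolding u_def u'_def inner_sum_left inner_sum_right
  by (intro sum_nonpos) (auto intro!: mult_nonneg_nonpos mult_nonpos_nonpos mult_nonneg_nonneg assms(3) simp: mult_le_0_iff zero_le_mult_iff)
 then have "u \<bullet> u = 0" using uu inner_ge_zero[of u] by (metis order_antisym)
 then have u0: "u = 0" "u' = 0" using uu by auto
 have "(\<Sum>v\<in>{v\<in>S. c v > 0}. c v * (v \<bullet> w)) = 0" using arg_cong[OF u0(1), of "%x. x \<bullet> w"] by (simp add: u_def inner_sum_left)
 then have 1: "{v\<in>S. c v > 0} = {}"
  using sum_pos[of "{v\<in>S. c v > 0}" "%v. c v * (v \<bullet> w)"] assms by force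
 have "(\<Sum>v\<in>{v\<in>S. c v < 0}. - c v * (v \<bullet> w)) = 0" using arg_cong[OF u0(2), of "%x. x \<bullet> w"] by (simp add: u'_def inner_sum_left)
 then have 2: "{v\<in>S. c v < 0} = {}"
  using sum_pos[of "{v\<in>S. c v < 0}" "%v. - c v * (v \<bullet> w)"] assms by (force simp: mult_neg_pos)
 show False using c(1) 1 2 by (metis (mono_tags, lifting) Collect_empty_eq linorder_less_linear)
qed

text \<open>The simple system is a parameter; it is supplied in the end by the definition of a
  Coxeter element.\<close>

locale roots =
 fixes \<Phi> P \<Delta> :: "(real^'n) set"
 assumes rs: "root_system \<Phi>" and irr: "irreducible_rs \<Phi>"
  and ps: "positive_system \<Phi> P" and ss: "simple_system \<Phi> P \<Delta>"
begin

lemma finite_roots: "finite \<Phi>" and zero_not_root: "0 ~: \<Phi>" and span_roots: "span \<Phi> = UNIV"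
 using rs by (auto simp: root_system_def)

lemma root_nonzero: "\<alpha> \<in> \<Phi> ==> \<alpha> ~= 0" using zero_not_root by auto
lemma root_norm_pos: "\<alpha> \<in> \<Phi> ==> \<alpha> \<bullet> \<alpha> > 0" using root_nonzero by simp

lemma rfl_root: "\<alpha> \<in> \<Phi> ==> \<beta> \<in> \<Phi> ==> rfl \<alpha> \<beta> \<in> \<Phi>"
 using rs by (auto simp: root_system_def rfl_def cart_def)

lemma neg_root: "\<alpha> \<in> \<Phi> ==> - \<alpha> \<in> \<Phi>" using rfl_root[of \<alpha> \<alpha>] by (simp add: rfl_self)

lemma reduced: "\<alpha> \<in> \<Phi> ==> c *\<^sub>R \<alpha> \<in> \<Phi> ==> c = 1 | c = -1"
 using rs by (auto simp: root_system_def)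

lemma cart_Ints: "\<alpha> \<in> \<Phi> ==> \<beta> \<in> \<Phi> ==> cart \<beta> \<alpha> \<in> \<int>"
 using rs by (auto simp: root_system_def cart_def)

lemma ex_pos_functional: "\<exists>v. (\<forall>\<alpha>\<in>\<Phi>. \<alpha> \<bullet> v ~= 0) & P = {\<alpha>\<in>\<Phi>. \<alpha> \<bullet> v > 0}"
 using ps by (simp add: positive_system_def)

lemma P_sub: "P <= \<Phi>" using ex_pos_functional by auto
lemma P_root: "\<alpha> \<in> P ==> \<alpha> \<in> \<Phi>" using P_sub by auto
lemma finite_P: "finite P" using P_sub finite_roots finite_subset by blast
lemma pos_or_neg: "\<alpha> \<in> \<Phi> ==> \<alpha> \<in> P | - \<alpha> \<in> P"
 using ex_pos_functional neg_root by (force simp: not_less_iff_gr_or_eq)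
lemma neg_notin_P: "\<alpha> \<in> P ==> - \<alpha> ~: P" using ex_pos_functional by force

lemma parallel_roots:
 assumes "\<alpha> \<in> \<Phi>" "\<beta> \<in> \<Phi>" "\<beta> \<in> span {\<alpha>}" shows "\<beta> = \<alpha> | \<beta> = - \<alpha>"
proof -
 obtain c where "\<beta> = c *\<^sub>R \<alpha>" using assms(3) by (auto simp: span_singleton)
 then show ?thesis using reduced[of \<alpha> c] assms by auto
qed

lemma npar_P: "npar P"
 unfolding npar_def using P_root root_nonzero parallel_roots neg_notin_P by metis

lemma cauchy_strict:
 fixes a b :: "real^'n"
 assumes "b ~: span {a}" "a ~= 0" shows "(a \<bullet> b)\<^sup>2 < (a \<bullet> a) * (b \<bullet> b)"
proof -
 let ?x = "b - ((a \<bullet> b) / (a \<bullet> a)) *\<^sub>R a"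
 have "?x ~= 0" using assms by (metis eq_iff_diff_eq_0 span_base span_scale insertI1)
 then have "0 < ?x \<bullet> ?x" by simp
 also have "?x \<bullet> ?x = b \<bullet> b - (a \<bullet> b)\<^sup>2 / (a \<bullet> a)"
  using assms(2) by (simp add: inner_diff_left inner_diff_right inner_commute power2_eq_square field_simps)
 finally show ?thesis using assms(2) by (simp add: field_simps)
qed

lemma cart_product:
 assumes "\<alpha> \<in> \<Phi>" "\<beta> \<in> \<Phi>" "\<beta> ~= \<alpha>" "\<beta> ~= - \<alpha>"
 shows "0 <= cart \<alpha> \<beta> * cart \<beta> \<alpha>" "cart \<alpha> \<beta> * cart \<beta> \<alpha> < 4"
proof -
 have p: "\<alpha> \<bullet> \<alpha> > 0" "\<beta> \<bullet> \<beta> > 0" using assms root_norm_pos by auto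
 have e: "cart \<alpha> \<beta> * cart \<beta> \<alpha> = 4 * (\<alpha> \<bullet> \<beta>)\<^sup>2 / ((\<alpha> \<bullet> \<alpha>) * (\<beta> \<bullet> \<beta>))"
  by (simp add: cart_def power2_eq_square inner_commute mult_ac)
 show "0 <= cart \<alpha> \<beta> * cart \<beta> \<alpha>" unfolding e using p by simp
 have "(\<alpha> \<bullet> \<beta>)\<^sup>2 < (\<alpha> \<bullet> \<alpha>) * (\<beta> \<bullet> \<beta>)"
  using cauchy_strict parallel_roots assms root_nonzero by blast
 then show "cart \<alpha> \<beta> * cart \<beta> \<alpha> < 4" unfolding e using p by (simp add: divide_less_eq)
qed

lemma cart_sgn: "\<alpha> \<in> \<Phi> ==> (cart x \<alpha> > 0 \<longleftrightarrow> x \<bullet> \<alpha> > 0) & (cart x \<alpha> < 0 \<longleftrightarrow> x \<bullet> \<alpha> < 0) & (cart x \<alpha> = 0 \<longleftrightarrow> x \<bullet> \<alpha> = 0)"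
proof -
 assume "\<alpha> \<in> \<Phi>"
 then have "2 / (\<alpha> \<bullet> \<alpha>) > 0" using root_norm_pos by simp
 moreover have "cart x \<alpha> = 2 / (\<alpha> \<bullet> \<alpha>) * (x \<bullet> \<alpha>)" by (simp add: cart_def)
 ultimately show ?thesis by (metis mult_less_0_iff mult_zero_right zero_less_mult_iff not_less_iff_gr_or_eq)
qed

lemma cart_cases:
 assumes "\<alpha> \<in> \<Phi>" "\<beta> \<in> \<Phi>" "\<beta> ~= \<alpha>" "\<alpha> \<bullet> \<beta> > 0"
 shows "(cart \<alpha> \<beta> = 1 & cart \<beta> \<alpha> \<in> {1,2,3}) | (cart \<beta> \<alpha> = 1 & cart \<alpha> \<beta> \<in> {1,2,3})"
proof -
 have n: "\<beta> ~= - \<alpha>"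
 proof
  assume "\<beta> = - \<alpha>"
  then have "\<alpha> \<bullet> \<beta> = - (\<alpha> \<bullet> \<alpha>)" by simp
  then show False using assms(4) inner_ge_zero[of \<alpha>] by linarith
 qed
 obtain a b :: int where ab: "cart \<alpha> \<beta> = of_int a" "cart \<beta> \<alpha> = of_int b"
  using cart_Ints assms by (metis Ints_cases)
 have pos: "a > 0" "b > 0" using cart_sgn[of \<beta> \<alpha>] cart_sgn[of \<alpha> \<beta>] assms ab by (auto simp: inner_commute)
 have "of_int (a * b) < (4::real)" using cart_product(2)[OF assms(1,2,3) n] ab by simp
 then have lt: "a * b < 4" by linarith
 have "a < 4" using pos lt by (smt (verit, best) mult_le_cancel_left1)
 moreover have "b < 4" using pos lt by (smt (verit, best) mult_le_cancel_right1)
 ultimately have "a \<in> {1,2,3}" "b \<in> {1,2,3}" using pos by auto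
 then show ?thesis using lt ab by auto
qed

lemma root_diff:
 assumes "\<alpha> \<in> \<Phi>" "\<beta> \<in> \<Phi>" "\<beta> ~= \<alpha>" "\<alpha> \<bullet> \<beta> > 0" shows "\<alpha> - \<beta> \<in> \<Phi>"
 using cart_cases[OF assms]
proof
 assume "cart \<alpha> \<beta> = 1 & cart \<beta> \<alpha> \<in> {1,2,3}"
 then show ?thesis using rfl_root[OF assms(2,1)] by (simp add: rfl_def)
next
 assume "cart \<beta> \<alpha> = 1 & cart \<alpha> \<beta> \<in> {1,2,3}"
 then show ?thesis using neg_root[OF rfl_root[OF assms(1,2)]] by (simp add: rfl_def)
qed

subsection \<open>Simple roots and heights\<close>

lemma D_sub: "\<Delta> <= P" and D_indep: "independent \<Delta>" using ss by (auto simp: simple_system_def)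
lemma D_pos: "\<delta> \<in> \<Delta> ==> \<delta> \<in> P" using D_sub by auto
lemma D_root: "\<delta> \<in> \<Delta> ==> \<delta> \<in> \<Phi>" using D_sub P_root by auto
lemma finite_D: "finite \<Delta>" using D_sub finite_P finite_subset by blast

lemma span_D: "span \<Delta> = UNIV"
proof -
 have "\<alpha> \<in> span \<Delta>" if "\<alpha> \<in> \<Phi>" for \<alpha>
 proof -
  obtain c where "\<alpha> = (\<Sum>\<beta>\<in>\<Delta>. c \<beta> *\<^sub>R \<beta>)" using ss \<open>\<alpha> \<in> \<Phi>\<close> unfolding simple_system_def by blast
  then show ?thesis by (simp add: span_sum span_scale span_base)
 qed
 then have "span \<Phi> <= span \<Delta>" by (intro span_minimal) auto
 then show ?thesis using span_roots by auto
qed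

lemma card_D: "card \<Delta> = CARD('n)"
 using span_D D_indep by (metis dim_UNIV dim_span dim_eq_card_independent DIM_cart DIM_real mult.right_neutral)

definition cf :: "real^'n => real^'n => real" where "cf x \<delta> = representation \<Delta> x \<delta>"

lemma linear_cf: "linear (%x. cf x \<delta>)"
 unfolding cf_def using D_indep span_D
 by (intro linearI) (auto simp: real_vector.representation_add real_vector.representation_scale)

lemma cf_sum: "(\<Sum>\<delta>\<in>\<Delta>. cf x \<delta> *\<^sub>R \<delta>) = x"
 unfolding cf_def using real_vector.sum_representation_eq[OF D_indep _ finite_D subset_refl] span_D by simp

lemma cf_basis: "\<delta> \<in> \<Delta> ==> cf \<delta> \<delta>' = (if \<delta>' = \<delta> then 1 else 0)"
 unfolding cf_def using real_vector.representation_basis[OF D_indep] by auto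

lemma cf_add: "cf (x + y) \<delta> = cf x \<delta> + cf y \<delta>" and cf_diff: "cf (x - y) \<delta> = cf x \<delta> - cf y \<delta>"
 and cf_scale: "cf (c *\<^sub>R x) \<delta> = c * cf x \<delta>" and cf_uminus: "cf (- x) \<delta> = - cf x \<delta>"
 using linear_add[OF linear_cf, of x y \<delta>] linear_diff[OF linear_cf, of x y \<delta>] linear_cmul[OF linear_cf, of c x \<delta>]
  linear_neg[OF linear_cf, of x \<delta>] by simp_all

lemma cf_unique: "x = (\<Sum>\<delta>\<in>\<Delta>. c \<delta> *\<^sub>R \<delta>) ==> \<delta> \<in> \<Delta> ==> cf x \<delta> = c \<delta>"
 by (simp add: linear_sum[OF linear_cf] linear_cmul[OF linear_cf] cf_basis finite_D if_distrib cong: if_cong)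

lemma cf_pos:
 assumes "\<beta> \<in> P" "\<delta> \<in> \<Delta>" shows "cf \<beta> \<delta> \<ge> 0"
proof -
 obtain c where c: "\<beta> = (\<Sum>\<beta>\<in>\<Delta>. c \<beta> *\<^sub>R \<beta>)" "(\<forall>\<beta>\<in>\<Delta>. c \<beta> \<ge> 0) | (\<forall>\<beta>\<in>\<Delta>. c \<beta> <= 0)"
  using ss P_root[OF assms(1)] unfolding simple_system_def by blast
 obtain v where v: "P = {\<alpha>\<in>\<Phi>. \<alpha> \<bullet> v > 0}" using ex_pos_functional by blast
 have "\<not> (\<forall>\<beta>\<in>\<Delta>. c \<beta> <= 0)"
 proof
  assume "\<forall>\<beta>\<in>\<Delta>. c \<beta> <= 0"
  then have "(\<Sum>\<beta>\<in>\<Delta>. c \<beta> * (\<beta> \<bullet> v)) <= 0" using v D_pos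
   by (intro sum_nonpos) (auto simp: mult_le_0_iff less_imp_le)
  then have "\<beta> \<bullet> v <= 0" by (subst c(1)) (simp add: inner_sum_left)
  then show False using assms v by auto
 qed
 then show ?thesis using c cf_unique assms by metis
qed

lemma pos_iff: "\<beta> \<in> \<Phi> ==> \<delta> \<in> \<Delta> ==> cf \<beta> \<delta> > 0 ==> \<beta> \<in> P"
 using pos_or_neg[of \<beta>] cf_pos[of "- \<beta>" \<delta>] by (auto simp: cf_uminus)

lemma ex_other_coeff:
 assumes "\<beta> \<in> P" "\<delta> \<in> \<Delta>" "\<beta> ~= \<delta>" shows "\<exists>\<epsilon>\<in>\<Delta>. \<epsilon> ~= \<delta> & cf \<beta> \<epsilon> > 0"
proof (rule ccontr)
 assume "\<not> ?thesis"
 then have z: "cf \<beta> \<epsilon> = 0" if "\<epsilon> \<in> \<Delta>" "\<epsilon> ~= \<delta>" for \<epsilon> using cf_pos[OF assms(1) that(1)] that by force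
 have "\<beta> = (\<Sum>\<epsilon>\<in>\<Delta>. cf \<beta> \<epsilon> *\<^sub>R \<epsilon>)" using cf_sum by simp
 also have "\<dots> = cf \<beta> \<delta> *\<^sub>R \<delta>" using z assms(2) finite_D by (subst sum.remove[of _ \<delta>]) auto
 finally have "\<beta> \<in> span {\<delta>}" by (metis span_base span_scale insertI1)
 then show False using npar_P assms D_pos unfolding npar_def by blast
qed

lemma rfl_simple_pos:
 assumes "\<delta> \<in> \<Delta>" "\<beta> \<in> P" "\<beta> ~= \<delta>" shows "rfl \<delta> \<beta> \<in> P - {\<delta>}"
proof -
 obtain \<epsilon> where e: "\<epsilon> \<in> \<Delta>" "\<epsilon> ~= \<delta>" "cf \<beta> \<epsilon> > 0" using ex_other_coeff[OF assms(2,1,3)] by blast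
 have "cf (rfl \<delta> \<beta>) \<epsilon> = cf \<beta> \<epsilon>" using e assms by (simp add: rfl_def cf_diff cf_scale cf_basis)
 then have "rfl \<delta> \<beta> \<in> P" using pos_iff[OF rfl_root] e assms D_root P_root by auto
 moreover have "rfl \<delta> \<beta> ~= \<delta>"
 proof
  assume "rfl \<delta> \<beta> = \<delta>"
  then have "\<beta> = - \<delta>" by (metis rfl_rfl rfl_self)
  then show False using assms D_pos neg_notin_P by blast
 qed
 ultimately show ?thesis by simp
qed

definition ht :: "real^'n => real" where "ht x = (\<Sum>\<delta>\<in>\<Delta>. cf x \<delta>)"

lemma ht_add: "ht (x + y) = ht x + ht y" and ht_diff: "ht (x - y) = ht x - ht y"
 and ht_scale: "ht (c *\<^sub>R x) = c * ht x" and ht_uminus: "ht (- x) = - ht x"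
 by (auto simp: ht_def cf_add cf_diff cf_scale cf_uminus sum.distrib sum_subtractf sum_distrib_left sum_negf)

lemma linear_ht: "linear ht" by (rule linearI) (auto simp: ht_add ht_scale)

lemma ht_simple: "\<delta> \<in> \<Delta> ==> ht \<delta> = 1"
 using finite_D by (simp add: ht_def cf_basis if_distrib cong: if_cong)

lemma ht_pos: assumes "\<beta> \<in> P" shows "ht \<beta> > 0"
proof -
 have "\<exists>\<delta>\<in>\<Delta>. cf \<beta> \<delta> ~= 0"
 proof (rule ccontr)
  assume "\<not> ?thesis"
  then have "\<beta> = 0" using cf_sum[of \<beta>] by simp
  then show False using assms P_root zero_not_root by blast
 qed
 then show ?thesis unfolding ht_def using cf_pos[OF assms] finite_D
  by (metis (no_types, lifting) less_eq_real_def sum_pos2)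
qed

lemma ht_pos_iff: "\<beta> \<in> \<Phi> ==> ht \<beta> > 0 \<longleftrightarrow> \<beta> \<in> P"
 using pos_or_neg[of \<beta>] ht_pos[of \<beta>] ht_pos[of "- \<beta>"] by (auto simp: ht_uminus)

lemma ht_nonzero: "\<beta> \<in> \<Phi> ==> ht \<beta> ~= 0"
 using pos_or_neg[of \<beta>] ht_pos[of \<beta>] ht_pos[of "- \<beta>"] by (auto simp: ht_uminus)

text \<open>The simple reflection permutes the other positive roots and reverses their pairing with
  \<delta>, so only \<gamma> = \<delta> contributes.\<close>

lemma sum_cart_simple:
 assumes "\<delta> \<in> \<Delta>" shows "(\<Sum>\<gamma>\<in>P. cart \<delta> \<gamma>) = 2"
proof -
 have bij: "bij_betw (rfl \<delta>) (P - {\<delta>}) (P - {\<delta>})"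
  by (rule bij_betwI[of _ _ _ "rfl \<delta>"]) (use rfl_simple_pos[OF assms] rfl_rfl in auto)
 have "(\<Sum>\<gamma>\<in>P - {\<delta>}. cart \<delta> \<gamma>) = (\<Sum>\<gamma>\<in>P - {\<delta>}. cart \<delta> (rfl \<delta> \<gamma>))"
  using sum.reindex_bij_betw[OF bij, of "cart \<delta>"] by simp
 also have "\<dots> = (\<Sum>\<gamma>\<in>P - {\<delta>}. - cart \<delta> \<gamma>)"
 proof (intro sum.cong refl)
  fix \<gamma>
  have "cart \<delta> (rfl \<delta> \<gamma>) = cart (rfl \<delta> (- \<delta>)) (rfl \<delta> \<gamma>)" by (metis rfl_rfl rfl_self)
  then show "cart \<delta> (rfl \<delta> \<gamma>) = - cart \<delta> \<gamma>" by (simp add: cart_rfl cart_uminus)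
 qed
 finally have "(\<Sum>\<gamma>\<in>P - {\<delta>}. cart \<delta> \<gamma>) = 0" by (simp add: sum_negf)
 then show ?thesis using assms D_pos finite_P cart_self[OF root_nonzero[OF D_root]] by (subst sum.remove[of _ \<delta>]) auto
qed

text \<open>Height is the pairing with half the sum of the positive coroots. Written as a sum over
  roots, it can be split over the planes through a given root.\<close>

lemma ht_eq_sum_cart: "2 * ht x = (\<Sum>\<gamma>\<in>P. cart x \<gamma>)"
proof -
 have "(\<Sum>\<gamma>\<in>P. cart x \<gamma>) = (\<Sum>\<gamma>\<in>P. cart (\<Sum>\<delta>\<in>\<Delta>. cf x \<delta> *\<^sub>R \<delta>) \<gamma>)" by (simp add: cf_sum)
 also have "\<dots> = (\<Sum>\<gamma>\<in>P. \<Sum>\<delta>\<in>\<Delta>. cf x \<delta> * cart \<delta> \<gamma>)"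
  by (simp add: linear_sum[OF linear_cart] cart_scale)
 also have "\<dots> = (\<Sum>\<delta>\<in>\<Delta>. cf x \<delta> * (\<Sum>\<gamma>\<in>P. cart \<delta> \<gamma>))"
  by (subst sum.swap) (simp add: sum_distrib_left)
 also have "\<dots> = (\<Sum>\<delta>\<in>\<Delta>. cf x \<delta> * 2)" by (intro sum.cong refl) (simp add: sum_cart_simple)
 finally show ?thesis by (simp add: ht_def sum_distrib_left mult.commute)
qed

lemma descend:
 assumes "\<beta> \<in> P" "\<beta> ~: \<Delta>" shows "\<exists>\<delta>\<in>\<Delta>. \<beta> - \<delta> \<in> P & \<beta> \<bullet> \<delta> > 0"
proof -
 have "\<exists>\<delta>\<in>\<Delta>. \<beta> \<bullet> \<delta> > 0"
 proof (rule ccontr)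
  assume n: "\<not> ?thesis"
  have "\<beta> \<bullet> \<beta> = \<beta> \<bullet> (\<Sum>\<delta>\<in>\<Delta>. cf \<beta> \<delta> *\<^sub>R \<delta>)" by (simp add: cf_sum)
  also have "\<dots> = (\<Sum>\<delta>\<in>\<Delta>. cf \<beta> \<delta> * (\<beta> \<bullet> \<delta>))" by (simp add: inner_sum_right)
  also have "\<dots> <= 0" using n cf_pos[OF assms(1)] by (intro sum_nonpos) (auto simp: mult_le_0_iff not_less)
  finally show False using root_norm_pos[OF P_root[OF assms(1)]] by simp
 qed
 then obtain \<delta> where d: "\<delta> \<in> \<Delta>" "\<beta> \<bullet> \<delta> > 0" by blast
 have ne: "\<delta> ~= \<beta>" using d assms by auto
 have r: "\<beta> - \<delta> \<in> \<Phi>" using root_diff[OF P_root[OF assms(1)] D_root[OF d(1)] ne d(2)] .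
 obtain \<epsilon> where e: "\<epsilon> \<in> \<Delta>" "\<epsilon> ~= \<delta>" "cf \<beta> \<epsilon> > 0" using ex_other_coeff[OF assms(1) d(1)] ne by auto
 have "cf (\<beta> - \<delta>) \<epsilon> > 0" using e d by (simp add: cf_diff cf_basis)
 then have "\<beta> - \<delta> \<in> P" using pos_iff[OF r e(1)] by simp
 then show ?thesis using d by blast
qed

lemma pos_root_induct [consumes 1, case_names simple step]:
 assumes "\<beta> \<in> P" "!!\<delta>. \<delta> \<in> \<Delta> ==> Q \<delta>"
  "!!\<gamma> \<delta>. \<gamma> \<in> P ==> \<delta> \<in> \<Delta> ==> \<gamma> + \<delta> \<in> P ==> (\<gamma> + \<delta>) \<bullet> \<delta> > 0 ==> Q \<gamma> ==> Q (\<gamma> + \<delta>)"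
 shows "Q \<beta>"
 using assms(1)
proof (induction "card {\<gamma>\<in>P. ht \<gamma> < ht \<beta>}" arbitrary: \<beta> rule: less_induct)
 case less
 show ?case
 proof (cases "\<beta> \<in> \<Delta>")
  case False
  then obtain \<delta> where d: "\<delta> \<in> \<Delta>" "\<beta> - \<delta> \<in> P" "\<beta> \<bullet> \<delta> > 0" using descend less.prems by blast
  have lt: "ht (\<beta> - \<delta>) < ht \<beta>" using d by (simp add: ht_diff ht_simple)
  have "{\<gamma>\<in>P. ht \<gamma> < ht (\<beta> - \<delta>)} \<subset> {\<gamma>\<in>P. ht \<gamma> < ht \<beta>}"
   using lt d(2) by auto
  then have "card {\<gamma>\<in>P. ht \<gamma> < ht (\<beta> - \<delta>)} < card {\<gamma>\<in>P. ht \<gamma> < ht \<beta>}"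
   using finite_P by (intro psubset_card_mono) auto
  then have "Q (\<beta> - \<delta>)" using less.hyps d(2) by blast
  then show ?thesis using assms(3)[OF d(2) d(1)] d(3) less.prems by simp
 qed (use assms(2) in auto)
qed

lemma ht_nat: "\<beta> \<in> P ==> \<exists>n\<ge>1. ht \<beta> = real n"
proof (induction rule: pos_root_induct)
 case (simple \<delta>)
 then show ?case by (auto simp: ht_simple)
next
 case (step \<gamma> \<delta>)
 then obtain n where "n \<ge> 1" "ht \<gamma> = real n" by blast
 then show ?case using step by (intro exI[of _ "Suc n"]) (simp add: ht_add ht_simple)
qed

definition hgt :: "real^'n => nat" where "hgt \<beta> = nat \<lfloor>ht \<beta>\<rfloor>"

lemma hgt_eq: "\<beta> \<in> P ==> real (hgt \<beta>) = ht \<beta>" and hgt_ge1: "\<beta> \<in> P ==> hgt \<beta> \<ge> 1"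
 using ht_nat[of \<beta>] by (auto simp: hgt_def)

lemma cf_Ints: "\<beta> \<in> P ==> \<delta> \<in> \<Delta> ==> cf \<beta> \<delta> \<in> \<int>"
 by (induction rule: pos_root_induct) (auto simp: cf_basis cf_add)

text \<open>Otherwise the difference would be a root of height 0.\<close>

lemma same_ht_obtuse:
 assumes "\<alpha> \<in> P" "\<beta> \<in> P" "ht \<alpha> = ht \<beta>" "\<alpha> ~= \<beta>" shows "\<alpha> \<bullet> \<beta> <= 0"
proof (rule ccontr)
 assume "\<not> ?thesis"
 then have "\<alpha> - \<beta> \<in> \<Phi>" using root_diff assms P_root by auto
 then have "ht (\<alpha> - \<beta>) ~= 0" by (rule ht_nonzero)
 then show False using assms by (simp add: ht_diff)
qed

lemma ex_ht_vector: "\<exists>w. \<forall>x. ht x = x \<bullet> w"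
proof (intro exI allI)
 fix x
 have "ht x = ht (\<Sum>b\<in>Basis. (x \<bullet> b) *\<^sub>R b)" by (simp add: euclidean_representation)
 also have "\<dots> = (\<Sum>b\<in>Basis. (x \<bullet> b) * ht b)" by (simp add: linear_sum[OF linear_ht] ht_scale)
 finally show "ht x = x \<bullet> (\<Sum>b\<in>Basis. ht b *\<^sub>R b)" by (simp add: inner_sum_right mult.commute)
qed

section \<open>Obtuse sets of positive roots\<close>

lemma pos_obtuse_independent:
 assumes "S <= P" "!!s t. s \<in> S ==> t \<in> S ==> s ~= t ==> s \<bullet> t <= 0"
 shows "independent S"
proof -
 obtain w where w: "!!x. ht x = x \<bullet> w" using ex_ht_vector by blast
 show ?thesis
 proof (rule obtuse_independent[where w = w])
  show "finite S" using assms finite_P finite_subset by blast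
  fix s assume "s \<in> S" then have "s \<in> P" using assms by blast
  then show "s \<bullet> w > 0" using ht_pos[of s] w by simp
 qed (use assms in auto)
qed

definition lvl :: "nat => (real^'n) set" where "lvl j = {\<alpha>\<in>P. hgt \<alpha> = j}"

lemma finite_lvl: "finite (lvl j)" using finite_P by (simp add: lvl_def)

lemma lvl_independent: "independent (lvl j)"
proof (rule pos_obtuse_independent)
 show "lvl j <= P" by (auto simp: lvl_def)
 fix s t assume "s \<in> lvl j" "t \<in> lvl j" "s ~= t"
 then show "s \<bullet> t <= 0" using same_ht_obtuse[of s t] hgt_eq[of s] hgt_eq[of t] by (simp add: lvl_def)
qed

lemma root_obtuse_angle:
 assumes "\<alpha> \<in> \<Phi>" "\<beta> \<in> \<Phi>" "\<alpha> \<bullet> \<beta> < 0" "\<beta> ~= - \<alpha>"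
 shows "(\<alpha> /\<^sub>R norm \<alpha>) \<bullet> (\<beta> /\<^sub>R norm \<beta>) <= - 1 / 2"
proof -
 have "(cart \<alpha> (- \<beta>) = 1 & cart (- \<beta>) \<alpha> \<in> {1,2,3}) | (cart (- \<beta>) \<alpha> = 1 & cart \<alpha> (- \<beta>) \<in> {1,2,3})"
 proof (rule cart_cases[OF assms(1) neg_root[OF assms(2)]])
  show "- \<beta> ~= \<alpha>" using assms(4) by auto
  show "\<alpha> \<bullet> - \<beta> > 0" using assms(3) by simp
 qed
 then have "cart \<alpha> (- \<beta>) * cart (- \<beta>) \<alpha> \<ge> 1" by auto
 then have ge: "cart \<alpha> \<beta> * cart \<beta> \<alpha> \<ge> 1" by (simp add: cart_uminus cart_uminus2)
 define c where "c = (\<alpha> /\<^sub>R norm \<alpha>) \<bullet> (\<beta> /\<^sub>R norm \<beta>)"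
 have "cart \<alpha> \<beta> * cart \<beta> \<alpha> = 4 * c\<^sup>2"
  by (simp add: cart_def c_def power2_eq_square inner_commute dot_square_norm field_simps)
 then have "c\<^sup>2 \<ge> (1/2)\<^sup>2" using ge by (simp add: power2_eq_square)
 then have "\<bar>c\<bar> \<ge> 1/2" by (metis abs_le_square_iff abs_of_pos half_gt_zero zero_less_one)
 moreover have "c <= 0" unfolding c_def using assms(3) by (simp add: mult_nonneg_nonpos)
 ultimately show ?thesis unfolding c_def[symmetric] by simp
qed

text \<open>The unit vectors along J are independent, so their sum has positive square; the diagonal
  contributes \<open>card J\<close> and each ordered edge at most -1/2. Thus the graph of
  non-orthogonality has fewer edges than vertices.\<close>

lemma forest_edge_bound:
 assumes "J <= P" "J ~= {}" "!!s t. s \<in> J ==> t \<in> J ==> s ~= t ==> s \<bullet> t <= 0"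
 shows "card {(s, t) \<in> J \<times> J. s \<bullet> t < 0} < 2 * card J"
proof -
 have fin: "finite J" using assms finite_P finite_subset by blast
 let ?e = "%s::real^'n. s /\<^sub>R norm s"
 let ?u = "\<Sum>s\<in>J. ?e s"
 have "?u ~= 0"
 proof
  assume "?u = 0"
  then have z: "(\<Sum>s\<in>J. (1 / norm s) *\<^sub>R s) = 0" by (simp add: divide_inverse_commute)
  obtain s where s: "s \<in> J" using assms by blast
  have "1 / norm s = 0"
   by (rule independentD[OF pos_obtuse_independent[OF assms(1,3)] fin subset_refl z s]) auto
  moreover have "s ~= 0" using s assms(1) P_root root_nonzero by blast
  ultimately show False by simp
 qed
 then have "0 < ?u \<bullet> ?u" by simp
 also have "?u \<bullet> ?u = (\<Sum>s\<in>J. \<Sum>t\<in>J. ?e s \<bullet> ?e t)" by (subst inner_sum_left) (simp only: inner_sum_right)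
 also have "\<dots> = (\<Sum>p\<in>J \<times> J. ?e (fst p) \<bullet> ?e (snd p))" by (simp add: sum.cartesian_product case_prod_beta)
 also have "\<dots> <= (\<Sum>p\<in>J \<times> J. (if fst p = snd p then 1 else 0) + (if fst p \<bullet> snd p < 0 then - 1/2 else 0))"
 proof (intro sum_mono)
  fix p assume p: "p \<in> J \<times> J"
  obtain s t where st: "p = (s, t)" "s \<in> J" "t \<in> J" using p by auto
  then have r: "s \<in> \<Phi>" "t \<in> \<Phi>" "t ~= - s" using assms(1) P_root neg_notin_P by auto
  show "?e (fst p) \<bullet> ?e (snd p) <= (if fst p = snd p then 1 else 0) + (if fst p \<bullet> snd p < 0 then - 1/2 else 0)"
  proof (cases "s = t")
   case True
   moreover have "norm t ~= 0" using root_nonzero[OF r(2)] by simp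
   ultimately show ?thesis using st by (simp add: dot_square_norm power2_eq_square)
  next
   case False
   then have "s \<bullet> t <= 0" using assms(3) st by blast
   then show ?thesis using root_obtuse_angle[OF r(1,2) _ r(3)] st False by (auto simp: less_le)
  qed
 qed
 also have "\<dots> = real (card {p \<in> J \<times> J. fst p = snd p}) - 1/2 * real (card {p \<in> J \<times> J. fst p \<bullet> snd p < 0})"
  using fin by (simp add: sum.distrib sum.If_cases Int_def)
 also have "{p \<in> J \<times> J. fst p = snd p} = (%s. (s, s)) ` J" by auto
 also have "card \<dots> = card J" by (intro card_image inj_onI) auto
 also have "{p \<in> J \<times> J. fst p \<bullet> snd p < 0} = {(s, t) \<in> J \<times> J. s \<bullet> t < 0}" by auto
 finally show ?thesis by simp
qed

text \<open>Reflection in a root of height \<open>j\<close> permutes the other positive roots whose height is a multiple of \<open>j\<close>,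
 so the sum of their coroots pairs to \<open>2\<close> with every root of height \<open>j\<close>. Hence heights in the span of the
 roots of height \<open>j\<close> are multiples of \<open>j / 2\<close>.\<close>

lemma rfl_level_pos:
 assumes a: "\<alpha> \<in> P" "ht \<alpha> = j" and b: "\<beta> \<in> P" "ht \<beta> = real q * j" "\<beta> ~= \<alpha>"
 shows "rfl \<alpha> \<beta> \<in> P - {\<alpha>} & (\<exists>q'. ht (rfl \<alpha> \<beta>) = real q' * j)"
proof -
 have j: "j > 0" using ht_pos a by blast
 obtain n :: int where n: "cart \<beta> \<alpha> = of_int n" using cart_Ints a b P_root by (metis Ints_cases)
 have rt: "rfl \<alpha> \<beta> \<in> \<Phi>" using rfl_root a b P_root by blast
 have h: "ht (rfl \<alpha> \<beta>) = (real q - of_int n) * j"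
  using a b n by (simp add: rfl_def ht_diff ht_scale algebra_simps)
 have nn: "\<beta> ~= - \<alpha>" using a b neg_notin_P by auto
 have "of_int n < real q"
 proof (rule ccontr)
  assume "\<not> ?thesis"
  then have qn: "int q <= n" by linarith
  have q1: "q \<ge> 1" using b ht_pos[OF b(1)] j by (cases q) auto
  have pos: "\<alpha> \<bullet> \<beta> > 0" using cart_sgn[OF P_root[OF a(1)], of \<beta>] n qn q1 by (simp add: inner_commute)
  have "n \<in> {1,2,3}" using cart_cases[OF P_root[OF a(1)] P_root[OF b(1)] b(3) pos] n by auto
  moreover have "real q - of_int n ~= 0" using ht_nonzero[OF rt] h by auto
  ultimately have "q = 1 | (q = 2 & n = 3)" using qn q1 by auto
  moreover have "q ~= 1" using same_ht_obtuse[OF a(1) b(1)] a b pos by auto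
  \<comment> \<open>In the remaining case \<beta> - \<alpha> is a root of height j, different from
    \<alpha> and at an acute angle to it, which \<open>same_ht_obtuse\<close> excludes.\<close>
  ultimately have q2: "q = 2" "n = 3" by auto
  have g: "\<beta> - \<alpha> \<in> \<Phi>" using root_diff[OF P_root[OF b(1)] P_root[OF a(1)]] b(3) pos by (auto simp: inner_commute)
  have hg: "ht (\<beta> - \<alpha>) = j" using a b q2 by (simp add: ht_diff)
  then have gP: "\<beta> - \<alpha> \<in> P" using ht_pos_iff[OF g] j by simp
  have "cart (\<beta> - \<alpha>) \<alpha> = 1" using n q2 cart_self[OF root_nonzero[OF P_root[OF a(1)]]] by (simp add: cart_diff)
  then have "(\<beta> - \<alpha>) \<bullet> \<alpha> > 0" using cart_sgn[OF P_root[OF a(1)], of "\<beta> - \<alpha>"] by simp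
  moreover have "\<beta> - \<alpha> ~= \<alpha>"
  proof
   assume "\<beta> - \<alpha> = \<alpha>"
   then have "\<beta> = 2 *\<^sub>R \<alpha>" by (simp add: scaleR_2 algebra_simps)
   then show False using reduced[OF P_root[OF a(1)], of 2] P_root[OF b(1)] by auto
  qed
  ultimately show False using same_ht_obtuse[OF gP a(1)] hg a by auto
 qed
 then have lt: "n < int q" by linarith
 then have "ht (rfl \<alpha> \<beta>) = real (nat (int q - n)) * j" using h by simp
 moreover have "rfl \<alpha> \<beta> \<in> P" using ht_pos_iff[OF rt] h lt j by simp
 moreover have "rfl \<alpha> \<beta> ~= \<alpha>" using nn by (metis rfl_rfl rfl_self)
 ultimately show ?thesis by blast
qed

lemma level_coroot_sum:
 assumes a: "\<alpha> \<in> P" "ht \<alpha> = j" and M: "M = {\<beta>\<in>P. \<exists>q. ht \<beta> = real q * j}"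
 shows "(\<Sum>\<gamma>\<in>M. cart \<alpha> \<gamma>) = 2"
proof -
 have fM: "finite M" "M <= P" using M finite_P by auto
 have aM: "\<alpha> \<in> M" using a M by (auto intro!: exI[of _ 1])
 have cl: "rfl \<alpha> \<beta> \<in> M - {\<alpha>}" if "\<beta> \<in> M - {\<alpha>}" for \<beta> using rfl_level_pos[OF a] that M by auto
 have bij: "bij_betw (rfl \<alpha>) (M - {\<alpha>}) (M - {\<alpha>})"
  by (rule bij_betwI[of _ _ _ "rfl \<alpha>"]) (use cl rfl_rfl in auto)
 have "(\<Sum>\<gamma>\<in>M - {\<alpha>}. cart \<alpha> \<gamma>) = (\<Sum>\<gamma>\<in>M - {\<alpha>}. cart \<alpha> (rfl \<alpha> \<gamma>))"
  using sum.reindex_bij_betw[OF bij, of "cart \<alpha>"] by simp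
 also have "\<dots> = (\<Sum>\<gamma>\<in>M - {\<alpha>}. - cart \<alpha> \<gamma>)"
 proof (intro sum.cong refl)
  fix \<gamma>
  have "cart \<alpha> (rfl \<alpha> \<gamma>) = cart (rfl \<alpha> (- \<alpha>)) (rfl \<alpha> \<gamma>)" by (metis rfl_rfl rfl_self)
  then show "cart \<alpha> (rfl \<alpha> \<gamma>) = - cart \<alpha> \<gamma>" by (simp add: cart_rfl cart_uminus)
 qed
 finally have "(\<Sum>\<gamma>\<in>M - {\<alpha>}. cart \<alpha> \<gamma>) = 0" by (simp add: sum_negf)
 then show ?thesis using aM fM cart_self[OF root_nonzero[OF P_root[OF a(1)]]] by (subst sum.remove[of _ \<alpha>]) auto
qed

text \<open>By the coroot sum, a root in the span below height j has height exactly j / 2; let J be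
  the set of these. Together with the roots of height j that are not sums of two members of J, they
  form an obtuse, hence independent, set in the span, so J is at most as large as the set of sums.
  But each sum gives an edge on J, and there are fewer edges than vertices.\<close>

lemma level_span_ht:
 assumes "\<beta> \<in> P" "\<beta> \<in> span (lvl j)" shows "hgt \<beta> \<ge> j"
proof (rule ccontr)
 assume low: "\<not> ?thesis"
 define G where "G = lvl j"
 have GP: "G <= P" "finite G" and Gh: "!!\<alpha>. \<alpha> \<in> G ==> ht \<alpha> = real j"
  using finite_P hgt_eq by (auto simp: G_def lvl_def)
 have j0: "real j > 0" using low by simp
 define M where "M = {\<beta>\<in>P. \<exists>q. ht \<beta> = real q * real j}"
 have two: "(\<Sum>\<gamma>\<in>M. cart x \<gamma>) * real j = 2 * ht x" if "x \<in> span G" for x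
  using that
 proof (induction rule: span_induct_alt)
  case base
  then show ?case by (simp add: cart_def ht_def cf_def real_vector.representation_zero)
 next
  case (step c y z)
  have "(\<Sum>\<gamma>\<in>M. cart y \<gamma>) = 2" using level_coroot_sum[OF _ Gh M_def] step(1) GP by blast
  then show ?case using step Gh[OF step(1)]
   by (simp add: cart_add cart_scale ht_add ht_scale sum.distrib sum_distrib_left[symmetric] algebra_simps)
 qed
 have half: "2 * hgt \<gamma> = j" if g: "\<gamma> \<in> P" "\<gamma> \<in> span G" "hgt \<gamma> < j" for \<gamma>
 proof -
  have "(\<Sum>\<gamma>'\<in>M. cart \<gamma> \<gamma>') \<in> \<int>" using cart_Ints P_root g(1) by (intro Ints_sum) (auto simp: M_def)
  then obtain n :: int where "(\<Sum>\<gamma>'\<in>M. cart \<gamma> \<gamma>') = of_int n" by (metis Ints_cases)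
  then have njh: "of_int n * real j = 2 * real (hgt \<gamma>)" using two[OF g(2)] hgt_eq[OF g(1)] by simp
  have e: "n * int j = 2 * int (hgt \<gamma>)"
  proof -
   have "real_of_int (n * int j) = real_of_int (2 * int (hgt \<gamma>))" using njh by simp
   then show ?thesis by (simp only: of_int_eq_iff)
  qed
  have "hgt \<gamma> \<ge> 1" using hgt_ge1 g by blast
  then have "0 < n * int j" "n * int j < 2 * int j" using e g(3) by auto
  then have "0 < n" "n < 2" using j0 by (auto simp: zero_less_mult_iff)
  then have "n = 1" by simp
  then show ?thesis using e by simp
 qed
 define J where "J = {\<gamma>\<in>P. \<gamma> \<in> span G & 2 * hgt \<gamma> = j}"
 have JP: "J <= P" "finite J" using finite_P by (auto simp: J_def)
 have bJ: "\<beta> \<in> J" using half[of \<beta>] assms low by (auto simp: J_def G_def)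
 have Jht: "2 * ht \<gamma> = real j" if "\<gamma> \<in> J" for \<gamma>
  using that hgt_eq[of \<gamma>] by (auto simp: J_def)
 have inJ: "\<gamma> \<in> J" if "\<gamma> \<in> \<Phi>" "\<gamma> \<in> span G" "2 * ht \<gamma> = real j" for \<gamma>
 proof -
  have "\<gamma> \<in> P" using ht_pos_iff[OF that(1)] that(3) j0 by simp
  moreover from this have "2 * hgt \<gamma> = j" using hgt_eq[of \<gamma>] that(3) by linarith
  ultimately show ?thesis using that by (simp add: J_def)
 qed
 have Jobt: "s \<bullet> t <= 0" if "s \<in> J" "t \<in> J" "s ~= t" for s t
  using same_ht_obtuse[of s t] Jht[of s] Jht[of t] that JP by auto
 define G1 where "G1 = {\<alpha>\<in>G. \<exists>\<gamma>\<in>J. \<alpha> - \<gamma> \<in> J}"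
 define G2 where "G2 = G - G1"
 have disj: "J \<inter> G2 = {}" using Jht Gh j0 by (force simp: G2_def)
 have GJ: "\<alpha> \<bullet> \<gamma> <= 0" if "\<alpha> \<in> G2" "\<gamma> \<in> J" for \<alpha> \<gamma>
 proof (rule ccontr)
  assume pos: "\<not> ?thesis"
  have ag: "\<alpha> \<in> G" "\<gamma> ~= \<alpha>" using that disj by (auto simp: G2_def)
  then have "\<alpha> - \<gamma> \<in> \<Phi>" using root_diff[of \<alpha> \<gamma>] GP JP P_root that pos by auto
  moreover have "\<alpha> - \<gamma> \<in> span G" using ag that by (auto simp: J_def span_base intro!: span_diff)
  moreover have "2 * ht (\<alpha> - \<gamma>) = real j" using Gh[OF ag(1)] Jht[OF that(2)] by (simp add: ht_diff)
  ultimately have "\<alpha> - \<gamma> \<in> J" by (rule inJ)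
  then show False using that ag by (auto simp: G2_def G1_def)
 qed
 have "independent (J \<union> G2)"
 proof (rule pos_obtuse_independent)
  show "J \<union> G2 <= P" using JP GP by (auto simp: G2_def)
  fix s t assume "s \<in> J \<union> G2" "t \<in> J \<union> G2" "s ~= t"
  then show "s \<bullet> t <= 0"
   using Jobt GJ[of s t] GJ[of t s] same_ht_obtuse[of s t] Gh subsetD[OF GP(1), of s] subsetD[OF GP(1), of t]
   by (auto simp: inner_commute G2_def)
 qed
 moreover have "J \<union> G2 <= span G" by (auto simp: J_def G2_def span_base)
 ultimately have "card (J \<union> G2) <= dim (span G)" using independent_card_le_dim by blast
 also have "\<dots> = card G" using lvl_independent by (simp add: dim_span dim_eq_card_independent G_def)
 also have "card G = card G1 + card G2"
  using GP by (subst card_Un_disjoint[symmetric]) (auto simp: G2_def G1_def intro!: arg_cong[of _ _ card])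
 also have "card (J \<union> G2) = card J + card G2" using JP GP disj by (intro card_Un_disjoint) (auto simp: G2_def)
 finally have le: "card J <= card G1" by simp
 have "\<exists>\<gamma>. \<alpha> \<in> G1 --> \<gamma> \<in> J & \<alpha> - \<gamma> \<in> J" for \<alpha> by (auto simp: G1_def)
 then obtain f where f: "!!\<alpha>. \<alpha> \<in> G1 ==> f \<alpha> \<in> J & \<alpha> - f \<alpha> \<in> J" by metis
 let ?E = "{(s, t) \<in> J \<times> J. s \<bullet> t < 0}"
 have neg: "f \<alpha> \<bullet> (\<alpha> - f \<alpha>) < 0" if "\<alpha> \<in> G1" for \<alpha>
 proof -
  let ?s = "f \<alpha>" and ?t = "\<alpha> - f \<alpha>"
  have st: "?s \<in> J" "?t \<in> J" using f that by auto
  then have r: "?s \<in> \<Phi>" "?t \<in> \<Phi>" "\<alpha> \<in> \<Phi>" using JP P_root that GP by (auto simp: G1_def)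
  have ne: "?s ~= ?t"
  proof
   assume "?s = ?t"
   then have "\<alpha> = 2 *\<^sub>R ?s" by (simp add: scaleR_2 algebra_simps)
   then show False using reduced[OF r(1), of 2] r(3) by auto
  qed
  have "?s \<bullet> ?t ~= 0"
  proof
   \<comment> \<open>If the summands were orthogonal, reflecting their sum in \<open>?t\<close>
     would give \<open>?s - ?t\<close>, a root of height 0.\<close>
   assume z: "?s \<bullet> ?t = 0"
   have "rfl ?t \<alpha> = rfl ?t ?s + rfl ?t ?t" using linear_add[OF linear_rfl, of ?t ?s ?t] by simp
   then have "rfl ?t \<alpha> = ?s - ?t" using z by (simp add: rfl_self rfl_fixed inner_commute)
   then have "?s - ?t \<in> \<Phi>" using rfl_root[OF r(2,3)] by simp
   then show False using ht_nonzero Jht[OF st(1)] Jht[OF st(2)] by (metis ht_diff right_minus_eq mult_left_cancel zero_neq_numeral)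
  qed
  then show ?thesis using Jobt[OF st ne] by simp
 qed
 have ff: "f \<alpha> ~= \<alpha> - f \<alpha>" if "\<alpha> \<in> G1" for \<alpha> using neg[OF that] by (metis inner_ge_zero not_le)
 have "card ((%\<alpha>. (f \<alpha>, \<alpha> - f \<alpha>)) ` G1 \<union> (%\<alpha>. (\<alpha> - f \<alpha>, f \<alpha>)) ` G1) <= card ?E"
  using f neg JP by (intro card_mono finite_subset[of ?E "J \<times> J"]) (auto simp: inner_commute)
 moreover have "card ((%\<alpha>. (f \<alpha>, \<alpha> - f \<alpha>)) ` G1 \<union> (%\<alpha>. (\<alpha> - f \<alpha>, f \<alpha>)) ` G1) = card G1 + card G1"
 proof (subst card_Un_disjoint)
  show "finite ((%\<alpha>. (f \<alpha>, \<alpha> - f \<alpha>)) ` G1)" "finite ((%\<alpha>. (\<alpha> - f \<alpha>, f \<alpha>)) ` G1)" using GP by (auto simp: G1_def)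
  have inj: "inj_on (%\<alpha>. (f \<alpha>, \<alpha> - f \<alpha>)) G1" "inj_on (%\<alpha>. (\<alpha> - f \<alpha>, f \<alpha>)) G1"
   by (auto intro!: inj_onI)
  show "card ((%\<alpha>. (f \<alpha>, \<alpha> - f \<alpha>)) ` G1) + card ((%\<alpha>. (\<alpha> - f \<alpha>, f \<alpha>)) ` G1) = card G1 + card G1"
   using inj by (simp add: card_image)
  show "(%\<alpha>. (f \<alpha>, \<alpha> - f \<alpha>)) ` G1 \<inter> (%\<alpha>. (\<alpha> - f \<alpha>, f \<alpha>)) ` G1 = {}"
  proof (rule ccontr)
   assume "\<not> ?thesis"
   then obtain a b where ab: "a \<in> G1" "b \<in> G1" "f a = b - f b" "a - f a = f b" by auto
   then have "a = b" by (metis add.commute diff_add_cancel)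
   then show False using ab ff by auto
  qed
 qed
 moreover have "card ?E < 2 * card J" using forest_edge_bound[OF JP(1) _ Jobt] bJ by auto
 ultimately show False using le by simp
qed

subsection \<open>Irreducibility\<close>

lemma orthogonal_split:
 assumes "A ~= {}" "B ~= {}" "A \<union> B = \<Phi>" "A \<inter> B = {}" "\<forall>a\<in>A. \<forall>b\<in>B. a \<bullet> b = 0" shows False
 using irr assms unfolding irreducible_rs_def by blast

text \<open>A root spans the -1 eigenspace of its reflection, so \<phi> scales every root.
  Reflecting one root in a non-orthogonal one forces equal factors, and irreducibility spreads the
  factor to all roots.\<close>

lemma commuting_scalar:
 assumes lin: "linear \<phi>" and com: "!!\<alpha> x. \<alpha> \<in> \<Phi> ==> \<phi> (rfl \<alpha> x) = rfl \<alpha> (\<phi> x)"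
 shows "\<exists>c. \<forall>x. \<phi> x = c *\<^sub>R x"
proof -
 have "\<exists>c. \<alpha> \<in> \<Phi> --> \<phi> \<alpha> = c *\<^sub>R \<alpha>" for \<alpha>
 proof (cases "\<alpha> \<in> \<Phi>")
  case True
  have "rfl \<alpha> (\<phi> \<alpha>) = - \<phi> \<alpha>" using com[OF True, of \<alpha>] lin by (simp add: rfl_self linear_neg)
  then show ?thesis using rfl_anti by blast
 qed auto
 then obtain c where c: "!!\<alpha>. \<alpha> \<in> \<Phi> ==> \<phi> \<alpha> = c \<alpha> *\<^sub>R \<alpha>" by metis
 have eq: "c \<alpha> = c \<beta>" if ab: "\<alpha> \<in> \<Phi>" "\<beta> \<in> \<Phi>" "\<alpha> \<bullet> \<beta> ~= 0" for \<alpha> \<beta>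
 proof (cases "\<beta> = \<alpha> | \<beta> = - \<alpha>")
  case True
  moreover have "c (- \<alpha>) *\<^sub>R (- \<alpha>) = - (c \<alpha> *\<^sub>R \<alpha>)" using c[OF neg_root[OF ab(1)]] c[OF ab(1)] linear_neg[OF lin, of \<alpha>] by metis
  then have "c (- \<alpha>) = c \<alpha>" using root_nonzero[OF ab(1)] by simp
  ultimately show ?thesis by auto
 next
  case False
  let ?n = "cart \<beta> \<alpha>"
  have g: "\<beta> - ?n *\<^sub>R \<alpha> \<in> \<Phi>" using rfl_root[OF ab(1,2)] by (simp add: rfl_def)
  let ?c = "c (\<beta> - ?n *\<^sub>R \<alpha>)"
  have n0: "?n ~= 0" using ab cart_sgn[OF ab(1), of \<beta>] by (auto simp: inner_commute)
  have "\<phi> (\<beta> - ?n *\<^sub>R \<alpha>) = c \<beta> *\<^sub>R \<beta> - ?n *\<^sub>R c \<alpha> *\<^sub>R \<alpha>"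
   using lin c ab by (simp add: linear_diff linear_cmul)
  then have "?c *\<^sub>R (\<beta> - ?n *\<^sub>R \<alpha>) = c \<beta> *\<^sub>R \<beta> - (?n * c \<alpha>) *\<^sub>R \<alpha>" using c[OF g] by simp
  then have e: "(?c - c \<beta>) *\<^sub>R \<beta> = (?n * (?c - c \<alpha>)) *\<^sub>R \<alpha>" by (simp add: algebra_simps)
  have 1: "?c - c \<beta> = 0"
  proof (rule ccontr)
   assume nz: "?c - c \<beta> ~= 0"
   have "\<beta> = (1 / (?c - c \<beta>)) *\<^sub>R ((?c - c \<beta>) *\<^sub>R \<beta>)" using nz by simp
   also have "\<dots> \<in> span {\<alpha>}" unfolding e by (intro span_scale span_base) auto
   finally show False using parallel_roots[OF ab(1,2)] False by blast
  qed
  then have "(?n * (?c - c \<alpha>)) *\<^sub>R \<alpha> = 0" using e by simp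
  then have "?c = c \<alpha>" using n0 root_nonzero[OF ab(1)] by auto
  then show ?thesis using 1 by simp
 qed
 show ?thesis
 proof (cases "\<Phi> = {}")
  case True
  then have "span {} = (UNIV :: (real^'n) set)" using span_roots by simp
  then have "x = 0" for x :: "real^'n" by (metis UNIV_I span_empty singletonD)
  then have "\<phi> x = 0 *\<^sub>R x" for x by metis
  then show ?thesis by blast
 next
  case False
  then obtain \<alpha>0 where a0: "\<alpha>0 \<in> \<Phi>" by blast
  have "{\<alpha>\<in>\<Phi>. c \<alpha> ~= c \<alpha>0} = {}"
  proof (rule ccontr)
   assume "\<not> ?thesis"
   moreover have "{\<alpha>\<in>\<Phi>. c \<alpha> = c \<alpha>0} ~= {}" using a0 by auto
   moreover have "{\<alpha>\<in>\<Phi>. c \<alpha> = c \<alpha>0} \<union> {\<alpha>\<in>\<Phi>. c \<alpha> ~= c \<alpha>0} = \<Phi>" by auto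
   moreover have "{\<alpha>\<in>\<Phi>. c \<alpha> = c \<alpha>0} \<inter> {\<alpha>\<in>\<Phi>. c \<alpha> ~= c \<alpha>0} = {}" by auto
   moreover have "\<forall>a\<in>{\<alpha>\<in>\<Phi>. c \<alpha> = c \<alpha>0}. \<forall>b\<in>{\<alpha>\<in>\<Phi>. c \<alpha> ~= c \<alpha>0}. a \<bullet> b = 0"
   proof (intro ballI)
    fix a b assume "a \<in> {\<alpha>\<in>\<Phi>. c \<alpha> = c \<alpha>0}" "b \<in> {\<alpha>\<in>\<Phi>. c \<alpha> ~= c \<alpha>0}"
    then have "a \<in> \<Phi>" "b \<in> \<Phi>" "c a ~= c b" by auto
    then show "a \<bullet> b = 0" using eq by blast
   qed
   ultimately show False by (intro orthogonal_split[of "{\<alpha>\<in>\<Phi>. c \<alpha> = c \<alpha>0}" "{\<alpha>\<in>\<Phi>. c \<alpha> ~= c \<alpha>0}"])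
  qed
  then have "\<phi> \<alpha> = c \<alpha>0 *\<^sub>R \<alpha>" if "\<alpha> \<in> \<Phi>" for \<alpha> using c that by auto
  then have "\<phi> x = c \<alpha>0 *\<^sub>R x" for x
   using linear_eq_on[OF lin linear_scale_self, of x \<Phi> "c \<alpha>0"] span_roots by auto
  then show ?thesis by blast
 qed
qed

text \<open>This ratio turns out to be the Coxeter number (\<open>hh_eq\<close>). The first climb,
  for m = 0, takes place before that is known, so the counts are stated with this real
  number.\<close>

definition hh :: real where "hh = 2 * real (card P) / real CARD('n)"

lemma sum_roots: "(\<Sum>\<beta>\<in>\<Phi>. f \<beta>) = (\<Sum>\<beta>\<in>P. f \<beta> + f (- \<beta>))" for f :: "real^'n => 'b::comm_monoid_add"
proof -
 have "\<Phi> = P \<union> uminus ` P"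
 proof
  show "\<Phi> <= P \<union> uminus ` P" using pos_or_neg by force
  show "P \<union> uminus ` P <= \<Phi>" using P_sub neg_root by auto
 qed
 moreover have "P \<inter> uminus ` P = {}" using neg_notin_P by auto
 ultimately have "(\<Sum>\<beta>\<in>\<Phi>. f \<beta>) = (\<Sum>\<beta>\<in>P. f \<beta>) + (\<Sum>\<beta>\<in>uminus ` P. f \<beta>)"
  using finite_P by (simp add: sum.union_disjoint)
 also have "(\<Sum>\<beta>\<in>uminus ` P. f \<beta>) = (\<Sum>\<beta>\<in>P. f (- \<beta>))" by (simp add: sum.reindex)
 finally show ?thesis by (simp add: sum.distrib)
qed

lemma card_roots: "card \<Phi> = 2 * card P"
 using sum_roots[of "%_. 1::nat"] by simp

text \<open>The left side commutes with all reflections, hence is a scalar; the scalar is found from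
  the trace, to which every positive root contributes 2.\<close>

lemma sum_cart_scalar: "(\<Sum>\<beta>\<in>P. cart x \<beta> *\<^sub>R \<beta>) = hh *\<^sub>R x"
proof -
 define T where "T x = (\<Sum>\<beta>\<in>\<Phi>. cart x \<beta> *\<^sub>R \<beta>)" for x
 have T: "T x = 2 *\<^sub>R (\<Sum>\<beta>\<in>P. cart x \<beta> *\<^sub>R \<beta>)" for x
  unfolding T_def sum_roots scaleR_sum_right
  by (intro sum.cong refl) (simp only: cart_uminus2 scaleR_minus_left scaleR_minus_right minus_minus scaleR_2)
 have "linear T" unfolding T_def by (rule linearI) (auto simp: cart_add cart_scale sum.distrib algebra_simps scaleR_sum_right)
 moreover have "T (rfl \<alpha> x) = rfl \<alpha> (T x)" if "\<alpha> \<in> \<Phi>" for \<alpha> x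
 proof -
  have bij: "bij_betw (rfl \<alpha>) \<Phi> \<Phi>"
   by (rule bij_betwI[of _ _ _ "rfl \<alpha>"]) (use rfl_root[OF that] rfl_rfl in auto)
  have "T (rfl \<alpha> x) = (\<Sum>\<beta>\<in>\<Phi>. cart (rfl \<alpha> x) (rfl \<alpha> \<beta>) *\<^sub>R rfl \<alpha> \<beta>)"
   unfolding T_def using sum.reindex_bij_betw[OF bij, of "%\<beta>. cart (rfl \<alpha> x) \<beta> *\<^sub>R \<beta>"] by simp
  also have "\<dots> = rfl \<alpha> (T x)" unfolding T_def
   by (simp add: cart_rfl linear_sum[OF linear_rfl] linear_cmul[OF linear_rfl])
  finally show ?thesis .
 qed
 ultimately obtain c where c: "!!x. T x = c *\<^sub>R x" using commuting_scalar by blast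
 have "(\<Sum>b\<in>Basis. T b \<bullet> b) = c * real CARD('n)" using c by simp
 moreover have "(\<Sum>b\<in>Basis. T b \<bullet> b) = 2 * (2 * real (card P))"
 proof -
  have "(\<Sum>b\<in>Basis. cart b \<beta> * (\<beta> \<bullet> b)) = 2" if "\<beta> \<in> P" for \<beta>
  proof -
   have "(\<Sum>b\<in>Basis. cart b \<beta> * (\<beta> \<bullet> b)) = 2 / (\<beta> \<bullet> \<beta>) * (\<Sum>b\<in>Basis. (\<beta> \<bullet> b) * (\<beta> \<bullet> b))"
    by (simp add: cart_def sum_distrib_left inner_commute mult_ac)
   also have "(\<Sum>b\<in>Basis. (\<beta> \<bullet> b) * (\<beta> \<bullet> b)) = \<beta> \<bullet> \<beta>" by (metis euclidean_inner)
   finally show ?thesis using root_norm_pos[OF P_root[OF that]] by simp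
  qed
  then have "(\<Sum>\<beta>\<in>P. \<Sum>b\<in>Basis. cart b \<beta> * (\<beta> \<bullet> b)) = 2 * real (card P)" by simp
  then show ?thesis unfolding T by (subst (asm) sum.swap) (simp add: inner_sum_left sum_distrib_left[symmetric])
 qed
 ultimately have "c = 2 * hh" by (simp add: hh_def field_simps)
 then have "2 *\<^sub>R (\<Sum>\<beta>\<in>P. cart x \<beta> *\<^sub>R \<beta>) = 2 *\<^sub>R (hh *\<^sub>R x)" using T[of x] c[of x] by simp
 then show ?thesis by (metis scaleR_cancel_left zero_neq_numeral)
qed

text \<open>Connectedness of the Dynkin diagram. By induction every positive root lies in the span
  of one of the two parts, so a disconnected base would split \<Phi> orthogonally.\<close>

lemma simple_irreducible:
 assumes "\<Delta>1 <= \<Delta>" "\<Delta>1 ~= {}" "!!a b. a \<in> \<Delta>1 ==> b \<in> \<Delta> - \<Delta>1 ==> a \<bullet> b = 0"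
 shows "\<Delta>1 = \<Delta>"
proof (rule ccontr)
 assume "\<Delta>1 ~= \<Delta>"
 define \<Delta>2 where "\<Delta>2 = \<Delta> - \<Delta>1"
 have D2: "\<Delta>2 ~= {}" "\<Delta>2 <= \<Delta>" "\<Delta>1 \<union> \<Delta>2 = \<Delta>" using assms \<open>\<Delta>1 ~= \<Delta>\<close> by (auto simp: \<Delta>2_def)
 have orth: "x \<bullet> y = 0" if "x \<in> span \<Delta>1" "y \<in> span \<Delta>2" for x y
 proof -
  have "orthogonal y x"
  proof (rule orthogonal_to_span[OF that(1)])
   fix a assume "a \<in> \<Delta>1"
   then have "orthogonal a y" using that(2) assms(3) by (intro orthogonal_to_span[OF that(2)]) (auto simp: orthogonal_def \<Delta>2_def)
   then show "orthogonal y a" by (simp add: orthogonal_commute)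
  qed
  then show ?thesis by (simp add: orthogonal_def inner_commute)
 qed
 have cf0: "cf x \<delta> = 0" if "x \<in> span S" "S <= \<Delta>" "\<delta> ~: S" for x \<delta> S
 proof -
  have "span S <= {x. cf x \<delta> = 0}"
   using that linear_0[OF linear_cf] by (intro span_minimal) (auto simp: subspace_def cf_add cf_scale cf_basis)
  then show ?thesis using that by auto
 qed
 \<comment> \<open>A simple root orthogonal to \<gamma> and absent from it cannot be added:
   reflecting the sum would make \<gamma> - \<delta> positive, although its coefficient at \<delta>
   is -1.\<close>
 have stepaux: False if g: "\<gamma> \<in> P" "\<delta> \<in> \<Delta>" "\<gamma> + \<delta> \<in> P" "\<gamma> \<bullet> \<delta> = 0" "cf \<gamma> \<delta> = 0" for \<gamma> \<delta>
 proof -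
  have "rfl \<delta> (\<gamma> + \<delta>) = \<gamma> - \<delta>" using g(4) linear_add[OF linear_rfl, of \<delta> \<gamma> \<delta>]
   by (simp add: rfl_self rfl_fixed inner_commute)
  moreover have "\<gamma> + \<delta> ~= \<delta>" using g P_root zero_not_root by auto
  ultimately have "\<gamma> - \<delta> \<in> P" using rfl_simple_pos[OF g(2,3)] by auto
  then have "cf (\<gamma> - \<delta>) \<delta> \<ge> 0" using cf_pos g by blast
  then show False using g by (simp add: cf_diff cf_basis)
 qed
 have P12: "\<beta> \<in> span \<Delta>1 | \<beta> \<in> span \<Delta>2" if "\<beta> \<in> P" for \<beta>
  using that
 proof (induction rule: pos_root_induct)
  case (simple \<delta>)
  then show ?case using D2 by (auto intro: span_base)
 next
  case (step \<gamma> \<delta>)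
  consider "\<gamma> \<in> span \<Delta>1" "\<delta> \<in> \<Delta>1" | "\<gamma> \<in> span \<Delta>2" "\<delta> \<in> \<Delta>2"
   | "\<gamma> \<in> span \<Delta>1" "\<delta> \<in> \<Delta>2" | "\<gamma> \<in> span \<Delta>2" "\<delta> \<in> \<Delta>1" using step D2 by blast
  then show ?case
  proof cases
   case 1 then show ?thesis by (auto intro: span_add span_base)
  next
   case 2 then show ?thesis by (auto intro: span_add span_base)
  next
   case 3
   then show ?thesis using stepaux[OF step(1,2,3)] orth[of \<gamma> \<delta>] cf0[of \<gamma> \<Delta>1 \<delta>] assms(1) by (auto simp: \<Delta>2_def span_base)
  next
   case 4
   then show ?thesis using stepaux[OF step(1,2,3)] orth[of \<delta> \<gamma>] cf0[of \<gamma> \<Delta>2 \<delta>] D2(2)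
    by (auto simp: \<Delta>2_def span_base inner_commute)
  qed
 qed
 define A where "A = {\<beta>\<in>\<Phi>. \<beta> \<in> span \<Delta>1}"
 define B where "B = {\<beta>\<in>\<Phi>. \<beta> \<in> span \<Delta>2}"
 have "A ~= {}" "B ~= {}" using assms(1,2) D2(1,2) D_root unfolding A_def B_def by (blast intro: span_base)+
 moreover have "A \<union> B = \<Phi>"
 proof -
  have "\<beta> \<in> A \<union> B" if "\<beta> \<in> \<Phi>" for \<beta>
   using pos_or_neg[OF that] P12[of \<beta>] P12[of "- \<beta>"] that span_neg[of "- \<beta>"] unfolding A_def B_def by auto
  then show ?thesis by (auto simp: A_def B_def)
 qed
 moreover have "\<forall>a\<in>A. \<forall>b\<in>B. a \<bullet> b = 0" using orth by (auto simp: A_def B_def)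
 moreover have "A \<inter> B = {}" using orth root_norm_pos by (force simp: A_def B_def)
 ultimately show False by (intro orthogonal_split[of A B])
qed

end

section \<open>Intersections inside planes of roots\<close>

text \<open>A plane of roots with base \<open>a, b\<close> is coded by the coordinate pairs of its positive roots; \<open>n = 1, 2, 3\<close>
 stands for the types \<open>A\<^sub>2\<close>, \<open>B\<^sub>2\<close>, \<open>G\<^sub>2\<close> with \<open>cart b a = - n\<close> and \<open>cart a b = - 1\<close>.\<close>

definition R2 :: "nat => (int \<times> int) set" where
 "R2 n = (if n = 1 then {(1,0), (0,1), (1,1)} else if n = 2 then {(1,0), (0,1), (1,1), (2,1)}
  else {(1,0), (0,1), (1,1), (2,1), (3,1), (3,2)})"

text \<open>Levels certainly present in the plane when \<open>p0\<close> is treated: coordinatewise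
  comparison implies comparison of heights for every base (\<open>ht_emb_less\<close>). Hyperplanes
  beyond these can only add coincidences.\<close>

definition I1 :: "nat => int \<times> int => int \<times> int => int set" where
 "I1 m p0 p = {if fst p <= fst p0 & snd p <= snd p0 then - int m else 1 - int m..int m}"

definition I2 :: "nat => int \<times> int => int \<times> int => int set" where
 "I2 m p0 p = {- int m..if fst p0 <= fst p & snd p0 <= snd p then int m + 1 else int m}"

text \<open>On the line \<open>p0 = t\<close>, the point cut out by \<open>p = k\<close> is recorded by the value \<open>c / q\<close> there of the form \<open>u a + v b\<close>.\<close>

definition cover :: "nat => int \<times> int => int => (int \<times> int => int set) => nat => bool" where
 "cover n p0 t I T \<longleftrightarrow> (\<exists>u v q C. q > 0 & finite C & u * snd p0 - fst p0 * v ~= 0 \<and>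
  card C + T <= (\<Sum>p\<in>R2 n - {p0}. card (I p)) \<and>
  (\<forall>p\<in>R2 n - {p0}. \<forall>k\<in>I p. \<exists>c\<in>C.
    q * ((u * snd p0 - fst p0 * v) * k + (fst p * v - snd p * u) * t) = (fst p * snd p0 - fst p0 * snd p) * c))"

text \<open>A triple \<open>(r, lo, hi)\<close> stands for the numbers q j + r with j from lo to hi.
  Counting repeated values twice does no harm, since an upper bound for the number of points is
  wanted.\<close>

lemma coverI:
 assumes "q > 0" "u * snd p0 - fst p0 * v ~= 0"
  "(\<Sum>(r, lo, hi)\<leftarrow>xs. nat (hi - lo + 1)) + T <= (\<Sum>p\<in>R2 n - {p0}. card (I p))"
  "\<forall>p\<in>R2 n - {p0}. \<forall>k\<in>I p. \<exists>(r, lo, hi)\<in>set xs. \<exists>j. lo <= j & j <= hi \<and>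
    q * ((u * snd p0 - fst p0 * v) * k + (fst p * v - snd p * u) * t) = (fst p * snd p0 - fst p0 * snd p) * (q * j + r)"
 shows "cover n p0 t I T"
proof -
 define C where "C xs = (\<Union>(r, lo, hi)\<in>set xs. (%j. q * j + r) ` {lo..hi})" for xs :: "(int \<times> int \<times> int) list"
 have "card (C xs) <= (\<Sum>(r, lo, hi)\<leftarrow>xs. nat (hi - lo + 1)) & finite (C xs)" for xs
 proof (induction xs)
  case (Cons x xs)
  obtain r lo hi where x: "x = (r, lo, hi)" by (cases x) auto
  have "card (C (x # xs)) <= card ((%j. q * j + r) ` {lo..hi}) + card (C xs)"
   by (simp add: C_def x card_Un_le)
  also have "card ((%j. q * j + r) ` {lo..hi}) <= nat (hi - lo + 1)"
   by (rule order_trans[OF card_image_le]) auto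
  finally show ?case using Cons by (auto simp: x C_def)
 qed (simp add: C_def)
 then have c: "card (C xs) + T <= (\<Sum>p\<in>R2 n - {p0}. card (I p))" "finite (C xs)"
  using assms(3) by (meson add_le_mono1 order_trans)+
 have "\<forall>p\<in>R2 n - {p0}. \<forall>k\<in>I p. \<exists>c\<in>C xs.
    q * ((u * snd p0 - fst p0 * v) * k + (fst p * v - snd p * u) * t) = (fst p * snd p0 - fst p0 * snd p) * c"
 proof (intro ballI)
  fix p k assume "p \<in> R2 n - {p0}" "k \<in> I p"
  then obtain r lo hi j where "(r, lo, hi) \<in> set xs" "lo <= j" "j <= hi"
   "q * ((u * snd p0 - fst p0 * v) * k + (fst p * v - snd p * u) * t) = (fst p * snd p0 - fst p0 * snd p) * (q * j + r)"
   using assms(4) by blast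
  then show "\<exists>c\<in>C xs. q * ((u * snd p0 - fst p0 * v) * k + (fst p * v - snd p * u) * t) = (fst p * snd p0 - fst p0 * snd p) * c"
   unfolding C_def by (intro bexI[of _ "q * j + r"] UN_I[of "(r, lo, hi)"]) auto
 qed
 with c assms(1,2) show ?thesis unfolding cover_def by blast
qed

text \<open>A quantifier-free form of \<open>\<exists>j\<in>{lo..hi}. N = D * (q * j + r)\<close>, which keeps the arithmetic decision procedure fast.\<close>
definition hits :: "int => int => int => int \<times> int \<times> int => bool" where
 "hits D N q x \<longleftrightarrow> (case x of (r, lo, hi) => D ~= 0 & D * q dvd N - D * r & D * D * q * lo <= D * (N - D * r) & D * (N - D * r) <= D * D * q * hi)"

lemma hitsD:
 assumes "hits D N q (r, lo, hi)" "q > 0" shows "\<exists>j. lo <= j & j <= hi & N = D * (q * j + r)"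
proof -
 have h: "D ~= 0" "D * q dvd N - D * r" "D * D * q * lo <= D * (N - D * r)" "D * (N - D * r) <= D * D * q * hi"
  using assms(1) unfolding hits_def prod.case by blast+
 from h(2) obtain j where j: "N - D * r = D * q * j" by (elim dvdE)
 have "D < 0 | 0 < D" using h(1) by linarith
 then have "0 < D * D" by (elim disjE) (rule mult_neg_neg, assumption+, rule mult_pos_pos, assumption+)
 then have pos: "0 < D * D * q" by (rule mult_pos_pos[OF _ assms(2)])
 have eq: "D * (N - D * r) = D * D * q * j" unfolding j by (simp only: mult.assoc)
 have "D * D * q * lo <= D * D * q * j" "D * D * q * j <= D * D * q * hi" using h(3,4) unfolding eq .
 then have "lo <= j" "j <= hi" using pos by (simp_all only: mult_le_cancel_left_pos)
 moreover have "N = D * (q * j + r)" using j by (simp add: algebra_simps)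
 ultimately show ?thesis by blast
qed

lemma coverI_dvd:
 assumes "q > 0" "u * snd p0 - fst p0 * v ~= 0"
  "(\<Sum>(r, lo, hi)\<leftarrow>xs. nat (hi - lo + 1)) + T <= (\<Sum>p\<in>R2 n - {p0}. card (I p))"
  "\<forall>p\<in>R2 n - {p0}. \<forall>k\<in>I p. \<exists>x\<in>set xs. hits (fst p * snd p0 - fst p0 * snd p)
    (q * ((u * snd p0 - fst p0 * v) * k + (fst p * v - snd p * u) * t)) q x"
 shows "cover n p0 t I T"
proof (rule coverI[OF assms(1-3)], intro ballI)
 fix p k assume pk: "p \<in> R2 n - {p0}" "k \<in> I p"
 from bspec[OF bspec[OF assms(4) pk(1)] pk(2)] obtain x where x: "x \<in> set xs" and c: "hits (fst p * snd p0 - fst p0 * snd p)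
    (q * ((u * snd p0 - fst p0 * v) * k + (fst p * v - snd p * u) * t)) q x" by (rule bexE)
 obtain r lo hi where xe: "x = (r, lo, hi)" by (rule prod_cases3)
 show "\<exists>(r, lo, hi)\<in>set xs. \<exists>j. lo <= j & j <= hi \<and>
   q * ((u * snd p0 - fst p0 * v) * k + (fst p * v - snd p * u) * t) = (fst p * snd p0 - fst p0 * snd p) * (q * j + r)"
  by (rule bexI[OF _ x], unfold xe prod.case, rule hitsD[OF c[unfolded xe] assms(1)])
qed

text \<open>For the long roots of \<open>G\<^sub>2\<close> the recorded values are integers, halves or thirds of integers.\<close>

lemma cover6I:
 assumes "u * snd p0 - fst p0 * v ~= 0" "a <= c" "e + 1 <= b"
  "nat (b - a + 1) + 3 * nat (e - c + 1) + T <= (\<Sum>p\<in>R2 n - {p0}. card (I p))"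
  "!!p k E d. p \<in> R2 n - {p0} ==> k \<in> I p ==> E = (u * snd p0 - fst p0 * v) * k + (fst p * v - snd p * u) * t ==>
    d = fst p * snd p0 - fst p0 * snd p ==>
    (\<bar>d\<bar> = 1 & a <= sgn d * E & sgn d * E <= b) | (\<bar>d\<bar> = 2 & 2 * c <= sgn d * E & sgn d * E <= 2 * e + 2) \<or>
    (\<bar>d\<bar> = 3 & 3 * c <= sgn d * E & sgn d * E <= 3 * e + 3)"
 shows "cover n p0 t I T"
proof (rule coverI[where u = u and v = v and q = 6 and xs = "[(0, a, b), (2, c, e), (3, c, e), (4, c, e)]"])
 show "\<forall>p\<in>R2 n - {p0}. \<forall>k\<in>I p. \<exists>(r, lo, hi)\<in>set [(0, a, b), (2, c, e), (3, c, e), (4, c, e)]. \<exists>j. lo <= j & j <= hi \<and>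
    6 * ((u * snd p0 - fst p0 * v) * k + (fst p * v - snd p * u) * t) = (fst p * snd p0 - fst p0 * snd p) * (6 * j + r)"
 proof (intro ballI)
  fix p k assume pk: "p \<in> R2 n - {p0}" "k \<in> I p"
  define E where "E = (u * snd p0 - fst p0 * v) * k + (fst p * v - snd p * u) * t"
  define d where "d = fst p * snd p0 - fst p0 * snd p"
  obtain x where x: "a <= x & x <= b & E = d * x | 2 * c <= x & x <= 2 * e + 2 & 2 * E = d * x \<or>
    3 * c <= x & x <= 3 * e + 3 & 3 * E = d * x"
  proof -
   have "(\<bar>d\<bar> = 1 & a <= sgn d * E & sgn d * E <= b) | (\<bar>d\<bar> = 2 & 2 * c <= sgn d * E & sgn d * E <= 2 * e + 2) \<or>
    (\<bar>d\<bar> = 3 & 3 * c <= sgn d * E & sgn d * E <= 3 * e + 3)" using assms(5)[OF pk E_def d_def] .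
   moreover have "\<bar>d\<bar> * E = d * (sgn d * E)" by (metis abs_sgn mult.assoc mult.commute)
   ultimately show thesis using that[of "sgn d * E"] by auto
  qed
  have "\<exists>y. 6 * E = d * y & ((\<exists>j. a <= j & j <= b & y = 6 * j) | (\<exists>j. c <= j & j <= e & (y = 6 * j + 2 | y = 6 * j + 3 | y = 6 * j + 4)))"
   using x
  proof (elim disjE conjE)
   assume "a <= x" "x <= b" "E = d * x"
   then show ?thesis by (intro exI[of _ "6 * x"]) auto
  next
   assume h: "2 * c <= x" "x <= 2 * e + 2" "2 * E = d * x"
   have "(\<exists>j. a <= j & j <= b & 3 * x = 6 * j) | (\<exists>j. c <= j & j <= e & (3 * x = 6 * j + 2 | 3 * x = 6 * j + 3 | 3 * x = 6 * j + 4))"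
   proof (cases "even x")
    case True
    then obtain j where "x = 2 * j" by (elim evenE)
    then show ?thesis using h assms(2,3) by (intro disjI1 exI[of _ j]) auto
   next
    case False
    then obtain j where "x = 2 * j + 1" by (elim oddE)
    then show ?thesis using h assms(2,3) by (intro disjI2 exI[of _ j]) auto
   qed
   then show ?thesis using h(3) by (intro exI[of _ "3 * x"]) auto
  next
   assume h: "3 * c <= x" "x <= 3 * e + 3" "3 * E = d * x"
   have "x = 3 * (x div 3) | x = 3 * (x div 3) + 1 | x = 3 * (x div 3) + 2" by presburger
   then have "(\<exists>j. a <= j & j <= b & 2 * x = 6 * j) | (\<exists>j. c <= j & j <= e & (2 * x = 6 * j + 2 | 2 * x = 6 * j + 3 | 2 * x = 6 * j + 4))"
   proof (elim disjE)
    assume "x = 3 * (x div 3)"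
    then show ?thesis using h assms(2,3) by (intro disjI1 exI[of _ "x div 3"]) linarith
   next
    assume "x = 3 * (x div 3) + 1"
    then show ?thesis using h assms(2,3) by (intro disjI2 exI[of _ "x div 3"]) linarith
   next
    assume "x = 3 * (x div 3) + 2"
    then show ?thesis using h assms(2,3) by (intro disjI2 exI[of _ "x div 3"]) linarith
   qed
   then show ?thesis using h(3) by (intro exI[of _ "2 * x"]) auto
  qed
  then show "\<exists>(r, lo, hi)\<in>set [(0, a, b), (2, c, e), (3, c, e), (4, c, e)]. \<exists>j. lo <= j & j <= hi \<and>
    6 * ((u * snd p0 - fst p0 * v) * k + (fst p * v - snd p * u) * t) = (fst p * snd p0 - fst p0 * snd p) * (6 * j + r)"
   unfolding E_def[symmetric] d_def[symmetric] by auto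
 qed
qed (use assms in auto)

text \<open>The suffix gives the type n and the root p0; \<open>cover1\<close> belongs to the
  passage from Shi to Catalan, \<open>cover2\<close> to the next one. Let H = 3, 4, 6 be the Coxeter
  number of the plane, which in rank two is its number of positive roots, and s the height of p0 in
  it. Then T is m (H - 2) + (s - 1) in the first and (m + 1) (H - 2) - (s - 1) in the second case.
  The lists contain all values that the auxiliary form takes on the line.\<close>

lemma cover1_1_10: "cover 1 (1, 0) (- int m) (I1 m (1, 0)) (m * 1 + 0)"
 by (rule coverI[where u = 0 and v = 1 and q = 1 and xs = "[(0, - int m + 1, 2 * int m)]"];
   simp add: R2_def I1_def I2_def insert_Diff_if hits_def; (simp add: Ball_def)?; presburger?)

lemma cover2_1_10: "cover 1 (1, 0) (int m + 1) (I2 m (1, 0)) ((m + 1) * 1 - 0)"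
 by (rule coverI[where u = 0 and v = 1 and q = 1 and xs = "[(0, - 2 * int m - 1, int m)]"];
   simp add: R2_def I1_def I2_def insert_Diff_if hits_def; (simp add: Ball_def)?; presburger?)

lemma cover1_1_01: "cover 1 (0, 1) (- int m) (I1 m (0, 1)) (m * 1 + 0)"
 by (rule coverI[where u = 1 and v = 0 and q = 1 and xs = "[(0, - int m + 1, 2 * int m)]"];
   simp add: R2_def I1_def I2_def insert_Diff_if hits_def; (simp add: Ball_def)?; presburger?)

lemma cover2_1_01: "cover 1 (0, 1) (int m + 1) (I2 m (0, 1)) ((m + 1) * 1 - 0)"
 by (rule coverI[where u = 1 and v = 0 and q = 1 and xs = "[(0, - 2 * int m - 1, int m)]"];
   simp add: R2_def I1_def I2_def insert_Diff_if hits_def; (simp add: Ball_def)?; presburger?)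

lemma cover1_1_11: "cover 1 (1, 1) (- int m) (I1 m (1, 1)) (m * 1 + 1)"
 by (rule coverI[where u = 1 and v = 0 and q = 1 and xs = "[(0, - 2 * int m, int m)]"];
   simp add: R2_def I1_def I2_def insert_Diff_if hits_def; (simp add: Ball_def)?; presburger?)

lemma cover2_1_11: "cover 1 (1, 1) (int m + 1) (I2 m (1, 1)) ((m + 1) * 1 - 1)"
 by (rule coverI[where u = 1 and v = 0 and q = 1 and xs = "[(0, - int m, 2 * int m + 1)]"];
   simp add: R2_def I1_def I2_def insert_Diff_if hits_def; (simp add: Ball_def)?; presburger?)

lemma cover1_2_10: "cover 2 (1, 0) (- int m) (I1 m (1, 0)) (m * 2 + 0)"
 by (rule coverI[where u = 0 and v = 1 and q = 1 and xs = "[(0, - int m + 1, 3 * int m)]"];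
   simp add: R2_def I1_def I2_def insert_Diff_if hits_def; (simp add: Ball_def)?; presburger?)

lemma cover2_2_10: "cover 2 (1, 0) (int m + 1) (I2 m (1, 0)) ((m + 1) * 2 - 0)"
 by (rule coverI[where u = 0 and v = 1 and q = 1 and xs = "[(0, - 3 * int m - 2, int m)]"];
   simp add: R2_def I1_def I2_def insert_Diff_if hits_def; (simp add: Ball_def)?; presburger?)

lemma cover1_2_01: "cover 2 (0, 1) (- int m) (I1 m (0, 1)) (m * 2 + 0)"
 by (rule coverI_dvd[where u = 1 and v = 0 and q = 2 and xs = "[(0, - int m + 1, 2 * int m), (1, 0, int m - 1)]"];
   simp add: R2_def I1_def I2_def insert_Diff_if hits_def; (simp add: Ball_def)?; presburger?)

lemma cover2_2_01: "cover 2 (0, 1) (int m + 1) (I2 m (0, 1)) ((m + 1) * 2 - 0)"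
 by (rule coverI_dvd[where u = 1 and v = 0 and q = 2 and xs = "[(0, - 2 * int m - 1, int m), (1, - int m - 1, - 1)]"];
   simp add: R2_def I1_def I2_def insert_Diff_if hits_def; (simp add: Ball_def)?; presburger?)

lemma cover1_2_11: "cover 2 (1, 1) (- int m) (I1 m (1, 1)) (m * 2 + 1)"
 by (rule coverI[where u = 1 and v = 0 and q = 1 and xs = "[(0, - 2 * int m, 2 * int m)]"];
   simp add: R2_def I1_def I2_def insert_Diff_if hits_def; (simp add: Ball_def)?; presburger?)

lemma cover2_2_11: "cover 2 (1, 1) (int m + 1) (I2 m (1, 1)) ((m + 1) * 2 - 1)"
 by (rule coverI[where u = 1 and v = 0 and q = 1 and xs = "[(0, - 2 * int m - 1, 2 * int m + 1)]"];
   simp add: R2_def I1_def I2_def insert_Diff_if hits_def; (simp add: Ball_def)?; presburger?)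

lemma cover1_2_21: "cover 2 (2, 1) (- int m) (I1 m (2, 1)) (m * 2 + 2)"
 by (rule coverI_dvd[where u = 1 and v = 0 and q = 2 and xs = "[(0, - 2 * int m, int m), (1, - int m, - 1)]"];
   simp add: R2_def I1_def I2_def insert_Diff_if hits_def; (simp add: Ball_def)?; presburger?)

lemma cover2_2_21: "cover 2 (2, 1) (int m + 1) (I2 m (2, 1)) ((m + 1) * 2 - 2)"
 by (rule coverI_dvd[where u = 1 and v = 0 and q = 2 and xs = "[(0, - int m, 2 * int m + 1), (1, 0, int m)]"];
   simp add: R2_def I1_def I2_def insert_Diff_if hits_def; (simp add: Ball_def)?; presburger?)

lemma cover1_3_10: "cover 3 (1, 0) (- int m) (I1 m (1, 0)) (m * 4 + 0)"
 by (rule coverI_dvd[where u = 0 and v = 1 and q = 2 and xs = "[(0, - int m + 1, 4 * int m), (1, int m, 2 * int m - 1)]"];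
   simp add: R2_def I1_def I2_def insert_Diff_if hits_def; (simp add: Ball_def)?; presburger?)

lemma cover2_3_10: "cover 3 (1, 0) (int m + 1) (I2 m (1, 0)) ((m + 1) * 4 - 0)"
 by (rule coverI_dvd[where u = 0 and v = 1 and q = 2 and xs = "[(0, - 4 * int m - 3, int m), (1, - 2 * int m - 2, - int m - 2)]"];
   simp add: R2_def I1_def I2_def insert_Diff_if hits_def; (simp add: Ball_def)?; presburger?)

lemma cover1_3_01: "cover 3 (0, 1) (- int m) (I1 m (0, 1)) (m * 4 + 0)"
\<comment> \<open>For m = 0 all intervals are empty, and the bounds chosen below would violate the
  premise \<open>a <= c\<close> of \<open>cover6I\<close>.\<close>
proof (cases "m = 0")
 case True
 then show ?thesis
  by (intro coverI[where u = 1 and v = 0 and q = 1 and xs = "[]"]) (auto simp: R2_def I1_def insert_Diff_if)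
next
 case False
 then show ?thesis
  by (intro cover6I[where u = 1 and v = 0 and a = "- int m + 1" and b = "2 * int m" and c = "0" and e = "int m - 1"];
   (simp add: R2_def I1_def insert_Diff_if)?; (auto simp: R2_def I1_def)?)
qed

lemma cover2_3_01: "cover 3 (0, 1) (int m + 1) (I2 m (0, 1)) ((m + 1) * 4 - 0)"
 by (rule cover6I[where u = 1 and v = 0 and a = "- 2 * int m - 1" and b = "int m" and c = "- int m - 1" and e = "- 1"];
   (simp add: R2_def I1_def I2_def insert_Diff_if)?;
   (auto simp: R2_def I1_def I2_def)?)

lemma cover1_3_11: "cover 3 (1, 1) (- int m) (I1 m (1, 1)) (m * 4 + 1)"
 by (rule coverI_dvd[where u = 1 and v = 0 and q = 2 and xs = "[(0, - 2 * int m, 3 * int m), (1, 0, int m - 1)]"];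
   simp add: R2_def I1_def I2_def insert_Diff_if hits_def; (simp add: Ball_def)?; presburger?)

lemma cover2_3_11: "cover 3 (1, 1) (int m + 1) (I2 m (1, 1)) ((m + 1) * 4 - 1)"
 by (rule coverI_dvd[where u = 1 and v = 0 and q = 2 and xs = "[(0, - 3 * int m - 2, 2 * int m + 1), (1, - int m - 1, - 1)]"];
   simp add: R2_def I1_def I2_def insert_Diff_if hits_def; (simp add: Ball_def)?; presburger?)

lemma cover1_3_21: "cover 3 (2, 1) (- int m) (I1 m (2, 1)) (m * 4 + 2)"
 by (rule coverI_dvd[where u = 1 and v = 0 and q = 2 and xs = "[(0, - 3 * int m, 2 * int m), (1, - int m, - 1)]"];
   simp add: R2_def I1_def I2_def insert_Diff_if hits_def; (simp add: Ball_def)?; presburger?)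

lemma cover2_3_21: "cover 3 (2, 1) (int m + 1) (I2 m (2, 1)) ((m + 1) * 4 - 2)"
 by (rule coverI_dvd[where u = 1 and v = 0 and q = 2 and xs = "[(0, - 2 * int m - 1, 3 * int m + 2), (1, 0, int m)]"];
   simp add: R2_def I1_def I2_def insert_Diff_if hits_def; (simp add: Ball_def)?; presburger?)

lemma cover1_3_31: "cover 3 (3, 1) (- int m) (I1 m (3, 1)) (m * 4 + 3)"
 by (rule cover6I[where u = 1 and v = 0 and a = "- 2 * int m" and b = "int m" and c = "- int m" and e = "- 1"];
   (simp add: R2_def I1_def I2_def insert_Diff_if)?;
   (auto simp: R2_def I1_def I2_def)?)

lemma cover2_3_31: "cover 3 (3, 1) (int m + 1) (I2 m (3, 1)) ((m + 1) * 4 - 3)"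
 by (rule cover6I[where u = 1 and v = 0 and a = "- int m" and b = "2 * int m + 1" and c = "0" and e = "int m"];
   (simp add: R2_def I1_def I2_def insert_Diff_if)?;
   (auto simp: R2_def I1_def I2_def)?)

lemma cover1_3_32: "cover 3 (3, 2) (- int m) (I1 m (3, 2)) (m * 4 + 4)"
 by (rule cover6I[where u = 1 and v = 1 and a = "- 2 * int m" and b = "int m" and c = "- int m" and e = "- 1"];
   (simp add: R2_def I1_def I2_def insert_Diff_if)?;
   (auto simp: R2_def I1_def I2_def)?)

lemma cover2_3_32: "cover 3 (3, 2) (int m + 1) (I2 m (3, 2)) ((m + 1) * 4 - 4)"
 by (rule cover6I[where u = 1 and v = 1 and a = "- int m" and b = "2 * int m + 1" and c = "0" and e = "int m"];
   (simp add: R2_def I1_def I2_def insert_Diff_if)?;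
   (auto simp: R2_def I1_def I2_def)?)

lemma cover1:
 assumes "p0 \<in> R2 n" "n \<in> {1, 2, 3}"
 shows "cover n p0 (- int m) (I1 m p0) (m * (card (R2 n) - 2) + nat (fst p0 + snd p0 - 1))"
proof -
 have c: "card (R2 1) = 3" "card (R2 2) = 4" "card (R2 3) = 6" by (simp_all add: R2_def)
 show ?thesis
  using assms cover1_1_10[of m] cover1_1_01[of m] cover1_1_11[of m]
   cover1_2_10[of m] cover1_2_01[of m] cover1_2_11[of m] cover1_2_21[of m]
   cover1_3_10[of m] cover1_3_01[of m] cover1_3_11[of m] cover1_3_21[of m] cover1_3_31[of m] cover1_3_32[of m]
  by (elim insertE emptyE; simp only: c; auto simp: R2_def)
qed

lemma cover2:
 assumes "p0 \<in> R2 n" "n \<in> {1, 2, 3}"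
 shows "cover n p0 (int m + 1) (I2 m p0) ((m + 1) * (card (R2 n) - 2) - nat (fst p0 + snd p0 - 1))"
proof -
 have c: "card (R2 1) = 3" "card (R2 2) = 4" "card (R2 3) = 6" by (simp_all add: R2_def)
 show ?thesis
  using assms cover2_1_10[of m] cover2_1_01[of m] cover2_1_11[of m]
   cover2_2_10[of m] cover2_2_01[of m] cover2_2_11[of m] cover2_2_21[of m]
   cover2_3_10[of m] cover2_3_01[of m] cover2_3_11[of m] cover2_3_21[of m] cover2_3_31[of m] cover2_3_32[of m]
  by (elim insertE emptyE; simp only: c; auto simp: R2_def)
qed

section \<open>From coordinate pairs to planes of roots\<close>

definition emb :: "real^'n => real^'n => int \<times> int => real^'n" where
 "emb a b p = of_int (fst p) *\<^sub>R a + of_int (snd p) *\<^sub>R b"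

lemma finite_R2: "finite (R2 n)" by (simp add: R2_def)

lemma R2_det: "n \<in> {1,2,3} ==> p0 \<in> R2 n ==> p \<in> R2 n - {p0} ==> fst p * snd p0 - fst p0 * snd p ~= 0"
 by (auto simp: R2_def split: if_splits)

text \<open>Since a multiple of u a + v b is a combination of p and p0, a hyperplane at p meets that
  of p0 exactly where this auxiliary form has one value c / q relative to the coning variable. So
  the flats are at most as many as the values in C.\<close>

lemma cover_flats:
 fixes a b :: "real^'n"
 assumes cov: "cover n p0 t I T" and n: "n \<in> {1,2,3}" "p0 \<in> R2 n" and inj: "inj_on (emb a b) (R2 n)"
  and fI: "!!p. finite (I p)"
  and L: "L = (%(p, k). (emb a b p, k)) ` (SIGMA p:R2 n - {p0}. I p)"
 shows "card (flt (emb a b p0, t) ` L) + T <= card L"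
proof -
 obtain u v q C where c: "q > 0" "finite C" "u * snd p0 - fst p0 * v ~= 0"
  "card C + T <= (\<Sum>p\<in>R2 n - {p0}. card (I p))"
  "!!p k. p \<in> R2 n - {p0} ==> k \<in> I p ==> \<exists>c\<in>C.
    q * ((u * snd p0 - fst p0 * v) * k + (fst p * v - snd p * u) * t) = (fst p * snd p0 - fst p0 * snd p) * c"
  using cov unfolding cover_def by (elim exE conjE) blast
 have "inj_on (%(p, k). (emb a b p, k)) (SIGMA p:R2 n - {p0}. I p)"
  using inj by (auto simp: inj_on_def)
 then have "card L = (\<Sum>p\<in>R2 n - {p0}. card (I p))"
  unfolding L using finite_R2 fI by (simp add: card_image card_SigmaI)
 moreover have "card (flt (emb a b p0, t) ` L) <= card C"
 proof -
  define G where "G c = {x. frm (emb a b p0, t) \<bullet> x = 0 & of_int q * (emb a b (u, v) \<bullet> snd x) = of_int c * fst x}" for c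
  have "flt (emb a b p0, t) ` L <= G ` C"
  proof clarify
   fix y k assume "(y, k) \<in> L"
   then obtain p where p: "p \<in> R2 n - {p0}" "k \<in> I p" "y = emb a b p" unfolding L by auto
   define A B d where "A = u * snd p0 - fst p0 * v" and "B = fst p * v - snd p * u" and "d = fst p * snd p0 - fst p0 * snd p"
   obtain c' where c': "c' \<in> C" "q * (A * k + B * t) = d * c'" using c(5)[OF p(1,2)] unfolding A_def B_def d_def by blast
   have d0: "d ~= 0" using R2_det[OF n p(1)] by (simp add: d_def)
   have A0: "A ~= 0" using c(3) by (simp add: A_def)
   have i1: "d * u = A * fst p + B * fst p0" "d * v = A * snd p + B * snd p0"
    by (simp_all add: A_def B_def d_def algebra_simps)
   have vec: "of_int d *\<^sub>R emb a b (u, v) = of_int A *\<^sub>R emb a b p + of_int B *\<^sub>R emb a b p0"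
   proof -
    have "of_int d *\<^sub>R emb a b (u, v) = of_int (d * u) *\<^sub>R a + of_int (d * v) *\<^sub>R b"
     by (simp add: emb_def scaleR_add_right)
    also have "\<dots> = of_int A *\<^sub>R emb a b p + of_int B *\<^sub>R emb a b p0"
     unfolding i1 by (simp add: emb_def algebra_simps)
    finally show ?thesis .
   qed
   have "frm (emb a b p, k) \<bullet> x = 0 \<longleftrightarrow> of_int q * (emb a b (u, v) \<bullet> snd x) = of_int c' * fst x"
    if x: "frm (emb a b p0, t) \<bullet> x = 0" for x
   proof -
    have x0: "emb a b p0 \<bullet> snd x = of_int t * fst x" using x by (simp add: frm_inner')
    have e: "of_int d * (emb a b (u, v) \<bullet> snd x) = of_int A * (emb a b p \<bullet> snd x) + of_int B * (of_int t * fst x)"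
     using arg_cong[OF vec, of "%w. w \<bullet> snd x"] x0 by (simp add: inner_add_left)
    have qc: "of_int d * (of_int c' * fst x) = of_int q * (of_int A * (of_int k * fst x) + of_int B * (of_int t * fst x))"
     using arg_cong[OF c'(2), of "%z. of_int z * fst x"] by (simp add: algebra_simps)
    have "of_int q * (emb a b (u, v) \<bullet> snd x) = of_int c' * fst x \<longleftrightarrow>
      of_int q * (of_int d * (emb a b (u, v) \<bullet> snd x)) = of_int d * (of_int c' * fst x)"
     using d0 by (auto simp: mult.left_commute)
    also have "\<dots> \<longleftrightarrow> of_int A * (emb a b p \<bullet> snd x) = of_int A * (of_int k * fst x)"
     unfolding e qc using c(1) by simp
    also have "\<dots> \<longleftrightarrow> frm (emb a b p, k) \<bullet> x = 0" using A0 by (auto simp: frm_inner')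
    finally show ?thesis by simp
   qed
   then have "flt (emb a b p0, t) (y, k) = G c'" unfolding flt_def G_def p(3) by blast
   then show "flt (emb a b p0, t) (y, k) \<in> G ` C" using c'(1) by blast
  qed
  then show ?thesis using c(2) by (meson card_image_le card_mono finite_imageI order_trans)
 qed
 ultimately show ?thesis using c(4) by linarith
qed

text \<open>\<open>R i j\<close> says that i a + j b is a root. If both coefficients are positive,
  both reflections keep it positive, whence j <= i <= n j; the same bounds for the reflected roots
  leave finitely many slopes i / j, and reducedness fixes the length.\<close>

lemma rank2_class:
 fixes R :: "real => real => bool" and n :: nat
 assumes n: "n \<in> {1,2,3}" and R10: "R 1 0" and R01: "R 0 1"
  and sg: "!!i j. R i j ==> (0 <= i & 0 <= j) | (i <= 0 & j <= 0)"
  and ra: "!!i j. R i j ==> R (real n * j - i) j" and rb: "!!i j. R i j ==> R i (i - j)"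
  and red: "!!i j c. R i j ==> R (c * i) (c * j) ==> c = 1 | c = -1" and nz: "\<not> R 0 0"
 shows "p \<in> R2 n ==> R (of_int (fst p)) (of_int (snd p))"
  and "R i j ==> 0 <= i ==> 0 <= j ==> \<exists>p\<in>R2 n. i = of_int (fst p) & j = of_int (snd p)"
proof -
 have R11: "R 1 1" using rb[OF R10] by simp
 have Rn1: "R (real n) 1" using ra[OF R01] by simp
 have R21: "R 2 1" if "n = 3" using ra[OF R11] that by simp
 have R32: "R 3 2" if "n = 3" using rb[OF Rn1] that by simp
 show "p \<in> R2 n ==> R (of_int (fst p)) (of_int (snd p))"
  using n R10 R01 R11 Rn1 R21 R32 by (auto simp: R2_def)
 assume ij: "R i j" "0 <= i" "0 <= j"
 have mul: "i = x & j = y" if "R x y" "i = c * x" "j = c * y" "c > 0" for c x y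
 proof -
  have "c = 1 | c = -1" using red[OF that(1), of c] ij that by simp
  then show ?thesis using that by simp
 qed
 have up: "j' <= i' & i' <= real n * j'" if "R i' j'" "0 < i'" "0 < j'" for i' j'
  using sg[OF ra[OF that(1)]] sg[OF rb[OF that(1)]] that by auto
 have e10: "(1, 0) \<in> R2 n" "(0, 1) \<in> R2 n" "(1, 1) \<in> R2 n" by (auto simp: R2_def)
 consider "j = 0" | "i = 0" "j > 0" | "i > 0" "j > 0" using ij by force
 then show "\<exists>p\<in>R2 n. i = of_int (fst p) & j = of_int (snd p)"
 proof cases
  case 1
  then have "i > 0" using ij nz by (cases "i = 0") auto
  then have "i = 1" using mul[OF R10, of i] 1 by simp
  then show ?thesis using 1 e10 by (intro bexI[of _ "(1, 0)"]) auto
 next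
  case 2
  then have "j = 1" using mul[OF R01, of j] by simp
  then show ?thesis using 2 e10 by (intro bexI[of _ "(0, 1)"]) auto
 next
  case 3
  note u = up[OF ij(1) 3]
  have diag: ?thesis if "i = j"
  proof -
   have "i = 1 & j = 1" using mul[OF R11, of j] that 3 by simp
   then show ?thesis using e10 by (intro bexI[of _ "(1, 1)"]) auto
  qed
  have edge: ?thesis if "i = real n * j" "n \<ge> 2"
  proof -
   have "i = real n & j = 1" using mul[OF Rn1, of j] that 3 by simp
   then show ?thesis using n that by (intro bexI[of _ "(int n, 1)"]) (auto simp: R2_def)
  qed
  have low: "real n * j - i = 0 | j <= real n * j - i"
   using up[OF ra[OF ij(1)]] u 3 by force
  have hi: "i = j | i <= real n * (i - j)"
   using up[OF rb[OF ij(1)]] u 3 by force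
  consider "n = 1" | "n = 2" | "n = 3" using n by auto
  then show ?thesis
  proof cases
   case 1
   then show ?thesis using u diag by simp
  next
   case 2
   then have "i = 2 * j | i = j" using low u by auto
   then show ?thesis using diag edge 2 by auto
  next
   case n3: 3
   consider "i = j" | "i = 3 * j" | "i ~= j" "i ~= 3 * j" by blast
   then show ?thesis
   proof cases
    case a: 3
    have h: "i <= 2 * j" "3 * j <= 2 * i" using low hi a n3 by auto
    let ?i = "3 * j - i"
    have R': "R ?i j" using ra[OF ij(1)] n3 by simp
    have p: "?i > 0" using h 3 by simp
    have "?i = j | ?i <= 3 * (?i - j)"
     using up[OF rb[OF R']] up[OF R' p 3(2)] p n3 by force
    then have "i = 2 * j | 2 * i = 3 * j" using h by auto
    then show ?thesis
    proof
     assume "i = 2 * j"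
     then have "i = 2 & j = 1" using mul[OF R21[OF n3], of j] 3 by simp
     then show ?thesis using n3 by (intro bexI[of _ "(2, 1)"]) (auto simp: R2_def)
    next
     assume "2 * i = 3 * j"
     then have "i = 3 & j = 2" using mul[OF R32[OF n3], of "j / 2"] 3 by simp
     then show ?thesis using n3 by (intro bexI[of _ "(3, 2)"]) (auto simp: R2_def)
    qed
   qed (use diag edge n3 in auto)
  qed
 qed
qed

lemma span_pair_exchange:
 fixes a b c :: "real^'n"
 assumes "c \<in> span {a, b}" "c ~: span {a}" shows "span {a, c} = span {a, b}"
proof -
 have "b \<in> span (insert c {a})" using in_span_insert[of c b "{a}"] assms by (simp add: insert_commute)
 then have "b \<in> span {a, c}" by (simp add: insert_commute)
 then show ?thesis using assms(1) by (intro span_eq[THEN iffD2]) (auto simp: span_base)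
qed

lemma span_pairE:
 fixes x a b :: "real^'n"
 assumes "x \<in> span {a, b}" obtains i j where "x = i *\<^sub>R a + j *\<^sub>R b"
proof -
 obtain i where "x - i *\<^sub>R a \<in> span {b}" using assms by (auto simp: span_breakdown_eq)
 then obtain j where "x - i *\<^sub>R a = j *\<^sub>R b" by (auto simp: span_singleton)
 then show thesis using that[of i j] by (metis add.commute diff_add_cancel)
qed

lemma pair_coords_unique:
 fixes a b :: "real^'n"
 assumes "b ~: span {a}" "a ~= 0" "i *\<^sub>R a + j *\<^sub>R b = i' *\<^sub>R a + j' *\<^sub>R b"
 shows "i = i' & j = j'"
proof -
 have e: "(j - j') *\<^sub>R b = (i' - i) *\<^sub>R a" using assms(3) by (simp add: algebra_simps)
 have "j = j'"
 proof (rule ccontr)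
  assume "j ~= j'"
  then have "b = (1 / (j - j')) *\<^sub>R ((j - j') *\<^sub>R b)" by simp
  also have "\<dots> \<in> span {a}" unfolding e by (intro span_scale span_base) auto
  finally show False using assms(1) by blast
 qed
 then show ?thesis using e assms(2) by simp
qed

context roots begin

text \<open>In the plane a vector is determined by its height and its product with \<open>w\<close>,
  the component of \<beta> orthogonal to \<alpha>. The two positive roots of extreme slope
  \<open>s\<close> bound a cone containing all the others, so they form a base of the plane; they
  need not be simple in \<Phi>.\<close>

lemma plane_base:
 assumes "\<alpha> \<in> P" "\<beta> \<in> P" "\<beta> ~= \<alpha>"
 shows "\<exists>a b. a \<in> P & b \<in> P & b ~: span {a} & span {a, b} = span {\<alpha>, \<beta>} \<and>
  (\<forall>\<gamma>\<in>P \<inter> span {\<alpha>, \<beta>}. \<exists>i j. 0 <= i & 0 <= j & \<gamma> = i *\<^sub>R a + j *\<^sub>R b)"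
proof -
 let ?S = "P \<inter> span {\<alpha>, \<beta>}"
 have nb: "\<beta> ~: span {\<alpha>}" using npar_P assms unfolding npar_def by blast
 have a0: "\<alpha> ~= 0" "\<alpha> \<bullet> \<alpha> > 0" using assms P_root root_nonzero by auto
 define w where "w = \<beta> - ((\<alpha> \<bullet> \<beta>) / (\<alpha> \<bullet> \<alpha>)) *\<^sub>R \<alpha>"
 have wa: "w \<bullet> \<alpha> = 0" using a0 by (simp add: w_def inner_diff_left inner_commute[of \<beta> \<alpha>])
 have w0: "w ~= 0" unfolding w_def using nb by (metis eq_iff_diff_eq_0 span_base span_scale insertI1)
 have wb: "w \<bullet> \<beta> > 0"
 proof -
  have "w \<bullet> \<beta> = w \<bullet> w" using wa by (simp add: w_def inner_diff_right)
  then show ?thesis using w0 by simp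
 qed
 define s where "s \<gamma> = (w \<bullet> \<gamma>) / ht \<gamma>" for \<gamma>
 have fS: "finite ?S" "?S ~= {}" using finite_P assms(1) by (auto simp: span_base)
 obtain a where a: "a \<in> ?S" "!!\<gamma>. \<gamma> \<in> ?S ==> s \<gamma> <= s a"
 proof -
  have "Max (s ` ?S) \<in> s ` ?S" using fS by (intro Max_in) auto
  then obtain a where "a \<in> ?S" "Max (s ` ?S) = s a" by blast
  moreover have "s \<gamma> <= Max (s ` ?S)" if "\<gamma> \<in> ?S" for \<gamma> using fS that by (intro Max_ge) auto
  ultimately show thesis using that by metis
 qed
 obtain b where b: "b \<in> ?S" "!!\<gamma>. \<gamma> \<in> ?S ==> s b <= s \<gamma>"
 proof -
  have "Min (s ` ?S) \<in> s ` ?S" using fS by (intro Min_in) auto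
  then obtain b where "b \<in> ?S" "Min (s ` ?S) = s b" by blast
  moreover have "Min (s ` ?S) <= s \<gamma>" if "\<gamma> \<in> ?S" for \<gamma> using fS that by (intro Min_le) auto
  ultimately show thesis using that by metis
 qed
 have "s \<beta> > 0" using wb ht_pos assms by (simp add: s_def)
 moreover have "s \<alpha> = 0" using wa by (simp add: s_def)
 ultimately have sab: "s b < s a" using a(2)[of \<beta>] b(2)[of \<alpha>] assms by (auto simp: span_base)
 have ab: "a \<in> P" "b \<in> P" "b ~= a" using a b sab by auto
 have nab: "b ~: span {a}" using npar_P ab unfolding npar_def by blast
 have zero: "y = 0" if yy: "y \<in> span {\<alpha>, \<beta>}" "ht y = 0" "w \<bullet> y = 0" for y
 proof -
  obtain i j where y: "y = i *\<^sub>R \<alpha> + j *\<^sub>R \<beta>" using span_pairE[OF yy(1)] by blast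
  have "j = 0" using yy(3) wa wb by (simp add: y inner_add_right)
  then have "i * ht \<alpha> = 0" using yy(2) by (simp add: y ht_scale)
  then show ?thesis using ht_pos[OF assms(1)] \<open>j = 0\<close> y by simp
 qed
 have "\<exists>i j. 0 <= i & 0 <= j & \<gamma> = i *\<^sub>R a + j *\<^sub>R b" if g: "\<gamma> \<in> ?S" for \<gamma>
 proof -
  define l where "l = (s \<gamma> - s b) / (s a - s b)"
  have l: "0 <= l" "l <= 1" using a(2)[OF g] b(2)[OF g] sab by (auto simp: l_def field_simps)
  have hp: "ht a > 0" "ht b > 0" "ht \<gamma> > 0" using ht_pos ab g by auto
  define i where "i = l * ht \<gamma> / ht a"
  define j where "j = (1 - l) * ht \<gamma> / ht b"
  let ?y = "\<gamma> - (i *\<^sub>R a + j *\<^sub>R b)"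
  have "?y \<in> span {\<alpha>, \<beta>}" using g a b by (intro span_diff span_add span_scale) auto
  moreover have "ht ?y = 0" using hp by (simp add: ht_diff ht_add ht_scale i_def j_def) (simp add: left_diff_distrib)
  moreover have "w \<bullet> ?y = 0"
  proof -
   have e: "w \<bullet> x = s x * ht x" if "ht x > 0" for x using that by (simp add: s_def)
   have "w \<bullet> ?y = ht \<gamma> * (s \<gamma> - (l * s a + (1 - l) * s b))"
    using hp by (simp add: inner_diff_right inner_add_right e i_def j_def field_simps)
   also have "l * s a + (1 - l) * s b = s b + l * (s a - s b)" by (simp add: algebra_simps)
   also have "\<dots> = s \<gamma>" using sab by (simp add: l_def)
   finally show ?thesis by simp
  qed
  ultimately have "?y = 0" by (rule zero)
  then show ?thesis using l hp by (intro exI[of _ i] exI[of _ j]) (auto simp: i_def j_def)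
 qed
 moreover have "span {a, b} = span {\<alpha>, \<beta>}"
 proof (rule subset_antisym)
  show "span {a, b} <= span {\<alpha>, \<beta>}" using a b by (intro span_minimal) auto
  have "\<alpha> \<in> span {a, b}" "\<beta> \<in> span {a, b}"
   using calculation[of \<alpha>] calculation[of \<beta>] assms
   by (auto simp: span_base intro!: span_add span_scale)
  then show "span {\<alpha>, \<beta>} <= span {a, b}" by (intro span_minimal) auto
 qed
 ultimately show ?thesis using ab nab by blast
qed

lemma plane_roots_signed:
 assumes ab: "a \<in> P" "b \<in> P" "b ~: span {a}"
  and nn: "!!\<gamma>. \<gamma> \<in> P \<inter> span {a, b} ==> \<exists>i j. 0 <= i & 0 <= j & \<gamma> = i *\<^sub>R a + j *\<^sub>R b"
  and r: "i *\<^sub>R a + j *\<^sub>R b \<in> \<Phi>"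
 shows "(0 <= i & 0 <= j) | (i <= 0 & j <= 0)"
proof -
 have a0: "a ~= 0" using ab P_root root_nonzero by blast
 have sp: "x *\<^sub>R a + y *\<^sub>R b \<in> span {a, b}" for x y by (intro span_add span_scale span_base) auto
 consider "i *\<^sub>R a + j *\<^sub>R b \<in> P" | "(- i) *\<^sub>R a + (- j) *\<^sub>R b \<in> P" using pos_or_neg[OF r] by auto
 then show ?thesis
 proof cases
  case 1
  then obtain i' j' where "0 <= i'" "0 <= j'" "i *\<^sub>R a + j *\<^sub>R b = i' *\<^sub>R a + j' *\<^sub>R b" using nn sp by blast
  then show ?thesis using pair_coords_unique[OF ab(3) a0, of i j i' j'] by auto
 next
  case 2
  then obtain i' j' where "0 <= i'" "0 <= j'" "(- i) *\<^sub>R a + (- j) *\<^sub>R b = i' *\<^sub>R a + j' *\<^sub>R b" using nn sp by blast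
  then show ?thesis using pair_coords_unique[OF ab(3) a0, of "- i" "- j" i' j'] by auto
 qed
qed

lemma plane_roots_typed:
 assumes ab: "a \<in> P" "b \<in> P" "b ~: span {a}"
  and nn: "!!\<gamma>. \<gamma> \<in> P \<inter> span {a, b} ==> \<exists>i j. 0 <= i & 0 <= j & \<gamma> = i *\<^sub>R a + j *\<^sub>R b"
  and c: "cart a b = - 1" "cart b a = - real n" "n \<in> {1,2,3}"
 shows "P \<inter> span {a, b} = emb a b ` R2 n"
proof -
 have r: "a \<in> \<Phi>" "b \<in> \<Phi>" "a ~= 0" "b ~= 0" using ab P_root root_nonzero by auto
 define R where "R i j \<longleftrightarrow> i *\<^sub>R a + j *\<^sub>R b \<in> \<Phi>" for i j
 have sg: "(0 <= i & 0 <= j) | (i <= 0 & j <= 0)" if "R i j" for i j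
  using plane_roots_signed[OF ab nn] that by (simp add: R_def)
 have ra: "R (real n * j - i) j" if "R i j" for i j
 proof -
  have "cart (i *\<^sub>R a + j *\<^sub>R b) a = 2 * i - real n * j"
   using c r by (simp add: cart_add cart_scale cart_self)
  then have "rfl a (i *\<^sub>R a + j *\<^sub>R b) = (i - (2 * i - real n * j)) *\<^sub>R a + j *\<^sub>R b"
   unfolding rfl_def by (simp only: scaleR_diff_left) simp
  then have "rfl a (i *\<^sub>R a + j *\<^sub>R b) = (real n * j - i) *\<^sub>R a + j *\<^sub>R b" by simp
  then show ?thesis using rfl_root[OF r(1), of "i *\<^sub>R a + j *\<^sub>R b"] that by (simp add: R_def)
 qed
 have rb: "R i (i - j)" if "R i j" for i j
 proof -
  have "cart (i *\<^sub>R a + j *\<^sub>R b) b = 2 * j - i"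
   using c r by (simp add: cart_add cart_scale cart_self)
  then have "rfl b (i *\<^sub>R a + j *\<^sub>R b) = i *\<^sub>R a + (j - (2 * j - i)) *\<^sub>R b"
   unfolding rfl_def by (simp only: scaleR_diff_left) simp
  then have "rfl b (i *\<^sub>R a + j *\<^sub>R b) = i *\<^sub>R a + (i - j) *\<^sub>R b" by simp
  then show ?thesis using rfl_root[OF r(2), of "i *\<^sub>R a + j *\<^sub>R b"] that by (simp add: R_def)
 qed
 have red: "x = 1 | x = -1" if "R i j" "R (x * i) (x * j)" for i j x
  using reduced[of "i *\<^sub>R a + j *\<^sub>R b" x] that by (simp add: R_def scaleR_add_right)
 have R1: "R 1 0" "R 0 1" "\<not> R 0 0" using r zero_not_root by (auto simp: R_def)
 have cl1: "R (of_int (fst p)) (of_int (snd p))" if "p \<in> R2 n" for p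
  by (rule rank2_class(1)[of n R, OF c(3) R1(1,2)]) (use sg ra rb red R1(3) that in blast)+
 have cl2: "\<exists>p\<in>R2 n. i = of_int (fst p) & j = of_int (snd p)" if "R i j" "0 <= i" "0 <= j" for i j
  by (rule rank2_class(2)[of n R, OF c(3) R1(1,2)]) (use sg ra rb red R1(3) that in blast)+
 show ?thesis
 proof (intro equalityI subsetI)
  fix \<gamma> assume g: "\<gamma> \<in> P \<inter> span {a, b}"
  then obtain i j where ij: "0 <= i" "0 <= j" "\<gamma> = i *\<^sub>R a + j *\<^sub>R b" using nn by blast
  then have "R i j" using g P_root by (auto simp: R_def)
  then obtain p where "p \<in> R2 n" "i = of_int (fst p)" "j = of_int (snd p)" using cl2 ij by blast
  then show "\<gamma> \<in> emb a b ` R2 n" using ij(3) by (auto simp: emb_def)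
 next
  fix \<gamma> assume "\<gamma> \<in> emb a b ` R2 n"
  then obtain p where p: "p \<in> R2 n" "\<gamma> = emb a b p" by blast
  then have "\<gamma> \<in> \<Phi>" using cl1 by (auto simp: R_def emb_def)
  moreover have "\<gamma> \<in> span {a, b}" unfolding p(2) emb_def by (intro span_add span_scale span_base) auto
  moreover have "ht \<gamma> > 0"
   using p(1) ht_pos[OF ab(1)] ht_pos[OF ab(2)] c(3)
   by (auto simp: p(2) emb_def ht_add ht_scale R2_def add_pos_pos split: if_splits)
  ultimately show "\<gamma> \<in> P \<inter> span {a, b}" using ht_pos_iff by auto
 qed
qed

end

text \<open>The number of coincidences, elements minus values, can only grow with L; so a lower
  bound obtained from the guaranteed levels holds for the full arrangement.\<close>

lemma coincidence_mono:
 assumes "finite L" "L0 <= L" shows "card (f ` L) + card L0 <= card (f ` L0) + card L"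
proof -
 have fin: "finite L0" using assms finite_subset by blast
 have "f ` L = f ` L0 \<union> f ` (L - L0)" using assms by auto
 then have "card (f ` L) <= card (f ` L0) + card (f ` (L - L0))" by (simp add: card_Un_le)
 also have "card (f ` (L - L0)) <= card (L - L0)" using assms by (intro card_image_le) auto
 also have "card (L - L0) = card L - card L0" using assms fin by (simp add: card_Diff_subset)
 finally show ?thesis using card_mono[OF assms] by linarith
qed

context roots begin

section \<open>Adding the counts over all planes\<close>

lemma cart_emb:
 assumes c: "cart a b = - 1" "cart b a = - real n" and ab: "a ~= 0" "b ~= 0"
 shows "cart (emb a b p) (emb a b q) =
  2 * (of_int (fst p * fst q) - real n / 2 * of_int (fst p * snd q + snd p * fst q) + real n * of_int (snd p * snd q)) /
  (of_int (fst q * fst q) - real n * of_int (fst q * snd q) + real n * of_int (snd q * snd q))"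
proof -
 let ?c = "a \<bullet> a"
 have c0: "?c > 0" "b \<bullet> b > 0" using ab by auto
 have ab': "a \<bullet> b = - real n / 2 * ?c" using c(2) c0 by (simp add: cart_def field_simps inner_commute)
 have "b \<bullet> b = - 2 * (a \<bullet> b)" using c(1) c0 by (simp add: cart_def field_simps)
 then have bb: "b \<bullet> b = real n * ?c" using ab' by simp
 have ip: "emb a b p \<bullet> emb a b q = ?c * (of_int (fst p * fst q) - real n / 2 * of_int (fst p * snd q + snd p * fst q) + real n * of_int (snd p * snd q))" for p q
  by (simp add: emb_def inner_add_left inner_add_right bb ab' inner_commute[of b a]) (simp add: algebra_simps)
 let ?X = "of_int (fst p * fst q) - real n / 2 * of_int (fst p * snd q + snd p * fst q) + real n * of_int (snd p * snd q)"
 let ?Y = "of_int (fst q * fst q) - real n * of_int (fst q * snd q) + real n * of_int (snd q * snd q)"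
 have 1: "emb a b p \<bullet> emb a b q = ?c * ?X" by (rule ip)
 have "real n / 2 * of_int (fst q * snd q + snd q * fst q) = real n * of_int (fst q * snd q)"
  by (simp add: mult.commute[of "real_of_int (snd q)"])
 then have 2: "emb a b q \<bullet> emb a b q = ?c * ?Y" by (simp only: ip)
 have "2 * (c * X) / (c * Y) = 2 * X / Y" if "c > 0" for c X Y :: real using that by simp
 from this[OF c0(1), of ?X ?Y] show ?thesis unfolding cart_def 1 2 .
qed

text \<open>The local count becomes a sum over the other roots of the plane of an expression in
  Cartan integers. Such a sum no longer mentions a base of the plane and can be added over all
  planes through a root, which is how local Coxeter numbers and heights give way to the global
  ones.\<close>

lemma R2_cart_sum:
 assumes c: "cart a b = - 1" "cart b a = - real n" and ab: "a ~= 0" "b ~= 0" and n: "n \<in> {1,2,3}" "p0 \<in> R2 n"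
 shows "(\<Sum>p\<in>R2 n - {p0}. cart (emb a b p0) (emb a b p) * (x * cart (emb a b p) (emb a b p0) + y) / 2) =
  x * (real (card (R2 n)) - 2) + y * of_int (fst p0 + snd p0 - 1)"
proof -
 note ce = cart_emb[OF c ab]
 consider "n = 1" | "n = 2" | "n = 3" using n(1) by auto
 then show ?thesis
 proof cases
  case 1
  then have "p0 = (1,0) | p0 = (0,1) | p0 = (1,1)" using n(2) by (simp add: R2_def)
  then show ?thesis by (elim disjE; simp add: 1 R2_def insert_Diff_if ce; simp add: field_simps)
 next
  case 2
  then have "p0 = (1,0) | p0 = (0,1) | p0 = (1,1) | p0 = (2,1)" using n(2) by (simp add: R2_def)
  then show ?thesis by (elim disjE; simp add: 2 R2_def insert_Diff_if ce; simp add: field_simps)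
 next
  case 3
  then have "p0 = (1,0) | p0 = (0,1) | p0 = (1,1) | p0 = (2,1) | p0 = (3,1) | p0 = (3,2)" using n(2) by (simp add: R2_def)
  then show ?thesis by (elim disjE; simp add: 3 R2_def insert_Diff_if ce; simp add: field_simps)
 qed
qed

text \<open>The base of the plane is either orthogonal, where the sum is 0 and no coincidence is
  claimed, or has Cartan integers -1 and -n in one of the two orders, where a \<open>cover\<close>
  bound applies.\<close>

lemma plane_count:
 assumes ab: "\<alpha> \<in> P" "\<beta> \<in> P" "\<beta> ~= \<alpha>" and fJ: "!!\<gamma>. finite (J \<gamma>)"
  and H: "!!a b n p0. a \<in> P ==> b \<in> P ==> n \<in> {1,2,3} ==> p0 \<in> R2 n ==> \<alpha> = emb a b p0 ==>
   \<exists>I T. cover n p0 t I T & (\<forall>p. finite (I p)) & (\<forall>p\<in>R2 n - {p0}. I p <= J (emb a b p)) \<and>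
    real T = x * (real (card (R2 n)) - 2) + y * of_int (fst p0 + snd p0 - 1)"
  and S: "S = P \<inter> span {\<alpha>, \<beta>} - {\<alpha>}"
 shows "real (card (flt (\<alpha>, t) ` Sigma S J)) + (\<Sum>\<gamma>\<in>S. cart \<alpha> \<gamma> * (x * cart \<gamma> \<alpha> + y) / 2) <= real (card (Sigma S J))"
proof -
 have fS: "finite S" using S finite_P by auto
 have fL: "finite (Sigma S J)" using fS fJ by auto
 obtain a b where a: "a \<in> P" "b \<in> P" "b ~: span {a}" "span {a, b} = span {\<alpha>, \<beta>}"
  and nn: "!!\<gamma>. \<gamma> \<in> P \<inter> span {a, b} ==> \<exists>i j. 0 <= i & 0 <= j & \<gamma> = i *\<^sub>R a + j *\<^sub>R b"
  using plane_base[OF ab] by metis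
 have aS: "\<alpha> \<in> P \<inter> span {a, b}" using ab a(4) by (auto simp: span_base)
 have typed: ?thesis if t: "a' \<in> P" "b' \<in> P" "b' ~: span {a'}" "span {a', b'} = span {\<alpha>, \<beta>}"
  "!!\<gamma>. \<gamma> \<in> P \<inter> span {a', b'} ==> \<exists>i j. 0 <= i & 0 <= j & \<gamma> = i *\<^sub>R a' + j *\<^sub>R b'"
  "cart a' b' = - 1" "cart b' a' = - real n" "n \<in> {1,2,3}" for a' b' n
 proof -
  have nz: "a' ~= 0" "b' ~= 0" using t P_root root_nonzero by auto
  have eq: "P \<inter> span {a', b'} = emb a' b' ` R2 n" by (rule plane_roots_typed[OF t(1-3,5-8)])
  have inj: "inj (emb a' b')"
   using pair_coords_unique[OF t(3) nz(1)] by (force simp: emb_def inj_on_def prod_eq_iff)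
  have "\<alpha> \<in> emb a' b' ` R2 n" using aS eq a(4) t(4) by auto
  then obtain p0 where p0: "p0 \<in> R2 n" "\<alpha> = emb a' b' p0" by blast
  have SR: "S = emb a' b' ` (R2 n - {p0})"
  proof -
   have "S = emb a' b' ` R2 n - emb a' b' ` {p0}" using S t(4) eq p0(2) by simp
   then show ?thesis using image_set_diff[OF inj, of "R2 n" "{p0}"] by simp
  qed
  obtain I T where I: "cover n p0 t I T" "!!p. finite (I p)" "!!p. p \<in> R2 n - {p0} ==> I p <= J (emb a' b' p)"
   "real T = x * (real (card (R2 n)) - 2) + y * of_int (fst p0 + snd p0 - 1)"
   using H[OF t(1,2,8) p0] by blast
  define L0 where "L0 = (%(p, k). (emb a' b' p, k)) ` (SIGMA p:R2 n - {p0}. I p)"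
  have c1: "card (flt (emb a' b' p0, t) ` L0) + T <= card L0"
   by (rule cover_flats[OF I(1) t(8) p0(1) inj_on_subset[OF inj subset_UNIV] I(2) L0_def])
  have "L0 <= Sigma S J" unfolding L0_def SR using I(3) by auto
  from coincidence_mono[OF fL this, of "flt (\<alpha>, t)"] c1
  have "card (flt (\<alpha>, t) ` Sigma S J) + T <= card (Sigma S J)" unfolding p0(2) by linarith
  moreover have "(\<Sum>\<gamma>\<in>S. cart \<alpha> \<gamma> * (x * cart \<gamma> \<alpha> + y) / 2) = real T"
   unfolding I(4) R2_cart_sum[OF t(6,7) nz t(8) p0(1), symmetric] SR p0(2)
   by (subst sum.reindex) (use inj in \<open>auto simp: inj_on_def\<close>)
  ultimately show ?thesis by simp
 qed
 have r: "a \<in> \<Phi>" "b \<in> \<Phi>" "a ~= 0" "b ~= 0" "b ~= a" using a P_root root_nonzero by (auto simp: span_base)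
 have "a \<bullet> b <= 0"
 proof (rule ccontr)
  assume "\<not> ?thesis"
  then have "1 *\<^sub>R a + (- 1) *\<^sub>R b \<in> \<Phi>" using root_diff[OF r(1,2,5)] by simp
  from plane_roots_signed[OF a(1-3) nn this] show False by auto
 qed
 then consider "a \<bullet> b = 0" | "a \<bullet> b < 0" by linarith
 then show ?thesis
 proof cases
  case 1
  have two: "\<gamma> = a | \<gamma> = b" if g: "\<gamma> \<in> P \<inter> span {a, b}" for \<gamma>
  proof -
   obtain i j where ij: "0 <= i" "0 <= j" "\<gamma> = i *\<^sub>R a + j *\<^sub>R b" using nn[OF g] by blast
   have "cart \<gamma> a = 2 * i" unfolding ij(3) using 1 r by (simp add: cart_add cart_scale cart_self) (simp add: cart_def inner_commute)
   then have "rfl a \<gamma> = (i - 2 * i) *\<^sub>R a + j *\<^sub>R b" unfolding rfl_def ij(3) by (simp only: scaleR_diff_left) simp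
   then have "(- i) *\<^sub>R a + j *\<^sub>R b \<in> \<Phi>" using rfl_root[OF r(1), of \<gamma>] g P_root by simp
   then have "i = 0 | j = 0" using plane_roots_signed[OF a(1-3) nn, of "- i" j] ij by auto
   then have "\<gamma> \<in> span {b} | \<gamma> \<in> span {a}" unfolding ij(3) by (auto simp: span_scale span_base)
   then show ?thesis using npar_P g a unfolding npar_def by blast
  qed
  have "cart \<alpha> \<gamma> * (x * cart \<gamma> \<alpha> + y) / 2 = 0" if "\<gamma> \<in> S" for \<gamma>
  proof -
   have "\<gamma> = a | \<gamma> = b" "\<alpha> = a | \<alpha> = b" "\<gamma> ~= \<alpha>" using two aS that S a(4) by auto
   then have "\<alpha> \<bullet> \<gamma> = 0" using 1 by (auto simp: inner_commute)
   then show ?thesis by (simp add: cart_def)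
  qed
  then have "(\<Sum>\<gamma>\<in>S. cart \<alpha> \<gamma> * (x * cart \<gamma> \<alpha> + y) / 2) = 0" by (intro sum.neutral) blast
  then show ?thesis using card_image_le[OF fL, of "flt (\<alpha>, t)"] by simp
 next
  case 2
  have nb: "- b ~= a" using a neg_notin_P by auto
  have "a \<bullet> (- b) > 0" using 2 by simp
  from cart_cases[OF r(1) neg_root[OF r(2)] nb this]
  consider n where "cart a b = - 1" "cart b a = - real n" "n \<in> {1,2,3}" | n where "cart b a = - 1" "cart a b = - real n" "n \<in> {1,2,3}"
  proof (elim disjE conjE)
   assume "cart a (- b) = 1" "cart (- b) a \<in> {1,2,3}"
   then show thesis using that(1)[of "nat \<lfloor>cart (- b) a\<rfloor>"] by (auto simp: cart_uminus cart_uminus2)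
  next
   assume "cart (- b) a = 1" "cart a (- b) \<in> {1,2,3}"
   then show thesis using that(2)[of "nat \<lfloor>cart a (- b)\<rfloor>"] by (auto simp: cart_uminus cart_uminus2)
  qed
  then show ?thesis
  proof cases
   case (1 n)
   then show ?thesis by (intro typed[OF a nn]) auto
  next
   case (2 n)
   have na: "a ~: span {b}"
   proof
    assume "a \<in> span {b}"
    then have "a = b" using npar_P a unfolding npar_def by blast
    then show False using r by simp
   qed
   have nn': "\<exists>i j. 0 <= i & 0 <= j & \<gamma> = i *\<^sub>R b + j *\<^sub>R a" if "\<gamma> \<in> P \<inter> span {b, a}" for \<gamma>
    using nn[of \<gamma>] that by (metis add.commute insert_commute)
   show ?thesis by (rule typed[OF a(2,1) na _ nn' 2]) (use a(4) in \<open>simp add: insert_commute\<close>)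
  qed
 qed
qed

text \<open>Pairing \<open>sum_cart_scalar\<close> with \<alpha> gives the part with
  \<open>hh\<close>, the coroot formula for heights gives the other; leaving out \<gamma> = \<alpha>
  accounts for the -2 and the -1.\<close>

lemma cart_sums:
 assumes "\<alpha> \<in> P"
 shows "(\<Sum>\<gamma>\<in>P - {\<alpha>}. cart \<alpha> \<gamma> * (x * cart \<gamma> \<alpha> + y) / 2) = x * (hh - 2) + y * (ht \<alpha> - 1)"
proof -
 have a0: "\<alpha> ~= 0" "\<alpha> \<bullet> \<alpha> ~= 0" using assms P_root root_nonzero by auto
 have "(\<Sum>\<gamma>\<in>P. cart \<alpha> \<gamma> * (\<gamma> \<bullet> \<alpha>)) = hh * (\<alpha> \<bullet> \<alpha>)"
  using arg_cong[OF sum_cart_scalar[of \<alpha>], of "%z. z \<bullet> \<alpha>"] by (simp add: inner_sum_left)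
 then have "(\<Sum>\<gamma>\<in>P. cart \<alpha> \<gamma> * (\<gamma> \<bullet> \<alpha>)) * (2 / (\<alpha> \<bullet> \<alpha>)) = 2 * hh" using a0 by simp
 then have 1: "(\<Sum>\<gamma>\<in>P. cart \<alpha> \<gamma> * cart \<gamma> \<alpha>) = 2 * hh"
  unfolding sum_distrib_right by (simp add: cart_def[of _ \<alpha>] mult_ac)
 have "(\<Sum>\<gamma>\<in>P. cart \<alpha> \<gamma> * (x * cart \<gamma> \<alpha> + y) / 2) =
  (x / 2) * (\<Sum>\<gamma>\<in>P. cart \<alpha> \<gamma> * cart \<gamma> \<alpha>) + (y / 2) * (\<Sum>\<gamma>\<in>P. cart \<alpha> \<gamma>)"
  unfolding sum_distrib_left sum.distrib[symmetric] by (intro sum.cong refl) (simp add: field_simps)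
 also have "\<dots> = x * hh + y * ht \<alpha>" unfolding 1 ht_eq_sum_cart[symmetric] by simp
 finally have "(\<Sum>\<gamma>\<in>P. cart \<alpha> \<gamma> * (x * cart \<gamma> \<alpha> + y) / 2) = x * hh + y * ht \<alpha>" .
 moreover have "(\<Sum>\<gamma>\<in>P. cart \<alpha> \<gamma> * (x * cart \<gamma> \<alpha> + y) / 2) =
  cart \<alpha> \<alpha> * (x * cart \<alpha> \<alpha> + y) / 2 + (\<Sum>\<gamma>\<in>P - {\<alpha>}. cart \<alpha> \<gamma> * (x * cart \<gamma> \<alpha> + y) / 2)"
  by (rule sum.remove[OF finite_P assms])
 moreover have "cart \<alpha> \<alpha> * (x * cart \<alpha> \<alpha> + y) / 2 = 2 * x + y"
  using cart_self[OF a0(1)] by (simp add: field_simps)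
 ultimately show ?thesis by (simp add: right_diff_distrib)
qed

text \<open>The planes spanned by \<alpha> and another root partition the remaining positive roots.
  Flats are counted plane by plane; the union bound has the right direction, as their number is
  bounded from above.\<close>

lemma global_count:
 assumes \<alpha>: "\<alpha> \<in> P" and fJ: "!!\<gamma>. finite (J \<gamma>)"
  and H: "!!a b n p0. a \<in> P ==> b \<in> P ==> n \<in> {1,2,3} ==> p0 \<in> R2 n ==> \<alpha> = emb a b p0 ==>
   \<exists>I T. cover n p0 t I T & (\<forall>p. finite (I p)) & (\<forall>p\<in>R2 n - {p0}. I p <= J (emb a b p)) \<and>
    real T = x * (real (card (R2 n)) - 2) + y * of_int (fst p0 + snd p0 - 1)"
 shows "real (card (flt (\<alpha>, t) ` Sigma (P - {\<alpha>}) J)) + (x * (hh - 2) + y * (ht \<alpha> - 1)) <= real (card (Sigma (P - {\<alpha>}) J))"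
proof -
 define Q where "Q \<beta> = P \<inter> span {\<alpha>, \<beta>} - {\<alpha>}" for \<beta>
 define QQ where "QQ = Q ` (P - {\<alpha>})"
 have fQ: "finite QQ" "!!S. S \<in> QQ ==> finite S" using finite_P by (auto simp: QQ_def Q_def)
 have U: "\<Union> QQ = P - {\<alpha>}" by (auto simp: QQ_def Q_def span_base)
 have Qeq: "Q \<gamma> = Q \<beta>" if "\<gamma> \<in> Q \<beta>" for \<gamma> \<beta>
 proof -
  have "\<gamma> ~: span {\<alpha>}" using npar_P that \<alpha> unfolding npar_def Q_def by blast
  then show ?thesis using span_pair_exchange[of \<gamma> \<alpha> \<beta>] that by (simp add: Q_def)
 qed
 have disj: "A \<inter> B = {}" if "A \<in> QQ" "B \<in> QQ" "A ~= B" for A B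
  using that Qeq unfolding QQ_def by blast
 have dsum: "(\<Sum>\<gamma>\<in>P - {\<alpha>}. f \<gamma>) = (\<Sum>S\<in>QQ. \<Sum>\<gamma>\<in>S. f \<gamma>)" for f :: "_ => real"
  unfolding U[symmetric] using fQ disj by (intro sum.Union_disjoint[unfolded comp_def]) auto
 have cS: "real (card (Sigma S J)) = (\<Sum>\<gamma>\<in>S. real (card (J \<gamma>)))" if "finite S" for S
  using that fJ by (simp add: card_SigmaI)
 have "flt (\<alpha>, t) ` Sigma (P - {\<alpha>}) J = (\<Union>S\<in>QQ. flt (\<alpha>, t) ` Sigma S J)"
  unfolding U[symmetric] by auto
 then have "card (flt (\<alpha>, t) ` Sigma (P - {\<alpha>}) J) <= (\<Sum>S\<in>QQ. card (flt (\<alpha>, t) ` Sigma S J))"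
  using card_UN_le[OF fQ(1)] by metis
 then have "real (card (flt (\<alpha>, t) ` Sigma (P - {\<alpha>}) J)) <= (\<Sum>S\<in>QQ. real (card (flt (\<alpha>, t) ` Sigma S J)))"
  by (metis of_nat_le_iff of_nat_sum)
 also have "\<dots> <= (\<Sum>S\<in>QQ. real (card (Sigma S J)) - (\<Sum>\<gamma>\<in>S. cart \<alpha> \<gamma> * (x * cart \<gamma> \<alpha> + y) / 2))"
 proof (rule sum_mono)
  fix S assume "S \<in> QQ"
  then obtain \<beta> where b: "\<beta> \<in> P" "\<beta> ~= \<alpha>" "S = P \<inter> span {\<alpha>, \<beta>} - {\<alpha>}" by (auto simp: QQ_def Q_def)
  from plane_count[OF \<alpha> b(1,2) fJ H b(3)]
  show "real (card (flt (\<alpha>, t) ` Sigma S J)) <= real (card (Sigma S J)) - (\<Sum>\<gamma>\<in>S. cart \<alpha> \<gamma> * (x * cart \<gamma> \<alpha> + y) / 2)"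
   by linarith
 qed
 also have "\<dots> = (\<Sum>S\<in>QQ. \<Sum>\<gamma>\<in>S. real (card (J \<gamma>))) - (\<Sum>S\<in>QQ. \<Sum>\<gamma>\<in>S. cart \<alpha> \<gamma> * (x * cart \<gamma> \<alpha> + y) / 2)"
  using cS fQ by (simp add: sum_subtractf)
 also have "\<dots> = real (card (Sigma (P - {\<alpha>}) J)) - (x * (hh - 2) + y * (ht \<alpha> - 1))"
  unfolding dsum[symmetric] cart_sums[OF \<alpha>] using cS[of "P - {\<alpha>}"] finite_P by simp
 finally show ?thesis by linarith
qed

definition J1 :: "nat => real^'n => real^'n => int set" where
 "J1 m \<alpha> \<gamma> = {if ht \<gamma> < ht \<alpha> then - int m else 1 - int m..int m}"

definition J2 :: "nat => real^'n => real^'n => int set" where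
 "J2 m \<alpha> \<gamma> = {- int m..if ht \<alpha> < ht \<gamma> then int m + 1 else int m}"

lemma ht_emb_less:
 assumes "a \<in> P" "b \<in> P" "fst p <= fst q" "snd p <= snd q" "p ~= q"
 shows "ht (emb a b p) < ht (emb a b q)"
proof -
 have h: "ht a > 0" "ht b > 0" using ht_pos assms by auto
 have "of_int (fst p) * ht a <= of_int (fst q) * ht a" "of_int (snd p) * ht b <= of_int (snd q) * ht b"
  using h assms by (auto intro!: mult_right_mono)
 moreover have "fst p < fst q | snd p < snd q" using assms(3-5) by (auto simp: prod_eq_iff)
 then have "of_int (fst p) * ht a < of_int (fst q) * ht a | of_int (snd p) * ht b < of_int (snd q) * ht b"
  using h by auto
 ultimately show ?thesis by (auto simp: emb_def ht_add ht_scale)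
qed

lemma count1:
 assumes "\<alpha> \<in> P"
 shows "real (card (flt (\<alpha>, - int m) ` Sigma (P - {\<alpha>}) (J1 m \<alpha>))) + (real m * (hh - 2) + (ht \<alpha> - 1))
  <= real (card (Sigma (P - {\<alpha>}) (J1 m \<alpha>)))"
proof -
 have "real (card (flt (\<alpha>, - int m) ` Sigma (P - {\<alpha>}) (J1 m \<alpha>))) + (real m * (hh - 2) + 1 * (ht \<alpha> - 1))
  <= real (card (Sigma (P - {\<alpha>}) (J1 m \<alpha>)))"
 proof (rule global_count[OF assms])
  fix a b n p0 assume h: "a \<in> P" "b \<in> P" "n \<in> {1,2,3::nat}" "p0 \<in> R2 n" "\<alpha> = emb a b p0"
  have "I1 m p0 p <= J1 m \<alpha> (emb a b p)" if "p \<in> R2 n - {p0}" for p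
   using ht_emb_less[OF h(1,2), of p p0] that by (auto simp: I1_def J1_def h(5))
  moreover have "card (R2 n) \<ge> 2" "fst p0 + snd p0 \<ge> 1" using h(3,4) by (auto simp: R2_def split: if_splits)
  then have "real (m * (card (R2 n) - 2) + nat (fst p0 + snd p0 - 1)) =
    real m * (real (card (R2 n)) - 2) + 1 * of_int (fst p0 + snd p0 - 1)" by (simp add: of_nat_diff)
  ultimately show "\<exists>I T. cover n p0 (- int m) I T & (\<forall>p. finite (I p)) & (\<forall>p\<in>R2 n - {p0}. I p <= J1 m \<alpha> (emb a b p)) \<and>
    real T = real m * (real (card (R2 n)) - 2) + 1 * of_int (fst p0 + snd p0 - 1)"
   using cover1[OF h(4,3), of m]
   by (intro exI[of _ "I1 m p0"] exI[of _ "m * (card (R2 n) - 2) + nat (fst p0 + snd p0 - 1)"]) (auto simp: I1_def)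
 qed (simp add: J1_def)
 then show ?thesis by simp
qed

lemma count2:
 assumes "\<alpha> \<in> P"
 shows "real (card (flt (\<alpha>, int m + 1) ` Sigma (P - {\<alpha>}) (J2 m \<alpha>))) + (real (m + 1) * (hh - 2) - (ht \<alpha> - 1))
  <= real (card (Sigma (P - {\<alpha>}) (J2 m \<alpha>)))"
proof -
 have "real (card (flt (\<alpha>, int m + 1) ` Sigma (P - {\<alpha>}) (J2 m \<alpha>))) + (real (m + 1) * (hh - 2) + (- 1) * (ht \<alpha> - 1))
  <= real (card (Sigma (P - {\<alpha>}) (J2 m \<alpha>)))"
 proof (rule global_count[OF assms])
  fix a b n p0 assume h: "a \<in> P" "b \<in> P" "n \<in> {1,2,3::nat}" "p0 \<in> R2 n" "\<alpha> = emb a b p0"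
  have "I2 m p0 p <= J2 m \<alpha> (emb a b p)" if "p \<in> R2 n - {p0}" for p
   using ht_emb_less[OF h(1,2), of p0 p] that by (auto simp: I2_def J2_def h(5))
  moreover have c: "card (R2 n) \<ge> 2" "fst p0 + snd p0 \<ge> 1" "nat (fst p0 + snd p0 - 1) <= card (R2 n) - 2"
   using h(3,4) by (auto simp: R2_def split: if_splits)
  then have "nat (fst p0 + snd p0 - 1) <= (m + 1) * (card (R2 n) - 2)" by (simp add: trans_le_add1)
  then have "real ((m + 1) * (card (R2 n) - 2) - nat (fst p0 + snd p0 - 1)) =
    real (m + 1) * (real (card (R2 n)) - 2) + (- 1) * of_int (fst p0 + snd p0 - 1)" using c by (simp add: of_nat_diff) (simp add: algebra_simps)
  ultimately show "\<exists>I T. cover n p0 (int m + 1) I T & (\<forall>p. finite (I p)) & (\<forall>p\<in>R2 n - {p0}. I p <= J2 m \<alpha> (emb a b p)) \<and>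
    real T = real (m + 1) * (real (card (R2 n)) - 2) + (- 1) * of_int (fst p0 + snd p0 - 1)"
   using cover2[OF h(4,3), of m]
   by (intro exI[of _ "I2 m p0"] exI[of _ "(m + 1) * (card (R2 n) - 2) - nat (fst p0 + snd p0 - 1)"]) (auto simp: I2_def)
 qed (simp add: J2_def)
 then show ?thesis by simp
qed

end

section \<open>From the Shi to the Catalan arrangement and back\<close>

lemma det_nonzero_independent:
 fixes R :: "'n::finite => real^'n"
 assumes "det (\<chi> i. R i) ~= 0" "(\<Sum>k\<in>UNIV. t k *\<^sub>R R k) = 0"
 shows "t i = 0"
proof -
 have "transpose (\<chi> k. R k) *v (\<chi> k. t k) = 0" using assms(2)
  by (simp add: matrix_mult_sum column_def transpose_def scalar_mult_eq_scaleR vec_lambda_eta)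
 moreover have "det (transpose (\<chi> k. R k)) ~= 0" using assms(1) by (simp add: det_transpose)
 ultimately have "(\<chi> k. t k) = 0"
  by (metis invertible_det_nz matrix_left_invertible_ker invertible_left_inverse)
 from arg_cong[OF this, of "%v. v $ i"] show ?thesis by simp
qed

context roots begin

definition shi :: "nat => ((real^'n) \<times> int) set" where "shi m = P \<times> {1 - int m..int m}"
definition cat :: "nat => ((real^'n) \<times> int) set" where "cat m = P \<times> {- int m..int m}"
definition up1 :: "nat => nat => ((real^'n) \<times> int) set" where
 "up1 m j = shi m \<union> {\<beta>\<in>P. hgt \<beta> < j} \<times> {- int m}"
text \<open>Heights are treated downwards because the critical degree (m + 1) hh - ht must rise by
  one from step to step: then elements raised at one height are critical again at the next.\<close>

definition up2 :: "nat => nat => ((real^'n) \<times> int) set" where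
 "up2 m j = cat m \<union> {\<beta>\<in>P. j < hgt \<beta>} \<times> {int m + 1}"

lemma finite_arr: "finite (shi m)" "finite (cat m)" "finite (up1 m j)" "finite (up2 m j)"
 using finite_P by (auto simp: shi_def cat_def up1_def up2_def)

lemma fst_arr: "fst ` shi m <= P" "fst ` cat m <= P" "fst ` up1 m j <= P" "fst ` up2 m j <= P"
 by (auto simp: shi_def cat_def up1_def up2_def)

lemma lvl_P: "\<alpha> \<in> lvl j ==> \<alpha> \<in> P" and lvl_hgt: "\<alpha> \<in> lvl j ==> hgt \<alpha> = j"
 and lvl_ht: "\<alpha> \<in> lvl j ==> ht \<alpha> = real j" and lvl_pos: "\<alpha> \<in> lvl j ==> 1 <= j"
 using hgt_eq hgt_ge1 by (auto simp: lvl_def)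

lemma hh_ge_2: "hh \<ge> 2"
proof -
 have "CARD('n) <= card P" using card_D D_sub finite_P card_mono by metis
 then show ?thesis unfolding hh_def by (simp add: field_simps)
qed

lemma ht_less_iff: "\<gamma> \<in> P ==> \<alpha> \<in> P ==> ht \<gamma> < ht \<alpha> \<longleftrightarrow> hgt \<gamma> < hgt \<alpha>"
 by (metis hgt_eq of_nat_less_iff)

text \<open>The degree adds the 2 m hyperplanes parallel to the new one, which meet it at infinity,
  and the m (hh - 2) + (j - 1) coincidences of \<open>count1\<close>.\<close>

lemma obst1:
 assumes a: "\<alpha> \<in> lvl j" and D: "real D = real m * hh + real j - 1"
 shows "\<exists>B. obst (up1 m j) (\<alpha>, - int m) D B \<and>
  (\<forall>x. frm (\<alpha>, - int m) \<bullet> x = 0 & fst x ~= 0 & (\<forall>l\<in>up1 m j. frm l \<bullet> x ~= 0) --> B x ~= 0)"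
proof (rule terao_polynomial[OF npar_P _ finite_arr(3) fst_arr(3), where r = "2 * m" and L = "Sigma (P - {\<alpha>}) (J1 m \<alpha>)"])
 have aP: "\<alpha> \<in> P" "hgt \<alpha> = j" "1 <= j" "ht \<alpha> = real j" using a lvl_P lvl_hgt lvl_pos lvl_ht by auto
 show "fst (\<alpha>, - int m) \<in> P" using aP by simp
 show "(\<alpha>, - int m) ~: up1 m j" using aP by (auto simp: up1_def shi_def)
 show "Sigma (P - {\<alpha>}) (J1 m \<alpha>) = {l \<in> up1 m j. fst l ~= fst (\<alpha>, - int m)}"
  using ht_less_iff[OF _ aP(1)] aP(2) by (auto simp: J1_def up1_def shi_def split: if_splits)
 have "{l \<in> up1 m j. fst l = fst (\<alpha>, - int m)} = {\<alpha>} \<times> {1 - int m..int m}"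
  using aP by (auto simp: up1_def shi_def)
 then show "2 * m = card {l \<in> up1 m j. fst l = fst (\<alpha>, - int m)}" by simp
 have "real m * 2 <= real m * hh" using hh_ge_2 by (intro mult_left_mono) auto
 then have "real (2 * m) <= real D" using D aP(3) by simp
 then show "2 * m <= D" by linarith
 have "real (D + card (flt (\<alpha>, - int m) ` Sigma (P - {\<alpha>}) (J1 m \<alpha>))) <= real (2 * m + card (Sigma (P - {\<alpha>}) (J1 m \<alpha>)))"
  using count1[OF aP(1), of m] D aP(4) by (simp add: algebra_simps)
 then show "D + card (flt (\<alpha>, - int m) ` Sigma (P - {\<alpha>}) (J1 m \<alpha>)) <= 2 * m + card (Sigma (P - {\<alpha>}) (J1 m \<alpha>))"
  by (simp only: of_nat_le_iff)
qed

text \<open>Here 2 m + 1 parallel hyperplanes and (m + 1) (hh - 2) - (j - 1) coincidences add up to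
  (m + 1) hh - j. The bound on j keeps this degree at least 2 m + 1, as the construction of the form
  requires.\<close>

lemma obst2:
 assumes a: "\<alpha> \<in> lvl j" and D: "real D = real (m + 1) * hh - real j" and j: "real j <= hh - 1"
 shows "\<exists>B. obst (up2 m j) (\<alpha>, int m + 1) D B \<and>
  (\<forall>x. frm (\<alpha>, int m + 1) \<bullet> x = 0 & fst x ~= 0 & (\<forall>l\<in>up2 m j. frm l \<bullet> x ~= 0) --> B x ~= 0)"
proof (rule terao_polynomial[OF npar_P _ finite_arr(4) fst_arr(4), where r = "2 * m + 1" and L = "Sigma (P - {\<alpha>}) (J2 m \<alpha>)"])
 have aP: "\<alpha> \<in> P" "hgt \<alpha> = j" "1 <= j" "ht \<alpha> = real j" using a lvl_P lvl_hgt lvl_pos lvl_ht by auto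
 show "fst (\<alpha>, int m + 1) \<in> P" using aP by simp
 show "(\<alpha>, int m + 1) ~: up2 m j" using aP by (auto simp: up2_def cat_def)
 show "Sigma (P - {\<alpha>}) (J2 m \<alpha>) = {l \<in> up2 m j. fst l ~= fst (\<alpha>, int m + 1)}"
  using ht_less_iff[OF aP(1)] aP(2) by (auto simp: J2_def up2_def cat_def split: if_splits)
 have "{l \<in> up2 m j. fst l = fst (\<alpha>, int m + 1)} = {\<alpha>} \<times> {- int m..int m}"
  using aP by (auto simp: up2_def cat_def)
 then show "2 * m + 1 = card {l \<in> up2 m j. fst l = fst (\<alpha>, int m + 1)}" by simp
 have "real m * 2 <= real m * hh" using hh_ge_2 by (intro mult_left_mono) auto
 then have "real (2 * m + 1) <= real D" using D j by (simp add: algebra_simps)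
 then show "2 * m + 1 <= D" by linarith
 have "real (D + card (flt (\<alpha>, int m + 1) ` Sigma (P - {\<alpha>}) (J2 m \<alpha>))) <= real (2 * m + 1 + card (Sigma (P - {\<alpha>}) (J2 m \<alpha>)))"
  using count2[OF aP(1), of m] D aP(4) by (simp add: algebra_simps)
 then show "D + card (flt (\<alpha>, int m + 1) ` Sigma (P - {\<alpha>}) (J2 m \<alpha>)) <= 2 * m + 1 + card (Sigma (P - {\<alpha>}) (J2 m \<alpha>))"
  by (simp only: of_nat_le_iff)
qed

lemma up1_Suc: "up1 m (Suc j) = up1 m j \<union> lvl j \<times> {- int m}"
 by (auto simp: up1_def lvl_def)

lemma up2_minus: "1 <= j ==> up2 m (j - 1) = up2 m j \<union> lvl j \<times> {int m + 1}"
 by (auto simp: up2_def lvl_def)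

lemma up1_1: "up1 m 1 = shi m" using hgt_ge1 by (force simp: up1_def)

lemma up2_0: "up2 m 0 = shi (Suc m)" using hgt_ge1 by (force simp: up2_def cat_def shi_def)

lemma up1_top: "(!!\<beta>. \<beta> \<in> P ==> hgt \<beta> < j) ==> up1 m j = cat m"
 by (auto simp: up1_def cat_def shi_def)

lemma up2_top: "(!!\<beta>. \<beta> \<in> P ==> hgt \<beta> <= j) ==> up2 m j = cat m"
 by (force simp: up2_def)

lemma independent_interpolate:
 assumes "independent (G :: (real^'n) set)" shows "\<exists>w. \<forall>\<alpha>\<in>G. \<alpha> \<bullet> w = c \<alpha>"
proof -
 obtain f where f: "linear f" "!!x. x \<in> G ==> f x = c x" using linear_independent_extend[OF assms, of c] by blast
 have "f x = x \<bullet> (\<Sum>b\<in>Basis. f b *\<^sub>R b)" for x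
 proof -
  have "f x = f (\<Sum>b\<in>Basis. (x \<bullet> b) *\<^sub>R b)" by (simp add: euclidean_representation)
  also have "\<dots> = (\<Sum>b\<in>Basis. (x \<bullet> b) * f b)" by (simp add: linear_sum[OF f(1)] linear_cmul[OF f(1)])
  finally show ?thesis by (simp add: inner_sum_right mult.commute)
 qed
 then show ?thesis using f(2) by metis
qed

text \<open>Hyperplanes of roots outside the span of \<open>lvl j\<close> are avoided by moving
  along the common zeros of \<open>lvl j\<close>. For a root in the span the value at the point is
  forced to be -m ht / j, which is at most -m by \<open>level_span_ht\<close>; but
  \<open>up1 m j\<close> has no k below -m, and k = -m only for heights below j.\<close>

lemma level_generic_point:
 assumes j: "1 <= j"
 shows "\<exists>y. (\<forall>\<alpha>\<in>lvl j. \<alpha> \<bullet> y = - real m) & (\<forall>l\<in>up1 m j. frm l \<bullet> (1, y) ~= 0)"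
proof -
 obtain y0 where y0: "!!\<alpha>. \<alpha> \<in> lvl j ==> \<alpha> \<bullet> y0 = - real m" using independent_interpolate[OF lvl_independent, of j "%_. - real m"] by blast
 define S where "S = {u. \<forall>\<alpha>\<in>lvl j. \<alpha> \<bullet> u = 0}"
 have sS: "subspace S" by (auto simp: S_def subspace_def inner_add_right)
 define F where "F = {\<beta>\<in>P. \<beta> ~: span (lvl j)}"
 have "\<exists>u\<in>S. (\<Prod>\<beta>\<in>F. \<beta> \<bullet> u) ~= 0"
 proof (rule rp_prod_nonzero_subspace[OF sS])
  show "finite F" using finite_P by (simp add: F_def)
  fix \<beta> assume b: "\<beta> \<in> F"
  obtain y z where yz: "y \<in> span (lvl j)" "!!w. w \<in> span (lvl j) ==> orthogonal z w" "\<beta> = y + z"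
   using orthogonal_subspace_decomp_exists[of "lvl j" \<beta>] by metis
  have "z \<in> S" using yz(2) by (auto simp: S_def orthogonal_def inner_commute span_base)
  moreover have "\<beta> \<bullet> z ~= 0"
  proof
   assume "\<beta> \<bullet> z = 0"
   moreover have "y \<bullet> z = 0" using yz(2)[OF yz(1)] by (simp add: orthogonal_def inner_commute)
   ultimately have "z = 0" using yz(3) by (simp add: inner_add_left)
   then show False using yz b by (simp add: F_def)
  qed
  ultimately show "\<exists>x\<in>S. \<beta> \<bullet> x ~= 0" by blast
 qed auto
 then obtain u where u: "u \<in> S" "(\<Prod>\<beta>\<in>F. \<beta> \<bullet> u) ~= 0" by blast
 have u2: "\<beta> \<bullet> u ~= 0" if "\<beta> \<in> F" for \<beta>
  using u(2) that finite_P by (auto simp: F_def prod_zero_iff)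
 have "finite ((%(\<beta>, k). (of_int k - \<beta> \<bullet> y0) / (\<beta> \<bullet> u)) ` up1 m j)" using finite_arr by auto
 then obtain s where s: "s ~: (%(\<beta>, k). (of_int k - \<beta> \<bullet> y0) / (\<beta> \<bullet> u)) ` up1 m j"
  using ex_new_if_finite[OF infinite_UNIV_char_0] by blast
 let ?y = "y0 + s *\<^sub>R u"
 have "\<forall>\<alpha>\<in>lvl j. \<alpha> \<bullet> ?y = - real m" using y0 u(1) by (auto simp: S_def inner_add_right)
 moreover have "frm l \<bullet> (1, ?y) ~= 0" if l: "l \<in> up1 m j" for l
 proof
  assume z: "frm l \<bullet> (1, ?y) = 0"
  obtain \<beta> k where bk: "l = (\<beta>, k)" by (cases l)
  have bP: "\<beta> \<in> P" using l bk by (auto simp: up1_def shi_def)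
  have e: "\<beta> \<bullet> y0 + s * (\<beta> \<bullet> u) = of_int k" using z bk by (simp add: frm_inner inner_add_right)
  show False
  proof (cases "\<beta> \<in> F")
   case True
   then have "s = (of_int k - \<beta> \<bullet> y0) / (\<beta> \<bullet> u)" using e u2 by (simp add: field_simps)
   then show False using s l bk by force
  next
   case False
   then have sp: "\<beta> \<in> span (lvl j)" using bP by (simp add: F_def)
   have "real j * (x \<bullet> y0) = - real m * ht x & x \<bullet> u = 0" if "x \<in> span (lvl j)" for x
    using that
   proof (induction rule: span_induct_alt)
    case base
    then show ?case using linear_0[OF linear_ht] by simp
   next
    case (step c x z)
    then show ?case using y0[OF step(1)] lvl_ht[OF step(1)] u(1)
     by (simp add: inner_add_left ht_add ht_scale S_def algebra_simps)
   qed
   from this[OF sp] have "real j * of_int k = - real m * real (hgt \<beta>)" using e hgt_eq[OF bP] by simp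
   then have "real_of_int (int j * k) = real_of_int (- (int m * int (hgt \<beta>)))" by simp
   then have jk: "int j * k = - (int m * int (hgt \<beta>))" by (simp only: of_int_eq_iff)
   have ge: "hgt \<beta> \<ge> j" using level_span_ht[OF bP sp] .
   have "k <= - int m"
   proof (rule ccontr)
    assume "\<not> ?thesis"
    then have "int j * (- int m + 1) <= int j * k" by (intro mult_left_mono) auto
    moreover have "int m * int j <= int m * int (hgt \<beta>)" using ge by (intro mult_left_mono) auto
    ultimately show False using jk j by (simp add: algebra_simps)
   qed
   then show False using l bk ge by (auto simp: up1_def shi_def)
  qed
 qed
 ultimately show ?thesis by blast
qed

lemma hyperplane_generic_point:
 assumes l: "fst l \<in> P" and A: "finite A" "fst ` A <= P" "l ~: A"
 shows "\<exists>x. frm l \<bullet> x = 0 & fst x ~= 0 & (\<forall>l'\<in>A. frm l' \<bullet> x ~= 0)"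
proof -
 let ?H = "{x. frm l \<bullet> x = 0}"
 let ?p = "%x. \<Prod>l'\<in>A. frm l' \<bullet> x"
 have "\<exists>x\<in>?H. ?p x ~= 0"
 proof (rule rp_prod_nonzero_subspace[OF subspace_hyperplane_inner A(1)])
  fix l' assume l': "l' \<in> A"
  then have "frm l' ~: span {frm l}" using frm_nonparallel[OF npar_P _ l, of l'] A by blast
  then show "\<exists>x\<in>?H. frm l' \<bullet> x ~= 0" using nonparallel_hyperplane_point by blast
 qed auto
 moreover have "(1::real, 0::real^'n) ~: span {frm l}"
  using l npar_P by (auto simp: span_singleton frm_def npar_def)
 then have "\<exists>x\<in>?H. (1, 0) \<bullet> x ~= 0" using nonparallel_hyperplane_point by blast
 ultimately have "\<exists>x\<in>?H. ?p x * ((1, 0) \<bullet> x) ~= 0"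
  using rp_mult_eq_0_subspace[OF subspace_hyperplane_inner[of "frm l"], of ?p "%x. (1, 0) \<bullet> x"]
   real_polynomial_function_prod[OF A(1) rp_inner] by blast
 then obtain x where x: "frm l \<bullet> x = 0" "?p x ~= 0" "(1, 0) \<bullet> x ~= 0" by auto
 then have "fst x ~= 0" by (cases x) simp
 moreover have "frm l' \<bullet> x ~= 0" if "l' \<in> A" for l' using x(2) A(1) that by (auto simp: prod_zero_iff)
 ultimately show ?thesis using x(1) by blast
qed

lemma FB_span:
 assumes "FB A \<theta> d" "finite A" "fst ` A <= P" "!!l. l \<in> A ==> frm l \<bullet> x ~= 0"
 shows "\<exists>t. w = (\<Sum>i\<in>UNIV. t i *\<^sub>R \<theta> i x)"
proof -
 obtain c where c: "c ~= 0" "!!x. det (\<chi> i. \<theta> i x) = c * Qf A x" using FB_det[OF npar_P assms(2,3,1)] by blast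
 have "Qf A x ~= 0" using assms(2,4) by (simp add: Qf_def)
 then have d: "det (\<chi> i. \<theta> i x) ~= 0" using c by simp
 have "w = (\<Sum>i\<in>UNIV. (det (\<chi> k. if k = i then w else (\<chi> i. \<theta> i x) $ k) / det (\<chi> i. \<theta> i x)) *\<^sub>R \<theta> i x)"
 proof -
  have "w = (1 / det (\<chi> i. \<theta> i x)) *\<^sub>R (det (\<chi> i. \<theta> i x) *\<^sub>R w)" using d by simp
  also have "\<dots> = (\<Sum>i\<in>UNIV. (det (\<chi> k. if k = i then w else (\<chi> i. \<theta> i x) $ k) / det (\<chi> i. \<theta> i x)) *\<^sub>R \<theta> i x)"
   unfolding cramer_expand[OF d, of w] by (simp add: scaleR_sum_right)
  finally show ?thesis .
 qed
 then show ?thesis by (rule exI[of _ "%i. det (\<chi> k. if k = i then w else (\<chi> i. \<theta> i x) $ k) / det (\<chi> i. \<theta> i x)"])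
qed

text \<open>At the generic point the basis spans V, and the roots of height j are independent, so
  all combinations of values on the new hyperplanes occur. Elements of degree below D restrict to
  zero there, so those of degree D already produce all values; larger degrees are excluded by
  \<open>dD\<close>.\<close>

lemma up1_step:
 assumes FB: "FB (up1 m j) \<theta> d" and j: "1 <= j" and D: "real D = real m * hh + real j - 1"
  and dD: "!!i. d i <= D"
 shows "\<exists>\<theta>' R. R <= {i. d i = D} & card R = card (lvl j) & FB (up1 m (Suc j)) \<theta>' (%i. if i \<in> R then Suc (d i) else d i)"
proof -
 define G where "G = lvl j \<times> {- int m}"
 have "\<exists>B. h \<in> G --> obst (up1 m j) h D B \<and>
  (\<forall>x. frm h \<bullet> x = 0 & fst x ~= 0 & (\<forall>l\<in>up1 m j. frm l \<bullet> x ~= 0) --> B x ~= 0)" for h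
  using obst1[OF _ D] by (cases "h \<in> G") (auto simp: G_def)
 then obtain B where B: "!!h. h \<in> G ==> obst (up1 m j) h D (B h)"
  "!!h x. h \<in> G ==> frm h \<bullet> x = 0 ==> fst x ~= 0 ==> (\<forall>l\<in>up1 m j. frm l \<bullet> x ~= 0) ==> B h x ~= 0" by metis
 obtain y where y: "!!\<alpha>. \<alpha> \<in> lvl j ==> \<alpha> \<bullet> y = - real m" "!!l. l \<in> up1 m j ==> frm l \<bullet> (1, y) ~= 0"
  using level_generic_point[OF j, of m] by blast
 define x where "x = (1::real, y)"
 have xG: "frm h \<bullet> x = 0" if "h \<in> G" for h using that y(1) by (auto simp: G_def x_def frm_inner)
 have Bx: "B h x ~= 0" if "h \<in> G" for h using B(2)[OF that xG[OF that]] y(2) by (simp add: x_def)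
 have th: "\<theta> i \<in> D0 (up1 m j)" "vhom (d i) (\<theta> i)" for i using FB by (auto simp: FB_def)
 have "\<exists>c. h \<in> G --> (\<forall>x'. frm h \<bullet> x' = 0 --> fst h \<bullet> \<theta> i x' = c * B h x') & (d i ~= D --> c = 0)" for h i
 proof (cases "h \<in> G")
  case True
  show ?thesis
  proof (cases "d i = D")
   case eq: True
   then show ?thesis using obst_exact[OF B(1)[OF True] th(1)[of i]] th(2)[of i] by auto
  next
   case False
   then have "d i < D" using dD[of i] by simp
   then have "\<theta> i \<in> D0 (insert h (up1 m j))" by (rule obst_low[OF B(1)[OF True] th])
   then show ?thesis by (intro exI[of _ 0]) (auto simp: D0_insert)
  qed
 qed auto
 then obtain c where c: "!!h i x'. h \<in> G ==> frm h \<bullet> x' = 0 ==> fst h \<bullet> \<theta> i x' = c h i * B h x'"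
  "!!h i. h \<in> G ==> d i ~= D ==> c h i = 0" by metis
 have "\<exists>\<theta>' R. R <= {i. d i = D} & card R = card G & FB (up1 m j \<union> G) \<theta>' (%i. if i \<in> R then Suc (d i) else d i)"
 proof (rule FB_add_batch[OF _ FB finite_arr(3) _ _ B(1)])
  show "finite G" using finite_lvl by (simp add: G_def)
  show "G \<inter> up1 m j = {}" by (auto simp: G_def up1_def shi_def lvl_def)
  fix h assume h: "h \<in> G"
  show "frm h ~= 0" using h lvl_P frm_nonzero[OF npar_P, of h] by (auto simp: G_def)
  show "\<exists>x. frm h \<bullet> x = 0 & B h x ~= 0" using xG[OF h] Bx[OF h] by blast
 next
  fix z :: "(real^'n) \<times> int => real"
  obtain w where w: "!!\<alpha>. \<alpha> \<in> lvl j ==> \<alpha> \<bullet> w = z (\<alpha>, - int m) * B (\<alpha>, - int m) x"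
   using independent_interpolate[OF lvl_independent, of j "%\<alpha>. z (\<alpha>, - int m) * B (\<alpha>, - int m) x"] by blast
  obtain t where t: "w = (\<Sum>i\<in>UNIV. t i *\<^sub>R \<theta> i x)" using FB_span[OF FB finite_arr(3) fst_arr(3)] y(2) unfolding x_def by blast
  have "fst h \<bullet> (\<Sum>i\<in>{i. d i = D}. t i *\<^sub>R \<theta> i x') = z h * B h x'" if h: "h \<in> G" and hx: "frm h \<bullet> x' = 0" for h x'
  proof -
   have s: "fst h \<bullet> (\<Sum>i\<in>UNIV. t i *\<^sub>R \<theta> i x'') = (\<Sum>i\<in>{i. d i = D}. t i * c h i) * B h x''" if "frm h \<bullet> x'' = 0" for x''
   proof -
    have "fst h \<bullet> (\<Sum>i\<in>UNIV. t i *\<^sub>R \<theta> i x'') = (\<Sum>i\<in>UNIV. t i * (c h i * B h x''))"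
     using c(1)[OF h that] by (simp add: inner_sum_right)
    also have "\<dots> = (\<Sum>i\<in>{i. d i = D}. t i * (c h i * B h x''))"
     using c(2)[OF h] by (intro sum.mono_neutral_right) auto
    finally show ?thesis by (simp add: sum_distrib_right mult.assoc)
   qed
   have "z h * B h x = (\<Sum>i\<in>{i. d i = D}. t i * c h i) * B h x"
    using s[OF xG[OF h]] w h t by (auto simp: G_def)
   then have zh: "z h = (\<Sum>i\<in>{i. d i = D}. t i * c h i)" using Bx[OF h] by simp
   show ?thesis unfolding zh using c(1)[OF h hx] by (simp add: inner_sum_right sum_distrib_right mult.assoc)
  qed
  then show "\<exists>t. \<forall>h\<in>G. \<forall>x'. frm h \<bullet> x' = 0 --> fst h \<bullet> (\<Sum>i\<in>{i. d i = D}. t i *\<^sub>R \<theta> i x') = z h * B h x'" by blast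
 qed auto
 moreover have "card G = card (lvl j)" by (simp add: G_def card_cartesian_product)
 ultimately show ?thesis by (simp add: up1_Suc G_def)
qed

text \<open>The degrees, shifted by c, form the partition dual to the numbers of roots of each
  height: every height raises as many degrees as it has roots.\<close>

definition cat_degrees :: "nat => nat => ('n => nat) => bool" where
 "cat_degrees m c d \<longleftrightarrow> (\<forall>i. c <= d i) & (\<forall>s\<ge>1. card {i. c + s <= d i} = card (lvl s))"

lemma up1_iterate:
 assumes FB: "FB (shi m) \<theta> (%_. c)" and c: "real c = real m * hh"
 shows "\<exists>\<theta> d. FB (up1 m (Suc j)) \<theta> d & (\<forall>i. c <= d i & d i <= c + j) & (\<forall>s. 1 <= s & s <= j --> card {i. c + s <= d i} = card (lvl s))"
proof (induction j)
 case 0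
 then show ?case using FB up1_1[of m] by (intro exI[of _ \<theta>] exI[of _ "%_. c"]) auto
next
 case (Suc j)
 then obtain \<theta> d where IH: "FB (up1 m (Suc j)) \<theta> d" "!!i. c <= d i & d i <= c + j"
  "!!s. 1 <= s & s <= j ==> card {i. c + s <= d i} = card (lvl s)" by blast
 obtain \<theta>' R where R: "R <= {i. d i = c + j}" "card R = card (lvl (Suc j))"
  "FB (up1 m (Suc (Suc j))) \<theta>' (%i. if i \<in> R then Suc (d i) else d i)"
  using up1_step[OF IH(1), of "c + j"] c IH(2) by auto
 let ?d = "%i. if i \<in> R then Suc (d i) else d i"
 have "card {i. c + s <= ?d i} = card (lvl s)" if s: "1 <= s" "s <= Suc j" for s
 proof (cases "s = Suc j")
  case True
  have "c + Suc j <= ?d i \<longleftrightarrow> i \<in> R" for i using R(1) IH(2)[of i] by auto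
  then show ?thesis using R(2) True by simp
 next
  case False
  then have "c + s <= ?d i \<longleftrightarrow> c + s <= d i" for i using R(1) s by auto
  then show ?thesis using IH(3)[of s] s False by simp
 qed
 moreover have "c <= ?d i & ?d i <= c + Suc j" for i using IH(2)[of i] R(1) by auto
 ultimately show ?case using R(3) by blast
qed

lemma ex_height_bound: "\<exists>j. \<forall>\<beta>\<in>P. hgt \<beta> <= j"
 using finite_P by (metis finite_nat_set_iff_bounded_le finite_imageI imageI)

lemma shi_to_cat:
 assumes FB: "FB (shi m) \<theta> (%_. c)" and c: "real c = real m * hh"
 shows "\<exists>\<theta> d. FB (cat m) \<theta> d & cat_degrees m c d"
proof -
 obtain j where j: "!!\<beta>. \<beta> \<in> P ==> hgt \<beta> <= j" using ex_height_bound by blast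
 obtain \<theta> d where h: "FB (up1 m (Suc j)) \<theta> d" "!!i. c <= d i & d i <= c + j"
  "!!s. 1 <= s & s <= j ==> card {i. c + s <= d i} = card (lvl s)" using up1_iterate[OF assms] by blast
 have top: "up1 m (Suc j) = cat m" by (rule up1_top) (use j in \<open>auto simp: less_Suc_eq_le\<close>)
 have "card {i. c + s <= d i} = card (lvl s)" if "1 <= s" for s
 proof (cases "s <= j")
  case False
  then have "lvl s = {}" using j by (force simp: lvl_def)
  moreover have "{i. c + s <= d i} = {}"
  proof -
   have "d i < c + s" for i using h(2)[of i] False by linarith
   then show ?thesis by (auto simp: not_le)
  qed
  ultimately show ?thesis by simp
 qed (use h(3) that in auto)
 then show ?thesis using h(1,2) top unfolding cat_degrees_def by metis
qed

text \<open>A degree below m h is below every critical degree of the first passage, so such a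
  derivation meets no obstruction and respects the added hyperplanes automatically.\<close>

lemma low_up1:
 assumes "\<delta> \<in> D0 (shi m)" "vhom e \<delta>" "e < m * h" and hh: "hh = real h"
 shows "\<delta> \<in> D0 (up1 m (Suc j))"
proof (induction j)
 case 0
 then show ?case using assms(1) up1_1[of m] by simp
next
 case (Suc j)
 have "\<delta> \<in> D0 (up1 m (Suc j) \<union> lvl (Suc j) \<times> {- int m})"
 proof (unfold D0_Un, rule IntI[OF Suc], unfold D0_def, intro CollectI conjI ballI)
  show "vp \<delta>" using assms(2) vhom_vp by blast
  fix l assume l: "l \<in> lvl (Suc j) \<times> {- int m}"
  then obtain \<alpha> where a: "l = (\<alpha>, - int m)" "\<alpha> \<in> lvl (Suc j)" by auto
  obtain B where "obst (up1 m (Suc j)) l (m * h + j) B" using obst1[OF a(2), of "m * h + j" m] a(1) hh by auto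
  from obst_low[OF this Suc assms(2)] have "\<delta> \<in> D0 (insert l (up1 m (Suc j)))" using assms(3) by simp
  then show "\<forall>x. frm l \<bullet> x = 0 --> fst l \<bullet> \<delta> x = 0" by (simp add: D0_insert)
 qed
 then show ?case by (simp add: up1_Suc[of m "Suc j"])
qed

lemma low_shi_to_cat:
 assumes "\<delta> \<in> D0 (shi m)" "vhom e \<delta>" "e < m * h" and hh: "hh = real h"
 shows "\<delta> \<in> D0 (cat m)"
proof -
 obtain j where j: "!!\<beta>. \<beta> \<in> P ==> hgt \<beta> <= j" using ex_height_bound by blast
 have "up1 m (Suc j) = cat m" by (rule up1_top) (use j in \<open>auto simp: less_Suc_eq_le\<close>)
 then show ?thesis using low_up1[OF assms, of j] by simp
qed

text \<open>The heights still to come are at most j, so the critical degrees ahead are at least (m +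
  1) h - j and exceed e.\<close>

lemma low_up2:
 assumes "\<delta> \<in> D0 (up2 m j)" "vhom e \<delta>" "e + j < Suc m * h" and hh: "hh = real h" and jh: "j < h"
 shows "\<delta> \<in> D0 (shi (Suc m))"
 using assms(1,3) jh
proof (induction j)
 case 0
 then show ?case by (simp add: up2_0)
next
 case (Suc j)
 have "\<delta> \<in> D0 (up2 m (Suc j) \<union> lvl (Suc j) \<times> {int m + 1})"
 proof (unfold D0_Un, rule IntI[OF Suc.prems(1)], unfold D0_def, intro CollectI conjI ballI)
  show "vp \<delta>" using assms(2) vhom_vp by blast
  fix l assume l: "l \<in> lvl (Suc j) \<times> {int m + 1}"
  then obtain \<alpha> where a: "l = (\<alpha>, int m + 1)" "\<alpha> \<in> lvl (Suc j)" by auto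
  have "real (Suc m * h - Suc j) = real (m + 1) * hh - real (Suc j)"
   using hh Suc.prems by (subst of_nat_diff) (auto simp: algebra_simps)
  moreover have "real (Suc j) <= hh - 1" using Suc.prems(3) hh by simp
  ultimately obtain B where "obst (up2 m (Suc j)) l (Suc m * h - Suc j) B"
   using obst2[OF a(2), of "Suc m * h - Suc j" m] a(1) by auto
  from obst_low[OF this Suc.prems(1) assms(2)] have "\<delta> \<in> D0 (insert l (up2 m (Suc j)))"
   using Suc.prems(2) by simp
  then show "\<forall>x. frm l \<bullet> x = 0 --> fst l \<bullet> \<delta> x = 0" by (simp add: D0_insert)
 qed
 then have "\<delta> \<in> D0 (up2 m j)" using up2_minus[of "Suc j" m] by simp
 then show ?case using Suc by simp
qed

text \<open>There are as many basis elements of degree D as new hyperplanes, so it suffices that no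
  nontrivial combination of them restricts to zero on all of these. By the two lemmas on low degrees
  such a combination would be a derivation of the next Catalan arrangement of degree below (m + 1)
  h, which \<open>low\<close> excludes.\<close>

lemma up2_step:
 assumes FB: "FB (up2 m j) \<theta> d" and j: "1 <= j" "j < h" and hh: "hh = real h"
  and D: "D = Suc m * h - j" and K: "card {i. d i = D} = card (lvl j)"
  and low: "\<forall>\<delta> e. \<delta> \<in> D0 (cat (Suc m)) --> vhom e \<delta> --> e < Suc m * h --> (\<forall>x. \<delta> x = 0)"
 shows "\<exists>\<theta>'. FB (up2 m (j - 1)) \<theta>' (%i. if d i = D then Suc D else d i)"
proof -
 define G where "G = lvl j \<times> {int m + 1}"
 have jm: "j <= Suc m * h" using j by (simp add: trans_le_add1 less_imp_le)
 have Dr: "real D = real (m + 1) * hh - real j" unfolding D using jm hh by (subst of_nat_diff) (auto simp: algebra_simps)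
 have jh: "real j <= hh - 1" using j hh by simp
 have DD: "D + j = Suc m * h" using D jm by simp
 have "\<exists>B. l \<in> G --> obst (up2 m j) l D B \<and>
  (\<forall>x. frm l \<bullet> x = 0 & fst x ~= 0 & (\<forall>l\<in>up2 m j. frm l \<bullet> x ~= 0) --> B x ~= 0)" for l
  using obst2[OF _ Dr jh] by (cases "l \<in> G") (auto simp: G_def)
 then obtain B where B: "!!l. l \<in> G ==> obst (up2 m j) l D (B l)"
  "!!l x. l \<in> G ==> frm l \<bullet> x = 0 & fst x ~= 0 & (\<forall>l\<in>up2 m j. frm l \<bullet> x ~= 0) ==> B l x ~= 0" by metis
 let ?K = "{i. d i = D}"
 have th: "\<theta> i \<in> D0 (up2 m j)" "vhom (d i) (\<theta> i)" for i using FB by (auto simp: FB_def)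
 have "\<exists>c. l \<in> G & i \<in> ?K --> (\<forall>x. frm l \<bullet> x = 0 --> fst l \<bullet> \<theta> i x = c * B l x)" for l i
  using obst_exact[OF B(1) th(1)[of i]] th(2)[of i] by (cases "l \<in> G & i \<in> ?K") auto
 then obtain c where c: "!!l i x. l \<in> G ==> i \<in> ?K ==> frm l \<bullet> x = 0 ==> fst l \<bullet> \<theta> i x = c l i * B l x" by metis
 have cG: "card G = card (lvl j)" "finite G" using finite_lvl by (auto simp: G_def card_cartesian_product)
 have inj0: "t i = 0" if tz: "!!l. l \<in> G ==> (\<Sum>i\<in>?K. t i * c l i) = 0" "i \<in> ?K" for t i
 proof -
  let ?\<delta> = "%x. \<Sum>i\<in>?K. t i *\<^sub>R \<theta> i x"
  have hom: "vhom D ?\<delta>"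
   by (rule vhom_sum) (use th(2) vhom_cmult in \<open>force+\<close>)
  have mem: "?\<delta> \<in> D0 (up2 m j)" by (rule D0_sum) (use th(1) D0_scale[OF _ rp_intros(2)] in auto)
  have "?\<delta> \<in> D0 (up2 m j \<union> G)"
  proof (unfold D0_Un, rule IntI[OF mem], unfold D0_def, intro CollectI conjI ballI allI impI)
   show "vp ?\<delta>" using hom vhom_vp by blast
   fix l x assume l: "l \<in> G" "frm l \<bullet> x = 0"
   have "fst l \<bullet> ?\<delta> x = (\<Sum>i\<in>?K. t i * (c l i * B l x))"
    using c[OF l(1) _ l(2)] by (simp add: inner_sum_right)
   also have "\<dots> = (\<Sum>i\<in>?K. t i * c l i) * B l x" by (simp add: sum_distrib_right mult.assoc)
   finally show "fst l \<bullet> ?\<delta> x = 0" using tz(1)[OF l(1)] by simp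
  qed
  then have m1: "?\<delta> \<in> D0 (up2 m (j - 1))" using up2_minus[OF j(1), of m] by (simp add: G_def)
  have "D + (j - 1) < Suc m * h" using DD j(1) by simp
  then have "?\<delta> \<in> D0 (shi (Suc m))" by (rule low_up2[OF m1 hom _ hh]) (use j in auto)
  moreover have Dlt: "D < Suc m * h" using DD j(1) by simp
  ultimately have "?\<delta> \<in> D0 (cat (Suc m))" by (intro low_shi_to_cat[OF _ hom _ hh])
  then have z: "?\<delta> x = 0" for x using low hom Dlt by blast
  obtain x where x: "det (\<chi> i. \<theta> i x) ~= 0" using FB by (auto simp: FB_def)
  show "t i = 0"
  proof (rule ccontr)
   assume ti: "t i ~= 0"
   have "(\<Sum>k\<in>UNIV. (if k \<in> ?K then t k else 0) *\<^sub>R \<theta> k x) = ?\<delta> x"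
    by (intro sum.mono_neutral_cong_right) auto
   then have "(if i \<in> ?K then t i else 0) = 0"
    using det_nonzero_independent[OF x, of "%k. if k \<in> ?K then t k else 0" i] z[of x] by simp
   then show False using tz(2) ti by simp
  qed
 qed
 have surj: "\<exists>t. \<forall>l\<in>G. (\<Sum>i\<in>?K. t i * c l i) = y l" for y
 proof -
  have "card ?K = card G" using K cG by simp
  then obtain \<pi> where \<pi>: "bij_betw \<pi> ?K G" using finite_same_card_bij[of ?K G] cG by auto
  \<comment> \<open>The square system indexed by \<open>?K\<close> is completed by the identity on
    the other indices, so that injectivity gives surjectivity for an endomorphism of
    \<open>real^'n\<close>.\<close>
  define T where "T t = (\<chi> i. if i \<in> ?K then \<Sum>k\<in>?K. t $ k * c (\<pi> i) k else t $ i)" for t :: "real^'n"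
  have lin: "linear T"
   by (rule linearI) (auto simp: T_def vec_eq_iff sum.distrib algebra_simps sum_distrib_left)
  have "inj T"
  proof (subst linear_injective_0[OF lin], intro allI impI)
   fix t assume Tt: "T t = 0"
   have ne: "t $ i = 0" if "i ~: ?K" for i using arg_cong[OF Tt, of "%v. v $ i"] that by (simp add: T_def)
   have "(\<Sum>k\<in>?K. t $ k * c l k) = 0" if "l \<in> G" for l
   proof -
    have "l \<in> \<pi> ` ?K" using \<pi> that by (simp add: bij_betw_def)
    then obtain i where "i \<in> ?K" "\<pi> i = l" by blast
    then show ?thesis using arg_cong[OF Tt, of "%v. v $ i"] by (simp add: T_def)
   qed
   then have "t $ i = 0" if "i \<in> ?K" for i using inj0[of "%i. t $ i"] that by blast
   with ne show "t = 0" by (auto simp: vec_eq_iff)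
  qed
  then have "surj T" using linear_injective_imp_surjective[OF lin] by blast
  then obtain t where t: "T t = (\<chi> i. y (\<pi> i))" using surjD[of T "\<chi> i. y (\<pi> i)"] by auto
  have "(\<Sum>i\<in>?K. t $ i * c l i) = y l" if "l \<in> G" for l
  proof -
   have "l \<in> \<pi> ` ?K" using \<pi> that by (simp add: bij_betw_def)
   then obtain i where "i \<in> ?K" "\<pi> i = l" by blast
   then show ?thesis using arg_cong[OF t, of "%v. v $ i"] by (simp add: T_def)
  qed
  then show ?thesis by (intro exI[of _ "%i. t $ i"]) blast
 qed
 have Bnz: "\<exists>x. frm l \<bullet> x = 0 & B l x ~= 0" if l: "l \<in> G" for l
 proof -
  have "fst l \<in> P" "l ~: up2 m j" using l by (auto simp: G_def up2_def cat_def lvl_def)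
  from hyperplane_generic_point[OF this(1) finite_arr(4) fst_arr(4) this(2)]
  show ?thesis using B(2)[OF l] by blast
 qed
 have "\<exists>\<theta>' R. R <= ?K & card R = card G & FB (up2 m j \<union> G) \<theta>' (%i. if i \<in> R then Suc (d i) else d i)"
 proof (rule FB_add_batch[OF cG(2) FB finite_arr(4) _ _ B(1) Bnz])
  show "G \<inter> up2 m j = {}" by (auto simp: G_def up2_def cat_def lvl_def)
  show "frm l ~= 0" if "l \<in> G" for l using that lvl_P frm_nonzero[OF npar_P, of l] by (auto simp: G_def)
  fix y
  obtain t where t: "!!l. l \<in> G ==> (\<Sum>i\<in>?K. t i * c l i) = y l" using surj[of y] by blast
  have "fst l \<bullet> (\<Sum>i\<in>?K. t i *\<^sub>R \<theta> i x) = y l * B l x" if "l \<in> G" "frm l \<bullet> x = 0" for l x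
   unfolding t[OF that(1), symmetric] using c[OF that(1) _ that(2)] by (simp add: inner_sum_right sum_distrib_right mult.assoc)
  then show "\<exists>t. \<forall>l\<in>G. \<forall>x. frm l \<bullet> x = 0 --> fst l \<bullet> (\<Sum>i\<in>?K. t i *\<^sub>R \<theta> i x) = y l * B l x" by blast
 qed auto
 then obtain \<theta>' R where R: "R <= ?K" "card R = card G" "FB (up2 m j \<union> G) \<theta>' (%i. if i \<in> R then Suc (d i) else d i)" by blast
 have "R = ?K" using R(1,2) K cG by (intro card_subset_eq) auto
 then have "(%i. if i \<in> R then Suc (d i) else d i) = (%i. if d i = D then Suc D else d i)" by auto
 then show ?thesis using R(3) up2_minus[OF j(1), of m] by (auto simp: G_def)
qed

text \<open>At stage j all smaller degrees have been raised to (m + 1) h - j, whence the maximum.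
  The critical elements are then those whose original degree is at most that number, and
  \<open>dual\<close> says that they are as many as the roots of height j.\<close>

lemma cat_to_shi:
 assumes FB: "FB (cat m) \<theta> d" and hh: "hh = real h"
  and dl: "!!i. m * h + 1 <= d i & d i < Suc m * h"
  and top: "!!\<beta>. \<beta> \<in> P ==> hgt \<beta> < h"
  and dual: "!!j. 1 <= j ==> j < h ==> card {i. d i <= Suc m * h - j} = card (lvl j)"
  and low: "\<forall>\<delta> e. \<delta> \<in> D0 (cat (Suc m)) --> vhom e \<delta> --> e < Suc m * h --> (\<forall>x. \<delta> x = 0)"
 shows "\<exists>\<theta>. FB (shi (Suc m)) \<theta> (%_. Suc m * h)"
proof -
 have h0: "1 < h" using hh hh_ge_2 by simp
 have "\<exists>\<theta>. FB (up2 m j) \<theta> (%i. max (d i) (Suc m * h - j))" if "j < h" for j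
  using that
 proof (induction "h - 1 - j" arbitrary: j)
  case 0
  then have j: "j = h - 1" by simp
  have "up2 m j = cat m" by (rule up2_top) (use top in \<open>force simp: j\<close>)
  moreover have "max (d i) (Suc m * h - j) = d i" for i using dl[of i] j h0 by (simp add: max_def)
  ultimately show ?case using FB by auto
 next
  case (Suc n)
  then have j: "Suc j < h" by simp
  then obtain \<theta> where IH: "FB (up2 m (Suc j)) \<theta> (%i. max (d i) (Suc m * h - Suc j))"
  proof -
   have "n = h - 1 - Suc j" using Suc.hyps(2) by simp
   from Suc.hyps(1)[OF this j] show thesis using that by blast
  qed
  let ?D = "Suc m * h - Suc j"
  have hm: "Suc j < Suc m * h" using j by (simp add: trans_less_add1)
  have eq: "max (d i) ?D = ?D \<longleftrightarrow> d i <= ?D" for i by auto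
  have K: "card {i. max (d i) ?D = ?D} = card (lvl (Suc j))" unfolding eq using dual[of "Suc j"] j by simp
  obtain \<theta>' where "FB (up2 m (Suc j - 1)) \<theta>' (%i. if max (d i) ?D = ?D then Suc ?D else max (d i) ?D)"
   using up2_step[OF IH _ j hh refl K low] by auto
  moreover have "(%i. if max (d i) ?D = ?D then Suc ?D else max (d i) ?D) = (%i. max (d i) (Suc m * h - j))"
   using hm by (auto simp: fun_eq_iff max_def)
  ultimately show ?case by auto
 qed
 from this[of 0] h0 obtain \<theta> where "FB (up2 m 0) \<theta> (%i. max (d i) (Suc m * h))" by auto
 moreover have "max (d i) (Suc m * h) = Suc m * h" for i using dl[of i] by simp
 ultimately show ?thesis by (auto simp: up2_0)
qed

end

section \<open>Evaluating real polynomial functions at complex points\<close>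

definition cvec :: "real^'n => complex^'n" where "cvec x = (\<chi> i. of_real (x $ i))"
definition cmat :: "real^'n^'n => complex^'n^'n" where "cmat M = (\<chi> i j. of_real (M $ i $ j))"

text \<open>Polynomials are given as functions on real points; values at complex points come from
  building a complex function in parallel. \<open>cext_unique\<close> shows that the result does not
  depend on the way the polynomial was built.\<close>

inductive cext :: "(real^'n => real) => (complex^'n => complex) => bool" where
 coord: "cext (%x. x $ i) (%z. z $ i)"
| const: "cext (%x. c) (%z. of_real c)"
| add: "cext p p' ==> cext q q' ==> cext (%x. p x + q x) (%z. p' z + q' z)"
| mult: "cext p p' ==> cext q q' ==> cext (%x. p x * q x) (%z. p' z * q' z)"

lemma cext_sum: "finite I ==> (!!i. i \<in> I ==> cext (p i) (p' i)) ==> cext (%x. \<Sum>i\<in>I. p i x) (%z. \<Sum>i\<in>I. p' i z)"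
 by (induction I rule: finite_induct) (auto intro: cext.add cext.const[of 0, simplified])

lemma cext_prod: "finite I ==> (!!i. i \<in> I ==> cext (p i) (p' i)) ==> cext (%x. \<Prod>i\<in>I. p i x) (%z. \<Prod>i\<in>I. p' i z)"
 by (induction I rule: finite_induct) (auto intro: cext.mult cext.const[of 1, simplified])

lemma cext_inner: "cext (%x. a \<bullet> x) (%z. \<Sum>i\<in>UNIV. of_real (a $ i) * z $ i)"
 unfolding inner_vec_def inner_real_def by (intro cext_sum cext.mult cext.const cext.coord) auto

lemma rp_cext: "rp p ==> \<exists>p'. cext p p'"
proof (induction rule: real_polynomial_function.induct)
 case (linear f)
 have "f x = (\<Sum>b\<in>Basis. f b *\<^sub>R b) \<bullet> x" for x
 proof -
  have "f x = f (\<Sum>b\<in>Basis. (x \<bullet> b) *\<^sub>R b)" by (simp add: euclidean_representation)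
  also have "\<dots> = (\<Sum>b\<in>Basis. (x \<bullet> b) * f b)"
   using linear by (simp add: bounded_linear.linear linear_sum linear_cmul)
  finally show ?thesis by (simp add: inner_sum_left mult.commute inner_commute[of x])
 qed
 then have "f = (%x. (\<Sum>b\<in>Basis. f b *\<^sub>R b) \<bullet> x)" by blast
 then show ?case using cext_inner by metis
qed (blast intro: cext.intros)+

lemma cext_real: "cext p p' ==> p' (cvec x) = of_real (p x)"
 by (induction rule: cext.induct) (auto simp: cvec_def)

lemma cext_matrix: "cext p p' ==> cext (%x. p (M *v x)) (%z. p' (cmat M *v z))"
proof (induction rule: cext.induct)
 case (coord i)
 show ?case unfolding matrix_vector_mult_def cmat_def
  by (simp, intro cext_sum cext.mult cext.const cext.coord) auto
qed (auto intro: cext.intros)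

lemma cext_line: "cext p p' ==> \<exists>u. \<forall>t. p' (a + t *s b) = poly u t"
proof (induction rule: cext.induct)
 case (coord i)
 have "\<forall>t. (a + t *s b) $ i = poly [:a $ i, b $ i:] t" by simp
 then show ?case by blast
next
 case (const c)
 have "\<forall>t. of_real c = poly [:of_real c:] (t::complex)" by simp
 then show ?case by blast
next
 case (add p p' q q')
 then show ?case by (metis poly_add)
next
 case (mult p p' q q')
 then show ?case by (metis poly_mult)
qed

lemma poly_eq_on_reals:
 fixes u v :: "complex poly"
 assumes "!!t::real. poly u (of_real t) = poly v (of_real t)" shows "u = v"
proof -
 have "range complex_of_real <= {x. poly (u - v) x = 0}" using assms by auto
 moreover have "infinite (range complex_of_real)"
  using infinite_UNIV_char_0 by (metis finite_imageD inj_of_real)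
 ultimately have "u - v = 0" using poly_roots_finite[of "u - v"] finite_subset by blast
 then show ?thesis by simp
qed

text \<open>A complex point lies on the complex line through its real part in the direction of its
  imaginary part. There both extensions are univariate polynomials that agree at all real
  parameters.\<close>

lemma cext_unique:
 assumes "cext p p'" "cext p q'" shows "p' z = q' z"
proof -
 define a where "a = (\<chi> i. Re (z $ i))"
 define b where "b = (\<chi> i. Im (z $ i))"
 have z: "z = cvec a + \<i> *s cvec b" by (simp add: vec_eq_iff cvec_def a_def b_def complex_eq[symmetric] mult.commute)
 obtain u where u: "!!t. p' (cvec a + t *s cvec b) = poly u t" using cext_line[OF assms(1)] by blast
 obtain v where v: "!!t. q' (cvec a + t *s cvec b) = poly v t" using cext_line[OF assms(2)] by blast
 have "cvec a + of_real t *s cvec b = cvec (a + t *\<^sub>R b)" for t by (simp add: vec_eq_iff cvec_def)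
 then have "poly u (of_real t) = poly v (of_real t)" for t
  using u[of "of_real t"] v[of "of_real t"] cext_real[OF assms(1)] cext_real[OF assms(2)] by metis
 then have "u = v" by (rule poly_eq_on_reals)
 then show ?thesis using u v z by metis
qed

definition ev :: "complex^'n => (real^'n => real) => complex" where
 "ev z p = (SOME p'. cext p p') z"

lemma ev_eq: "cext p p' ==> ev z p = p' z"
 unfolding ev_def by (metis cext_unique someI)

lemma ev_cext: "rp p ==> cext p (%z. ev z p)"
proof -
 assume "rp p"
 then obtain p' where p': "cext p p'" using rp_cext by blast
 then have "(%z. ev z p) = p'" using ev_eq by blast
 then show ?thesis using p' by simp
qed

lemma ev_mult: "rp p ==> rp q ==> ev z (%x. p x * q x) = ev z p * ev z q"
 by (rule ev_eq) (intro cext.mult ev_cext)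
lemma ev_const: "ev z (%x. c) = of_real c" by (rule ev_eq) (rule cext.const)
lemma ev_cmult: "rp p ==> ev z (%x. c * p x) = of_real c * ev z p"
 by (rule ev_eq) (intro cext.mult cext.const ev_cext)
lemma ev_sum: "finite I ==> (!!i. i \<in> I ==> rp (p i)) ==> ev z (%x. \<Sum>i\<in>I. p i x) = (\<Sum>i\<in>I. ev z (p i))"
 by (rule ev_eq) (intro cext_sum ev_cext)
lemma ev_prod: "finite I ==> (!!i. i \<in> I ==> rp (p i)) ==> ev z (%x. \<Prod>i\<in>I. p i x) = (\<Prod>i\<in>I. ev z (p i))"
 by (rule ev_eq) (intro cext_prod ev_cext)
lemma ev_inner: "ev z (%x. a \<bullet> x) = (\<Sum>i\<in>UNIV. of_real (a $ i) * z $ i)"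
 by (rule ev_eq) (rule cext_inner)
lemma ev_matrix: "rp p ==> ev z (%x. p (M *v x)) = ev (cmat M *v z) p"
 using ev_eq[OF cext_matrix[OF ev_cext]] by blast

text \<open>A real factor is a scalar matrix, covered by \<open>ev_matrix\<close>; for complex
  factors both sides are polynomials in the factor that agree on the reals.\<close>

lemma ev_hom:
 fixes p :: "real^'n => real"
 assumes "hom d p" shows "ev (c *s z) p = c ^ d * ev z p"
proof -
 have rp: "rp p" using hom_rp[OF assms] .
 have real: "ev (of_real r *s z) p = of_real r ^ d * ev z p" for r
 proof -
  have "(%x. p ((mat r :: real^'n^'n) *v x)) = (%x. r ^ d * p x)"
  proof
   fix x :: "real^'n"
   have "mat r *v x = r *\<^sub>R x" by (simp add: vec_eq_iff matrix_vector_mult_def mat_def if_distrib if_distribR cong: if_cong)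
   then show "p (mat r *v x) = r ^ d * p x" using hom_scale[OF assms] by simp
  qed
  then have "ev (cmat (mat r) *v z) p = of_real (r ^ d) * ev z p"
   using ev_matrix[OF rp, of z "mat r"] ev_cmult[OF rp, of z "r ^ d"] by simp
  moreover have "cmat (mat r) *v z = of_real r *s z"
   by (simp add: vec_eq_iff matrix_vector_mult_def mat_def cmat_def if_distrib if_distribR cong: if_cong)
  ultimately show ?thesis by simp
 qed
 obtain u where u: "!!t. ev (0 + t *s z) p = poly u t" using cext_line[OF ev_cext[OF rp], of 0 z] by blast
 have "u = monom (ev z p) d"
 proof (rule poly_eq_on_reals)
  fix t :: real
  have "poly u (of_real t) = ev (of_real t *s z) p" using u[of "of_real t"] by simp
  then show "poly u (of_real t) = poly (monom (ev z p) d) (of_real t)"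
   using real[of t] by (simp add: poly_monom mult.commute)
 qed
 then show ?thesis using u[of c] by (simp add: poly_monom mult.commute)
qed

section \<open>Values of vector fields at complex points\<close>

definition evv :: "complex^'n => (real^'n => real^'n) => complex^'n" where
 "evv z \<theta> = (\<chi> i. ev z (%x. \<theta> x $ i))"

lemma evv_hom: "vhom d \<theta> ==> evv (c *s z) \<theta> = c ^ d *s evv z \<theta>"
 by (simp add: vec_eq_iff evv_def ev_hom vhom_iff)

lemma evv_equivariant:
 assumes "vp \<theta>" "!!x. \<theta> (M *v x) = M *v \<theta> x"
 shows "evv (cmat M *v z) \<theta> = cmat M *v evv z \<theta>"
proof -
 have r: "rp (%x. \<theta> x $ i)" for i using assms(1) by (simp add: vp_def)
 have "ev (cmat M *v z) (%x. \<theta> x $ i) = (\<Sum>j\<in>UNIV. of_real (M $ i $ j) * ev z (%x. \<theta> x $ j))" for i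
 proof -
  have "ev (cmat M *v z) (%x. \<theta> x $ i) = ev z (%x. \<theta> (M *v x) $ i)" using ev_matrix[OF r] by simp
  also have "\<dots> = ev z (%x. \<Sum>j\<in>UNIV. M $ i $ j * \<theta> x $ j)" by (simp only: assms(2)) (simp add: matrix_vector_mult_def)
  also have "\<dots> = (\<Sum>j\<in>UNIV. ev z (%x. M $ i $ j * \<theta> x $ j))" by (rule ev_sum) (auto intro: rp_cmult r)
  finally show ?thesis by (simp add: ev_cmult[OF r])
 qed
 then show ?thesis by (simp add: vec_eq_iff evv_def matrix_vector_mult_def cmat_def)
qed

lemma ev_det:
 fixes \<theta> :: "'n::finite => real^'n => real^'n"
 assumes "!!i. vp (\<theta> i)"
 shows "ev z (%x. det (\<chi> i. \<theta> i x)) = det (\<chi> i. evv z (\<theta> i))"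
proof -
 have r: "rp (%x. \<theta> i x $ j)" for i j using assms by (simp add: vp_def)
 have "ev z (%x. \<Sum>p\<in>{p. p permutes UNIV}. of_int (sign p) * (\<Prod>i\<in>UNIV. \<theta> i x $ p i)) =
  (\<Sum>p\<in>{p. p permutes UNIV}. of_real (of_int (sign p)) * (\<Prod>i\<in>UNIV. ev z (%x. \<theta> i x $ p i)))"
  by (rule ev_eq) (intro cext_sum cext.mult cext.const cext_prod ev_cext r finite_permutations; simp)
 then show ?thesis by (simp add: det_def evv_def)
qed

section \<open>Invariant derivations\<close>

context roots begin

text \<open>Logarithmic derivations of the arrangement of mirrors in V. They arise from the Catalan
  case m = 0 by setting the coning variable to 0.\<close>

definition D1 :: "(real^'n => real^'n) set" where
 "D1 = {\<theta>. vp \<theta> & (\<forall>\<beta>\<in>P. \<forall>x. \<beta> \<bullet> x = 0 --> \<beta> \<bullet> \<theta> x = 0)}"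

definition Qp :: "real^'n => real" where "Qp x = (\<Prod>\<beta>\<in>P. \<beta> \<bullet> x)"

definition eqv :: "(real^'n => real^'n) => bool" where
 "eqv \<theta> \<longleftrightarrow> (\<forall>\<alpha>\<in>\<Phi>. \<forall>x. \<theta> (rfl \<alpha> x) = rfl \<alpha> (\<theta> x))"

lemma D1_root: "\<theta> \<in> D1 ==> \<beta> \<in> \<Phi> ==> \<beta> \<bullet> x = 0 ==> \<beta> \<bullet> \<theta> x = 0"
 using pos_or_neg[of \<beta>] by (force simp: D1_def)

lemma P_nonpar: "\<beta> \<in> P ==> \<gamma> \<in> P ==> \<beta> ~= \<gamma> ==> \<beta> ~: span {\<gamma>}"
 using npar_P unfolding npar_def by blast

lemma vp_linear_compose: "vp \<theta> ==> linear f ==> vp (%x. \<theta> (f x))"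
 for f :: "'b::euclidean_space => 'c::euclidean_space"
 using rp_linear_compose by (auto simp: vp_def)

lemma vp_rfl: assumes "vp \<theta>" shows "vp (%x. rfl \<alpha> (\<theta> x))"
proof -
 have "rp (%x. cart (\<theta> x) \<alpha>)"
  unfolding cart_def using vp_inner[OF assms, of \<alpha>] by (auto simp: inner_commute intro!: real_polynomial_function_divide rp_cmult)
 then have "vp (%x. cart (\<theta> x) \<alpha> *\<^sub>R \<alpha>)" by (intro vp_scale vp_const)
 then show ?thesis unfolding rfl_def using assms by (intro vp_diff)
qed

lemma D1_conj: assumes "\<theta> \<in> D1" "\<alpha> \<in> \<Phi>" shows "(%x. rfl \<alpha> (\<theta> (rfl \<alpha> x))) \<in> D1"
proof -
 have "\<beta> \<bullet> rfl \<alpha> (\<theta> (rfl \<alpha> x)) = 0" if "\<beta> \<in> P" "\<beta> \<bullet> x = 0" for \<beta> x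
 proof -
  have "rfl \<alpha> \<beta> \<bullet> rfl \<alpha> x = 0" using that by (simp add: rfl_inner)
  then have "rfl \<alpha> \<beta> \<bullet> \<theta> (rfl \<alpha> x) = 0" using D1_root[OF assms(1)] rfl_root[OF assms(2)] P_root that by blast
  then show ?thesis by (simp add: rfl_inner_swap)
 qed
 moreover have "vp (%x. rfl \<alpha> (\<theta> (rfl \<alpha> x)))"
  using assms vp_linear_compose[OF _ linear_rfl] vp_rfl by (auto simp: D1_def)
 ultimately show ?thesis by (simp add: D1_def)
qed

lemma vp_divisible:
 assumes "vp \<theta>" "a ~= 0" "!!x. a \<bullet> x = 0 ==> \<theta> x = 0"
 shows "\<exists>\<eta>. vp \<eta> & (\<forall>x. \<theta> x = (a \<bullet> x) *\<^sub>R \<eta> x)"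
proof -
 have "\<exists>g. rp g & (\<forall>x. \<theta> x $ i = (a \<bullet> x) * g x)" for i
  using pdvd_linear[of "%x. \<theta> x $ i" a] assms by (auto simp: vp_def pdvd_def)
 then obtain g where g: "!!i. rp (g i)" "!!i x. \<theta> x $ i = (a \<bullet> x) * g i x" by metis
 then show ?thesis by (intro exI[of _ "%x. \<chi> i. g i x"]) (auto simp: vp_def vec_eq_iff)
qed

text \<open>The two terms agree on the mirror of \<alpha>, so the form can be divided out. The
  delicate condition on the quotient is the one at \<alpha> itself: if the \<alpha> component of
  \<theta> is the form times g, then that of the quotient is g minus its reflection, which vanishes
  on the mirror.\<close>

lemma D1_diff_conj:
 assumes "\<theta> \<in> D1" "\<alpha> \<in> P"
 shows "\<exists>\<eta>\<in>D1. \<forall>x. \<theta> x - rfl \<alpha> (\<theta> (rfl \<alpha> x)) = (\<alpha> \<bullet> x) *\<^sub>R \<eta> x"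
proof -
 have a: "\<alpha> \<in> \<Phi>" "\<alpha> ~= 0" using assms P_root root_nonzero by auto
 let ?d = "%x. \<theta> x - rfl \<alpha> (\<theta> (rfl \<alpha> x))"
 have vt: "vp \<theta>" using assms by (simp add: D1_def)
 have vd: "vp ?d" using vp_diff[OF vt] D1_conj[OF assms(1) a(1)] by (auto simp: D1_def)
 have "?d x = 0" if "\<alpha> \<bullet> x = 0" for x
  using D1_root[OF assms(1) a(1) that] rfl_fixed[OF that] rfl_fixed[of \<alpha> "\<theta> x"] by simp
 then obtain \<eta> where e: "vp \<eta>" "!!x. ?d x = (\<alpha> \<bullet> x) *\<^sub>R \<eta> x" using vp_divisible[OF vd a(2)] by blast
 have "\<beta> \<bullet> \<eta> x = 0" if b: "\<beta> \<in> P" "\<beta> \<bullet> x = 0" for \<beta> x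
 proof (cases "\<beta> = \<alpha>")
  case False
  have "(\<alpha> \<bullet> x) * (\<beta> \<bullet> \<eta> x) = 0" if "x \<in> {x. \<beta> \<bullet> x = 0}" for x
  proof -
   have "\<beta> \<bullet> ?d x = 0" using D1_root[OF assms(1) P_root[OF b(1)], of x] D1_root[OF D1_conj[OF assms(1) a(1)] P_root[OF b(1)], of x] that
    by (simp add: inner_diff_right)
   then show ?thesis using e(2)[of x] by simp
  qed
  from rp_mult_eq_0_subspace[OF subspace_hyperplane_inner rp_inner vp_inner[OF e(1)] this]
  have "(\<forall>x\<in>{x. \<beta> \<bullet> x = 0}. \<alpha> \<bullet> x = 0) | (\<forall>x\<in>{x. \<beta> \<bullet> x = 0}. \<beta> \<bullet> \<eta> x = 0)" .
  then show ?thesis using nonparallel_hyperplane_point[OF P_nonpar[OF assms(2) b(1)]] False b(2) by blast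
 next
  case True
  obtain g where g: "rp g" "!!x. \<alpha> \<bullet> \<theta> x = (\<alpha> \<bullet> x) * g x"
   using pdvd_linear[OF vp_inner[OF vt] a(2), of \<alpha>] D1_root[OF assms(1) a(1)] by (auto simp: pdvd_def)
  have "(\<alpha> \<bullet> x) * (\<alpha> \<bullet> \<eta> x) = (\<alpha> \<bullet> x) * (g x - g (rfl \<alpha> x))" for x
  proof -
   have ax: "\<alpha> \<bullet> rfl \<alpha> y = - (\<alpha> \<bullet> y)" for y by (metis rfl_inner_swap rfl_self inner_minus_left)
   have "(\<alpha> \<bullet> x) * (\<alpha> \<bullet> \<eta> x) = \<alpha> \<bullet> ?d x" using e(2)[of x] by simp
   also have "\<dots> = \<alpha> \<bullet> \<theta> x + \<alpha> \<bullet> \<theta> (rfl \<alpha> x)" by (simp add: inner_diff_right ax)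
   finally show ?thesis using g(2) by (simp add: ax algebra_simps)
  qed
  then have "\<alpha> \<bullet> \<eta> x = g x - g (rfl \<alpha> x)" for x
   by (rule rp_cancel[of "%x. \<alpha> \<bullet> \<eta> x" "%x. g x - g (rfl \<alpha> x)" "%x. \<alpha> \<bullet> x", rotated 3])
    (use a e(1) g(1) rp_linear_compose[OF g(1) linear_rfl] in \<open>auto intro: vp_inner exI[of _ \<alpha>]\<close>)
  then show ?thesis using b True rfl_fixed[of \<alpha> x] by simp
 qed
 then have "\<eta> \<in> D1" using e(1) by (simp add: D1_def)
 then show ?thesis using e(2) by blast
qed

lemma D1_generates:
 assumes "!!i. \<phi> i \<in> D1" "c ~= 0" "!!x. det (\<chi> i. \<phi> i x) = c * Qp x" "\<delta> \<in> D1"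
 shows "\<exists>f. (\<forall>i. rp (f i)) & (\<forall>x. \<delta> x = (\<Sum>i\<in>UNIV. f i x *\<^sub>R \<phi> i x))"
 by (rule cramer_module[where A = P and u = id and r = id and c = c])
  (use assms finite_P P_nonpar P_root root_nonzero in \<open>auto simp: D1_def Qp_def\<close>)

text \<open>Each group element is stored with its inverse, because conjugating a vector field needs
  both.\<close>

inductive_set weyl :: "((real^'n => real^'n) \<times> (real^'n => real^'n)) set" where
 weyl_id: "(%x. x, %x. x) \<in> weyl"
| weyl_rfl: "(w, w') \<in> weyl ==> \<alpha> \<in> P ==> (%x. w (rfl \<alpha> x), %x. rfl \<alpha> (w' x)) \<in> weyl"

lemma weyl_props:
 "(w, w') \<in> weyl ==> linear w & linear w' & (\<forall>x. w (w' x) = x) & (\<forall>x. w' (w x) = x) & w ` \<Phi> <= \<Phi>"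
proof (induction rule: weyl.induct)
 case weyl_id
 then show ?case by (simp add: linear_id[unfolded id_def])
next
 case (weyl_rfl w w' \<alpha>)
 have "linear (%x. w (rfl \<alpha> x))" "linear (%x. rfl \<alpha> (w' x))"
  using weyl_rfl linear_compose[OF linear_rfl, of w] linear_compose[OF _ linear_rfl, of w'] by (auto simp: o_def)
 moreover have "w (rfl \<alpha> x) \<in> \<Phi>" if "x \<in> \<Phi>" for x
  using weyl_rfl.IH rfl_root[OF P_root[OF weyl_rfl.hyps(2)] that] by blast
 moreover have "w (rfl \<alpha> (rfl \<alpha> (w' x))) = x" "rfl \<alpha> (w' (w (rfl \<alpha> x))) = x" for x
  using weyl_rfl.IH by (simp_all add: rfl_rfl)
 ultimately show ?case by (simp add: image_subset_iff)
qed

lemma finite_weyl: "finite weyl"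
proof -
 have "inj_on (%p. restrict (fst p) \<Phi>) weyl"
 proof (rule inj_onI)
  fix p q assume pq: "p \<in> weyl" "q \<in> weyl" "restrict (fst p) \<Phi> = restrict (fst q) \<Phi>"
  obtain w w' v v' where e: "p = (w, w')" "q = (v, v')" by (cases p, cases q)
  have W: "linear w" "!!x. w (w' x) = x" "!!x. w' (w x) = x" "linear v" "!!x. v (v' x) = x" "!!x. v' (v x) = x"
   using weyl_props pq e by auto
  have "w x = v x" if "x \<in> \<Phi>" for x using pq(3) that e by (metis fst_conv restrict_apply')
  then have wv: "w x = v x" for x using linear_eq_on[OF W(1,4), of x \<Phi>] span_roots by auto
  then have "w' x = v' x" for x using W by metis
  then show "p = q" using wv e by auto
 qed
 moreover have "(%p. restrict (fst p) \<Phi>) ` weyl <= \<Phi> \<rightarrow>\<^sub>E \<Phi>"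
  using weyl_props by (force simp: PiE_def extensional_def)
 ultimately show ?thesis using finite_roots by (meson finite_PiE finite_imageD finite_subset)
qed

lemma weyl_reindex:
 fixes f :: "_ => 'b::comm_monoid_add"
 assumes "\<alpha> \<in> P"
 shows "(\<Sum>p\<in>weyl. f (%x. fst p (rfl \<alpha> x), %x. rfl \<alpha> (snd p x))) = (\<Sum>p\<in>weyl. f p)"
proof -
 let ?g = "%p. (%x. fst p (rfl \<alpha> x), %x. rfl \<alpha> (snd p x))"
 have "bij_betw ?g weyl weyl"
 proof (rule bij_betwI[of _ _ _ ?g])
  show "?g \<in> weyl \<rightarrow> weyl" "?g \<in> weyl \<rightarrow> weyl" using weyl_rfl[OF _ assms] by auto
 qed (auto simp: rfl_rfl)
 from sum.reindex_bij_betw[OF this, of f] show ?thesis .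
qed

section \<open>Averaging a basis over the Weyl group\<close>

definition avg :: "(real^'n => real^'n) => real^'n => real^'n" where
 "avg \<theta> x = (1 / real (card weyl)) *\<^sub>R (\<Sum>p\<in>weyl. snd p (\<theta> (fst p x)))"

lemma card_weyl: "card weyl > 0" using finite_weyl weyl_id by (metis card_gt_0_iff empty_iff)

lemma eqv_avg: "eqv (avg \<theta>)"
proof -
 have "avg \<theta> (rfl \<alpha> x) = rfl \<alpha> (avg \<theta> x)" if a: "\<alpha> \<in> P" for \<alpha> x
 proof -
  have "(\<Sum>p\<in>weyl. snd p (\<theta> (fst p x))) = (\<Sum>p\<in>weyl. rfl \<alpha> (snd p (\<theta> (fst p (rfl \<alpha> x)))))"
   using weyl_reindex[OF a, of "%p. snd p (\<theta> (fst p x))"] by simp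
  also have "\<dots> = rfl \<alpha> (\<Sum>p\<in>weyl. snd p (\<theta> (fst p (rfl \<alpha> x))))" by (simp add: linear_sum[OF linear_rfl])
  finally show ?thesis unfolding avg_def by (simp add: linear_cmul[OF linear_rfl] rfl_rfl)
 qed
 then have "avg \<theta> (rfl \<alpha> x) = rfl \<alpha> (avg \<theta> x)" if "\<alpha> \<in> \<Phi>" for \<alpha> x
  using pos_or_neg[OF that] rfl_uminus[of \<alpha>] by metis
 then show ?thesis by (simp add: eqv_def)
qed

lemma eqv_rfl: "eqv \<theta> ==> \<alpha> \<in> \<Phi> ==> \<theta> (rfl \<alpha> x) = rfl \<alpha> (\<theta> x)" by (simp add: eqv_def)

text \<open>Conjugation by one more reflection changes the field by a linear form times an element
  of \<open>D1\<close>, hence by a combination of the basis with coefficients vanishing at the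
  origin.\<close>

lemma weyl_D1:
 assumes gen: "!!\<delta>. \<delta> \<in> D1 ==> \<exists>f. (\<forall>i. rp (f i)) & (\<forall>x. \<delta> x = (\<Sum>i\<in>UNIV. f i x *\<^sub>R \<phi> i x))" and t: "\<theta> \<in> D1"
 shows "(w, w') \<in> weyl ==> (%x. w' (\<theta> (w x))) \<in> D1 \<and>
  (\<exists>f. (\<forall>i. rp (f i) & f i 0 = 0) & (\<forall>x. \<theta> x - w' (\<theta> (w x)) = (\<Sum>i\<in>UNIV. f i x *\<^sub>R \<phi> i x)))"
proof (induction rule: weyl.induct)
 case weyl_id
 then show ?case using t by (auto intro!: exI[of _ "%_ _. 0"])
next
 case (weyl_rfl w w' \<alpha>)
 let ?t = "%x. w' (\<theta> (w x))"
 obtain f where f: "!!i. rp (f i)" "!!i. f i 0 = 0" "!!x. \<theta> x - ?t x = (\<Sum>i\<in>UNIV. f i x *\<^sub>R \<phi> i x)" using weyl_rfl by blast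
 obtain \<eta> where e: "\<eta> \<in> D1" "!!x. ?t x - rfl \<alpha> (?t (rfl \<alpha> x)) = (\<alpha> \<bullet> x) *\<^sub>R \<eta> x"
  using D1_diff_conj[of ?t \<alpha>] weyl_rfl by blast
 obtain g where g: "!!i. rp (g i)" "!!x. \<eta> x = (\<Sum>i\<in>UNIV. g i x *\<^sub>R \<phi> i x)" using gen[OF e(1)] by blast
 have "\<theta> x - rfl \<alpha> (?t (rfl \<alpha> x)) = (\<Sum>i\<in>UNIV. (f i x + (\<alpha> \<bullet> x) * g i x) *\<^sub>R \<phi> i x)" for x
 proof -
  have "\<theta> x - rfl \<alpha> (?t (rfl \<alpha> x)) = (\<theta> x - ?t x) + (?t x - rfl \<alpha> (?t (rfl \<alpha> x)))" by simp
  also have "\<dots> = (\<Sum>i\<in>UNIV. f i x *\<^sub>R \<phi> i x) + (\<alpha> \<bullet> x) *\<^sub>R (\<Sum>i\<in>UNIV. g i x *\<^sub>R \<phi> i x)"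
   unfolding f(3) e(2) g(2) ..
  finally show ?thesis by (simp add: scaleR_sum_right scaleR_add_left sum.distrib)
 qed
 moreover have "rp (%x. f i x + (\<alpha> \<bullet> x) * g i x)" for i
  using f(1) g(1) by (intro rp_intros(3,4) rp_inner)
 ultimately show ?case using D1_conj[of ?t \<alpha>] weyl_rfl f(2) P_root
  by (intro conjI exI[of _ "%i x. f i x + (\<alpha> \<bullet> x) * g i x"]) auto
qed

text \<open>Averaging multiplies the basis by a matrix I - G with G(0) = 0. Its determinant is 1 at
  the origin, so the averaged family stays independent, and by degrees its determinant is again a
  constant times \<open>Qp\<close>.\<close>

lemma invariant_basis:
 assumes ph: "!!i. \<phi> i \<in> D1" "!!i. vhom (d i) (\<phi> i)" and c: "c ~= 0" "!!x. det (\<chi> i. \<phi> i x) = c * Qp x"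
  and sd: "sum d UNIV = card P"
 shows "\<exists>\<psi> c'. (\<forall>i. \<psi> i \<in> D1 & vhom (d i) (\<psi> i) & eqv (\<psi> i)) & c' ~= 0 & (\<forall>x. det (\<chi> i. \<psi> i x) = c' * Qp x)"
proof -
 note gen = D1_generates[OF ph(1) c]
 let ?N = "real (card weyl)"
 have N0: "?N ~= 0" using card_weyl by simp
 define Fp where "Fp p i f \<longleftrightarrow> (\<forall>k. rp (f k) & f k 0 = 0) \<and>
  (\<forall>x. \<phi> i x - snd p (\<phi> i (fst p x)) = (\<Sum>k\<in>UNIV. f k x *\<^sub>R \<phi> k x))" for p i and f :: "'n => real^'n => real"
 define F where "F p i = (SOME f. Fp p i f)" for p i
 have "\<exists>f. Fp p i f" if "p \<in> weyl" for p i
  unfolding Fp_def using weyl_D1[OF gen ph(1)[of i], of "fst p" "snd p"] that by auto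
 then have F0: "Fp p i (F p i)" if "p \<in> weyl" for p i unfolding F_def using that by (metis someI_ex)
 have F: "rp (F p i k) & F p i k 0 = 0" "\<phi> i x - snd p (\<phi> i (fst p x)) = (\<Sum>k\<in>UNIV. F p i k x *\<^sub>R \<phi> k x)"
  if "p \<in> weyl" for p i k x using F0[OF that, of i] unfolding Fp_def by blast+
 define G where "G i k x = (1 / ?N) * (\<Sum>p\<in>weyl. F p i k x)" for i k x
 have rG: "rp (G i k)" for i k unfolding G_def[abs_def] using F(1) finite_weyl by (intro rp_cmult real_polynomial_function_sum) auto
 have G0: "G i k 0 = 0" for i k unfolding G_def using F(1) by simp
 have avgG: "avg (\<phi> i) x = \<phi> i x - (\<Sum>k\<in>UNIV. G i k x *\<^sub>R \<phi> k x)" for i x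
 proof -
  have "(\<Sum>p\<in>weyl. snd p (\<phi> i (fst p x))) = (\<Sum>p\<in>weyl. \<phi> i x - (\<Sum>k\<in>UNIV. F p i k x *\<^sub>R \<phi> k x))"
   by (intro sum.cong refl) (simp add: F(2)[symmetric])
  also have "\<dots> = ?N *\<^sub>R \<phi> i x - (\<Sum>k\<in>UNIV. (\<Sum>p\<in>weyl. F p i k x) *\<^sub>R \<phi> k x)"
  proof -
   have "(\<Sum>p\<in>weyl. \<Sum>k\<in>UNIV. F p i k x *\<^sub>R \<phi> k x) = (\<Sum>k\<in>UNIV. (\<Sum>p\<in>weyl. F p i k x) *\<^sub>R \<phi> k x)"
    by (subst sum.swap) (simp only: scaleR_sum_left)
   then show ?thesis by (simp only: sum_subtractf sum_constant_scaleR)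
  qed
  finally show ?thesis unfolding avg_def G_def using N0
   by (simp add: scaleR_diff_right scaleR_sum_right)
 qed
 have memA: "avg (\<phi> i) \<in> D1" for i
 proof -
  have "(%x. snd p (\<phi> i (fst p x))) \<in> D1" if "p \<in> weyl" for p
   using weyl_D1[OF gen ph(1)[of i], of "fst p" "snd p"] that by auto
  then have "vp (%x. \<Sum>p\<in>weyl. snd p (\<phi> i (fst p x)))" "!!\<beta> x. \<beta> \<in> P ==> \<beta> \<bullet> x = 0 ==> (\<Sum>p\<in>weyl. \<beta> \<bullet> snd p (\<phi> i (fst p x))) = 0"
   using finite_weyl by (auto simp: D1_def intro!: vp_sum sum.neutral)
  then show ?thesis unfolding D1_def avg_def[abs_def] by (auto simp: inner_sum_right intro!: vp_scale[of "%_. 1 / ?N"])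
 qed
 have homA: "vhom (d i) (avg (\<phi> i))" for i
 proof -
  have "vp (avg (\<phi> i))" using memA by (simp add: D1_def)
  moreover have "avg (\<phi> i) (r *\<^sub>R x) = r ^ d i *\<^sub>R avg (\<phi> i) x" for r x
  proof -
   have "snd p (\<phi> i (fst p (r *\<^sub>R x))) = r ^ d i *\<^sub>R snd p (\<phi> i (fst p x))" if "p \<in> weyl" for p
    using weyl_props[of "fst p" "snd p"] that ph(2)[of i] by (simp add: linear_cmul vhom_def)
   then show ?thesis unfolding avg_def by (simp add: scaleR_sum_right[symmetric] mult.commute)
  qed
  ultimately show ?thesis by (simp add: vhom_def)
 qed
 have detA: "det (\<chi> i. avg (\<phi> i) x) = det (\<chi> i k. (if i = k then 1 else 0) - G i k x) * (c * Qp x)" for x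
 proof -
  have "(\<chi> i. avg (\<phi> i) x) = (\<chi> i k. (if i = k then 1 else 0) - G i k x) ** (\<chi> i. \<phi> i x)"
  proof -
   have "(\<Sum>k\<in>UNIV. ((if i = k then 1 else 0) - G i k x) * \<phi> k x $ j) = \<phi> i x $ j - (\<Sum>k\<in>UNIV. G i k x * \<phi> k x $ j)" for i j
    by (simp only: left_diff_distrib sum_subtractf mult_delta_left) simp
   then show ?thesis by (simp add: vec_eq_iff matrix_matrix_mult_def avgG)
  qed
  then show ?thesis by (simp add: det_mul c(2))
 qed
 have Qnz: "\<exists>x. Qp x ~= 0" and rQ: "rp Qp" and hQ: "hom (card P) Qp"
 proof -
  have "\<exists>x\<in>UNIV. (\<Prod>\<beta>\<in>P. \<beta> \<bullet> x) ~= 0"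
  proof (rule rp_prod_nonzero_subspace[OF subspace_UNIV finite_P])
   fix \<beta> assume "\<beta> \<in> P"
   then show "\<exists>x\<in>UNIV. \<beta> \<bullet> x ~= 0" using P_root root_nonzero by (intro bexI[of _ \<beta>]) auto
  qed auto
  then show "\<exists>x. Qp x ~= 0" by (simp add: Qp_def)
  show "hom (card P) Qp" unfolding Qp_def[abs_def] by (rule hom_prod_linear[OF finite_P])
  then show "rp Qp" by (rule hom_rp)
 qed
 obtain g where g: "rp g" "!!x. det (\<chi> i. avg (\<phi> i) x) = Qp x * g x"
 proof -
  have "pdvd (%x. \<Prod>\<beta>\<in>P. \<beta> \<bullet> x) (%x. det (\<chi> i. avg (\<phi> i) x))"
   by (rule det_pdvd[OF finite_P, where r = id])
    (use memA P_nonpar P_root root_nonzero in \<open>auto simp: D1_def\<close>)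
  then show thesis using that by (auto simp: pdvd_def Qp_def)
 qed
 have hd: "hom (card P) (%x. det (\<chi> i. avg (\<phi> i) x))" using hom_det[of d "%i. avg (\<phi> i)"] homA sd by simp
 have "hom (card P - card P) g" by (rule hom_quotient(1)[OF hd hQ Qnz g]) simp
 then have gc: "g x = g 0" for x using hom_0_const[of g x] by simp
 have "g 0 ~= 0"
 proof
  assume "g 0 = 0"
  then have z: "det (\<chi> i k. (if i = k then 1 else 0) - G i k x) * (c * Qp x) = 0" for x
   using g(2)[of x] gc[of x] detA[of x] by simp
  have rI: "rp (%x. det (\<chi> i k. (if i = k then 1 else 0) - G i k x))"
  proof -
   have "rp (%x. (if i = k then 1 else 0) - G i k x)" for i k
    using real_polynomial_function_diff[OF rp_intros(2) rG] .
   then show ?thesis by (intro rp_det) (simp add: vp_def)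
  qed
  have "det (\<chi> i k. (if i = k then 1 else 0) - G i k x) = 0" for x
   by (rule rp_mult_eq_0[OF rI rp_cmult[OF rQ]]) (use z Qnz c in auto)
  from this[of 0] have "det (mat 1 :: real^'n^'n) = 0" by (simp add: G0 mat_def)
  then show False by simp
 qed
 moreover have "det (\<chi> i. avg (\<phi> i) x) = g 0 * Qp x" for x using g(2)[of x] gc[of x] by simp
 ultimately show ?thesis using memA homA eqv_avg by (intro exI[of _ "%i. avg (\<phi> i)"] exI[of _ "g 0"]) auto
qed

end

section \<open>Coxeter elements and their regular eigenvectors\<close>

text \<open>Bilinear, without conjugation, so that this is the value at a complex point of the real
  linear form given by \<open>a\<close>.\<close>

definition cip :: "real^'n => complex^'n => complex" where
 "cip a z = (\<Sum>i\<in>UNIV. of_real (a $ i) * z $ i)"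

lemma cip_add: "cip a (z + w) = cip a z + cip a w"
 and cip_smult: "cip a (c *s z) = c * cip a z"
 and cip_cvec: "cip a (cvec x) = of_real (a \<bullet> x)"
 by (simp_all add: cip_def cvec_def inner_vec_def sum.distrib sum_subtractf sum_negf algebra_simps sum_distrib_left)

lemma cip_sum: "cip a (\<Sum>i\<in>I. f i) = (\<Sum>i\<in>I. cip a (f i))"
 by (induction I rule: infinite_finite_induct) (auto simp: cip_add, auto simp: cip_def)

lemma cip_matrix:
 assumes "!!x. (M *v a) \<bullet> (M *v x) = a \<bullet> x"
 shows "cip (M *v a) (cmat M *v z) = cip a z"
 using ev_matrix[OF rp_inner, of z "M *v a" M] assms by (simp add: ev_inner cip_def)

lemma cmat_mult: "cmat (A ** B) = cmat A ** cmat B"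
 by (simp add: vec_eq_iff cmat_def matrix_matrix_mult_def)
lemma cmat_id: "cmat (mat 1) = mat 1" by (simp add: vec_eq_iff cmat_def mat_def)

definition ccart :: "complex^'n => real^'n => complex" where
 "ccart z \<alpha> = 2 * cip \<alpha> z / of_real (\<alpha> \<bullet> \<alpha>)"

lemma ccart_add: "ccart (z + w) \<alpha> = ccart z \<alpha> + ccart w \<alpha>"
 and ccart_smult: "ccart (c *s z) \<alpha> = c * ccart z \<alpha>"
 and ccart_cvec: "ccart (cvec x) \<alpha> = of_real (cart x \<alpha>)"
 by (simp_all add: ccart_def cart_def cip_add cip_smult cip_cvec add_divide_distrib inner_commute distrib_left)

lemma ccart_sum: "ccart (\<Sum>i\<in>I. f i) \<alpha> = (\<Sum>i\<in>I. ccart (f i) \<alpha>)"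
 by (simp add: ccart_def cip_sum sum_distrib_left sum_divide_distrib)

lemma refl_mat_rfl: "refl_mat \<alpha> *v x = rfl \<alpha> x"
proof -
 have "(\<Sum>j\<in>UNIV. 2 * \<alpha> $ i * \<alpha> $ j / (\<alpha> \<bullet> \<alpha>) * x $ j) = cart x \<alpha> * \<alpha> $ i" for i
  unfolding cart_def inner_vec_def inner_real_def[abs_def] by (simp add: sum_distrib_left sum_divide_distrib mult_ac)
 then show ?thesis
  unfolding vec_eq_iff refl_mat_def matrix_vector_mult_def rfl_def
  by (simp only: vec_lambda_beta left_diff_distrib sum_subtractf mult_delta_left) simp
qed

lemma cmat_refl_mat: "cmat (refl_mat \<alpha>) *v z = z - ccart z \<alpha> *s cvec \<alpha>"
proof -
 have "(\<Sum>j\<in>UNIV. of_real (2 * \<alpha> $ i * \<alpha> $ j / (\<alpha> \<bullet> \<alpha>)) * z $ j) = ccart z \<alpha> * of_real (\<alpha> $ i)" for i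
  unfolding ccart_def cip_def by (simp add: sum_distrib_left sum_divide_distrib mult_ac)
 moreover have "of_real (if i = j then 1 else 0) * z $ j = (if i = j then z $ j else 0)" for i j by simp
 ultimately show ?thesis
  unfolding vec_eq_iff refl_mat_def cmat_def matrix_vector_mult_def cvec_def
  by (simp only: vec_lambda_beta of_real_diff left_diff_distrib sum_subtractf) simp
qed

lemma mat_pow_0: "mat_pow M 0 = mat 1" and mat_pow_Suc: "mat_pow M (Suc k) = M ** mat_pow M k"
 by (simp_all add: mat_pow_def)

lemma mat_pow_add: "mat_pow M (a + b) = mat_pow M a ** mat_pow M b"
 by (induction a) (simp_all add: mat_pow_0 mat_pow_Suc matrix_mul_assoc)

lemma mat_pow_mult: "mat_pow M (a * b) = mat_pow (mat_pow M a) b"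
 by (induction b) (simp_all add: mat_pow_0 mat_pow_Suc mat_pow_add)

lemma mat_pow_1: "mat_pow M (Suc 0) = M" by (simp add: mat_pow_0 mat_pow_Suc)

lemma mat_pow_id: "mat_pow (mat 1) k = mat 1" by (induction k) (simp_all add: mat_pow_0 mat_pow_Suc)

lemma mat_pow_comm: "mat_pow M k ** M = M ** mat_pow M k"
 using mat_pow_add[of M k "Suc 0"] mat_pow_Suc[of M k] by (simp add: mat_pow_1)

lemma foldr_rfl_inner: "foldr rfl K x \<bullet> foldr rfl K y = x \<bullet> y"
 by (induction K) (auto simp: rfl_inner)

lemma foldr_refl_mat: "foldr (%\<alpha> M. refl_mat \<alpha> ** M) K (mat 1) *v x = foldr rfl K x"
 by (induction K) (simp_all add: matrix_vector_mul_assoc[symmetric] refl_mat_rfl)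

lemma foldr_rfl_diff: "foldr rfl K x - x \<in> span (set K)"
proof (induction K)
 case Nil then show ?case by (simp add: span_zero)
next
 case (Cons a K)
 let ?y = "foldr rfl K x"
 have "rfl a ?y - x = (?y - x) - cart ?y a *\<^sub>R a" by (simp add: rfl_def)
 moreover have "?y - x \<in> span (set (a # K))" using Cons span_mono[of "set K" "set (a # K)"] by auto
 moreover have "cart ?y a *\<^sub>R a \<in> span (set (a # K))" by (intro span_scale span_base) auto
 ultimately show ?case by (simp only: foldr.simps o_apply span_diff)
qed

text \<open>The first reflection displaces along its own root, the others within the span of theirs;
  by independence both displacements are zero.\<close>

lemma foldr_rfl_fixed:
 assumes "independent (set K)" "distinct K" "foldr rfl K x = x" shows "\<forall>\<alpha>\<in>set K. \<alpha> \<bullet> x = 0"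
 using assms
proof (induction K)
 case (Cons a K)
 let ?y = "foldr rfl K x"
 have a: "a ~: span (set K)" "independent (set K)" "a ~= 0"
  using Cons.prems(1,2) span_zero[of "set K"] by (auto simp: independent_insert)
 have y: "?y = rfl a x" using Cons.prems(3) rfl_rfl[of a ?y] by simp
 then have d: "?y - x = - (cart x a *\<^sub>R a)" by (simp add: rfl_def)
 have "cart x a = 0"
 proof (rule ccontr)
  assume n: "cart x a ~= 0"
  have "cart x a *\<^sub>R a \<in> span (set K)" using foldr_rfl_diff[of K x] unfolding d using span_neg by fastforce
  from span_scale[OF this, of "1 / cart x a"] show False using a n by simp
 qed
 then have "a \<bullet> x = 0" "?y = x" using a d by (auto simp: cart_def inner_commute)
 then show ?case using Cons.IH a(2) Cons.prems(2) by simp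
qed simp

lemma nonneg_quadratic:
 fixes e f :: real
 assumes "!!t. 0 <= 2 * t * e + t\<^sup>2 * f" "f \<ge> 0" shows "e = 0"
proof (rule ccontr)
 assume e: "e ~= 0"
 define t where "t = - e / (f + 1)"
 have et: "e = - t * (f + 1)" unfolding t_def using assms(2) by simp
 then have "t ~= 0" using e by auto
 then have "0 < t\<^sup>2 * (f + 2)" using assms(2) by simp
 moreover have "2 * t * e + t\<^sup>2 * f = - (t\<^sup>2 * (f + 2))" unfolding et by (simp add: algebra_simps power2_eq_square)
 ultimately show False using assms(1)[of t] by simp
qed

context roots begin

lemma simple_obtuse: "\<delta> \<in> \<Delta> ==> \<epsilon> \<in> \<Delta> ==> \<delta> ~= \<epsilon> ==> \<delta> \<bullet> \<epsilon> <= 0"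
 using same_ht_obtuse D_pos ht_simple by simp

lemma D_nonempty: "\<Delta> ~= {}" using card_D by auto

text \<open>The Perron vector of the Cartan matrix is found by maximising \<open>\<Sum> (cf u \<delta>)\<^sup>2 |\<delta>|\<^sup>2\<close> on the
 unit sphere; replacing coefficients by absolute values does not increase the norm.\<close>
lemma perron:
 "\<exists>y \<kappa>. 0 < \<kappa> & \<kappa> <= 1 & (\<forall>\<delta>\<in>\<Delta>. y \<delta> > 0) & (\<forall>\<delta>\<in>\<Delta>. (\<Sum>\<epsilon>\<in>\<Delta>. y \<epsilon> * cart \<epsilon> \<delta>) = 2 * \<kappa> * y \<delta>)"
proof -
 define b where "b u w = (\<Sum>\<delta>\<in>\<Delta>. cf u \<delta> * cf w \<delta> * (\<delta> \<bullet> \<delta>))" for u w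
 have b_add: "b (u + t *\<^sub>R w) (u + t *\<^sub>R w) = b u u + 2 * t * b u w + t\<^sup>2 * b w w" for u t w
  unfolding b_def by (simp add: cf_add cf_scale power2_eq_square algebra_simps sum.distrib sum_distrib_left)
 have b_scale: "b (t *\<^sub>R w) (t *\<^sub>R w) = t\<^sup>2 * b w w" for t w
  unfolding b_def by (simp add: cf_scale power2_eq_square algebra_simps sum_distrib_left)
 have ccf: "continuous_on S (%u. cf u \<delta>)" for S \<delta>
  using linear_continuous_on[OF linear_conv_bounded_linear[THEN iffD1, OF linear_cf]] .
 have "continuous_on (sphere 0 1) (%u. b u u)" unfolding b_def by (intro continuous_intros ccf)
 moreover have "sphere (0::real^'n) 1 ~= {}" by simp
 ultimately obtain u where u: "norm u = 1" and mx0: "!!w. norm w = 1 ==> b w w <= b u u"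
  using continuous_attains_sup[OF compact_sphere, of "0::real^'n" 1 "%u. b u u"] by auto
 define R where "R = b u u"
 have mx: "b w w <= R * (w \<bullet> w)" for w
 proof (cases "w = 0")
  case False
  have "b (w /\<^sub>R norm w) (w /\<^sub>R norm w) <= R" unfolding R_def using False by (intro mx0) simp
  then show ?thesis using False by (simp only: b_scale) (simp add: field_simps power2_norm_eq_inner)
 qed (simp add: b_def cf_scale[of 0, simplified])
 \<comment> \<open>Evaluation at a simple root bounds the maximum below by 1. Hence \<kappa> = 1 / R
   is at most 1, so that 1 - \<kappa> can be a cosine later.\<close>
 have R1: "R \<ge> 1"
 proof -
  obtain \<delta> where d: "\<delta> \<in> \<Delta>" using D_nonempty by blast
  have "b \<delta> \<delta> = \<delta> \<bullet> \<delta>" unfolding b_def using d finite_D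
   by (simp add: cf_basis if_distrib if_distribR sum.delta cong: if_cong)
  then show ?thesis using mx[of \<delta>] root_norm_pos[OF D_root[OF d]] by simp
 qed
 define u' where "u' = (\<Sum>\<delta>\<in>\<Delta>. \<bar>cf u \<delta>\<bar> *\<^sub>R \<delta>)"
 have cu: "cf u' \<delta> = \<bar>cf u \<delta>\<bar>" if "\<delta> \<in> \<Delta>" for \<delta> using cf_unique[OF u'_def that] .
 have bu': "b u' u' = R" unfolding R_def b_def by (intro sum.cong) (auto simp: cu)
 have "u' \<bullet> u' <= u \<bullet> u"
 proof -
  have "u' \<bullet> u' = (\<Sum>\<delta>\<in>\<Delta>. \<Sum>\<epsilon>\<in>\<Delta>. \<bar>cf u \<delta>\<bar> * \<bar>cf u \<epsilon>\<bar> * (\<delta> \<bullet> \<epsilon>))"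
   unfolding u'_def by (simp add: inner_sum_left inner_sum_right sum_distrib_left mult_ac inner_commute)
  also have "\<dots> <= (\<Sum>\<delta>\<in>\<Delta>. \<Sum>\<epsilon>\<in>\<Delta>. cf u \<delta> * cf u \<epsilon> * (\<delta> \<bullet> \<epsilon>))"
  proof (intro sum_mono)
   fix \<delta> \<epsilon> assume de: "\<delta> \<in> \<Delta>" "\<epsilon> \<in> \<Delta>"
   show "\<bar>cf u \<delta>\<bar> * \<bar>cf u \<epsilon>\<bar> * (\<delta> \<bullet> \<epsilon>) <= cf u \<delta> * cf u \<epsilon> * (\<delta> \<bullet> \<epsilon>)"
   proof (cases "\<delta> = \<epsilon>")
    case False
    have "cf u \<delta> * cf u \<epsilon> <= \<bar>cf u \<delta>\<bar> * \<bar>cf u \<epsilon>\<bar>" by (metis abs_ge_self abs_mult)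
    then show ?thesis using simple_obtuse[OF de False] by (rule mult_right_mono_neg)
   qed simp
  qed
  also have "\<dots> = u \<bullet> u"
   by (subst (5 6) cf_sum[symmetric]) (simp only: inner_sum_left inner_sum_right sum_distrib_left mult_ac inner_commute inner_scaleR_left inner_scaleR_right)
  finally show ?thesis .
 qed
 also have "u \<bullet> u = 1" using u by (simp add: norm_eq_1)
 finally have uu: "R * (u' \<bullet> u') = R" using mx[of u'] bu' R1
  by (smt (verit) mult_left_le mult.right_neutral mult_le_cancel_left_pos)
 \<comment> \<open>\<open>u'\<close> attains the maximum as well, so the first variation of the
   difference between R times the square norm and b vanishes at \<open>u'\<close>.\<close>
 have lag: "b u' w = R * (u' \<bullet> w)" for w
 proof (rule ccontr)
  let ?e = "R * (u' \<bullet> w) - b u' w" and ?f = "R * (w \<bullet> w) - b w w"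
  assume "b u' w ~= R * (u' \<bullet> w)"
  then have e: "?e ~= 0" by simp
  have q: "0 <= 2 * t * ?e + t\<^sup>2 * ?f" for t
   using mx[of "u' + t *\<^sub>R w"] uu bu' unfolding b_add
   by (simp add: inner_add_left inner_add_right inner_commute power2_eq_square algebra_simps)
  have f: "?f \<ge> 0" using mx[of w] by simp
  show False using nonneg_quadratic[OF q f] e by simp
 qed
 have eq: "u' \<bullet> \<delta> = (1 / R) * cf u' \<delta> * (\<delta> \<bullet> \<delta>)" if d: "\<delta> \<in> \<Delta>" for \<delta>
 proof -
  have "b u' \<delta> = cf u' \<delta> * (\<delta> \<bullet> \<delta>)" unfolding b_def using d finite_D
   by (simp add: cf_basis if_distrib if_distribR sum.delta' cong: if_cong)
  then show ?thesis using lag[of \<delta>] R1 by (simp add: field_simps)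
 qed
 have ge: "cf u' \<delta> \<ge> 0" if "\<delta> \<in> \<Delta>" for \<delta> using cu[OF that] by simp
 have us: "u' \<bullet> w = (\<Sum>\<epsilon>\<in>\<Delta>. cf u' \<epsilon> * (\<epsilon> \<bullet> w))" for w
  by (subst cf_sum[of u', symmetric]) (simp only: inner_sum_left inner_scaleR_left)
 \<comment> \<open>At a simple root with zero coefficient the eigenvalue equation is a vanishing sum
   of terms of one sign. So this root is orthogonal to all those with positive coefficient, and
   connectedness rules it out.\<close>
 define D' where "D' = {\<delta>\<in>\<Delta>. cf u' \<delta> > 0}"
 have "D' = \<Delta>"
 proof (rule simple_irreducible)
  show "D' <= \<Delta>" by (auto simp: D'_def)
  show "D' ~= {}"
  proof
   assume "D' = {}"
   then have "cf u' \<delta> = 0" if "\<delta> \<in> \<Delta>" for \<delta> using ge[OF that] that by (force simp: D'_def)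
   then have "u' \<bullet> u' = 0" using us[of u'] by simp
   then show False using uu R1 by simp
  qed
  fix a d assume ad: "a \<in> D'" "d \<in> \<Delta> - D'"
  then have d: "d \<in> \<Delta>" "cf u' d = 0" using ge[of d] by (force simp: D'_def)+
  have "(\<Sum>\<epsilon>\<in>\<Delta>. - (cf u' \<epsilon> * (\<epsilon> \<bullet> d))) = 0" using eq[OF d(1)] d(2) us[of d] by (simp add: sum_negf)
  moreover have "- (cf u' \<epsilon> * (\<epsilon> \<bullet> d)) \<ge> 0" if "\<epsilon> \<in> \<Delta>" for \<epsilon>
   using ge[OF that] simple_obtuse[OF that d(1)] d(2) by (cases "\<epsilon> = d") (auto simp: mult_nonneg_nonpos)
  ultimately have "cf u' a * (a \<bullet> d) = 0" using sum_nonneg_eq_0_iff[OF finite_D, of "%\<epsilon>. - (cf u' \<epsilon> * (\<epsilon> \<bullet> d))"] ad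
   by (auto simp: D'_def)
  then show "a \<bullet> d = 0" using ad by (auto simp: D'_def)
 qed
 then have pos: "\<forall>\<delta>\<in>\<Delta>. cf u' \<delta> > 0" by (auto simp: D'_def)
 have "(\<Sum>\<epsilon>\<in>\<Delta>. cf u' \<epsilon> * cart \<epsilon> \<delta>) = 2 * (1 / R) * cf u' \<delta>" if d: "\<delta> \<in> \<Delta>" for \<delta>
 proof -
  have "(\<Sum>\<epsilon>\<in>\<Delta>. cf u' \<epsilon> * cart \<epsilon> \<delta>) = 2 * (u' \<bullet> \<delta>) / (\<delta> \<bullet> \<delta>)"
   unfolding us cart_def by (simp add: sum_distrib_left sum_divide_distrib mult_ac)
  then show ?thesis using eq[OF d] root_norm_pos[OF D_root[OF d]] by simp
 qed
 then show ?thesis using pos R1 by (intro exI[of _ "cf u'"] exI[of _ "1 / R"]) auto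
qed

text \<open>On a forest every antisymmetric edge function is a difference of vertex values: set
  aside a vertex with at most one neighbour, which exists by the edge bound, and choose its value
  last. It allows the factors of the Coxeter element to come in any order.\<close>

lemma tree_potential:
 assumes anti: "!!\<delta> \<epsilon>. \<sigma> \<epsilon> \<delta> = - \<sigma> \<delta> \<epsilon>"
 shows "\<exists>\<phi>::_ => real. \<forall>\<delta>\<in>\<Delta>. \<forall>\<epsilon>\<in>\<Delta>. \<delta> \<bullet> \<epsilon> < 0 --> \<phi> \<delta> - \<phi> \<epsilon> = \<sigma> \<delta> \<epsilon>"
proof -
 have "J <= \<Delta> ==> \<exists>\<phi>::_ => real. \<forall>\<delta>\<in>J. \<forall>\<epsilon>\<in>J. \<delta> \<bullet> \<epsilon> < 0 --> \<phi> \<delta> - \<phi> \<epsilon> = \<sigma> \<delta> \<epsilon>" for J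
 proof (induction "card J" arbitrary: J)
  case 0
  then have "J = {}" using finite_subset[OF _ finite_D] by simp
  then show ?case by simp
 next
  case (Suc n)
  have fJ: "finite J" using Suc finite_subset[OF _ finite_D] by simp
  have ob: "s \<bullet> t <= 0" if "s \<in> J" "t \<in> J" "s ~= t" for s t using simple_obtuse Suc.prems that by blast
  have "card {(s, t) \<in> J \<times> J. s \<bullet> t < 0} < 2 * card J"
   by (rule forest_edge_bound) (use Suc D_sub ob in auto)
  moreover have "{(s, t) \<in> J \<times> J. s \<bullet> t < 0} = Sigma J (%s. {t\<in>J. s \<bullet> t < 0})" by auto
  ultimately have lt: "(\<Sum>s\<in>J. card {t\<in>J. s \<bullet> t < 0}) < 2 * card J" using fJ by simp
  have "\<exists>s\<in>J. card {t\<in>J. s \<bullet> t < 0} <= 1"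
  proof (rule ccontr)
   assume "\<not> ?thesis"
   then have "(\<Sum>s\<in>J. 2) <= (\<Sum>s\<in>J. card {t\<in>J. s \<bullet> t < 0})" by (intro sum_mono) force
   then show False using lt by simp
  qed
  then obtain s where s: "s \<in> J" "card {t\<in>J. s \<bullet> t < 0} <= 1" by blast
  have "n = card (J - {s})" "J - {s} <= \<Delta>" using Suc s fJ by auto
  from Suc(1)[OF this] obtain \<phi> :: "_ => real" where
   ph: "!!\<delta> \<epsilon>. \<delta> \<in> J - {s} ==> \<epsilon> \<in> J - {s} ==> \<delta> \<bullet> \<epsilon> < 0 ==> \<phi> \<delta> - \<phi> \<epsilon> = \<sigma> \<delta> \<epsilon>" by blast
  have ss: "\<not> s \<bullet> s < 0" by (simp add: not_less)
  have "\<exists>q. \<forall>t\<in>J. s \<bullet> t < 0 --> q - \<phi> t = \<sigma> s t"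
  proof (cases "\<exists>t\<in>J. s \<bullet> t < 0")
   case True
   then obtain t where t: "t \<in> J" "s \<bullet> t < 0" by blast
   have "t' = t" if "t' \<in> J" "s \<bullet> t' < 0" for t'
    using s(2) t that fJ card_le_Suc0_iff_eq[of "{t\<in>J. s \<bullet> t < 0}"] by auto
   then show ?thesis by (intro exI[of _ "\<sigma> s t + \<phi> t"]) auto
  qed blast
  then obtain q where q: "!!t. t \<in> J ==> s \<bullet> t < 0 ==> q - \<phi> t = \<sigma> s t" by blast
  have "(\<phi>(s := q)) \<delta> - (\<phi>(s := q)) \<epsilon> = \<sigma> \<delta> \<epsilon>" if de: "\<delta> \<in> J" "\<epsilon> \<in> J" "\<delta> \<bullet> \<epsilon> < 0" for \<delta> \<epsilon>
  proof -
   have "\<delta> ~= \<epsilon>" using de(3) inner_ge_zero[of \<delta>] by (auto simp del: inner_ge_zero)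
   then consider "\<delta> ~= s" "\<epsilon> ~= s" | "\<delta> = s" "\<epsilon> ~= s" | "\<delta> ~= s" "\<epsilon> = s" by blast
   then show ?thesis
   proof cases
    case 1 then show ?thesis using ph de by simp
   next
    case 2 then show ?thesis using q de by simp
   next
    case 3 then show ?thesis using q[of \<delta>] de anti[of s \<delta>] by (simp add: inner_commute)
   qed
  qed
  then show ?case by blast
 qed
 then show ?thesis by blast
qed

end

locale coxeter = roots \<Phi> P \<Delta> for \<Phi> P \<Delta> :: "(real^'n) set" +
 fixes L :: "(real^'n) list" and C :: "real^'n^'n" and h :: nat
 assumes dL: "distinct L" and sL: "set L = \<Delta>" and CL: "C = foldr (%\<alpha> M. refl_mat \<alpha> ** M) L (mat 1)"
  and h0: "0 < h" and Ch: "mat_pow C h = mat 1" and Cmin: "!!k. 0 < k ==> k < h ==> mat_pow C k ~= mat 1"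
begin

section \<open>Orbits of roots under a Coxeter element\<close>

lemma C_foldr: "C *v x = foldr rfl L x" by (simp add: CL foldr_refl_mat)

lemma foldr_root: "set K <= \<Phi> ==> \<beta> \<in> \<Phi> ==> foldr rfl K \<beta> \<in> \<Phi>"
 by (induction K) (auto simp: rfl_root)

lemma C_root: "\<beta> \<in> \<Phi> ==> C *v \<beta> \<in> \<Phi>" using foldr_root[of L] sL D_root by (auto simp: C_foldr)

lemma Cp_root: "\<beta> \<in> \<Phi> ==> mat_pow C k *v \<beta> \<in> \<Phi>"
 by (induction k) (auto simp: mat_pow_0 mat_pow_Suc matrix_vector_mul_assoc[symmetric] C_root)

lemma C_fixed: "C *v x = x ==> x = 0"
proof -
 assume "C *v x = x"
 then have z: "\<forall>\<alpha>\<in>\<Delta>. \<alpha> \<bullet> x = 0" using foldr_rfl_fixed[of L x] sL dL D_indep by (simp add: C_foldr)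
 have "x \<bullet> x = (\<Sum>\<delta>\<in>\<Delta>. cf x \<delta> *\<^sub>R \<delta>) \<bullet> x" by (simp add: cf_sum)
 also have "\<dots> = 0" using z by (simp add: inner_sum_left)
 finally show ?thesis by simp
qed

lemma Cp_inner: "(mat_pow C k *v x) \<bullet> (mat_pow C k *v y) = x \<bullet> y"
 by (induction k) (simp_all add: mat_pow_0 mat_pow_Suc matrix_vector_mul_assoc[symmetric] C_foldr foldr_rfl_inner)

text \<open>By \<open>crossing\<close> this contains every positive root that the inverse of C makes
  negative, and it has at most as many elements as L.\<close>

definition crs :: "(real^'n) set" where "crs = (%i. foldr rfl (take i L) (L ! i)) ` {..<length L}"

lemma card_crs: "card crs <= CARD('n)"
proof -
 have "card crs <= length L" unfolding crs_def using card_image_le[of "{..<length L}"] by fastforce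
 then show ?thesis using dL sL card_D distinct_card by metis
qed

text \<open>Apply the factors of C one by one. A simple reflection turns a negative root positive
  only if that root is the negative of its own simple root; the factors applied afterwards carry the
  result along.\<close>

lemma crossing: "\<beta> \<in> \<Phi> ==> \<beta> ~: P ==> C *v \<beta> \<in> P ==> C *v \<beta> \<in> crs"
proof -
 assume b: "\<beta> \<in> \<Phi>" "\<beta> ~: P" "C *v \<beta> \<in> P"
 have "set K <= \<Delta> ==> foldr rfl K \<beta> \<in> P ==> \<exists>i<length K. foldr rfl K \<beta> = foldr rfl (take i K) (K ! i)" for K
 proof (induction K)
  case Nil then show ?case using b by simp
 next
  case (Cons a K)
  let ?y = "foldr rfl K \<beta>"
  have yr: "?y \<in> \<Phi>" using foldr_root[of K \<beta>] Cons.prems(1) D_root b(1) by auto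
  show ?case
  proof (cases "?y \<in> P")
   case True
   then obtain i where "i < length K" "?y = foldr rfl (take i K) (K ! i)" using Cons by auto
   then show ?thesis by (intro exI[of _ "Suc i"]) simp
  next
   case False
   then have n: "- ?y \<in> P" using pos_or_neg[OF yr] by blast
   have "rfl a (- ?y) ~: P" using neg_notin_P[OF Cons.prems(2)] by (simp add: linear_neg[OF linear_rfl])
   then have "- ?y = a" using rfl_simple_pos[of a "- ?y"] n Cons.prems(1) by auto
   then have "?y = - a" by (metis minus_minus)
   then show ?thesis by (intro exI[of _ 0]) (simp add: rfl_self linear_neg[OF linear_rfl])
  qed
 qed
 from this[of L] show ?thesis using b sL by (auto simp: crs_def C_foldr)
qed

lemma Cp_mod: "mat_pow C k = mat_pow C (k mod h)"
proof -
 have "mat_pow C (h * (k div h)) = mat 1"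
  unfolding mat_pow_mult Ch by (simp add: mat_pow_id)
 then show ?thesis using mat_pow_add[of C "h * (k div h)" "k mod h"] by simp
qed

lemma orbit_sum_zero: "(\<Sum>k<h. mat_pow C k *v x) = 0"
proof (rule C_fixed)
 have "C *v (\<Sum>k<h. mat_pow C k *v x) = (\<Sum>k<h. mat_pow C (Suc k) *v x)"
  by (simp add: linear_sum[OF matrix_vector_mul_linear] mat_pow_Suc matrix_vector_mul_assoc)
 also have "\<dots> = (\<Sum>k<h. mat_pow C k *v x)"
  using sum.lessThan_Suc_shift[of "%k. mat_pow C k *v x" h] Ch by (simp add: mat_pow_0)
 finally show "C *v (\<Sum>k<h. mat_pow C k *v x) = (\<Sum>k<h. mat_pow C k *v x)" .
qed

lemma orbit_meets_P: assumes "\<gamma> \<in> \<Phi>" shows "\<exists>k<h. mat_pow C k *v \<gamma> \<in> P"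
proof (rule ccontr)
 assume n: "\<not> ?thesis"
 then have "- (mat_pow C k *v \<gamma>) \<in> P" if "k < h" for k using pos_or_neg[OF Cp_root[OF assms]] that by blast
 then have "ht (- (mat_pow C k *v \<gamma>)) > 0" if "k < h" for k using that ht_pos by blast
 then have "(\<Sum>k<h. - ht (mat_pow C k *v \<gamma>)) > 0" using h0 by (intro sum_pos) (auto simp: ht_uminus)
 moreover have "(\<Sum>k<h. ht (mat_pow C k *v \<gamma>)) = 0"
  using linear_sum[OF linear_ht, of "%k. mat_pow C k *v \<gamma>" "{..<h}"] linear_0[OF linear_ht] by (simp add: orbit_sum_zero)
 ultimately show False by (simp add: sum_negf)
qed

text \<open>The sum over the powers of C is fixed by C, hence zero, so every orbit contains roots of
  both signs and turns from negative to positive somewhere. Both the regularity of the eigenvector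
  and the bound on the number of roots rest on this.\<close>

lemma orbit_crossing: assumes "\<gamma> \<in> \<Phi>" shows "\<exists>k. mat_pow C k *v \<gamma> \<in> crs"
proof -
 obtain k where k: "mat_pow C k *v (- \<gamma>) \<in> P" using orbit_meets_P[OF neg_root[OF assms]] by blast
 then have kn: "mat_pow C k *v \<gamma> ~: P" using neg_notin_P by (force simp: linear_neg[OF matrix_vector_mul_linear])
 let ?g = "mat_pow C k *v \<gamma>"
 obtain j where "mat_pow C j *v ?g \<in> P" using orbit_meets_P[OF Cp_root[OF assms]] by blast
 then obtain i where i: "mat_pow C i *v ?g \<in> P" "!!i'. i' < i ==> mat_pow C i' *v ?g ~: P"
  using exists_least_iff[of "%j. mat_pow C j *v ?g \<in> P"] by blast
 have "i ~= 0" using i(1) kn by (intro notI) (simp add: mat_pow_0)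
 then obtain i' where i': "i = Suc i'" by (cases i) auto
 have "C *v (mat_pow C i' *v ?g) \<in> crs"
 proof (rule crossing)
  show "mat_pow C i' *v ?g \<in> \<Phi>" by (intro Cp_root assms)
  show "mat_pow C i' *v ?g ~: P" using i(2) i' by blast
  show "C *v (mat_pow C i' *v ?g) \<in> P" using i(1) unfolding i' mat_pow_Suc by (simp only: matrix_vector_mul_assoc matrix_mul_assoc)
 qed
 then have "mat_pow C (i + k) *v \<gamma> \<in> crs" by (simp add: i' mat_pow_Suc mat_pow_add matrix_vector_mul_assoc matrix_mul_assoc)
 then show ?thesis by blast
qed

text \<open>The Perron vector y gives the moduli and the potential \<phi> the phases of the
  coefficients. Along an edge the phase changes by t, in the direction prescribed by the order of
  the two factors; so the neighbours of \<alpha> before it and, after multiplication by \<omega>,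
  those behind it contribute with the same phase, and the Perron equation with cos t = 1 - \<kappa>
  becomes the relation E. On \<open>crs\<close> the pairing with the eigenvector is a nonzero
  multiple of \<omega> - 1; orbits carry this to all roots.\<close>

lemma regular_eigenvector:
 "\<exists>v \<omega>. cmat C *v v = \<omega> *s v & (\<forall>\<beta>\<in>\<Phi>. cip \<beta> v ~= 0)"
proof -
 obtain y \<kappa> where k: "0 < \<kappa>" "\<kappa> <= 1" and y: "!!\<delta>. \<delta> \<in> \<Delta> ==> y \<delta> > 0"
  and eq: "!!\<delta>. \<delta> \<in> \<Delta> ==> (\<Sum>\<epsilon>\<in>\<Delta>. y \<epsilon> * cart \<epsilon> \<delta>) = 2 * \<kappa> * y \<delta>" using perron by blast
 define pos where "pos \<delta> = (SOME i. i < length L & L ! i = \<delta>)" for \<delta>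
 have pos: "pos (L ! i) = i" if "i < length L" for i
  unfolding pos_def using that dL nth_eq_iff_index_eq by (intro some_equality) auto
 obtain \<phi> :: "_ => real" where
  ph: "!!\<delta> \<epsilon>. \<delta> \<in> \<Delta> ==> \<epsilon> \<in> \<Delta> ==> \<delta> \<bullet> \<epsilon> < 0 ==> \<phi> \<delta> - \<phi> \<epsilon> = sgn (real (pos \<epsilon>) - real (pos \<delta>))"
 proof -
  have "sgn (real (pos \<delta>) - real (pos \<epsilon>)) = - sgn (real (pos \<epsilon>) - real (pos \<delta>))" for \<delta> \<epsilon> by (simp add: sgn_if)
  from tree_potential[of "%\<delta> \<epsilon>. sgn (real (pos \<epsilon>) - real (pos \<delta>))", OF this] show thesis using that by blast
 qed
 define t where "t = arccos (1 - \<kappa>)"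
 have t: "cos t = 1 - \<kappa>" unfolding t_def using k by (intro cos_arccos) auto
 define \<omega> where "\<omega> = cis (2 * t)"
 have l1: "\<omega> ~= 1"
 proof
  assume "\<omega> = 1"
  then have "cos (2 * t) = 1" by (simp add: \<omega>_def complex_eq_iff)
  moreover have "cos (2 * t) = 2 * (cos t)\<^sup>2 - 1" by (rule cos_double_cos)
  ultimately have "(cos t)\<^sup>2 = 1" by simp
  then have "cos t = 1 | cos t = -1" by (simp add: power2_eq_1_iff)
  then show False using t k by auto
 qed
 define x where "x \<delta> = of_real (y \<delta>) * cis (\<phi> \<delta> * t)" for \<delta>
 have x0: "x \<delta> ~= 0" if "\<delta> \<in> \<Delta>" for \<delta> using y[OF that] by (simp add: x_def cis_neq_zero)
 have E: "(\<Sum>\<delta>\<in>set L1. x \<delta> * of_real (cart \<delta> \<alpha>)) + \<omega> * (\<Sum>\<delta>\<in>set L2. x \<delta> * of_real (cart \<delta> \<alpha>)) = - (1 + \<omega>) * x \<alpha>"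
  if LL: "L = L1 @ \<alpha> # L2" for L1 \<alpha> L2
 proof -
  have a: "\<alpha> \<in> \<Delta>" and sub: "set L1 <= \<Delta>" "set L2 <= \<Delta>" using sL LL by auto
  have pa: "pos \<alpha> = length L1" using pos[of "length L1"] LL by simp
  have p1: "pos \<delta> < length L1" if m: "\<delta> \<in> set L1" for \<delta>
  proof -
   obtain i where i: "i < length L1" "L1 ! i = \<delta>" using m unfolding in_set_conv_nth by blast
   have "L ! i = \<delta>" "i < length L" using i by (simp_all add: LL nth_append)
   then show ?thesis using pos[of i] i by simp
  qed
  have p2: "length L1 < pos \<delta>" if m: "\<delta> \<in> set L2" for \<delta>
  proof -
   obtain i where i: "i < length L2" "L2 ! i = \<delta>" using m unfolding in_set_conv_nth by blast
   have "L ! (length L1 + Suc i) = \<delta>" "length L1 + Suc i < length L" using i by (simp_all add: LL nth_append)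
   then show ?thesis using pos[of "length L1 + Suc i"] by simp
  qed
  let ?w = "cis (\<phi> \<alpha> * t + t)"
  have c0: "\<delta> \<bullet> \<alpha> < 0 | cart \<delta> \<alpha> = 0" if "\<delta> \<in> \<Delta>" "\<delta> ~= \<alpha>" for \<delta>
   using simple_obtuse[OF that(1) a that(2)] cart_sgn[OF D_root[OF a], of \<delta>] by linarith
  have n: "\<alpha> ~: set L1" "\<alpha> ~: set L2" "set L1 \<inter> set L2 = {}" using dL LL by auto
  have t1: "x \<delta> * of_real (cart \<delta> \<alpha>) = ?w * of_real (y \<delta> * cart \<delta> \<alpha>)" if "\<delta> \<in> set L1" for \<delta>
  proof (cases "cart \<delta> \<alpha> = 0")
   case False
   have d: "\<delta> \<in> \<Delta>" "\<delta> ~= \<alpha>" using that sub n by auto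
   have "\<phi> \<delta> = \<phi> \<alpha> + 1" using ph[OF d(1) a] c0[OF d] False p1[OF that] pa by (simp add: sgn_if)
   then show ?thesis by (simp add: x_def algebra_simps)
  qed simp
  have t2: "\<omega> * (x \<delta> * of_real (cart \<delta> \<alpha>)) = ?w * of_real (y \<delta> * cart \<delta> \<alpha>)" if "\<delta> \<in> set L2" for \<delta>
  proof (cases "cart \<delta> \<alpha> = 0")
   case False
   have d: "\<delta> \<in> \<Delta>" "\<delta> ~= \<alpha>" using that sub n by auto
   have "\<phi> \<delta> = \<phi> \<alpha> - 1" using ph[OF d(1) a] c0[OF d] False p2[OF that] pa by (simp add: sgn_if)
   then have "2 * t + \<phi> \<delta> * t = \<phi> \<alpha> * t + t" by (simp add: left_diff_distrib)
   then have "\<omega> * cis (\<phi> \<delta> * t) = ?w" unfolding \<omega>_def cis_mult by (rule arg_cong)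
   then show ?thesis by (simp add: x_def algebra_simps)
  qed simp
  have D: "\<Delta> = insert \<alpha> (set L1 \<union> set L2)" using sL LL by auto
  have "(\<Sum>\<epsilon>\<in>\<Delta>. y \<epsilon> * cart \<epsilon> \<alpha>) = 2 * y \<alpha> + ((\<Sum>\<epsilon>\<in>set L1. y \<epsilon> * cart \<epsilon> \<alpha>) + (\<Sum>\<epsilon>\<in>set L2. y \<epsilon> * cart \<epsilon> \<alpha>))"
   unfolding D using n cart_self[OF root_nonzero[OF D_root[OF a]]] by (simp add: sum.union_disjoint)
  then have s: "(\<Sum>\<epsilon>\<in>set L1. y \<epsilon> * cart \<epsilon> \<alpha>) + (\<Sum>\<epsilon>\<in>set L2. y \<epsilon> * cart \<epsilon> \<alpha>) = - 2 * cos t * y \<alpha>"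
   using eq[OF a] unfolding t by (simp add: algebra_simps)
  have "(\<Sum>\<delta>\<in>set L1. x \<delta> * of_real (cart \<delta> \<alpha>)) + \<omega> * (\<Sum>\<delta>\<in>set L2. x \<delta> * of_real (cart \<delta> \<alpha>))
   = ?w * of_real ((\<Sum>\<epsilon>\<in>set L1. y \<epsilon> * cart \<epsilon> \<alpha>) + (\<Sum>\<epsilon>\<in>set L2. y \<epsilon> * cart \<epsilon> \<alpha>))"
   by (simp only: sum_distrib_left of_real_add of_real_sum distrib_left t1 t2 cong: sum.cong)
  also have "\<dots> = - (of_real (2 * cos t) * cis t) * x \<alpha>"
   unfolding s x_def by (simp add: cis_mult[symmetric])
  also have "of_real (2 * cos t) * cis t = 1 + \<omega>"
   unfolding \<omega>_def by (simp add: complex_eq_iff cos_double_cos sin_double power2_eq_square)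
  finally show ?thesis by simp
 qed
 let ?S = "%K. \<Sum>\<delta>\<in>set K. x \<delta> *s cvec \<delta>"
 let ?M = "%K. foldr (%\<alpha> M. refl_mat \<alpha> ** M) K (mat 1)"
 define v where "v = ?S L"
 have ccS: "ccart (?S K) \<alpha> = (\<Sum>\<delta>\<in>set K. x \<delta> * of_real (cart \<delta> \<alpha>))" for K \<alpha>
  by (simp add: ccart_sum ccart_smult ccart_cvec)
 \<comment> \<open>The reflections act from the right end of L. By E each one multiplies the
   coefficient of its own root by \<omega> and leaves the others alone.\<close>
 have suf: "L = L1 @ L2 ==> cmat (?M L2) *v v = ?S L1 + \<omega> *s ?S L2" for L1 L2
 proof (induction L2 arbitrary: L1)
  case Nil then show ?case by (simp add: cmat_id v_def)
 next
  case (Cons a K)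
  have n: "a ~: set L1" "a ~: set K" and a: "a \<in> \<Delta>" using dL Cons.prems sL by auto
  let ?z = "?S (L1 @ [a]) + \<omega> *s ?S K"
  have S1: "?S (L1 @ [a]) = ?S L1 + x a *s cvec a" using n by (simp add: add.commute)
  have "ccart ?z a = ccart (?S L1) a + \<omega> * ccart (?S K) a + x a * 2"
   using cart_self[OF root_nonzero[OF D_root[OF a]]] by (simp only: S1 ccart_add ccart_smult ccart_cvec) simp
  also have "\<dots> = (1 - \<omega>) * x a" using E[OF Cons.prems] by (simp only: ccS) (simp add: algebra_simps)
  finally have c: "ccart ?z a = (1 - \<omega>) * x a" .
  have "cmat (?M (a # K)) *v v = cmat (refl_mat a) *v (cmat (?M K) *v v)" by (simp add: cmat_mult matrix_vector_mul_assoc)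
  also have "\<dots> = ?z - ((1 - \<omega>) * x a) *s cvec a" using Cons.IH[of "L1 @ [a]"] Cons.prems by (simp only: append_assoc append_Cons append_Nil cmat_refl_mat c)
  also have "\<dots> = ?S L1 + \<omega> *s ?S (a # K)" using n by (simp only: S1) (simp add: vec_eq_iff algebra_simps)
  finally show ?case .
 qed
 have ev: "cmat C *v v = \<omega> *s v" using suf[of "[]" L] by (simp add: CL v_def)
 have reg: "cip (foldr rfl (take i L) (L ! i)) (\<omega> *s v) ~= 0" if i: "i < length L" for i
 proof -
  let ?K = "take i L" and ?a = "L ! i" and ?R = "drop i L" and ?R' = "drop (Suc i) L"
  have LL: "L = ?K @ ?a # ?R'" using i by (simp add: id_take_nth_drop)
  have a: "?a \<in> \<Delta>" using i sL by auto
  have nR: "?a ~: set ?R'" using dL LL by (metis distinct.simps(2) distinct_append)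
  let ?w = "cmat (?M ?R) *v v"
  have "?M (K @ K') = ?M K ** ?M K'" for K K' by (induction K) (simp_all add: matrix_mul_assoc)
  from this[of ?K ?R] have "\<omega> *s v = cmat (?M ?K) *v ?w" unfolding ev[symmetric] CL by (simp add: cmat_mult matrix_vector_mul_assoc)
  moreover have "cip (?M ?K *v ?a) (cmat (?M ?K) *v ?w) = cip ?a ?w"
   by (rule cip_matrix) (simp add: foldr_refl_mat foldr_rfl_inner)
  ultimately have "cip (foldr rfl ?K ?a) (\<omega> *s v) = cip ?a ?w" by (simp only: foldr_refl_mat)
  moreover have "ccart ?w ?a = (\<omega> - 1) * x ?a"
  proof -
   have R: "?R = ?a # ?R'" using i by (simp add: Cons_nth_drop_Suc)
   have "?w = ?S ?K + \<omega> *s ?S ?R" using suf[of ?K ?R] by simp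
   also have "?S ?R = x ?a *s cvec ?a + ?S ?R'" unfolding R using nR by simp
   finally have "ccart ?w ?a = ccart (?S ?K) ?a + \<omega> * (x ?a * 2 + ccart (?S ?R') ?a)"
    using cart_self[OF root_nonzero[OF D_root[OF a]]] by (simp only: ccart_add ccart_smult ccart_cvec) simp
   then show ?thesis using E[OF LL] by (simp only: ccS) (simp add: algebra_simps)
  qed
  ultimately show ?thesis using l1 x0[OF a] by (auto simp: ccart_def)
 qed
 have evk: "cmat (mat_pow C k) *v v = \<omega> ^ k *s v" for k
 proof (induction k)
  case 0 then show ?case by (simp add: mat_pow_0 cmat_id)
 next
  case (Suc k)
  have "cmat (mat_pow C (Suc k)) *v v = cmat (mat_pow C k) *v (cmat C *v v)"
   by (simp add: mat_pow_Suc mat_pow_comm[symmetric] cmat_mult matrix_vector_mul_assoc)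
  then show ?case using Suc ev by (simp add: matrix_vector_mult_scaleR vec.scale)
 qed
 have "cip \<beta> v ~= 0" if b: "\<beta> \<in> \<Phi>" for \<beta>
 proof
  assume z: "cip \<beta> v = 0"
  obtain k where "mat_pow C k *v \<beta> \<in> crs" using orbit_crossing[OF b] by blast
  then obtain i where i: "i < length L" "mat_pow C k *v \<beta> = foldr rfl (take i L) (L ! i)" by (auto simp: crs_def)
  have "cip (mat_pow C k *v \<beta>) (cmat (mat_pow C k) *v v) = 0" using cip_matrix[of "mat_pow C k" \<beta> v] Cp_inner z by simp
  then have "\<omega> ^ k * cip (mat_pow C k *v \<beta>) v = 0" by (simp add: evk cip_smult)
  then have "cip (mat_pow C k *v \<beta>) v = 0" by (simp add: \<omega>_def cis_neq_zero)
  then show False using reg[OF i(1)] unfolding i(2)[symmetric] by (simp add: cip_smult)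
 qed
 then show ?thesis using ev by blast
qed

end

section \<open>Traces of powers of integer matrices modulo primes\<close>

text \<open>An element not fixed by g has an orbit of exactly p elements, on which w is constant;
  such orbits are removed one at a time.\<close>

lemma sum_mod_prime_orbits:
 fixes w :: "'a => int"
 assumes p: "prime p" and "finite S" "!!x. x \<in> S ==> g x \<in> S" "!!x. x \<in> S ==> (g ^^ p) x = x"
  "!!x. x \<in> S ==> w (g x) = w x"
 shows "int p dvd (\<Sum>x\<in>S. w x) - (\<Sum>x\<in>{x\<in>S. g x = x}. w x)"
 using assms(2-)
proof (induction "card S" arbitrary: S rule: less_induct)
 case less
 show ?case
 proof (cases "\<forall>x\<in>S. g x = x")
  case True
  then have "{x\<in>S. g x = x} = S" by blast
  then show ?thesis by simp
 next
  case False
  then obtain x where x: "x \<in> S" "g x ~= x" by blast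
  have per: "(g ^^ p) x = x" using less x by blast
  have p0: "p > 0" using p prime_gt_0_nat by blast
  have red: "(g ^^ m) x = (g ^^ (m mod p)) x" for m using funpow_mod_eq[OF per, of m] by simp
  have nofix: "g ((g ^^ k) x) ~= (g ^^ k) x" if "k < p" for k
  proof
   assume a: "g ((g ^^ k) x) = (g ^^ k) x"
   have "(g ^^ (p - k)) ((g ^^ Suc k) x) = (g ^^ (p - k)) ((g ^^ k) x)" using a by simp
   then have "(g ^^ (p - k + Suc k)) x = (g ^^ (p - k + k)) x" by (simp only: funpow_add o_apply)
   then have "g ((g ^^ p) x) = (g ^^ p) x" using that by simp
   then show False using per x by simp
  qed
  let ?f = "%k. (g ^^ k) x"
  have inj: "inj_on ?f {..<p}"
  proof (rule linorder_inj_onI)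
   fix i j :: nat assume ij: "i < j" "i \<in> {..<p}" "j \<in> {..<p}"
   show "?f i ~= ?f j"
   proof
    assume "?f i = ?f j"
    then have "(g ^^ (p - i)) (?f i) = (g ^^ (p - i)) (?f j)" by simp
    then have "(g ^^ (p - i + i)) x = (g ^^ (p - i + j)) x" by (simp only: funpow_add o_apply)
    moreover have "p - i + i = p" "p - i + j = (j - i) + p" using ij by auto
    ultimately have "x = (g ^^ (j - i)) x" using per by (simp only: funpow_add o_apply)
    then have d: "(g ^^ (j - i)) x = x" by simp
    have "\<not> p dvd (j - i)" using ij by (auto dest: dvd_imp_le)
    then obtain a b where ab: "(j - i) * a = Suc (p * b)" using bezout_prime[OF p] by blast
    have "x = (g ^^ ((j - i) * a)) x" using funpow_mod_eq[OF d, of "(j - i) * a"] by simp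
    also have "\<dots> = g ((g ^^ (p * b)) x)" by (simp add: ab)
    also have "\<dots> = g x" using funpow_mod_eq[OF per, of "p * b"] by simp
    finally show False using x by simp
   qed
  qed auto
  define U where "U = ?f ` {..<p}"
  have US: "U <= S"
  proof -
   have "?f k \<in> S" for k by (induction k) (use x less.prems(2) in auto)
   then show ?thesis by (auto simp: U_def)
  qed
  have wU: "w (?f k) = w x" for k
  proof (induction k)
   case (Suc k)
   have "?f k \<in> S" for k by (induction k) (use x less.prems(2) in auto)
   then show ?case using less.prems(4) Suc by simp
  qed simp
  have sU: "(\<Sum>y\<in>U. w y) = int p * w x" unfolding U_def using inj by (simp add: sum.reindex wU)
  have xU: "x \<in> U" unfolding U_def using p0 by (intro image_eqI[of _ _ 0]) auto
  have "int p dvd (\<Sum>y\<in>S - U. w y) - (\<Sum>y\<in>{y\<in>S - U. g y = y}. w y)"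
  proof (rule less.hyps)
   show "card (S - U) < card S" using less.prems(1) x xU by (intro psubset_card_mono) auto
   show "g y \<in> S - U" if y: "y \<in> S - U" for y
   proof -
    have "g y ~: U"
    proof
     assume "g y \<in> U"
     then obtain k where k: "g y = ?f k" by (auto simp: U_def)
     have "(g ^^ Suc (p - 1)) y = y" using less.prems(3)[of y] y p0 by simp
     then have "y = (g ^^ (p - 1)) (g y)" by (simp only: funpow_Suc_right o_apply)
     also have "\<dots> = ?f (p - 1 + k)" unfolding k by (simp add: funpow_add)
     also have "\<dots> = ?f ((p - 1 + k) mod p)" by (rule red)
     finally have "y \<in> U" using p0 by (auto simp: U_def)
     then show False using y by simp
    qed
    then show ?thesis using y less.prems(2) by simp
   qed
  qed (use less.prems in auto)
  moreover have "{y\<in>S - U. g y = y} = {y\<in>S. g y = y}" using nofix by (auto simp: U_def)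
  ultimately have "int p dvd ((\<Sum>y\<in>S - U. w y) - (\<Sum>y\<in>{y\<in>S. g y = y}. w y)) + int p * w x" by (intro dvd_add) auto
  moreover have "(\<Sum>y\<in>S. w y) = (\<Sum>y\<in>S - U. w y) + int p * w x"
   using sum.subset_diff[OF US less.prems(1), of w] sU by simp
  ultimately show ?thesis by (simp add: algebra_simps)
 qed
qed

lemma rotate1_fixed: "xs @ [x] = x # xs ==> xs = replicate (length xs) x"
proof (induction xs)
 case (Cons a xs)
 then have "a = x" "xs @ [x] = x # xs" by auto
 then show ?case using Cons.IH by simp
qed simp

lemma rotate1_fixed_lists:
 "{xs \<in> {xs. set xs <= A & length xs = Suc k}. rotate1 xs = xs} = (%a. replicate (Suc k) a) ` A"
proof (intro equalityI subsetI)
 fix xs assume "xs \<in> {xs \<in> {xs. set xs <= A & length xs = Suc k}. rotate1 xs = xs}"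
 then obtain x ys where "xs = x # ys" "length ys = k" "x \<in> A" "ys @ [x] = x # ys" by (cases xs) auto
 then show "xs \<in> (%a. replicate (Suc k) a) ` A" using rotate1_fixed[of ys x] by force
qed (auto simp: replicate_append_same)

lemma rotate1_orbits:
 fixes w :: "'a list => int"
 assumes "prime (Suc k)" "finite A" "!!xs. set xs <= A ==> length xs = Suc k ==> w (rotate1 xs) = w xs"
 shows "int (Suc k) dvd (\<Sum>xs\<in>{xs. set xs <= A & length xs = Suc k}. w xs) - (\<Sum>a\<in>A. w (replicate (Suc k) a))"
proof -
 have "inj_on (%a. replicate (Suc k) a) A" by (rule inj_onI) simp
 then have "(\<Sum>xs\<in>(%a. replicate (Suc k) a) ` A. w xs) = (\<Sum>a\<in>A. w (replicate (Suc k) a))" by (simp only: sum.reindex o_def)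
 moreover have "int (Suc k) dvd (\<Sum>xs\<in>{xs. set xs <= A & length xs = Suc k}. w xs)
  - (\<Sum>xs\<in>{xs \<in> {xs. set xs <= A & length xs = Suc k}. rotate1 xs = xs}. w xs)"
 proof (rule sum_mod_prime_orbits[OF assms(1)])
  show "finite {xs. set xs <= A & length xs = Suc k}" using finite_lists_length_eq[OF assms(2)] .
  fix xs assume "xs \<in> {xs. set xs <= A & length xs = Suc k}"
  then show "(rotate1 ^^ Suc k) xs = xs" "rotate1 xs \<in> {xs. set xs <= A & length xs = Suc k}" "w (rotate1 xs) = w xs"
   using assms(3) rotate_id[of "Suc k" xs] unfolding rotate_def by auto
 qed
 ultimately show ?thesis by (simp only: rotate1_fixed_lists)
qed

lemma fermat_int: assumes "prime p" shows "int p dvd x ^ p - x"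
proof -
 obtain k where k: "p = Suc k" using prime_gt_0_nat[OF assms] by (cases p) auto
 define n where "n = nat (x mod int p)"
 have n: "int n = x mod int p" using k by (simp add: n_def)
 have "int p dvd int (n ^ p) - int n"
  using rotate1_orbits[of k "{..<n}" "%_. 1"] assms card_lists_length_eq[of "{..<n}" "Suc k"] by (simp add: k)
 moreover have d: "int p dvd x - int n" unfolding n by (simp add: mod_eq_dvd_iff[symmetric])
 moreover have "int p dvd x ^ p - int n ^ p"
  using dvd_mult2[OF d] unfolding power_diff_sumr2 .
 ultimately have "int p dvd (x ^ p - int n ^ p) + (int (n ^ p) - int n)" "int p dvd x - int n" by (simp_all only: dvd_add)
 from dvd_diff[OF this] show ?thesis by simp
qed

section \<open>Traces as sums over closed walks\<close>

fun walk :: "int^'n^'n => 'n => 'n list => 'n => int" where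
 "walk A i [] j = A $ i $ j"
| "walk A i (x # xs) j = A $ i $ x * walk A x xs j"

lemma walk_snoc: "walk A i (xs @ [y]) j = walk A i xs y * A $ y $ j"
 by (induction xs arbitrary: i) auto

lemma lists_length_Suc: "{xs::'n list. length xs = Suc k} = (%(x, xs). x # xs) ` (UNIV \<times> {xs. length xs = k})"
 by (auto simp: length_Suc_conv image_iff)

lemma sum_lists_length_Suc:
 fixes f :: "'n::finite list => int"
 shows "(\<Sum>xs\<in>{xs. length xs = Suc k}. f xs) = (\<Sum>x\<in>UNIV. \<Sum>xs\<in>{xs. length xs = k}. f (x # xs))"
 unfolding lists_length_Suc by (subst sum.reindex) (auto simp: inj_on_def sum.cartesian_product split_def)

lemma mat_pow_walks:
 fixes A :: "int^'n^'n"
 shows "mat_pow A (Suc k) $ i $ j = (\<Sum>xs\<in>{xs. length xs = k}. walk A i xs j)"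
proof (induction k arbitrary: i)
 case 0
 then show ?case by (simp add: mat_pow_1)
next
 case (Suc k)
 have "mat_pow A (Suc (Suc k)) $ i $ j = (\<Sum>x\<in>UNIV. A $ i $ x * mat_pow A (Suc k) $ x $ j)"
  by (subst mat_pow_Suc) (simp add: matrix_matrix_mult_def)
 then show ?case by (simp only: Suc sum_lists_length_Suc walk.simps sum_distrib_left)
qed

text \<open>Rotation permutes the closed walks of length p. Modulo p only the constant walks remain;
  they contribute p-th powers of the diagonal entries, which Fermat's congruence turns into the
  entries themselves.\<close>

lemma trace_mat_pow_prime:
 fixes A :: "int^'n^'n"
 assumes p: "prime p" shows "int p dvd trace (mat_pow A p) - trace A"
proof -
 obtain k where k: "p = Suc k" using prime_gt_0_nat[OF p] by (cases p) auto
 define w where "w ys = walk A (hd ys) (tl ys) (hd ys)" for ys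
 have t: "trace (mat_pow A p) = (\<Sum>ys\<in>{ys. set ys <= UNIV & length ys = Suc k}. w ys)"
  unfolding trace_def k mat_pow_walks by (simp add: sum_lists_length_Suc w_def)
 have r: "w (rotate1 ys) = w ys" if "length ys = Suc k" for ys
 proof -
  from that have "ys ~= []" by auto
  then obtain y zs where "ys = y # zs" by (cases ys) auto
  then show ?thesis by (cases zs) (auto simp: w_def walk_snoc)
 qed
 have "walk A a (replicate j a) a = A $ a $ a ^ Suc j" for a j by (induction j) auto
 then have f: "w (replicate (Suc k) a) = A $ a $ a ^ p" for a by (simp add: w_def k)
 have "int p dvd trace (mat_pow A p) - (\<Sum>a\<in>UNIV. A $ a $ a ^ p)"
  unfolding t using rotate1_orbits[of k UNIV w] p r by (simp only: k f[unfolded k]) simp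
 moreover have "int p dvd (\<Sum>a\<in>UNIV. A $ a $ a ^ p - A $ a $ a)" by (intro dvd_sum fermat_int p)
 ultimately have "int p dvd (trace (mat_pow A p) - (\<Sum>a\<in>UNIV. A $ a $ a ^ p)) + (\<Sum>a\<in>UNIV. A $ a $ a ^ p - A $ a $ a)"
  by (rule dvd_add)
 then show ?thesis by (simp add: trace_def sum_subtractf)
qed

section \<open>Eigenvalues of Coxeter elements\<close>

lemma eigenbasis:
 fixes N :: "complex^'n^'n"
 assumes e: "!!i. N *v w i = \<nu> i *s w i" and d: "det (\<chi> i. w i) ~= 0"
 shows "det N = (\<Prod>i\<in>UNIV. \<nu> i)" and "trace N = (\<Sum>i\<in>UNIV. \<nu> i)" and "(!!i. \<nu> i = 1) ==> N = mat 1"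
proof -
 let ?W = "\<chi> i. w i" and ?D = "\<chi> i j. if i = j then \<nu> i else 0"
 have eq: "?W ** transpose N = ?D ** ?W"
 proof -
  have "(\<Sum>k\<in>UNIV. w i $ k * N $ j $ k) = \<nu> i * w i $ j" for i j
   using e[of i] by (simp add: vec_eq_iff matrix_vector_mult_def mult.commute)
  moreover have "(\<Sum>k\<in>UNIV. (if i = k then \<nu> i else 0) * w k $ j) = \<nu> i * w i $ j" for i j
   by (simp only: mult_delta_left) simp
  ultimately show ?thesis by (simp add: vec_eq_iff matrix_matrix_mult_def transpose_def)
 qed
 have "det ?W * det N = det ?D * det ?W" using arg_cong[OF eq, of det] by (simp add: det_mul det_transpose)
 moreover have "det ?D = (\<Prod>i\<in>UNIV. \<nu> i)" by (subst det_diagonal) auto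
 ultimately show "det N = (\<Prod>i\<in>UNIV. \<nu> i)" using d by simp
 obtain V where V: "?W ** V = mat 1" "V ** ?W = mat 1" using d unfolding invertible_det_nz[symmetric] invertible_def by blast
 have N: "transpose N = V ** (?W ** transpose N)" by (simp only: matrix_mul_assoc V matrix_mul_lid)
 then have "trace (transpose N) = trace (V ** ?D ** ?W)" unfolding eq by (simp only: matrix_mul_assoc)
 also have "\<dots> = trace (?W ** (V ** ?D))" by (rule trace_mul_sym)
 also have "\<dots> = trace ?D" by (simp only: matrix_mul_assoc V matrix_mul_lid)
 finally show "trace N = (\<Sum>i\<in>UNIV. \<nu> i)" by (simp add: trace_def transpose_def)
 assume "!!i. \<nu> i = 1"
 then have "?D = mat 1" by (simp add: vec_eq_iff mat_def)
 then have "?W ** transpose N = ?W" using eq by simp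
 then have "transpose N = mat 1" using N V by simp
 then have "transpose (transpose N) = transpose (mat 1)" by simp
 then show "N = mat 1" by (simp only: transpose_transpose transpose_mat)
qed

text \<open>Orthogonality of characters: summing the power sums against powers of the inverse of
  \<open>a\<close>, which is \<open>a ^ (h - 1)\<close>, counts the entries equal to
  \<open>a\<close>.\<close>

lemma power_sums_determine_multiplicities:
 fixes z w :: "'a::finite => complex"
 assumes h: "0 < h" and z: "!!i. z i ^ h = 1" and w: "!!i. w i ^ h = 1" and a: "a ^ h = 1"
  and s: "!!k. (\<Sum>i\<in>UNIV. z i ^ k) = (\<Sum>i\<in>UNIV. w i ^ k)"
 shows "card {i. z i = a} = card {i. w i = a}"
proof -
 let ?b = "a ^ (h - 1)"
 have ab: "a * ?b = 1" using a h by (simp flip: power_Suc)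
 have g: "(\<Sum>k<h. (u * ?b) ^ k) = (if u = a then of_nat h else 0)" if u: "u ^ h = 1" for u
 proof (cases "u = a")
  case False
  have n: "u * ?b ~= 1"
  proof
   assume "u * ?b = 1"
   then have "u * (a * ?b) = a" by (simp only: mult.left_commute[of u] mult_1_right)
   then show False using False by (simp only: ab) simp
  qed
  have "?b ^ h = (a ^ h) ^ (h - 1)" by (simp add: mult.commute flip: power_mult)
  then have "(u * ?b) ^ h = 1" using u a by (simp add: power_mult_distrib)
  then show ?thesis using geometric_sum[OF n, of h] False by simp
 qed (simp only: ab power_one, simp)
 have c: "(\<Sum>k<h. ?b ^ k * (\<Sum>i\<in>UNIV. y i ^ k)) = of_nat h * of_nat (card {i. y i = a})"
  if y: "!!i. y i ^ h = 1" for y :: "'a => complex"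
 proof -
  have "(\<Sum>k<h. ?b ^ k * (\<Sum>i\<in>UNIV. y i ^ k)) = (\<Sum>i\<in>UNIV. \<Sum>k<h. (y i * ?b) ^ k)"
   by (subst sum.swap) (simp only: sum_distrib_left power_mult_distrib, simp only: mult.commute)
  also have "\<dots> = (\<Sum>i\<in>UNIV. if y i = a then of_nat h else 0)" using g[OF y] by simp
  finally show ?thesis by (simp add: sum.If_cases mult.commute)
 qed
 have "of_nat h * of_nat (card {i. z i = a}) = (of_nat h * of_nat (card {i. w i = a}) :: complex)"
  unfolding c[of z, OF z, symmetric] c[of w, OF w, symmetric] s ..
 then show ?thesis using h by simp
qed

context coxeter begin

text \<open>In the base of simple roots C has integer entries, because it maps roots to roots and
  these have integral coefficients.\<close>

lemma trace_integer: "\<exists>A::int^'n^'n. \<forall>k. trace (mat_pow C k) = of_int (trace (mat_pow A k))"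
proof -
 obtain q :: "'n => real^'n" where q: "bij_betw q UNIV \<Delta>"
  using finite_same_card_bij[OF finite_class.finite_UNIV finite_D] card_D by auto
 then have qD: "q i \<in> \<Delta>" for i by (auto simp: bij_betw_def)
 have qs: "(\<Sum>j\<in>UNIV. cf x (q j) *\<^sub>R q j) = x" for x
  using sum.reindex_bij_betw[OF q, of "%\<delta>. cf x \<delta> *\<^sub>R \<delta>"] cf_sum by simp
 define A :: "int^'n^'n" where "A = (\<chi> i j. \<lfloor>cf (C *v q i) (q j)\<rfloor>)"
 define R where "R = (%B::int^'n^'n. \<chi> i j. real_of_int (B $ i $ j))"
 have A: "R A $ i $ j = cf (C *v q i) (q j)" for i j
 proof -
  have "C *v q i \<in> \<Phi>" using C_root D_root qD by blast
  then have "cf (C *v q i) (q j) \<in> \<int>"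
   using pos_or_neg[of "C *v q i"] cf_Ints[of "C *v q i", OF _ qD] cf_Ints[of "- (C *v q i)", OF _ qD, of j] by (auto simp: cf_uminus)
  then show ?thesis unfolding R_def A_def by (auto elim: Ints_cases)
 qed
 have Rm: "R (B ** B') = R B ** R B'" for B B' by (simp add: R_def vec_eq_iff matrix_matrix_mult_def)
 define S where "S = (\<chi> i. q i)"
 define S' where "S' = (\<chi> a j. cf (axis a 1) (q j))"
 have "S' ** S = mat 1"
 proof -
  have "(\<Sum>j\<in>UNIV. cf (axis a 1) (q j) * q j $ b) = mat 1 $ a $ b" for a b
   using arg_cong[OF qs[of "axis a 1"], of "%v. v $ b"] by (simp add: axis_def mat_def eq_commute)
  then show ?thesis by (simp add: S_def S'_def vec_eq_iff matrix_matrix_mult_def)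
 qed
 then have SS: "S' ** S = mat 1" "S ** S' = mat 1" using matrix_left_right_inverse by blast+
 have AS: "R A ** S = S ** transpose C"
 proof -
  have "(\<Sum>j\<in>UNIV. R A $ i $ j * q j $ b) = (C *v q i) $ b" for i b
   using arg_cong[OF qs[of "C *v q i"], of "%v. v $ b"] by (simp add: A)
  moreover have "(\<Sum>j\<in>UNIV. q i $ j * C $ b $ j) = (C *v q i) $ b" for i b by (simp add: matrix_vector_mult_def mult.commute)
  ultimately show ?thesis by (simp add: S_def vec_eq_iff matrix_matrix_mult_def transpose_def)
 qed
 have pw: "R (mat_pow A k) ** S = S ** transpose (mat_pow C k)" for k
 proof (induction k)
  case 0
  have "R (mat 1) = mat 1" by (simp add: R_def mat_def vec_eq_iff)
  then show ?case by (simp add: mat_pow_0 transpose_mat)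
 next
  case (Suc k)
  have "R (mat_pow A (Suc k)) ** S = R A ** (R (mat_pow A k) ** S)" by (simp add: mat_pow_Suc Rm matrix_mul_assoc)
  also have "\<dots> = S ** (transpose C ** transpose (mat_pow C k))" by (simp add: Suc AS matrix_mul_assoc)
  also have "transpose C ** transpose (mat_pow C k) = transpose (mat_pow C (Suc k))"
   by (simp add: mat_pow_Suc mat_pow_comm[symmetric] matrix_transpose_mul)
  finally show ?case .
 qed
 have "trace (mat_pow C k) = of_int (trace (mat_pow A k))" for k
 proof -
  have "R (mat_pow A k) = R (mat_pow A k) ** S ** S'" by (simp only: matrix_mul_assoc[symmetric] SS matrix_mul_rid)
  then have "trace (R (mat_pow A k)) = trace (S ** transpose (mat_pow C k) ** S')" by (simp only: pw)
  also have "\<dots> = trace (S' ** (S ** transpose (mat_pow C k)))" by (rule trace_mul_sym)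
  also have "\<dots> = trace (mat_pow C k)" by (simp add: matrix_mul_assoc SS trace_def transpose_def)
  finally show ?thesis by (simp add: trace_def R_def)
 qed
 then show ?thesis by blast
qed

end

locale spectral = coxeter \<Phi> P \<Delta> L C h for \<Phi> P \<Delta> :: "(real^'n) set" and L C h +
 fixes \<psi> :: "'n => real^'n => real^'n" and d :: "'n => nat" and c :: real and v :: "complex^'n" and \<omega> :: complex
 assumes psi: "!!i. \<psi> i \<in> D1" "!!i. vhom (d i) (\<psi> i)" "!!i. eqv (\<psi> i)"
  and c0: "c ~= 0" and detc: "!!x. det (\<chi> i. \<psi> i x) = c * Qp x"
  and sumd: "sum d UNIV = card P" and v: "cmat C *v v = \<omega> *s v" and reg: "!!\<beta>. \<beta> \<in> \<Phi> ==> cip \<beta> v ~= 0"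
begin

lemma psi_vp: "vp (\<psi> i)" using psi(2) vhom_vp by blast

lemma eqv_C: assumes "eqv \<theta>" shows "\<theta> (C *v x) = C *v \<theta> x"
proof -
 have "set K <= \<Phi> ==> \<theta> (foldr rfl K x) = foldr rfl K (\<theta> x)" for K
  by (induction K) (use assms in \<open>auto simp: eqv_rfl\<close>)
 then show ?thesis using sL D_root by (auto simp: C_foldr)
qed

lemma ev_Qp: "ev v Qp = (\<Prod>\<beta>\<in>P. cip \<beta> v)"
 unfolding Qp_def[abs_def] using ev_prod[OF finite_P, of "%\<beta> x. \<beta> \<bullet> x" v] by (simp add: rp_inner ev_inner cip_def)

lemma rp_Qp: "rp Qp" unfolding Qp_def[abs_def] by (rule hom_rp[OF hom_prod_linear[OF finite_P]])

text \<open>The determinant of the basis is c times the product of the positive roots, and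
  regularity of v says that none of these vanishes at v.\<close>

lemma evv_basis: "det (\<chi> i. evv v (\<psi> i)) ~= 0"
proof -
 have "det (\<chi> i. evv v (\<psi> i)) = ev v (%x. c * Qp x)" using ev_det[of \<psi> v, OF psi_vp] by (simp only: detc)
 also have "\<dots> = of_real c * (\<Prod>\<beta>\<in>P. cip \<beta> v)" by (simp only: ev_cmult[OF rp_Qp] ev_Qp)
 finally show ?thesis using c0 reg P_root finite_P by auto
qed

text \<open>By equivariance C takes the value at v to the value at C v = \<omega> v, which by
  homogeneity is \<omega> to the degree times the value at v.\<close>

lemma evv_eigen: "cmat (mat_pow C k) *v evv v (\<psi> i) = (\<omega> ^ d i) ^ k *s evv v (\<psi> i)"
proof (induction k)
 case 0 then show ?case by (simp add: mat_pow_0 cmat_id)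
next
 case (Suc k)
 have "cmat C *v evv v (\<psi> i) = \<omega> ^ d i *s evv v (\<psi> i)"
  using evv_equivariant[OF psi_vp[of i] eqv_C[OF psi(3)[of i]], of v] unfolding v evv_hom[OF psi(2)] by simp
 then show ?case using Suc
  by (simp add: mat_pow_Suc cmat_mult matrix_vector_mul_assoc[symmetric] vec.scale vector_smult_assoc mult.commute)
qed

lemma trace_eigen: "complex_of_real (trace (mat_pow C k)) = (\<Sum>i\<in>UNIV. (\<omega> ^ d i) ^ k)"
proof -
 have "trace (cmat (mat_pow C k)) = (\<Sum>i\<in>UNIV. (\<omega> ^ d i) ^ k)" by (rule eigenbasis(2)[OF evv_eigen evv_basis])
 then show ?thesis by (simp add: trace_def cmat_def)
qed

lemma charpoly: "det (mat z - cmat C) = (\<Prod>i\<in>UNIV. z - \<omega> ^ d i)"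
proof (rule eigenbasis(1)[OF _ evv_basis])
 fix i
 have "cmat C *v evv v (\<psi> i) = \<omega> ^ d i *s evv v (\<psi> i)" using evv_eigen[of "Suc 0" i] by (simp add: mat_pow_1)
 moreover have "mat z *v y = z *s y" for y :: "complex^'n"
  by (simp add: vec_eq_iff matrix_vector_mult_def mat_def if_distrib if_distribR cong: if_cong)
 ultimately show "(mat z - cmat C) *v evv v (\<psi> i) = (z - \<omega> ^ d i) *s evv v (\<psi> i)"
  by (simp add: matrix_vector_mult_diff_rdistrib vec_eq_iff algebra_simps)
qed

lemma ex_root: "\<exists>\<beta>. \<beta> \<in> \<Phi>" using D_nonempty D_root by blast

lemma v_eigen: "cmat (mat_pow C k) *v v = \<omega> ^ k *s v"
 by (induction k) (simp_all add: mat_pow_0 cmat_id mat_pow_Suc cmat_mult matrix_vector_mul_assoc[symmetric] vec.scale v vector_smult_assoc mult.commute)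

lemma v_nonzero: "v ~= 0"
 using ex_root reg by (force simp: cip_def)

text \<open>If the r-th power of \<omega> is 1, then all eigenvalues of the r-th power of C are 1,
  and this power, diagonal on the values of the basis, is the identity.\<close>

lemma order: "\<omega> ^ k = 1 \<longleftrightarrow> h dvd k"
proof -
 have h1: "\<omega> ^ h = 1"
 proof -
  have "v = \<omega> ^ h *s v" using v_eigen[of h] by (simp add: Ch cmat_id)
  moreover obtain j where "v $ j ~= 0" using v_nonzero by (auto simp: vec_eq_iff)
  ultimately have "v $ j = \<omega> ^ h * v $ j" by (metis vector_smult_component)
  then show ?thesis using \<open>v $ j ~= 0\<close> by simp
 qed
 have "\<omega> ^ k = \<omega> ^ (k mod h)"
 proof -
  have "\<omega> ^ k = (\<omega> ^ h) ^ (k div h) * \<omega> ^ (k mod h)" by (simp flip: power_mult power_add)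
  then show ?thesis using h1 by simp
 qed
 moreover have "\<omega> ^ r ~= 1" if r: "0 < r" "r < h" for r
 proof
  assume a: "\<omega> ^ r = 1"
  have "cmat (mat_pow C r) = mat 1"
  proof (rule eigenbasis(3)[OF evv_eigen evv_basis])
   fix i
   have "(\<omega> ^ d i) ^ r = (\<omega> ^ r) ^ d i" by (simp add: mult.commute flip: power_mult)
   then show "(\<omega> ^ d i) ^ r = 1" using a by simp
  qed
  then have "complex_of_real (mat_pow C r $ i $ j) = complex_of_real (mat 1 $ i $ j)" for i j
   by (simp add: vec_eq_iff cmat_def mat_def)
  then have "mat_pow C r = mat 1" by (simp only: of_real_eq_iff vec_eq_iff) simp
  then show False using Cmin r by blast
 qed
 moreover have "k mod h < h" using h0 by simp
 ultimately show ?thesis by (cases "k mod h = 0") (auto simp: dvd_eq_mod_eq_0)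
qed

lemma omega_norm: "norm \<omega> = 1"
proof -
 have "norm \<omega> ^ h = 1" using order[of h] by (simp flip: norm_power)
 then show ?thesis using power_eq_imp_eq_base[of "norm \<omega>" h 1] h0 by simp
qed

lemma eigenvalue_not_1: "\<not> h dvd d i"
proof
 assume "h dvd d i"
 then have f: "cmat C *v evv v (\<psi> i) = evv v (\<psi> i)" using evv_eigen[of "Suc 0" i] order[of "d i"] by (simp add: mat_pow_1)
 let ?w = "evv v (\<psi> i)"
 define a where "a = (\<chi> j. Re (?w $ j))"
 define b where "b = (\<chi> j. Im (?w $ j))"
 have "C *v a = a" "C *v b = b"
  using arg_cong[OF f, of "%u. \<chi> j. Re (u $ j)"] arg_cong[OF f, of "%u. \<chi> j. Im (u $ j)"]
  by (simp_all add: a_def b_def vec_eq_iff matrix_vector_mult_def cmat_def Re_sum Im_sum)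
 then have "a = 0" "b = 0" using C_fixed by blast+
 then have "?w = 0" by (simp add: a_def b_def vec_eq_iff complex_eq_iff)
 then have "row i (\<chi> i. evv v (\<psi> i)) = 0" by (simp add: row_def vec_eq_iff)
 then show False using evv_basis det_zero_row by blast
qed

text \<open>Every root is one of the h powers of C applied to one of the at most n crossing
  roots.\<close>

lemma card_roots_le: "card \<Phi> <= CARD('n) * h"
proof -
 have "\<Phi> <= (%(\<delta>, k). mat_pow C k *v \<delta>) ` (crs \<times> {..<h})"
 proof
  fix \<gamma> assume "\<gamma> \<in> \<Phi>"
  then obtain k where k: "mat_pow C k *v \<gamma> \<in> crs" using orbit_crossing by blast
  let ?j = "h - k mod h"
  have "mat_pow C (?j + k) = mat 1"
  proof -
   have "k mod h < h" using h0 by simp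
   then have "(?j + k mod h) mod h = 0" by simp
   then have "(?j + k) mod h = 0" by (simp only: mod_add_right_eq)
   then show ?thesis using Cp_mod[of "?j + k"] by (simp add: mat_pow_0)
  qed
  then have "mat_pow C (?j mod h) *v (mat_pow C k *v \<gamma>) = \<gamma>"
   using Cp_mod[of ?j] by (simp add: mat_pow_add matrix_vector_mul_assoc)
  then show "\<gamma> \<in> (%(\<delta>, k). mat_pow C k *v \<delta>) ` (crs \<times> {..<h})"
   using k h0 by (intro image_eqI[of _ _ "(mat_pow C k *v \<gamma>, ?j mod h)"]) auto
 qed
 moreover have f: "finite crs" by (simp add: crs_def)
 ultimately have "card \<Phi> <= card (crs \<times> {..<h})" by (intro surj_card_le) auto
 also have "\<dots> <= CARD('n) * h" using card_crs by (simp add: card_cartesian_product)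
 finally show ?thesis .
qed

text \<open>C is real, so its spectrum is stable under complex conjugation, which inverts the powers
  of \<omega>.\<close>

lemma residue_duality: "card {i. d i mod h = r} = card {i. h dvd d i + r}" if "r < h"
proof -
 have "card {i. \<omega> ^ d i = \<omega> ^ r} = card {i. cnj (\<omega> ^ d i) = \<omega> ^ r}"
 proof (rule power_sums_determine_multiplicities[OF h0])
  show "(\<omega> ^ d i) ^ h = 1" "(cnj (\<omega> ^ d i)) ^ h = 1" for i
  proof -
   show 1: "(\<omega> ^ d i) ^ h = 1" using order[of "d i * h"] by (simp add: power_mult)
   show "(cnj (\<omega> ^ d i)) ^ h = 1" using arg_cong[OF 1, of cnj] by simp
  qed
  show "(\<omega> ^ r) ^ h = 1" using order[of "r * h"] by (simp add: power_mult)
  show "(\<Sum>i\<in>UNIV. (\<omega> ^ d i) ^ k) = (\<Sum>i\<in>UNIV. (cnj (\<omega> ^ d i)) ^ k)" for k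
  proof -
   have "cnj (\<Sum>i\<in>UNIV. (\<omega> ^ d i) ^ k) = (\<Sum>i\<in>UNIV. (\<omega> ^ d i) ^ k)" unfolding trace_eigen[symmetric] by (rule complex_cnj_complex_of_real)
   then show ?thesis by simp
  qed
 qed
 moreover have "\<omega> ^ a = \<omega> ^ r \<longleftrightarrow> a mod h = r" for a
 proof -
  have w0: "\<omega> ^ (h - r) ~= 0" using omega_norm by auto
  have "\<omega> ^ a = \<omega> ^ r \<longleftrightarrow> \<omega> ^ (a + (h - r)) = \<omega> ^ (r + (h - r))" unfolding power_add mult_cancel_right using w0 by blast
  also have "\<dots> \<longleftrightarrow> h dvd a + (h - r)" using order[of "a + (h - r)"] order[of h] that by simp
  also have "\<dots> \<longleftrightarrow> a mod h = r"
  proof -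
   have "h dvd a + (h - r) \<longleftrightarrow> int h dvd int a - int r"
   proof -
    have "int (a + (h - r)) = (int a - int r) + int h" using that by simp
    then have "int h dvd int (a + (h - r)) \<longleftrightarrow> int h dvd int a - int r" by (simp only: dvd_add_left_iff dvd_refl)
    then show ?thesis by (simp only: int_dvd_int_iff)
   qed
   also have "\<dots> \<longleftrightarrow> int (a mod h) = int (r mod h)" by (simp only: mod_eq_dvd_iff[symmetric] of_nat_mod)
   also have "\<dots> \<longleftrightarrow> a mod h = r mod h" by simp
   finally show ?thesis using that by simp
  qed
  finally show ?thesis .
 qed
 moreover have "cnj (\<omega> ^ a) = \<omega> ^ r \<longleftrightarrow> h dvd a + r" for a
 proof -
  have n: "\<omega> ^ a * cnj (\<omega> ^ a) = 1" unfolding complex_norm_square[symmetric] norm_power omega_norm by simp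
  have "cnj (\<omega> ^ a) = \<omega> ^ r \<longleftrightarrow> \<omega> ^ a * \<omega> ^ r = 1"
  proof
   assume "\<omega> ^ a * \<omega> ^ r = 1"
   then have "\<omega> ^ a * \<omega> ^ r = \<omega> ^ a * cnj (\<omega> ^ a)" using n by simp
   moreover have "\<omega> ^ a ~= 0" using omega_norm by auto
   ultimately show "cnj (\<omega> ^ a) = \<omega> ^ r" unfolding mult_cancel_left by (elim disjE) (erule (1) notE, erule sym)
  qed (use n in simp)
  then show ?thesis using order[of "a + r"] by (simp add: power_add)
 qed
 ultimately show ?thesis by simp
qed

lemma residue_sum: "2 * (\<Sum>i\<in>UNIV. d i mod h) = CARD('n) * h"
proof -
 define n where "n r = card {i. d i mod h = r}" for r
 have n: "n r = n (h - r)" if "r \<in> {1..<h}" for r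
 proof -
  have "{i. h dvd d i + r} = {i. d i mod h = h - r}"
  proof -
   have "h dvd a + r \<longleftrightarrow> a mod h = h - r" for a
   proof -
    have "h dvd a + r \<longleftrightarrow> h dvd a mod h + r" by (simp add: dvd_eq_mod_eq_0 mod_add_left_eq)
    also have "\<dots> \<longleftrightarrow> a mod h = h - r"
    proof
     assume "h dvd a mod h + r"
     then obtain k where k: "a mod h + r = h * k" by blast
     have "a mod h < h" using h0 by simp
     then have "a mod h + r < h * 2" "0 < a mod h + r" using that unfolding atLeastLessThan_iff by linarith+
     then have "k < 2" "0 < k" unfolding k using h0 by auto
     then have "k = 1" by simp
     then show "a mod h = h - r" using k by simp
    qed (use that in auto)
    finally show ?thesis .
   qed
   then show ?thesis by simp
  qed
  then show ?thesis using residue_duality[of r] that by (simp add: n_def)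
 qed
 have rng: "(%i. d i mod h) ` UNIV <= {1..<h}" using eigenvalue_not_1 h0 by (auto simp: dvd_eq_mod_eq_0 Suc_le_eq)
 have s: "(\<Sum>i\<in>UNIV. f (d i mod h)) = (\<Sum>r\<in>{1..<h}. n r * f r)" for f :: "nat => nat"
  using sum_fun_comp[OF finite_class.finite_UNIV finite_atLeastLessThan rng, of f] by (simp add: n_def)
 have "(\<Sum>r\<in>{1..<h}. n r * r) = (\<Sum>r\<in>{1..<h}. n (h - r) * (h - r))"
  by (rule sum.reindex_bij_witness[of _ "%r. h - r" "%r. h - r"]) auto
 also have "\<dots> = (\<Sum>r\<in>{1..<h}. n r * (h - r))" by (rule sum.cong) (use n in auto)
 finally have "2 * (\<Sum>r\<in>{1..<h}. n r * r) = (\<Sum>r\<in>{1..<h}. n r * r) + (\<Sum>r\<in>{1..<h}. n r * (h - r))" by simp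
 also have "\<dots> = (\<Sum>r\<in>{1..<h}. n r * h)" unfolding sum.distrib[symmetric]
  by (rule sum.cong) (auto simp: add_mult_distrib2[symmetric])
 also have "\<dots> = CARD('n) * h" using s[of "%_. h"] by simp
 finally show ?thesis using s[of "%r. r"] by simp
qed

text \<open>The residues of the degrees sum to n h / 2 by duality. The degrees sum to the number of
  positive roots, at most n h / 2 by the orbit bound. No residue exceeds its degree, so equality
  holds throughout.\<close>

lemma degree_mod: "d i mod h = d i" and card_P: "2 * card P = CARD('n) * h"
proof -
 have le: "(\<Sum>i\<in>UNIV. d i mod h) <= (\<Sum>i\<in>UNIV. d i)" by (intro sum_mono) simp
 have "2 * (\<Sum>i\<in>UNIV. d i) <= CARD('n) * h" using card_roots_le card_roots sumd by simp
 then have eq: "(\<Sum>i\<in>UNIV. d i mod h) = (\<Sum>i\<in>UNIV. d i)" using residue_sum le by simp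
 then show "2 * card P = CARD('n) * h" using residue_sum sumd by simp
 have "(\<Sum>i\<in>UNIV. d i - d i mod h) = 0"
  using sum_subtractf_nat[of UNIV "%i. d i mod h" d] eq by simp
 then have "d i - d i mod h = 0" by simp
 then show "d i mod h = d i" using mod_less_eq_dividend[of "d i" h] by linarith
qed

lemma degree_bounds: "1 <= d i" "d i < h"
proof -
 show "1 <= d i" using eigenvalue_not_1[of i] by (cases "d i") auto
 show "d i < h" using degree_mod[of i] mod_less_divisor[OF h0, of "d i"] by simp
qed

lemma hh_eq: "hh = real h"
proof -
 have "real (2 * card P) = real (CARD('n) * h)" using card_P by simp
 then have "2 * real (card P) = real CARD('n) * real h" by simp
 then show ?thesis unfolding hh_def by simp
qed

lemma degree_duality: assumes "r <= h" shows "card {i. d i = r} = card {i. d i = h - r}"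
proof (cases "r = 0 | r = h")
 case True
 have "d i ~= 0 & d i ~= h" for i using degree_bounds[of i] by auto
 then have "{i. d i = 0} = {}" "{i. d i = h} = {}" by simp_all
 then show ?thesis using True by auto
next
 case False
 then have r: "0 < r" "r < h" using assms by auto
 have "{i. h dvd d i + r} = {i. d i = h - r}"
 proof -
  have "h dvd d i + r \<longleftrightarrow> d i = h - r" for i
  proof
   assume "h dvd d i + r"
   then obtain k where k: "d i + r = h * k" by blast
   have "d i + r < h * 2" "0 < d i + r" using r degree_bounds[of i] by auto
   then have "k < 2" "0 < k" unfolding k using h0 by auto
   then have "k = 1" by simp
   then show "d i = h - r" using k by simp
  qed (use r in auto)
  then show ?thesis by simp
 qed
 then show ?thesis using residue_duality[OF r(2)] degree_mod by simp
qed

end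

context spectral begin

text \<open>Traces of powers of C are integers bounded by the dimension, and replacing k by k p does
  not change them modulo p; when p exceeds twice the dimension, congruence is equality. This acts
  like the Galois automorphism taking \<omega> to its n-th power.\<close>

lemma galois_power_sums:
 assumes "0 < n" "!!p. prime p ==> p dvd n ==> 2 * CARD('n) < p"
 shows "(\<Sum>i\<in>UNIV. (\<omega> ^ d i) ^ (k * n)) = (\<Sum>i\<in>UNIV. (\<omega> ^ d i) ^ k)"
proof -
 obtain A :: "int^'n^'n" where A: "!!k. trace (mat_pow C k) = of_int (trace (mat_pow A k))" using trace_integer by blast
 define T where "T k = trace (mat_pow A k)" for k
 have T: "complex_of_real (of_int (T k)) = (\<Sum>i\<in>UNIV. (\<omega> ^ d i) ^ k)" for k
  using trace_eigen[of k] by (simp add: A T_def)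
 have b: "\<bar>T k\<bar> <= int CARD('n)" for k
 proof -
  have "norm (complex_of_real (of_int (T k))) <= (\<Sum>i\<in>(UNIV::'n set). norm ((\<omega> ^ d i) ^ k))" unfolding T by (rule norm_sum)
  then show ?thesis by (simp add: norm_power omega_norm)
 qed
 have step: "T (k * p) = T k" if p: "prime p" "2 * CARD('n) < p" for k p
 proof (rule ccontr)
  assume n: "T (k * p) ~= T k"
  have "int p dvd T (k * p) - T k" unfolding T_def mat_pow_mult by (rule trace_mat_pow_prime[OF p(1)])
  then have "int p <= \<bar>T (k * p) - T k\<bar>" using n dvd_imp_le_int[of "T (k * p) - T k" "int p"] by simp
  then show False using b[of "k * p"] b[of k] p(2) by linarith
 qed
 have "T (k * n) = T k" using assms
 proof (induction n arbitrary: k rule: less_induct)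
  case (less n)
  show ?case
  proof (cases "n = 1")
   case False
   then obtain p where p: "prime p" "p dvd n" using prime_factor_nat by blast
   then obtain m where m: "n = p * m" by blast
   have m0: "0 < m" "m < n" using m less.prems(1) prime_gt_1_nat[OF p(1)] by auto
   have "T (k * n) = T (k * p * m)" by (simp add: m mult.assoc)
   also have "\<dots> = T (k * p)" using less.IH[OF m0(2,1), of "k * p"] less.prems(2) m by simp
   also have "\<dots> = T k" using step p less.prems(2) by blast
   finally show ?thesis .
  qed simp
 qed
 then show ?thesis by (simp only: T[symmetric])
qed

end

text \<open>Take for t the product of the primes up to N that do not divide x: a small prime
  dividing x does not divide h t, and any other small prime divides h t but not x.\<close>

lemma ex_congruent_with_large_primes:
 fixes x h N :: nat
 assumes "coprime x h" "0 < h"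
 shows "\<exists>t. 0 < x + h * t & (\<forall>p. prime p --> p dvd x + h * t --> N < p)"
proof -
 define S where "S = {p. prime p & p <= N & \<not> p dvd x}"
 have fS: "finite S" unfolding S_def by (rule finite_subset[of _ "{..N}"]) auto
 define t where "t = \<Prod>S"
 have t0: "0 < t" unfolding t_def using fS prime_gt_0_nat by (auto simp: S_def intro!: prod_pos)
 have "N < q" if q: "prime q" "q dvd x + h * t" for q
 proof (rule ccontr)
  assume "\<not> N < q"
  then have qN: "q <= N" by simp
  show False
  proof (cases "q dvd x")
   case True
   then have "q dvd h * t" using q(2) by (simp add: dvd_add_right_iff)
   moreover have "\<not> q dvd h" using coprime_common_divisor[OF assms(1) True] not_prime_unit q(1) by blast
   ultimately have "q dvd t" using prime_dvd_mult_iff[OF q(1)] by blast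
   then obtain p where p: "p \<in> S" "q dvd p" unfolding t_def using prime_dvd_prod_iff[OF fS q(1), of "%x. x"] by auto
   then have "q = p" using primes_dvd_imp_eq[OF q(1)] by (simp add: S_def)
   then show False using p(1) True by (simp add: S_def)
  next
   case False
   then have "q \<in> S" using q qN by (simp add: S_def)
   then have "q dvd h * t" unfolding t_def using fS by (intro dvd_mult dvd_prodI)
   then show False using q(2) False by (simp add: dvd_add_left_iff)
  qed
 qed
 then show ?thesis using t0 assms(2) by (intro exI[of _ t]) auto
qed

lemma linear_factors_determine_roots:
 fixes M N :: "complex multiset"
 assumes "!!z. (\<Prod>r\<in>#M. z - r) = (\<Prod>r\<in>#N. z - r)" shows "M = N"
proof -
 define f where "f M = (\<Prod>r\<in>#M. [:- r, 1:])" for M :: "complex multiset"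
 have p: "poly (f M) z = (\<Prod>r\<in>#M. z - r)" for M z unfolding f_def by (induction M) (auto simp: algebra_simps)
 have n: "f M ~= 0" for M unfolding f_def by (auto simp: prod_mset_zero_iff)
 have r: "proots (f M) = M" for M
 proof (induction M)
  case (add a M)
  have "proots (f (add_mset a M)) = proots ([:- a, 1:] * f M)" unfolding f_def by simp
  also have "\<dots> = proots [:- a, 1:] + proots (f M)" using n[of M] by (intro proots_mult) auto
  finally show ?case using add by simp
 qed (simp add: f_def)
 have "poly (f M) = poly (f N)" using p assms by auto
 then have "f M = f N" by (simp only: poly_eq_poly_eq_iff)
 then have "proots (f M) = proots (f N)" by simp
 then show ?thesis by (simp only: r)
qed

context spectral begin

text \<open>\<omega> is a primitive h-th root of unity, say the b-th power of exp(2 pi i / h). An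
  exponent inverse to b modulo h, with large prime factors only, carries \<omega> to exp(2 pi i / h)
  without changing the power sums, so both give the same multiset of eigenvalues. Degrees and
  exponents lie below h and are determined by it.\<close>

lemma exponents_eq_degrees:
 assumes E: "\<forall>e\<in>#E. e < h"
  and cp: "!!z. det (mat z - cmat C) = (\<Prod>e\<in>#E. z - exp (2 * of_real pi * \<i> * of_nat e / of_nat h))"
 shows "E = image_mset d (mset_set UNIV)"
proof -
 define Z where "Z e = exp (2 * of_real pi * \<i> * of_nat e / of_nat h)" for e :: nat
 have h1: "1 <= h" using h0 by simp
 have Zeq: "Z a = Z b \<longleftrightarrow> a mod h = b mod h" for a b unfolding Z_def by (rule complex_root_unity_eq[OF h1])
 have Zpow: "Z a ^ k = Z (a * k)" for a k unfolding Z_def by (simp add: exp_of_nat_mult[symmetric] mult_ac)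
 have Z0: "Z 0 = 1" by (simp add: Z_def)
 have hr: "(\<omega> ^ d i) ^ h = 1" for i using order[of "d i * h"] by (simp add: power_mult)
 have h2: "2 <= h" using hh_ge_2 hh_eq by simp
 have "\<omega> \<in> {z. z ^ h = 1}" using order[of h] by simp
 then have "\<exists>b<h. \<omega> = Z b" unfolding complex_roots_unity[OF h1] Z_def by auto
 then obtain b where b: "\<omega> = Z b" "b < h" by (elim exE conjE)
 have cop: "gcd b h = 1"
 proof -
  define g where "g = gcd b h"
  have "g dvd b" "g dvd h" by (simp_all add: g_def)
  then obtain b' h' where bh: "b = g * b'" "h = g * h'" by (elim dvdE)
  have "h' ~= 0" using bh(2) h0 by (intro notI) simp
  have "b * h' = b' * h" by (simp only: bh mult_ac)
  then have "Z (b * h') = Z 0" unfolding Zeq by simp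
  then have "\<omega> ^ h' = 1" by (simp only: b(1) Zpow Z0)
  then have "h dvd h'" by (simp only: order)
  then have "h <= h'" using \<open>h' ~= 0\<close> by (simp add: dvd_imp_le)
  then have "g * h' <= 1 * h'" by (simp only: bh(2)[symmetric] mult_1)
  then have "g <= 1" using \<open>h' ~= 0\<close> by simp
  moreover have "g ~= 0" using bh(2) h0 by (intro notI) simp
  ultimately show ?thesis unfolding g_def by linarith
 qed
 have "b ~= 0" using cop h2 by (intro notI) simp
 then obtain x y where xy: "b * x = h * y + 1" using bezout_nat[of b h] cop by auto
 have "coprime x h"
 proof (rule coprimeI)
  fix q assume "q dvd x" "q dvd h"
  then have "q dvd b * x" "q dvd h * y" by auto
  then show "is_unit q" unfolding xy using dvd_add_right_iff by blast
 qed
 from ex_congruent_with_large_primes[OF this h0, of "2 * CARD('n)"] obtain t where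
  t': "0 < x + h * t & (\<forall>p. prime p --> p dvd x + h * t --> 2 * CARD('n) < p)" by (rule exE)
 then have t: "0 < x + h * t" "!!p. prime p ==> p dvd x + h * t ==> 2 * CARD('n) < p" by simp_all
 have "\<omega> ^ (x + h * t) = Z 1"
 proof -
  have "b * (x + h * t) = h * (y + b * t) + 1" using xy by (simp add: algebra_simps)
  then have "Z (b * (x + h * t)) = Z 1" unfolding Zeq by (simp only: mod_mult_self4)
  then show ?thesis by (simp only: b(1) Zpow)
 qed
 then have wd: "(\<omega> ^ d i) ^ (k * (x + h * t)) = Z (d i) ^ k" for i k
 proof -
  assume a: "\<omega> ^ (x + h * t) = Z 1"
  have "(\<omega> ^ d i) ^ (k * (x + h * t)) = (\<omega> ^ (x + h * t)) ^ (d i * k)" by (simp only: power_mult[symmetric] mult_ac)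
  then show ?thesis by (simp only: a Zpow mult_1)
 qed
 have zr: "Z (d i) ^ h = 1" for i using Zeq[of "d i * h" 0] Z0 by (simp add: Zpow)
 have cnt: "card {i. \<omega> ^ d i = a} = card {i. Z (d i) = a}" for a
 proof (cases "a ^ h = 1")
  case True
  show ?thesis
   by (rule power_sums_determine_multiplicities[OF h0 hr zr True]) (use galois_power_sums[OF t] wd in simp)
 next
  case False
  then have "\<omega> ^ d i ~= a" "Z (d i) ~= a" for i using hr[of i] zr[of i] by auto
  then show ?thesis by simp
 qed
 have cm: "count (image_mset f (mset_set UNIV)) a = card {i. f i = a}" for f :: "'n => complex" and a
  by (simp add: count_image_mset vimage_def)
 have M12: "image_mset (%i. \<omega> ^ d i) (mset_set UNIV) = image_mset (%i. Z (d i)) (mset_set UNIV)"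
  by (rule multiset_eqI) (simp only: cm cnt)
 have "image_mset Z E = image_mset (%i. \<omega> ^ d i) (mset_set UNIV)"
 proof (rule linear_factors_determine_roots)
  fix z
  have "(\<Prod>r\<in>#image_mset Z E. z - r) = (\<Prod>e\<in>#E. z - Z e)" by (simp add: image_mset.compositionality o_def)
  also have "\<dots> = (\<Prod>i\<in>UNIV. z - \<omega> ^ d i)" using cp[of z] charpoly[of z] by (simp add: Z_def)
  also have "\<dots> = (\<Prod>r\<in>#image_mset (%i. \<omega> ^ d i) (mset_set UNIV). z - r)"
   by (simp add: prod_unfold_prod_mset image_mset.compositionality o_def)
  finally show "(\<Prod>r\<in>#image_mset Z E. z - r) = (\<Prod>r\<in>#image_mset (%i. \<omega> ^ d i) (mset_set UNIV). z - r)" .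
 qed
 then have eq: "image_mset Z E = image_mset (%i. Z (d i)) (mset_set UNIV)" using M12 by simp
 have "inj_on Z {..<h}" by (rule inj_onI) (simp add: Zeq)
 then have g: "inv_into {..<h} Z (Z e) = e" if "e < h" for e using that by simp
 have "image_mset (inv_into {..<h} Z) (image_mset Z E) = E"
 proof -
  have "image_mset (%e. inv_into {..<h} Z (Z e)) E = image_mset (%e. e) E" by (rule image_mset_cong) (use E g in auto)
  then show ?thesis by (simp add: image_mset.compositionality o_def)
 qed
 moreover have "image_mset (inv_into {..<h} Z) (image_mset (%i. Z (d i)) (mset_set UNIV)) = image_mset d (mset_set UNIV)"
  unfolding image_mset.compositionality o_def by (rule image_mset_cong) (use g degree_bounds in auto)
 ultimately show ?thesis using eq by simp
qed

end

section \<open>Derivations with higher multiplicities\<close>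

lemma rp_inner_vp: "vp \<theta> ==> vp \<phi> ==> rp (%x. \<theta> x \<bullet> \<phi> x)" for \<theta> :: "'a::euclidean_space => real^'n"
 unfolding inner_vec_def inner_real_def vp_def by (intro real_polynomial_function_sum rp_intros(4)) auto

lemma hom_inner_vhom: "vhom a \<theta> ==> vhom b \<phi> ==> hom (a + b) (%x. \<theta> x \<bullet> \<phi> x)" for \<theta> :: "'a::euclidean_space => real^'n"
 unfolding inner_vec_def inner_real_def vhom_iff by (intro hom_sum hom_mult) auto

lemma vp_grad: "rp p ==> vp (grad p)" for p :: "real^'n => real"
 unfolding vp_def using rp_grad[of p "axis i 1" for i] by (simp add: inner_axis')

lemma vp_id: "vp (%x. x :: real^'n)"
 unfolding vp_def
proof
 fix i show "rp (%x. (x :: real^'n) $ i)" using rp_inner[of "axis i 1 :: real^'n"] by (simp add: inner_axis')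
qed

lemma hom_grad:
 fixes p :: "'a::euclidean_space => real"
 assumes "hom e p" shows "hom (e - 1) (%x. u \<bullet> grad p x)"
proof -
 have rp: "rp p" using hom_rp[OF assms] .
 have s: "u \<bullet> grad p (r *\<^sub>R x) = r ^ (e - 1) * (u \<bullet> grad p x)" if r: "r ~= 0" for r x
 proof -
  have lin: "linear (%y. r *\<^sub>R y :: 'a)" by (rule linearI) (auto simp: algebra_simps)
  have "grad (%y. p (r *\<^sub>R y)) x = r ^ e *\<^sub>R grad p x"
   unfolding hom_scale[OF assms] by (rule grad_unique) (use has_derivative_mult_right[OF has_derivative_grad[OF rp], of "r ^ e"] in simp)
  then have eq: "r * (u \<bullet> grad p (r *\<^sub>R x)) = r ^ e * (u \<bullet> grad p x)"
   using grad_linear_compose[OF rp lin, of x u] by (simp add: inner_commute)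
  show ?thesis
  proof (cases e)
   \<comment> \<open>\<open>e - 1\<close> is truncated here; p is constant and its gradient is
     zero.\<close>
   case 0
   define k where "k = p 0"
   have pk: "p = (%x. k)" using hom_0_const assms 0 unfolding k_def by blast
   have "(p has_derivative (%h. 0 \<bullet> h)) (at y)" for y unfolding pk by simp
   then have "grad p y = 0" for y by (rule grad_unique)
   then show ?thesis by simp
  next
   case (Suc n) then show ?thesis using eq r by simp
  qed
 qed
 moreover have "u \<bullet> grad p 0 = 0 ^ (e - 1) * (u \<bullet> grad p x)" for x
 proof -
  have "((%r::real. u \<bullet> grad p (r *\<^sub>R x)) \<longlongrightarrow> u \<bullet> grad p 0) (at 0)" by (rule tendsto_scale_0[OF rp_grad[OF rp]])
  moreover have "((%r::real. r ^ (e - 1) * (u \<bullet> grad p x)) \<longlongrightarrow> 0 ^ (e - 1) * (u \<bullet> grad p x)) (at 0)"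
   by (intro tendsto_intros)
  then have "((%r::real. u \<bullet> grad p (r *\<^sub>R x)) \<longlongrightarrow> 0 ^ (e - 1) * (u \<bullet> grad p x)) (at 0)"
   by (rule Lim_transform_eventually) (auto simp: eventually_at_filter s)
  ultimately show ?thesis by (rule LIM_unique)
 qed
 ultimately have "u \<bullet> grad p (r *\<^sub>R x) = r ^ (e - 1) * (u \<bullet> grad p x)" for r x by (cases "r = 0") auto
 then show ?thesis using rp_grad[OF rp] by (simp add: hom_def)
qed

lemma vhom_grad: "hom e p ==> vhom (e - 1) (grad p)" for p :: "real^'n => real"
 unfolding vhom_iff using hom_grad[of e p "axis i 1" for i] by (simp add: inner_axis')

lemma grad_inner_vp:
 fixes \<theta> :: "'a::euclidean_space => real^'n"
 assumes "vp \<theta>" shows "grad (%x. u \<bullet> \<theta> x) x = (\<Sum>j\<in>UNIV. u $ j *\<^sub>R grad (%x. \<theta> x $ j) x)"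
proof (rule grad_unique)
 have "((%x. \<Sum>j\<in>UNIV. u $ j * \<theta> x $ j) has_derivative (%h. \<Sum>j\<in>UNIV. u $ j * (grad (%x. \<theta> x $ j) x \<bullet> h))) (at x)"
  using assms by (intro has_derivative_sum has_derivative_mult_right has_derivative_grad) (simp add: vp_def)
 then show "((%x. u \<bullet> \<theta> x) has_derivative (%h. (\<Sum>j\<in>UNIV. u $ j *\<^sub>R grad (%x. \<theta> x $ j) x) \<bullet> h)) (at x)"
  by (simp add: inner_vec_def[of u] inner_sum_left)
qed

lemma grad_invariant:
 assumes "rp p" "!!x. p (rfl \<alpha> x) = p x" shows "grad p (rfl \<alpha> x) = rfl \<alpha> (grad p x)"
proof -
 have "rfl \<alpha> (grad p (rfl \<alpha> x)) \<bullet> u = grad p x \<bullet> u" for u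
  using grad_linear_compose[OF assms(1) linear_rfl, of \<alpha> x u] assms(2) by (simp add: rfl_inner_swap)
 then have "rfl \<alpha> (grad p (rfl \<alpha> x)) = grad p x" using vector_eq_rdot by blast
 then show ?thesis using rfl_rfl[of \<alpha> "grad p (rfl \<alpha> x)"] by simp
qed

lemma det_rows_mult: "det (\<chi> i. M *v R i) = det M * det (\<chi> i. R i)" for M :: "real^'n^'n"
proof -
 have "(\<chi> i. M *v R i) = (\<chi> i. R i) ** transpose M"
  by (simp add: vec_eq_iff matrix_matrix_mult_def matrix_vector_mult_def transpose_def mult.commute)
 then show ?thesis by (simp add: det_mul det_transpose)
qed

lemma inner_rfl_self: "\<alpha> \<bullet> rfl \<alpha> x = - (\<alpha> \<bullet> x)"
 using rfl_inner_swap[of \<alpha> \<alpha> x] by (simp add: rfl_self)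

context spectral begin

section \<open>Mirrors and the top degree\<close>

lemma Qp_remove: "\<alpha> \<in> P ==> Qp x = (\<alpha> \<bullet> x) * (\<Prod>\<beta>\<in>P - {\<alpha>}. \<beta> \<bullet> x)"
 unfolding Qp_def using prod.remove[OF finite_P] by blast

lemma rest_generic: assumes "\<alpha> \<in> P" shows "\<exists>x. \<alpha> \<bullet> x = 0 & (\<Prod>\<beta>\<in>P - {\<alpha>}. \<beta> \<bullet> x) ~= 0"
proof -
 have "\<exists>x\<in>{x. \<alpha> \<bullet> x = 0}. (\<Prod>\<beta>\<in>P - {\<alpha>}. \<beta> \<bullet> x) ~= 0"
 proof (rule rp_prod_nonzero_subspace[OF subspace_hyperplane_inner])
  fix \<beta> assume "\<beta> \<in> P - {\<alpha>}"
  then show "\<exists>x\<in>{x. \<alpha> \<bullet> x = 0}. \<beta> \<bullet> x ~= 0" using nonparallel_hyperplane_point[OF P_nonpar[of \<beta> \<alpha>]] assms by auto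
 qed (use finite_P in auto)
 then show ?thesis by blast
qed

lemma rp_rest: "rp (%x. \<Prod>\<beta>\<in>P - {\<alpha>}. \<beta> \<bullet> x)"
 by (rule hom_rp[OF hom_prod_linear]) (use finite_P in simp)

lemma P_nonzero: "\<alpha> \<in> P ==> \<alpha> ~= 0" using P_root root_nonzero by blast

lemma Qp_nonzero: "\<exists>x. Qp x ~= 0"
proof -
 have "\<exists>x\<in>UNIV. (\<Prod>\<beta>\<in>P. \<beta> \<bullet> x) ~= 0"
 proof (rule rp_prod_nonzero_subspace[OF subspace_UNIV finite_P])
  fix \<beta> assume "\<beta> \<in> P"
  then show "\<exists>x\<in>UNIV. \<beta> \<bullet> x ~= 0" using P_nonzero by (intro bexI[of _ \<beta>]) auto
 qed auto
 then show ?thesis by (simp add: Qp_def)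
qed

text \<open>The determinant identity of the invariant basis is compared at x and at its reflection.
  The form \<alpha> changes sign and can be cancelled; the rest of \<open>Qp\<close> is compared at
  a generic point of the mirror, which is fixed.\<close>

lemma det_refl_mat: assumes a: "\<alpha> \<in> P" shows "det (refl_mat \<alpha>) = -1"
proof -
 let ?D = "det (refl_mat \<alpha>)" and ?Q = "%x. \<Prod>\<beta>\<in>P - {\<alpha>}. \<beta> \<bullet> x"
 have "c * Qp (rfl \<alpha> x) = ?D * (c * Qp x)" for x
 proof -
  have "c * Qp (rfl \<alpha> x) = det (\<chi> i. refl_mat \<alpha> *v \<psi> i x)"
   unfolding detc[symmetric] by (simp only: eqv_rfl[OF psi(3) P_root[OF a]] refl_mat_rfl)
  then show ?thesis by (simp only: det_rows_mult detc)
 qed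
 then have "(\<alpha> \<bullet> x) * (- ?Q (rfl \<alpha> x)) = (\<alpha> \<bullet> x) * (?D * ?Q x)" for x
  using c0 Qp_remove[OF a, of x] Qp_remove[OF a, of "rfl \<alpha> x"] by (simp add: inner_rfl_self mult_ac)
 then have "- ?Q (rfl \<alpha> x) = ?D * ?Q x" for x
  by (rule rp_cancel[of "%x. - ?Q (rfl \<alpha> x)" "%x. ?D * ?Q x" "%x. \<alpha> \<bullet> x", rotated 3])
   (use P_nonzero[OF a] rp_linear_compose[OF rp_rest linear_rfl] rp_cmult[OF rp_rest] in \<open>auto intro: exI[of _ \<alpha>]\<close>)
 note eq = this
 obtain x where x: "\<alpha> \<bullet> x = 0" "?Q x ~= 0" using rest_generic[OF a] by blast
 have "- ?Q x = ?D * ?Q x" using eq[of x] unfolding rfl_fixed[OF x(1)] .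
 then have "(?D + 1) * ?Q x = 0" by (simp add: algebra_simps)
 then show ?thesis using x(2) by simp
qed

text \<open>\<omega> is itself an eigenvalue of C, with eigenvector v. So it equals its own power
  for some degree, and h divides that degree minus 1.\<close>

lemma ex_degree_1: "\<exists>i. d i = 1"
proof -
 have h2: "2 <= h" using hh_ge_2 hh_eq by simp
 have "mat \<omega> *v v = \<omega> *s v" by (simp add: vec_eq_iff matrix_vector_mult_def mat_def if_distrib if_distribR cong: if_cong)
 then have "(mat \<omega> - cmat C) *v v = 0" using v by (simp add: matrix_vector_mult_diff_rdistrib)
 moreover have "x = 0" if "invertible (mat \<omega> - cmat C)" "(mat \<omega> - cmat C) *v x = 0" for x
 proof -
  obtain B where B: "B ** (mat \<omega> - cmat C) = mat 1" using \<open>invertible (mat \<omega> - cmat C)\<close> unfolding invertible_def by blast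
  have "x = B *v ((mat \<omega> - cmat C) *v x)" by (simp only: matrix_vector_mul_assoc B matrix_vector_mul_lid)
  then show ?thesis using that(2) by simp
 qed
 ultimately have "det (mat \<omega> - cmat C) = 0" using v_nonzero invertible_det_nz[of "mat \<omega> - cmat C"] by blast
 then obtain i where "\<omega> - \<omega> ^ d i = 0" unfolding charpoly by auto
 then have "\<omega> * (1 - \<omega> ^ (d i - 1)) = 0" using degree_bounds[of i] by (cases "d i") (auto simp: algebra_simps)
 then have "\<omega> ^ (d i - 1) = 1" using omega_norm by auto
 then have "d i - 1 = 0" using order[of "d i - 1"] degree_bounds[of i] by (auto dest: dvd_imp_le)
 then show ?thesis using degree_bounds[of i] by (intro exI[of _ i]) simp
qed

text \<open>Equivariant fields of degree 1 are linear maps commuting with the reflections, hence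
  scalars, so two of them are dependent.\<close>

lemma degree_1_unique: assumes "d i = 1" "d j = 1" shows "i = j"
proof (rule ccontr)
 assume ij: "i ~= j"
 have lin: "linear (\<psi> k)" if k: "d k = 1" for k
 proof -
  define G where "G b = grad (%x. \<psi> k x $ b) 0" for b
  have "\<psi> k x $ b = G b \<bullet> x" for x b
  proof -
   have "hom 1 (%x. \<psi> k x $ b)" using psi(2)[of k] k by (simp add: vhom_iff)
   then have hm: "hom 0 (%y. x \<bullet> grad (%x. \<psi> k x $ b) y)" "x \<bullet> grad (%x. \<psi> k x $ b) x = real 1 * \<psi> k x $ b"
    using hom_grad[of 1 "%x. \<psi> k x $ b" x] euler_homogeneous[of 1 "%x. \<psi> k x $ b" x] by simp_all
   then show ?thesis using hom_0_const[OF hm(1), of x] by (simp add: inner_commute G_def)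
  qed
  then show ?thesis by (intro linearI) (simp_all add: vec_eq_iff inner_add_right)
 qed
 obtain a b where ab: "!!x. \<psi> i x = a *\<^sub>R x" "!!x. \<psi> j x = b *\<^sub>R x"
  using commuting_scalar[OF lin[OF assms(1)] eqv_rfl[OF psi(3)]] commuting_scalar[OF lin[OF assms(2)] eqv_rfl[OF psi(3)]] by blast
 obtain x where x: "det (\<chi> k. \<psi> k x) ~= 0" using Qp_nonzero c0 unfolding detc by auto
 have "(\<Sum>k\<in>UNIV. (if k = i then b else if k = j then - a else 0) *\<^sub>R \<psi> k x) = 0"
 proof -
  have "(\<Sum>k\<in>UNIV. (if k = i then b else if k = j then - a else 0) *\<^sub>R \<psi> k x)
   = (\<Sum>k\<in>{i, j}. (if k = i then b else if k = j then - a else 0) *\<^sub>R \<psi> k x)"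
   by (rule sum.mono_neutral_right) auto
  also have "\<dots> = 0" using ij by (simp add: ab)
  finally show ?thesis .
 qed
 from det_nonzero_independent[OF x this, of i] det_nonzero_independent[OF x this, of j] ij have "\<psi> i x = 0" by (simp add: ab)
 then have "row i (\<chi> k. \<psi> k x) = 0" by (simp add: row_def vec_eq_iff)
 then show False using x det_zero_row by blast
qed

text \<open>Duality moves the unique degree 1 to a unique degree h - 1, which singles out the index
  of the primitive field.\<close>

lemma ex_top: "\<exists>t. d t = h - 1 & (\<forall>i. i ~= t --> d i + 1 < h)"
proof -
 obtain i where i: "d i = 1" using ex_degree_1 by blast
 then have "{i. d i = 1} = {i}" using degree_1_unique by auto
 then have "card {i. d i = h - 1} = 1" using degree_duality[of 1] h0 by simp
 then obtain t where t: "{i. d i = h - 1} = {t}" by (rule card_1_singletonE)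
 have "d j + 1 < h" if "j ~= t" for j
 proof -
  have "d j ~= h - 1" using t that by blast
  then show ?thesis using degree_bounds[of j] by linarith
 qed
 then show ?thesis using t by blast
qed

end

locale spectral_top = spectral \<Phi> P \<Delta> L C h \<psi> d c v \<omega>
 for \<Phi> P \<Delta> :: "(real^'n) set" and L C h \<psi> d c v \<omega> +
 fixes t assumes dt: "d t = h - 1" and dnt: "!!i. i ~= t ==> d i + 1 < h"
begin

text \<open>Cofactors of row t: up to the factor \<open>c * Qp\<close> this vector is dual to
  \<open>\<psi> t\<close> and annihilates the other basis fields. The coefficients of eta / Qp have
  degree 1 - h, so differentiation along it lowers degrees by h.\<close>

definition eta :: "real^'n => real^'n" where
 "eta x = (\<chi> b. det (\<chi> k. if k = t then axis b 1 else \<psi> k x))"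

lemma eta_inner: "eta x \<bullet> u = det (\<chi> k. if k = t then u else \<psi> k x)"
proof -
 have "det (\<chi> k. if k = t then u else \<psi> k x) = det (\<chi> k. if k = t then (\<Sum>b\<in>UNIV. u $ b *s axis b 1) else \<psi> k x)"
  by (simp only: basis_expansion)
 also have "\<dots> = (\<Sum>b\<in>UNIV. det (\<chi> k. if k = t then u $ b *s axis b 1 else \<psi> k x))"
  using det_linear_row_sum[of UNIV t "%_ b. u $ b *s axis b 1" "%k. \<psi> k x"] by simp
 also have "\<dots> = (\<Sum>b\<in>UNIV. u $ b * det (\<chi> k. if k = t then axis b 1 else \<psi> k x))"
  using det_row_mul[of t "u $ b" "%_. axis b 1" "%k. \<psi> k x" for b] by simp
 finally show ?thesis by (simp add: eta_def inner_vec_def mult.commute)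
qed

lemma vhom_eta: "vhom (card P - d t) eta"
 unfolding vhom_iff
proof
 fix b
 have "vhom ((d(t := 0)) k) (%x. if k = t then axis b 1 else \<psi> k x)" for k
  using psi(2)[of k] by (cases "k = t") (auto simp: vhom_def vp_const)
 then have "hom (\<Sum>k\<in>UNIV. (d(t := 0)) k) (%x. det (\<chi> k. if k = t then axis b 1 else \<psi> k x))"
  by (rule hom_det[of "d(t := 0)" "%k x. if k = t then axis b 1 else \<psi> k x"])
 moreover have "(\<Sum>k\<in>UNIV. (d(t := 0)) k) = card P - d t"
 proof -
  have "(\<Sum>k\<in>UNIV. (d(t := 0)) k) = (\<Sum>k\<in>UNIV - {t}. (d(t := 0)) k)" by (subst sum.remove[of _ t]) auto
  also have "\<dots> = (\<Sum>k\<in>UNIV - {t}. d k)" by (rule sum.cong) auto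
  finally show ?thesis using sumd sum.remove[of UNIV t d] by simp
 qed
 ultimately show "hom (card P - d t) (%x. eta x $ b)" by (simp add: eta_def)
qed

lemma vp_eta: "vp eta" using vhom_vp[OF vhom_eta] .

lemma eta_psi: "eta x \<bullet> \<psi> i x = (if i = t then c * Qp x else 0)"
proof (cases "i = t")
 case True
 then have "(\<chi> k. if k = t then \<psi> i x else \<psi> k x) = (\<chi> k. \<psi> k x)" by (simp add: vec_eq_iff)
 then have "eta x \<bullet> \<psi> i x = c * Qp x" by (simp only: eta_inner detc)
 then show ?thesis using True by simp
next
 case False
 have "det (\<chi> k. if k = t then \<psi> i x else \<psi> k x) = 0"
  by (rule det_identical_rows[OF False]) (use False in \<open>simp add: row_def vec_eq_iff\<close>)
 then show ?thesis using False by (simp add: eta_inner)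
qed

text \<open>On the mirror the basis fields are orthogonal to \<alpha>; if u is too, so are all rows.
  Hence eta is a multiple of \<alpha> there.\<close>

lemma eta_perp: assumes "\<alpha> \<in> P" "\<alpha> \<bullet> x = 0" "\<alpha> \<bullet> u = 0" shows "eta x \<bullet> u = 0"
 unfolding eta_inner by (rule det_eq_0_orthogonal[of \<alpha>]) (use assms P_nonzero psi(1) in \<open>auto simp: D1_def\<close>)

lemma eta_rfl: assumes "\<alpha> \<in> P" shows "eta (rfl \<alpha> x) = - rfl \<alpha> (eta x)"
proof -
 have "eta (rfl \<alpha> x) \<bullet> u = (- rfl \<alpha> (eta x)) \<bullet> u" for u
 proof -
  have "(\<chi> k. if k = t then u else \<psi> k (rfl \<alpha> x)) = (\<chi> k. refl_mat \<alpha> *v (if k = t then rfl \<alpha> u else \<psi> k x))"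
   by (auto simp: vec_eq_iff refl_mat_rfl rfl_rfl eqv_rfl[OF psi(3) P_root[OF assms]])
  then have "eta (rfl \<alpha> x) \<bullet> u = det (refl_mat \<alpha>) * (eta x \<bullet> rfl \<alpha> u)" unfolding eta_inner by (simp only: det_rows_mult)
  then show ?thesis by (simp add: det_refl_mat[OF assms] rfl_inner_swap)
 qed
 then show ?thesis using vector_eq_rdot by blast
qed

text \<open>Passing from v to C v = \<omega> v multiplies the value by the k-th power of \<omega>,
  and invariance leaves it unchanged.\<close>

lemma invariant_vanishes:
 assumes "hom k f" "!!x. f (C *v x) = f x" "\<not> h dvd k" shows "ev v f = 0"
proof -
 have "ev v f = ev v (%x. f (C *v x))" by (simp only: assms(2))
 also have "\<dots> = ev (cmat C *v v) f" by (rule ev_matrix[OF hom_rp[OF assms(1)]])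
 also have "\<dots> = \<omega> ^ k * ev v f" by (simp only: v ev_hom[OF assms(1)])
 finally have "(\<omega> ^ k - 1) * ev v f = 0" by (simp add: algebra_simps)
 then show ?thesis using order[of k] assms(3) by simp
qed

lemma cancel_linear:
 fixes \<alpha> :: "'b::euclidean_space"
 assumes "\<alpha> ~= 0" "rp p" "rp q" "!!x. (\<alpha> \<bullet> x) * p x = (\<alpha> \<bullet> x) * q x" shows "p x = q x"
 by (rule rp_cancel[OF assms(2,3) rp_inner assms(4)]) (use assms(1) in \<open>auto intro: exI[of _ \<alpha>]\<close>)

text \<open>If \<open>eta\<close> vanished on some mirror, the product \<open>p\<close> of the squares of all such roots would be an
 invariant whose gradient has no \<open>\<psi> t\<close> component, so Euler's formula would force \<open>p\<close> to vanish
 at the regular eigenvector.\<close>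
lemma eta_generic: assumes a: "\<alpha> \<in> P" shows "\<exists>x. \<alpha> \<bullet> x = 0 & eta x \<bullet> \<alpha> ~= 0"
proof (rule ccontr)
 assume n: "\<not> ?thesis"
 define O' where "O' = {\<beta>\<in>P. \<forall>x. \<beta> \<bullet> x = 0 --> eta x = 0}"
 have fO: "finite O'" and OP: "!!\<beta>. \<beta> \<in> O' ==> \<beta> \<in> P" using finite_P by (auto simp: O'_def)
 have aO: "\<alpha> \<in> O'"
 proof -
  have "eta x = 0" if x: "\<alpha> \<bullet> x = 0" for x
  proof -
   have "\<alpha> \<bullet> eta x = 0" using n x by (auto simp: inner_commute)
   from eta_perp[OF a x this] show ?thesis by simp
  qed
  then show ?thesis using a by (simp add: O'_def)
 qed
 have cO: "1 <= card O'" using aO fO by (auto simp: Suc_le_eq card_gt_0_iff)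
 \<comment> \<open>The reflections acting on mirrors, with signs chosen so as to return to positive
   roots. The action preserves O', which makes p invariant.\<close>
 define f where "f \<gamma> \<beta> = (if rfl \<gamma> \<beta> \<in> P then rfl \<gamma> \<beta> else - rfl \<gamma> \<beta>)" for \<gamma> \<beta>
 have fP: "f \<gamma> \<beta> \<in> P" if "\<gamma> \<in> P" "\<beta> \<in> P" for \<gamma> \<beta>
  using pos_or_neg[OF rfl_root[OF P_root P_root]] that by (auto simp: f_def)
 have ff: "f \<gamma> (f \<gamma> \<beta>) = \<beta>" if "\<beta> \<in> P" for \<gamma> \<beta>
  using that neg_notin_P[OF that] by (auto simp: f_def rfl_rfl linear_neg[OF linear_rfl])
 have fO': "f \<gamma> \<beta> \<in> O'" if g: "\<gamma> \<in> P" "\<beta> \<in> O'" for \<gamma> \<beta>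
 proof -
  have "eta x = 0" if x: "f \<gamma> \<beta> \<bullet> x = 0" for x
  proof -
   have "rfl \<gamma> \<beta> \<bullet> x = 0" using x by (auto simp: f_def split: if_splits)
   then have "eta (rfl \<gamma> x) = 0" using g(2) by (simp add: O'_def rfl_inner_swap)
   then have "rfl \<gamma> (eta x) = 0" using eta_rfl[OF g(1), of x] by simp
   then have "rfl \<gamma> (rfl \<gamma> (eta x)) = 0" by (simp add: linear_0[OF linear_rfl])
   then show ?thesis by (simp add: rfl_rfl)
  qed
  then show ?thesis using fP[OF g(1) OP[OF g(2)]] by (simp add: O'_def)
 qed
 define p where "p x = (\<Prod>\<beta>\<in>O'. (\<beta> \<bullet> x)\<^sup>2)" for x
 have pinv: "p (rfl \<gamma> x) = p x" if g: "\<gamma> \<in> P" for \<gamma> x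
 proof -
  have "p (rfl \<gamma> x) = (\<Prod>\<beta>\<in>O'. (f \<gamma> \<beta> \<bullet> x)\<^sup>2)" unfolding p_def by (intro prod.cong refl) (simp add: f_def rfl_inner_swap)
  also have "\<dots> = p x" unfolding p_def
   by (rule prod.reindex_bij_witness[of _ "f \<gamma>" "f \<gamma>"]) (use ff OP fO'[OF g] in auto)
  finally show ?thesis .
 qed
 have "hom (\<Sum>\<beta>\<in>O'. 2 * 1) p" unfolding p_def[abs_def] by (intro hom_prod fO hom_power hom_inner)
 then have hp: "hom (2 * card O') p" by (simp add: mult.commute)
 then have rpp: "rp p" by (rule hom_rp)
 have gD: "grad p \<in> D1"
 proof -
  have "\<beta> \<bullet> grad p x = 0" if b: "\<beta> \<in> P" "\<beta> \<bullet> x = 0" for \<beta> x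
  proof -
   have "grad p x = rfl \<beta> (grad p x)" using grad_invariant[OF rpp pinv[OF b(1)], of x] rfl_fixed[OF b(2)] by simp
   then have "\<beta> \<bullet> grad p x = - (\<beta> \<bullet> grad p x)" using arg_cong[of _ _ "%y. \<beta> \<bullet> y"] unfolding inner_rfl_self[symmetric] by blast
   then show ?thesis by simp
  qed
  then show ?thesis using vp_grad[OF rpp] by (simp add: D1_def)
 qed
 obtain r where r: "!!i. rp (r i)" "!!x. grad p x = (\<Sum>i\<in>UNIV. r i x *\<^sub>R \<psi> i x)"
  using D1_generates[OF psi(1) c0 detc gD] by blast
 have eg: "eta x \<bullet> grad p x = r t x * (c * Qp x)" for x
  unfolding r(2) by (simp add: inner_sum_right eta_psi if_distrib cong: if_cong)
 \<comment> \<open>eta contains the factor \<beta>, and the quotient paired with \<beta> is odd, so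
   it contains another one. Thus the derivative of p along eta has order at least 3 along the
   mirror, and division by \<open>Qp\<close> leaves order 2.\<close>
 have d2: "pdvd (%x. (\<beta> \<bullet> x) ^ 2) (r t)" if b: "\<beta> \<in> O'" for \<beta>
 proof -
  have bP: "\<beta> \<in> P" and b0: "\<beta> ~= 0" using OP[OF b] P_nonzero by auto
  define q where "q x = (\<Prod>\<gamma>\<in>O' - {\<beta>}. (\<gamma> \<bullet> x)\<^sup>2)" for x
  have rq: "rp q"
  proof -
   have "hom (\<Sum>\<beta>\<in>O' - {\<beta>}. 2 * 1) q" unfolding q_def[abs_def] using fO by (intro hom_prod hom_power hom_inner) simp
   then show ?thesis by (rule hom_rp)
  qed
  have pq: "p = (%x. (\<beta> \<bullet> x)\<^sup>2 * q x)" unfolding p_def[abs_def] q_def[abs_def] using prod.remove[OF fO b] by blast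
  have rb2: "rp (%x. (\<beta> \<bullet> x)\<^sup>2)" using hom_rp[OF hom_power[OF hom_inner]] .
  have gp: "grad p x = (\<beta> \<bullet> x)\<^sup>2 *\<^sub>R grad q x + q x *\<^sub>R ((2 * (\<beta> \<bullet> x)) *\<^sub>R \<beta>)" for x
   unfolding pq using grad_mult[OF rb2 rq, of x] grad_power[OF rp_inner, of \<beta> 2 x] by (simp add: grad_inner)
  obtain \<eta> where e: "vp \<eta>" "!!x. eta x = (\<beta> \<bullet> x) *\<^sub>R \<eta> x"
   using vp_divisible[OF vp_eta b0] b by (auto simp: O'_def)
  have "(\<beta> \<bullet> x) * (\<beta> \<bullet> \<eta> x) = (\<beta> \<bullet> x) * (- (\<beta> \<bullet> \<eta> (rfl \<beta> x)))" for x
  proof -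
   have "\<beta> \<bullet> eta (rfl \<beta> x) = \<beta> \<bullet> eta x" unfolding eta_rfl[OF bP] by (simp add: inner_rfl_self)
   then show ?thesis unfolding e(2) by (simp add: inner_rfl_self)
  qed
  then have ev: "\<beta> \<bullet> \<eta> x = - (\<beta> \<bullet> \<eta> (rfl \<beta> x))" for x
   by (rule cancel_linear[OF b0, of "%x. \<beta> \<bullet> \<eta> x" "%x. - (\<beta> \<bullet> \<eta> (rfl \<beta> x))", rotated 2])
    (use vp_inner[OF e(1)] rp_linear_compose[OF vp_inner[OF e(1)] linear_rfl] in auto)
  have "\<beta> \<bullet> \<eta> x = 0" if "\<beta> \<bullet> x = 0" for x using ev[of x] rfl_fixed[OF that] by simp
  then obtain g where g: "rp g" "!!x. \<beta> \<bullet> \<eta> x = (\<beta> \<bullet> x) * g x"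
   using pdvd_linear[OF vp_inner[OF e(1)] b0, of \<beta>] by (auto simp: pdvd_def)
  define g3 where "g3 x = \<eta> x \<bullet> grad q x + 2 * (q x * g x)" for x
  have rg3: "rp g3" unfolding g3_def[abs_def]
   by (intro rp_intros(3) rp_inner_vp e(1) vp_grad rq rp_cmult rp_intros(4) g(1))
  let ?Q = "%x. \<Prod>\<gamma>\<in>P - {\<beta>}. \<gamma> \<bullet> x"
  have "(\<beta> \<bullet> x) * ((c * ?Q x) * r t x) = (\<beta> \<bullet> x) * ((\<beta> \<bullet> x) ^ 2 * g3 x)" for x
  proof -
   have "(\<beta> \<bullet> x) * ((c * ?Q x) * r t x) = eta x \<bullet> grad p x" unfolding eg Qp_remove[OF bP] by (simp add: mult_ac)
   also have "\<dots> = (\<beta> \<bullet> x) ^ 3 * (\<eta> x \<bullet> grad q x) + 2 * q x * (\<beta> \<bullet> x)\<^sup>2 * (\<beta> \<bullet> \<eta> x)"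
    unfolding gp e(2) by (simp add: inner_add_right inner_commute[of _ \<beta>] power2_eq_square power3_eq_cube)
   also have "\<dots> = (\<beta> \<bullet> x) * ((\<beta> \<bullet> x) ^ 2 * g3 x)" unfolding g(2) g3_def by (simp add: power2_eq_square power3_eq_cube algebra_simps)
   finally show ?thesis .
  qed
  then have "(c * ?Q x) * r t x = (\<beta> \<bullet> x) ^ 2 * g3 x" for x
   by (rule cancel_linear[OF b0, of "%x. (c * ?Q x) * r t x" "%x. (\<beta> \<bullet> x) ^ 2 * g3 x", rotated 2])
    (intro rp_intros(4) rp_cmult rp_rest r(1) rb2 rg3)+
  then have "pdvd (%x. (\<beta> \<bullet> x) ^ 2) (%x. (c * ?Q x) * r t x)" using rg3 by (intro pdvdI)
  then show ?thesis using rest_generic[OF bP] c0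
   by (intro pdvd_linear_power_cancel[OF b0 _ _ r(1), of "%x. c * ?Q x"] rp_cmult rp_rest) auto
 qed
 have "pdvd (%x. \<Prod>\<beta>\<in>O'. (\<beta> \<bullet> x) ^ 2) (r t)"
  by (rule pdvd_prod_linear_powers[OF fO r(1), where u = "%\<beta>. \<beta>" and k = "%_. 2"]) (use P_nonzero OP P_nonpar d2 in simp_all)
 then obtain g where g: "rp g" "!!x. r t x = p x * g x" unfolding pdvd_def p_def by blast
 \<comment> \<open>As p divides \<open>r t\<close>, the derivative of p along eta is divisible by Qp
   times p; its degree is too small for that, so \<open>r t\<close> is zero.\<close>
 have g0: "g x = 0" for x
 proof -
  have h1: "hom ((card P - d t) + (2 * card O' - 1)) (%x. eta x \<bullet> grad p x)" by (rule hom_inner_vhom[OF vhom_eta vhom_grad[OF hp]])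
  have h2: "hom (card P + 2 * card O') (%x. c * Qp x * p x)"
   unfolding Qp_def[abs_def] by (intro hom_mult hom_cmult hom_prod_linear finite_P hp)
  obtain x where x: "Qp x ~= 0" using Qp_nonzero by blast
  then have "p x ~= 0" unfolding p_def Qp_def using finite_P fO OP by auto
  then have h3: "\<exists>x. c * Qp x * p x ~= 0" using x c0 by (intro exI[of _ x]) simp
  have h4: "eta x \<bullet> grad p x = c * Qp x * p x * g x" for x unfolding eg g(2) by simp
  have "(card P - d t) + (2 * card O' - 1) < card P + 2 * card O'" using cO by linarith
  then show ?thesis by (rule hom_quotient(2)[OF h1 h2 h3 g(1) h4])
 qed
 have ip: "rp (%x. x \<bullet> \<psi> i x)" for i by (rule rp_inner_vp[OF vp_id psi_vp])
 \<comment> \<open>For i other than t, the invariant \<open>x \<bullet> \<psi> i x\<close> has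
   degree d i + 1 strictly between 0 and h, so it vanishes at v.\<close>
 have "ev v (%x. r i x * (x \<bullet> \<psi> i x)) = 0" for i
 proof (cases "i = t")
  case True
  then show ?thesis using ev_const[of v 0] by (simp add: g(2) g0)
 next
  case False
  have "hom (1 + d i) (%x. x \<bullet> \<psi> i x)" by (rule hom_inner_vhom[OF _ psi(2)]) (simp add: vhom_def vp_id)
  moreover have "(C *v x) \<bullet> \<psi> i (C *v x) = x \<bullet> \<psi> i x" for x
   unfolding eqv_C[OF psi(3)] by (simp add: C_foldr foldr_rfl_inner)
  moreover have "\<not> h dvd 1 + d i" using dnt[OF False] by (auto dest: dvd_imp_le)
  ultimately have "ev v (%x. x \<bullet> \<psi> i x) = 0" by (rule invariant_vanishes)
  then show ?thesis by (simp add: ev_mult[OF r(1) ip])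
 qed
 then have "ev v (%x. \<Sum>i\<in>UNIV. r i x * (x \<bullet> \<psi> i x)) = 0"
  by (subst ev_sum) (auto intro: rp_intros(4) r(1) ip)
 moreover have "(%x. \<Sum>i\<in>UNIV. r i x * (x \<bullet> \<psi> i x)) = (%x. real (2 * card O') * p x)"
 proof
  fix x
  have "(\<Sum>i\<in>UNIV. r i x * (x \<bullet> \<psi> i x)) = x \<bullet> grad p x" unfolding r(2) by (simp add: inner_sum_right)
  then show "(\<Sum>i\<in>UNIV. r i x * (x \<bullet> \<psi> i x)) = real (2 * card O') * p x" by (simp only: euler_homogeneous[OF hp])
 qed
 ultimately have "of_real (real (2 * card O')) * ev v p = 0" by (simp only: ev_cmult[OF rpp])
 then have "ev v p = 0" using cO by auto
 moreover have "ev v p = (\<Prod>\<beta>\<in>O'. cip \<beta> v * cip \<beta> v)"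
 proof -
  have "p = (%x. \<Prod>\<beta>\<in>O'. (\<beta> \<bullet> x) * (\<beta> \<bullet> x))" by (simp add: p_def[abs_def] power2_eq_square)
  then show ?thesis using ev_prod[OF fO, of "%\<beta> x. (\<beta> \<bullet> x) * (\<beta> \<bullet> x)" v]
   by (simp add: ev_mult rp_inner ev_inner cip_def rp_intros(4))
 qed
 ultimately show False using reg OP P_root fO by auto
qed

text \<open>Derivations of the mirror arrangement with constant multiplicity k. The multiplicity 2 M
  + 1 comes from the 2 M + 1 parallel hyperplanes of \<open>cat M\<close> that coincide at
  infinity.\<close>

definition DK :: "nat => (real^'n => real^'n) set" where
 "DK k = {\<theta>. vp \<theta> & (\<forall>\<beta>\<in>P. pdvd (%x. (\<beta> \<bullet> x) ^ k) (%x. \<beta> \<bullet> \<theta> x))}"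

lemma DK_vp: "\<theta> \<in> DK k ==> vp \<theta>" by (simp add: DK_def)

lemma DK_root: assumes "\<theta> \<in> DK k" "\<beta> \<in> \<Phi>" shows "\<exists>g. rp g & (\<forall>x. \<beta> \<bullet> \<theta> x = (\<beta> \<bullet> x) ^ k * g x)"
proof (cases "\<beta> \<in> P")
 case True then show ?thesis using assms(1) by (auto simp: DK_def pdvd_def)
next
 case False
 then have "- \<beta> \<in> P" using pos_or_neg assms(2) by blast
 then obtain g where g: "rp g" "!!x. (- \<beta>) \<bullet> \<theta> x = ((- \<beta>) \<bullet> x) ^ k * g x" using assms(1) by (auto simp: DK_def pdvd_def)
 have "\<beta> \<bullet> \<theta> x = (\<beta> \<bullet> x) ^ k * (- ((- 1) ^ k) * g x)" for x
  using g(2)[of x] power_minus[of "\<beta> \<bullet> x" k] by (simp add: minus_equation_iff[of "\<beta> \<bullet> \<theta> x"] mult_ac)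
 then show ?thesis using rp_cmult[OF g(1)] by blast
qed

lemma DK_D1: assumes "\<theta> \<in> DK (Suc k)" shows "\<theta> \<in> D1"
 using assms DK_root[OF assms P_root] by (fastforce simp: D1_def DK_def)

lemma DK_conj: assumes "\<theta> \<in> DK k" "\<alpha> \<in> \<Phi>" shows "(%x. rfl \<alpha> (\<theta> (rfl \<alpha> x))) \<in> DK k"
proof -
 have "pdvd (%x. (\<beta> \<bullet> x) ^ k) (%x. \<beta> \<bullet> rfl \<alpha> (\<theta> (rfl \<alpha> x)))" if b: "\<beta> \<in> P" for \<beta>
 proof -
  obtain g where g: "rp g" "!!x. rfl \<alpha> \<beta> \<bullet> \<theta> x = (rfl \<alpha> \<beta> \<bullet> x) ^ k * g x" using DK_root[OF assms(1) rfl_root[OF assms(2) P_root[OF b]]] by blast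
  have "\<beta> \<bullet> rfl \<alpha> (\<theta> (rfl \<alpha> x)) = (\<beta> \<bullet> x) ^ k * g (rfl \<alpha> x)" for x
   using g(2)[of "rfl \<alpha> x"] unfolding rfl_inner by (simp only: rfl_inner_swap)
  then show ?thesis using rp_linear_compose[OF g(1) linear_rfl] by (intro pdvdI)
 qed
 moreover have "vp (%x. rfl \<alpha> (\<theta> (rfl \<alpha> x)))" using vp_rfl[OF vp_linear_compose[OF DK_vp[OF assms(1)] linear_rfl]] .
 ultimately show ?thesis by (simp add: DK_def)
qed

text \<open>As in \<open>D1_diff_conj\<close>, with multiplicity. The odd exponent matters at
  \<alpha>: the two terms then combine to the power of the form times g minus its reflection, which
  supplies the extra factor to be divided out.\<close>

lemma DK_diff_conj:
 assumes th: "\<theta> \<in> DK (Suc (2 * n))" and a: "\<alpha> \<in> P"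
 shows "\<exists>\<eta>\<in>DK (Suc (2 * n)). \<forall>x. \<theta> x - rfl \<alpha> (\<theta> (rfl \<alpha> x)) = (\<alpha> \<bullet> x) *\<^sub>R \<eta> x"
proof -
 obtain \<eta> where e: "\<eta> \<in> D1" "!!x. \<theta> x - rfl \<alpha> (\<theta> (rfl \<alpha> x)) = (\<alpha> \<bullet> x) *\<^sub>R \<eta> x" using D1_diff_conj[OF DK_D1[OF th] a] by blast
 have ve: "vp \<eta>" using e(1) by (simp add: D1_def)
 let ?k = "Suc (2 * n)"
 have "pdvd (%x. (\<beta> \<bullet> x) ^ ?k) (%x. \<beta> \<bullet> \<eta> x)" if b: "\<beta> \<in> P" for \<beta>
 proof (cases "\<beta> = \<alpha>")
  case False
  obtain g where g: "rp g" "!!x. \<beta> \<bullet> \<theta> x = (\<beta> \<bullet> x) ^ ?k * g x" using DK_root[OF th P_root[OF b]] by blast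
  obtain g' where g': "rp g'" "!!x. \<beta> \<bullet> rfl \<alpha> (\<theta> (rfl \<alpha> x)) = (\<beta> \<bullet> x) ^ ?k * g' x"
   using DK_root[OF DK_conj[OF th P_root[OF a]] P_root[OF b]] by blast
  have "(\<alpha> \<bullet> x) * (\<beta> \<bullet> \<eta> x) = (\<beta> \<bullet> x) ^ ?k * (g x - g' x)" for x
  proof -
   have "(\<alpha> \<bullet> x) * (\<beta> \<bullet> \<eta> x) = \<beta> \<bullet> (\<theta> x - rfl \<alpha> (\<theta> (rfl \<alpha> x)))" unfolding e(2) by simp
   then show ?thesis unfolding inner_diff_right g(2) g'(2) by (simp only: right_diff_distrib)
  qed
  then have "pdvd (%x. (\<beta> \<bullet> x) ^ ?k) (%x. (\<alpha> \<bullet> x) * (\<beta> \<bullet> \<eta> x))" using real_polynomial_function_diff[OF g(1) g'(1)] by (intro pdvdI)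
  moreover have "\<exists>x. \<beta> \<bullet> x = 0 & \<alpha> \<bullet> x ~= 0" using nonparallel_hyperplane_point[OF P_nonpar[OF a b]] False by auto
  ultimately show ?thesis by (intro pdvd_linear_power_cancel[OF P_nonzero[OF b] rp_inner _ vp_inner[OF ve]])
 next
  case True
  obtain g where g: "rp g" "!!x. \<alpha> \<bullet> \<theta> x = (\<alpha> \<bullet> x) ^ ?k * g x" using DK_root[OF th P_root[OF a]] by blast
  have rgs: "rp (%x. g (rfl \<alpha> x))" using rp_linear_compose[OF g(1) linear_rfl] .
  have "pdvd (%x. \<alpha> \<bullet> x) (%x. g x - g (rfl \<alpha> x))"
   by (rule pdvd_linear[OF real_polynomial_function_diff[OF g(1) rgs] P_nonzero[OF a]]) (simp add: rfl_fixed)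
  then obtain g' where g': "rp g'" "!!x. g x - g (rfl \<alpha> x) = (\<alpha> \<bullet> x) * g' x" by (auto simp: pdvd_def)
  have "(\<alpha> \<bullet> x) * (\<alpha> \<bullet> \<eta> x) = (\<alpha> \<bullet> x) * ((\<alpha> \<bullet> x) ^ ?k * g' x)" for x
  proof -
   have "(- (\<alpha> \<bullet> x)) ^ ?k = - ((\<alpha> \<bullet> x) ^ ?k)" by (rule power_minus_odd) simp
   then have s: "\<alpha> \<bullet> rfl \<alpha> (\<theta> (rfl \<alpha> x)) = (\<alpha> \<bullet> x) ^ ?k * g (rfl \<alpha> x)"
    using g(2)[of "rfl \<alpha> x"] by (simp only: inner_rfl_self)
   have "(\<alpha> \<bullet> x) * (\<alpha> \<bullet> \<eta> x) = \<alpha> \<bullet> (\<theta> x - rfl \<alpha> (\<theta> (rfl \<alpha> x)))" unfolding e(2) by simp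
   also have "\<dots> = (\<alpha> \<bullet> x) ^ ?k * (g x - g (rfl \<alpha> x))" unfolding inner_diff_right s g(2) by (simp only: right_diff_distrib)
   also have "\<dots> = (\<alpha> \<bullet> x) * ((\<alpha> \<bullet> x) ^ ?k * g' x)" unfolding g'(2) by (simp only: mult_ac)
   finally show ?thesis .
  qed
  then have "\<alpha> \<bullet> \<eta> x = (\<alpha> \<bullet> x) ^ ?k * g' x" for x
   by (rule cancel_linear[OF P_nonzero[OF a], of "%x. \<alpha> \<bullet> \<eta> x" "%x. (\<alpha> \<bullet> x) ^ ?k * g' x", rotated 2])
    (intro vp_inner ve rp_intros(4) hom_rp[OF hom_power[OF hom_inner]] g'(1))+
  then show ?thesis using True g'(1) by (intro pdvdI[of g']) auto
 qed
 then have "\<eta> \<in> DK ?k" using ve by (simp add: DK_def)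
 then show ?thesis using e(2) by blast
qed

lemma eta_derivative:
 assumes "rp g" "!!x. \<alpha> \<bullet> \<theta> x = (\<alpha> \<bullet> x) ^ Suc k * g x"
 shows "eta x \<bullet> grad (%y. \<alpha> \<bullet> \<theta> y) x = (\<alpha> \<bullet> x) ^ k * ((\<alpha> \<bullet> x) * (eta x \<bullet> grad g x) + real (Suc k) * (g x * (eta x \<bullet> \<alpha>)))"
proof -
 have r: "rp (%x. (\<alpha> \<bullet> x) ^ Suc k)" by (rule hom_rp[OF hom_power[OF hom_inner]])
 have "grad (%y. \<alpha> \<bullet> \<theta> y) x = (\<alpha> \<bullet> x) ^ Suc k *\<^sub>R grad g x + g x *\<^sub>R ((real (Suc k) * (\<alpha> \<bullet> x) ^ k) *\<^sub>R \<alpha>)"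
  unfolding assms(2) using grad_mult[OF r assms(1), of x] grad_power[OF rp_inner, of \<alpha> "Suc k" x] by (simp only: grad_inner diff_Suc_1)
 then show ?thesis by (simp only: inner_add_right inner_scaleR_right) (simp add: algebra_simps)
qed

lemma zero_if_perp: assumes "!!\<alpha>. \<alpha> \<in> P ==> \<alpha> \<bullet> x = 0" shows "x = 0"
proof -
 have "x \<bullet> x = (\<Sum>\<delta>\<in>\<Delta>. cf x \<delta> *\<^sub>R \<delta>) \<bullet> x" by (simp add: cf_sum)
 also have "\<dots> = 0" using assms D_pos by (simp add: inner_sum_left)
 finally show ?thesis by simp
qed

text \<open>On each mirror eta is somewhere transversal, so a derivative that vanishes forces one
  more order of vanishing along the mirror than was known. Repeating this makes the order exceed the
  degree.\<close>

lemma eta_derivative_zero: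
 assumes th: "\<theta> \<in> D1" "vhom e \<theta>" and z: "!!u x. eta x \<bullet> grad (%y. u \<bullet> \<theta> y) x = 0"
 shows "\<theta> x = 0"
proof (rule zero_if_perp)
 fix \<alpha> assume a: "\<alpha> \<in> P"
 have rt: "rp (%x. \<alpha> \<bullet> \<theta> x)" using vp_inner[OF vhom_vp[OF th(2)]] .
 have "pdvd (%x. (\<alpha> \<bullet> x) ^ Suc k) (%x. \<alpha> \<bullet> \<theta> x)" for k
 proof (induction k)
  case 0
  then show ?case using pdvd_linear[OF rt P_nonzero[OF a]] th(1) a by (simp add: D1_def)
 next
  case (Suc k)
  then obtain g where g: "rp g" "!!x. \<alpha> \<bullet> \<theta> x = (\<alpha> \<bullet> x) ^ Suc k * g x" by (auto simp: pdvd_def)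
  let ?b = "%x. (\<alpha> \<bullet> x) * (eta x \<bullet> grad g x) + real (Suc k) * (g x * (eta x \<bullet> \<alpha>))"
  have rea: "rp (%x. eta x \<bullet> \<alpha>)" using vp_inner[OF vp_eta, of \<alpha>] by (simp add: inner_commute)
  have rb: "rp ?b"
   by (intro rp_intros(3,4) rp_inner rp_inner_vp vp_eta vp_grad g(1) rp_cmult rea)
  have "?b x * (\<alpha> \<bullet> x) ^ k = 0" for x using eta_derivative[OF g, where x = x] z[of x \<alpha>] by (simp only: mult.commute)
  then have b0: "?b x = 0" for x
   by (rule rp_mult_eq_0[OF rb hom_rp[OF hom_power[OF hom_inner]]]) (use P_nonzero[OF a] in \<open>auto intro: exI[of _ \<alpha>]\<close>)
  have "g x * (eta x \<bullet> \<alpha>) = 0" if "x \<in> {x. \<alpha> \<bullet> x = 0}" for x using b0[of x] that by simp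
  from rp_mult_eq_0_subspace[OF subspace_hyperplane_inner g(1) rea this]
  have "\<forall>x. \<alpha> \<bullet> x = 0 --> g x = 0" using eta_generic[OF a] by blast
  then obtain g' where g': "rp g'" "!!x. g x = (\<alpha> \<bullet> x) * g' x" using pdvd_linear[OF g(1) P_nonzero[OF a]] by (auto simp: pdvd_def)
  show ?case by (rule pdvdI[OF g'(1)]) (simp add: g(2) g'(2))
 qed
 from this[of e] obtain g where g: "rp g" "!!x. \<alpha> \<bullet> \<theta> x = (\<alpha> \<bullet> x) ^ Suc e * g x" by (auto simp: pdvd_def)
 have "g x = 0"
  by (rule hom_quotient(2)[OF vhom_inner[OF th(2)] hom_power[OF hom_inner] _ g]) (use P_nonzero[OF a] in \<open>auto intro: exI[of _ \<alpha>]\<close>)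
 then show "\<alpha> \<bullet> \<theta> x = 0" by (simp add: g(2))
qed

lemma top_le: "h - 1 <= card P" using member_le_sum[of t UNIV d] sumd dt by simp

text \<open>Along a mirror the derivative along eta loses one order and division by
  \<open>Qp\<close> another, so multiplicity n + 3 becomes n + 1; the degree becomes (card P - (h -
  1)) + (e - 1) - card P = e - h. Equivariance permits the division: on a mirror the derivative is
  reversed by the reflection, hence a multiple of \<alpha>, and its \<alpha> component vanishes by
  multiplicity.\<close>

lemma eta_descent:
 assumes th: "\<theta> \<in> DK (Suc (Suc (Suc n)))" "vhom e \<theta>" "eqv \<theta>"
 shows "\<exists>\<sigma>\<in>DK (Suc n). (\<forall>u x. eta x \<bullet> grad (%y. u \<bullet> \<theta> y) x = Qp x * (u \<bullet> \<sigma> x)) \<and>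
  (h <= e --> vhom (e - h) \<sigma>) & (e < h --> (\<forall>x. \<sigma> x = 0))"
proof -
 have vt: "vp \<theta>" using vhom_vp[OF th(2)] .
 define \<tau> where "\<tau> x = (\<chi> j. eta x \<bullet> grad (%y. \<theta> y $ j) x)" for x
 have ut: "eta x \<bullet> grad (%y. u \<bullet> \<theta> y) x = u \<bullet> \<tau> x" for u x
  unfolding grad_inner_vp[OF vt] \<tau>_def by (simp add: inner_sum_right inner_vec_def[of u])
 have ht: "hom ((card P - d t) + (e - 1)) (%x. \<tau> x $ j)" for j
  using hom_inner_vhom[OF vhom_eta vhom_grad, of e "%y. \<theta> y $ j"] th(2) by (simp add: \<tau>_def vhom_iff)
 have tz: "\<tau> x = 0" if a: "\<alpha> \<in> P" "\<alpha> \<bullet> x = 0" for \<alpha> x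
 proof -
  have sx: "rfl \<alpha> x = x" using rfl_fixed[OF a(2)] .
  have e1: "eta x = - rfl \<alpha> (eta x)" using eta_rfl[OF a(1), of x] unfolding sx .
  have se: "rfl \<alpha> (eta x) = - eta x" by (rule minus_equation_iff[THEN iffD1, THEN sym, OF e1[symmetric]])
  have "rfl \<alpha> (\<tau> x) \<bullet> u = (- \<tau> x) \<bullet> u" for u
  proof -
   have "rfl \<alpha> (\<tau> x) \<bullet> u = eta x \<bullet> grad (%y. rfl \<alpha> u \<bullet> \<theta> y) x" unfolding ut by (simp only: rfl_inner_swap[of \<alpha> "\<tau> x" u] inner_commute[of "\<tau> x"])
   also have "(%y. rfl \<alpha> u \<bullet> \<theta> y) = (%y. u \<bullet> \<theta> (rfl \<alpha> y))" unfolding eqv_rfl[OF th(3) P_root[OF a(1)]] rfl_inner_swap ..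
   also have "eta x \<bullet> grad (%y. u \<bullet> \<theta> (rfl \<alpha> y)) x = grad (%y. u \<bullet> \<theta> y) (rfl \<alpha> x) \<bullet> rfl \<alpha> (eta x)"
    using grad_linear_compose[OF vp_inner[OF vt, of u] linear_rfl, of \<alpha> x "eta x"] by (simp add: inner_commute)
   also have "\<dots> = - (u \<bullet> \<tau> x)" unfolding sx se ut[symmetric] by (simp add: inner_commute)
   finally show ?thesis by (simp add: inner_commute)
  qed
  then have "rfl \<alpha> (\<tau> x) = - \<tau> x" using vector_eq_rdot by blast
  then have t1: "\<tau> x = (cart (\<tau> x) \<alpha> / 2) *\<^sub>R \<alpha>" by (rule rfl_anti)
  obtain g where g: "rp g" "!!x. \<alpha> \<bullet> \<theta> x = (\<alpha> \<bullet> x) ^ Suc (Suc (Suc n)) * g x" using DK_root[OF th(1) P_root[OF a(1)]] by blast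
  have "\<alpha> \<bullet> \<tau> x = 0" unfolding ut[symmetric] eta_derivative[OF g] using a(2) by simp
  then have "cart (\<tau> x) \<alpha> = 0" by (simp add: cart_def inner_commute)
  then show ?thesis using t1 by simp
 qed
 have "\<exists>g. rp g & (\<forall>x. \<tau> x $ j = Qp x * g x)" for j
 proof -
  have "pdvd (%x. \<Prod>\<beta>\<in>P. \<beta> \<bullet> x) (%x. \<tau> x $ j)"
   by (rule pdvd_prod_linear[OF finite_P hom_rp[OF ht]]) (use P_nonzero P_nonpar tz in auto)
  then show ?thesis by (auto simp: pdvd_def Qp_def)
 qed
 then have "\<exists>G. \<forall>j. rp (G j) & (\<forall>x. \<tau> x $ j = Qp x * G j x)" by (intro choice allI)
 then obtain G where G: "!!j. rp (G j)" "!!j x. \<tau> x $ j = Qp x * G j x" by blast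
 define \<sigma> where "\<sigma> x = (\<chi> j. G j x)" for x
 have vs: "vp \<sigma>" using G(1) by (simp add: vp_def \<sigma>_def)
 have ts: "\<tau> x = Qp x *\<^sub>R \<sigma> x" for x by (simp add: vec_eq_iff G(2) \<sigma>_def)
 have hQ: "hom (card P) Qp" unfolding Qp_def[abs_def] by (rule hom_prod_linear[OF finite_P])
 have "pdvd (%x. (\<alpha> \<bullet> x) ^ Suc n) (%x. \<alpha> \<bullet> \<sigma> x)" if a: "\<alpha> \<in> P" for \<alpha>
 proof -
  obtain g where g: "rp g" "!!x. \<alpha> \<bullet> \<theta> x = (\<alpha> \<bullet> x) ^ Suc (Suc (Suc n)) * g x" using DK_root[OF th(1) P_root[OF a]] by blast
  let ?b = "%x. (\<alpha> \<bullet> x) * (eta x \<bullet> grad g x) + real (Suc (Suc (Suc n))) * (g x * (eta x \<bullet> \<alpha>))"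
  let ?Q = "%x. \<Prod>\<gamma>\<in>P - {\<alpha>}. \<gamma> \<bullet> x"
  have rea: "rp (%x. eta x \<bullet> \<alpha>)" using vp_inner[OF vp_eta, of \<alpha>] by (simp add: inner_commute)
  have rb: "rp ?b"
   by (intro rp_intros(3,4) rp_inner rp_inner_vp vp_eta vp_grad g(1) rp_cmult rea)
  have "(\<alpha> \<bullet> x) * (?Q x * (\<alpha> \<bullet> \<sigma> x)) = (\<alpha> \<bullet> x) * ((\<alpha> \<bullet> x) ^ Suc n * ?b x)" for x
  proof -
   have "(\<alpha> \<bullet> x) * (?Q x * (\<alpha> \<bullet> \<sigma> x)) = \<alpha> \<bullet> \<tau> x" unfolding ts Qp_remove[OF a] by simp
   also have "\<dots> = (\<alpha> \<bullet> x) ^ Suc (Suc n) * ?b x" unfolding ut[symmetric] by (rule eta_derivative[OF g])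
   finally show ?thesis by (simp only: power_Suc mult_ac)
  qed
  then have "?Q x * (\<alpha> \<bullet> \<sigma> x) = (\<alpha> \<bullet> x) ^ Suc n * ?b x" for x
   by (rule cancel_linear[OF P_nonzero[OF a], of "%x. ?Q x * (\<alpha> \<bullet> \<sigma> x)" "%x. (\<alpha> \<bullet> x) ^ Suc n * ?b x", rotated 2])
    (intro vp_inner vs rp_intros(4) hom_rp[OF hom_power[OF hom_inner]] rp_rest rb)+
  then have "pdvd (%x. (\<alpha> \<bullet> x) ^ Suc n) (%x. ?Q x * (\<alpha> \<bullet> \<sigma> x))" using rb by (intro pdvdI)
  then show ?thesis using rest_generic[OF a]
   by (intro pdvd_linear_power_cancel[OF P_nonzero[OF a] rp_rest _ vp_inner[OF vs]])
 qed
 then have "\<sigma> \<in> DK (Suc n)" using vs by (simp add: DK_def)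
 moreover have h2: "2 <= h" using hh_ge_2 hh_eq by simp
 have "vhom (e - h) \<sigma>" if "h <= e"
 proof -
  have eq: "(card P - d t) + (e - 1) - card P = e - h" "card P <= (card P - d t) + (e - 1)" using top_le dt h2 that by auto
  have "hom (e - h) (%x. \<sigma> x $ j)" for j
   using hom_quotient(1)[OF ht hQ Qp_nonzero G(1) G(2) eq(2)] unfolding eq(1) by (simp add: \<sigma>_def)
  then show ?thesis by (simp add: vhom_iff)
 qed
 moreover have "\<sigma> x = 0" if "e < h" for x
 proof -
  have lt: "(card P - d t) + (e - 1) < card P" using top_le dt h2 that by auto
  have "\<sigma> x $ j = 0" for j using hom_quotient(2)[OF ht hQ Qp_nonzero G(1) G(2) lt] by (simp add: \<sigma>_def)
  then show ?thesis by (simp add: vec_eq_iff)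
 qed
 moreover have "eta x \<bullet> grad (%y. u \<bullet> \<theta> y) x = Qp x * (u \<bullet> \<sigma> x)" for u x unfolding ut ts by simp
 ultimately show ?thesis by blast
qed

text \<open>Outer induction on m, inner on the degree. The failure of equivariance, divided by
  \<alpha>, has smaller degree and hence vanishes. So \<theta> is equivariant,
  \<open>eta_descent\<close> lowers m by one and the degree by h, and a vanishing descendant forces
  \<theta> to vanish.\<close>

lemma no_low_degree: "\<theta> \<in> DK (Suc (2 * m)) ==> vhom e \<theta> ==> e < m * h ==> \<theta> x = 0"
proof (induction m arbitrary: \<theta> e x)
 case (Suc m)
 let ?k = "Suc (2 * Suc m)"
 have "\<theta> \<in> DK ?k --> vhom e \<theta> --> e < Suc m * h --> (\<forall>x. \<theta> x = 0)" for \<theta> e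
 proof (induction e arbitrary: \<theta> rule: less_induct)
  case (less e)
  show ?case
  proof (intro impI allI)
   fix x assume th: "\<theta> \<in> DK ?k" "vhom e \<theta>" "e < Suc m * h"
   have inv: "\<theta> (rfl \<alpha> y) = rfl \<alpha> (\<theta> y)" if a: "\<alpha> \<in> P" for \<alpha> y
   proof -
    obtain \<eta> where e: "\<eta> \<in> DK ?k" "!!x. \<theta> x - rfl \<alpha> (\<theta> (rfl \<alpha> x)) = (\<alpha> \<bullet> x) *\<^sub>R \<eta> x" using DK_diff_conj[OF th(1) a] by blast
    have vd: "vhom e (%x. \<theta> x - rfl \<alpha> (\<theta> (rfl \<alpha> x)))"
     using th(2) vp_diff[OF DK_vp[OF th(1)] DK_vp[OF DK_conj[OF th(1) P_root[OF a]]]]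
     by (simp add: vhom_def linear_cmul[OF linear_rfl] scaleR_diff_right)
    have cj: "hom e (%x. (\<alpha> \<bullet> x) * \<eta> x $ j)" "rp (%x. \<eta> x $ j)" for j
     using vd DK_vp[OF e(1)] unfolding vhom_iff e(2) by (auto simp: vp_def)
    have a1: "\<exists>x. \<alpha> \<bullet> x ~= 0" using P_nonzero[OF a] by (intro exI[of _ \<alpha>]) simp
    have "\<eta> x = 0" for x
    proof (cases e)
     case 0
     then have "\<eta> x $ j = 0" for j by (intro hom_quotient(2)[OF cj(1) hom_inner a1 cj(2)]) auto
     then show ?thesis by (simp add: vec_eq_iff)
    next
     case (Suc e')
     then have "hom (e - 1) (%x. \<eta> x $ j)" for j by (intro hom_quotient(1)[OF cj(1) hom_inner a1 cj(2)]) auto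
     then have "vhom (e - 1) \<eta>" by (simp add: vhom_iff)
     moreover have "e - 1 < e" "e - 1 < Suc m * h" using Suc th(3) by auto
     ultimately show ?thesis using less e(1) by blast
    qed
    then have "\<theta> (rfl \<alpha> y) = rfl \<alpha> (\<theta> (rfl \<alpha> (rfl \<alpha> y)))" using e(2)[of "rfl \<alpha> y"] by simp
    then show ?thesis by (simp add: rfl_rfl)
   qed
   have "\<theta> (rfl \<alpha> y) = rfl \<alpha> (\<theta> y)" if "\<alpha> \<in> \<Phi>" for \<alpha> y
    using pos_or_neg[OF that] inv[of \<alpha> y] inv[of "- \<alpha>" y] unfolding rfl_uminus by blast
   then have eq: "eqv \<theta>" by (simp add: eqv_def)
   have "\<theta> \<in> DK (Suc (Suc (Suc (2 * m))))" using th(1) by simp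
   from eta_descent[OF this th(2) eq] obtain \<sigma> where s: "\<sigma> \<in> DK (Suc (2 * m))"
    "!!u x. eta x \<bullet> grad (%y. u \<bullet> \<theta> y) x = Qp x * (u \<bullet> \<sigma> x)" "h <= e ==> vhom (e - h) \<sigma>" "e < h ==> \<forall>x. \<sigma> x = 0" by blast
   have "\<sigma> x = 0" for x
   proof (cases "e < h")
    case False
    then have "e - h < m * h" using th(3) by (simp add: less_diff_conv2)
    then show ?thesis using Suc.IH[OF s(1) s(3)] False by simp
   qed (use s(4) in blast)
   then show "\<theta> x = 0" using s(2) by (intro eta_derivative_zero[OF DK_D1[OF th(1)] th(2)]) simp
  qed
 qed
 then show ?case using Suc.prems by blast
qed simp

text \<open>At infinity the derivation has multiplicity 2 M + 1 and low degree, so it vanishes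
  there. It is then divisible by the coning variable, and the quotient is a derivation of the same
  arrangement of smaller degree.\<close>

lemma low_cat: "\<delta> \<in> D0 (cat M) ==> vhom e \<delta> ==> e < M * h ==> \<delta> x = 0"
proof (induction e arbitrary: \<delta> x rule: less_induct)
 case (less e)
 have vd: "vp \<delta>" using vhom_vp[OF less.prems(2)] .
 have lin: "linear (%y::real^'n. (0::real, y))" by (rule linearI) auto
 have "vhom e (%y. \<delta> (0, y))"
 proof -
  have "\<delta> (0, r *\<^sub>R y) = r ^ e *\<^sub>R \<delta> (0, y)" for r y
  proof -
   have "\<delta> (r *\<^sub>R (0, y)) = r ^ e *\<^sub>R \<delta> (0, y)" using less.prems(2) unfolding vhom_def by blast
   then show ?thesis by simp
  qed
  then show ?thesis using vp_linear_compose[OF vd lin] by (simp add: vhom_def)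
 qed
 moreover have "(%y. \<delta> (0, y)) \<in> DK (Suc (2 * M))"
 proof -
  have "pdvd (%y. (\<beta> \<bullet> y) ^ Suc (2 * M)) (%y. \<beta> \<bullet> \<delta> (0, y))" if b: "\<beta> \<in> P" for \<beta>
  proof -
   have "pdvd (%x. \<Prod>k\<in>{- int M..int M}. frm (\<beta>, k) \<bullet> x) (%x. \<beta> \<bullet> \<delta> x)"
   proof (rule pdvd_prod_linear)
    show "frm (\<beta>, k) ~= 0" for k using frm_nonzero[OF npar_P, of "(\<beta>, k)"] b by simp
    show "frm (\<beta>, i) ~: span {frm (\<beta>, j)}" if "i ~= j" for i j using frm_nonparallel[OF npar_P, of "(\<beta>, i)" "(\<beta>, j)"] b that by simp
    show "\<beta> \<bullet> \<delta> x = 0" if "i \<in> {- int M..int M}" "frm (\<beta>, i) \<bullet> x = 0" for i x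
    proof -
     have "\<forall>l\<in>cat M. \<forall>x. frm l \<bullet> x = 0 --> fst l \<bullet> \<delta> x = 0" using less.prems(1) unfolding D0_def by blast
     moreover have "(\<beta>, i) \<in> cat M" using b that unfolding cat_def by blast
     ultimately have "\<forall>x. frm (\<beta>, i) \<bullet> x = 0 --> fst (\<beta>, i) \<bullet> \<delta> x = 0" by (rule bspec)
     from spec[OF this, of x] that(2) show ?thesis unfolding fst_conv by (rule mp)
    qed
   qed (auto intro: vp_inner vd)
   then obtain g where g: "rp g" "!!x. \<beta> \<bullet> \<delta> x = (\<Prod>k\<in>{- int M..int M}. frm (\<beta>, k) \<bullet> x) * g x" by (auto simp: pdvd_def)
   have "\<beta> \<bullet> \<delta> (0, y) = (\<beta> \<bullet> y) ^ Suc (2 * M) * g (0, y)" for y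
   proof -
    have "nat (int M - - int M + 1) = Suc (2 * M)" by simp
    then have "(\<Prod>k\<in>{- int M..int M}. frm (\<beta>, k) \<bullet> (0, y)) = (\<beta> \<bullet> y) ^ Suc (2 * M)"
     unfolding frm_inner by (simp only: prod_constant card_atLeastAtMost_int mult_zero_right diff_zero)
    then show ?thesis using g(2)[of "(0, y)"] by simp
   qed
   then show ?thesis using rp_linear_compose[OF g(1) lin] by (intro pdvdI)
  qed
  then show ?thesis using vp_linear_compose[OF vd lin] by (simp add: DK_def)
 qed
 ultimately have z: "\<delta> (0, y) = 0" for y using no_low_degree[of "%y. \<delta> (0, y)" M e] less.prems(3) by blast
 have i1: "(1::real, 0::real^'n) \<bullet> x = fst x" for x by (cases x) simp
 have "(1::real, 0::real^'n) ~= 0" by (simp add: zero_prod_def)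
 moreover have "\<delta> x = 0" if "(1, 0) \<bullet> x = 0" for x using that z[of "snd x"] unfolding i1 by (cases x) simp
 ultimately obtain \<delta>' where d': "vp \<delta>'" "!!x. \<delta> x = fst x *\<^sub>R \<delta>' x" using vp_divisible[OF vd, of "(1, 0)"] unfolding i1 by blast
 have hf: "hom 1 (%x::real \<times> (real^'n). fst x)" using hom_inner[of "(1::real, 0::real^'n)"] unfolding i1 .
 have e1: "\<exists>x::real \<times> (real^'n). fst x ~= 0" by (intro exI[of _ "(1, 0)"]) simp
 have cj: "hom e (%x. \<delta> x $ j)" "rp (%x. \<delta>' x $ j)" "\<delta> x $ j = fst x * \<delta>' x $ j" for j x
  using less.prems(2) d' by (auto simp: vhom_iff vp_def)
 have "\<delta>' x = 0" for x
 proof (cases e)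
  case 0
  then have "\<delta>' x $ j = 0" for j by (intro hom_quotient(2)[OF cj(1) hf e1 cj(2) cj(3)]) auto
  then show ?thesis by (simp add: vec_eq_iff)
 next
  case (Suc e')
  then have "hom (e - 1) (%x. \<delta>' x $ j)" for j by (intro hom_quotient(1)[OF cj(1) hf e1 cj(2) cj(3)]) auto
  then have "vhom (e - 1) \<delta>'" by (simp add: vhom_iff)
  moreover have "\<delta>' \<in> D0 (cat M)"
  proof -
   have "fst l \<bullet> \<delta>' x = 0" if l: "l \<in> cat M" "frm l \<bullet> x = 0" for l x
   proof -
    have "fst y * (fst l \<bullet> \<delta>' y) = 0" if "y \<in> {y. frm l \<bullet> y = 0}" for y
    proof -
     have "fst l \<bullet> \<delta> y = 0" using less.prems(1) l(1) that unfolding D0_def by blast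
     then show ?thesis by (simp add: d'(2))
    qed
    from rp_mult_eq_0_subspace[OF subspace_hyperplane_inner hom_rp[OF hf] vp_inner[OF d'(1)] this]
    have "(\<forall>y\<in>{y. frm l \<bullet> y = 0}. fst y = 0) | (\<forall>y\<in>{y. frm l \<bullet> y = 0}. fst l \<bullet> \<delta>' y = 0)" .
    moreover have "frm l \<bullet> (1, (of_int (snd l) / (fst l \<bullet> fst l)) *\<^sub>R fst l) = 0"
    proof -
     have "fst l ~= 0" using l(1) P_nonzero by (auto simp: cat_def)
     then show ?thesis by (simp add: frm_inner')
    qed
    ultimately have "\<forall>y\<in>{y. frm l \<bullet> y = 0}. fst l \<bullet> \<delta>' y = 0" by fastforce
    then show ?thesis using l(2) by blast
   qed
   then show ?thesis using d'(1) unfolding D0_def by blast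
  qed
  ultimately show ?thesis using less.IH[of "e - 1" \<delta>'] less.prems(3) Suc by simp
 qed
 then show ?case by (simp add: d'(2))
qed

end

section \<open>Polynomial functions and the coned arrangement\<close>

lemma is_poly_monomial: "is_poly (%x. c * monomial_fun m x)"
 unfolding is_poly_def by (intro exI[of _ "{m}"] exI[of _ "%_. c"]) simp

lemma is_poly_add: assumes "is_poly p" "is_poly q" shows "is_poly (%x. p x + q x)"
proof -
 obtain M c where p: "finite M" "p = (%x. \<Sum>m\<in>M. c m * monomial_fun m x)" using assms(1) unfolding is_poly_def by blast
 obtain N e where q: "finite N" "q = (%x. \<Sum>m\<in>N. e m * monomial_fun m x)" using assms(2) unfolding is_poly_def by blast
 let ?c = "%m. (if m \<in> M then c m else 0) + (if m \<in> N then e m else 0)"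
 have "(\<Sum>m\<in>M. c m * monomial_fun m x) = (\<Sum>m\<in>M \<union> N. (if m \<in> M then c m else 0) * monomial_fun m x)" for x
  using p(1) q(1) by (intro sum.mono_neutral_cong_left) auto
 moreover have "(\<Sum>m\<in>N. e m * monomial_fun m x) = (\<Sum>m\<in>M \<union> N. (if m \<in> N then e m else 0) * monomial_fun m x)" for x
  using p(1) q(1) by (intro sum.mono_neutral_cong_left) auto
 ultimately have "p x + q x = (\<Sum>m\<in>M \<union> N. ?c m * monomial_fun m x)" for x
  unfolding p(2) q(2) by (simp only: distrib_right sum.distrib)
 then show ?thesis unfolding is_poly_def using p(1) q(1) by (intro exI[of _ "M \<union> N"] exI[of _ ?c]) auto
qed

lemma is_poly_sum: "finite I ==> (!!i. i \<in> I ==> is_poly (f i)) ==> is_poly (%x. \<Sum>i\<in>I. f i x)"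
proof (induction I rule: finite_induct)
 case empty
 then show ?case using is_poly_monomial[of 0] by simp
qed (simp add: is_poly_add)

lemma monomial_fun_mult: "monomial_fun m x * monomial_fun m' x = monomial_fun (%i. m i + m' i) x"
 by (simp add: monomial_fun_def power_add prod.distrib)

lemma rp_coord: "rp (%x::real^'k::finite. x $ i)" by (rule vp_id[unfolded vp_def, rule_format])

lemma is_poly_iff: "is_poly p \<longleftrightarrow> rp p"
proof
 assume "is_poly p"
 then obtain M c where "finite M" "p = (%x. \<Sum>m\<in>M. c m * monomial_fun m x)" unfolding is_poly_def by blast
 moreover have "rp (monomial_fun m)" for m :: "'a => nat"
  unfolding monomial_fun_def[abs_def] by (intro real_polynomial_function_prod real_polynomial_function_power rp_coord) simp
 ultimately show "rp p" by (auto intro!: real_polynomial_function_sum rp_cmult)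
next
 assume "rp p"
 then show "is_poly p"
 proof (induction rule: real_polynomial_function.induct)
  case (linear f)
  have "f x = (\<Sum>i\<in>UNIV. f (axis i 1) * monomial_fun (%j. if j = i then 1 else 0) x)" for x
  proof -
   have "f x = f (\<Sum>i\<in>UNIV. x $ i *\<^sub>R axis i 1)" using basis_expansion[of x] by (simp add: scalar_mult_eq_scaleR)
   also have "\<dots> = (\<Sum>i\<in>UNIV. x $ i * f (axis i 1))"
    using linear by (simp add: bounded_linear.linear linear_sum linear_cmul)
   moreover have "monomial_fun (%j. if j = i then 1 else 0) x = x $ i" for i
   proof -
    have "monomial_fun (%j. if j = i then 1 else 0) x = (\<Prod>j\<in>UNIV. if j = i then x $ j else 1)"
     unfolding monomial_fun_def by (rule prod.cong) auto
    then show ?thesis by simp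
   qed
   ultimately show ?thesis by (simp add: mult.commute)
  qed
  then have "f = (%x. \<Sum>i\<in>UNIV. f (axis i 1) * monomial_fun (%j. if j = i then 1 else 0) x)" by blast
  moreover have "is_poly (%x. \<Sum>i\<in>UNIV. f (axis i 1) * monomial_fun (%j. if j = i then 1 else 0) x)"
   by (intro is_poly_sum is_poly_monomial) simp
  ultimately show ?case by simp
 next
  case (const c)
  then show ?case using is_poly_monomial[of c "%_. 0"] by (simp add: monomial_fun_def)
 next
  case (add p q)
  then show ?case by (intro is_poly_add)
 next
  case (mult p q)
  obtain M c where p: "finite M" "p = (%x. \<Sum>m\<in>M. c m * monomial_fun m x)" using mult unfolding is_poly_def by blast
  obtain N e where q: "finite N" "q = (%x. \<Sum>m\<in>N. e m * monomial_fun m x)" using mult unfolding is_poly_def by blast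
  have "p x * q x = (\<Sum>m\<in>M. \<Sum>m'\<in>N. (c m * e m') * monomial_fun (%i. m i + m' i) x)" for x
   unfolding p(2) q(2) sum_product monomial_fun_mult[symmetric] by (simp only: mult_ac)
  then have "(%x. p x * q x) = (%x. \<Sum>m\<in>M. \<Sum>m'\<in>N. (c m * e m') * monomial_fun (%i. m i + m' i) x)" by blast
  then show ?case using p(1) q(1) by (simp only: is_poly_sum is_poly_monomial)
 qed
qed

text \<open>Comparing the coefficients of s^d in p(s x), for fixed x, discards the monomials of all
  other degrees.\<close>

lemma homog_poly_iff_hom: assumes "hom d p" shows "homog_poly d p"
proof -
 obtain M c where p: "finite M" "!!x. p x = (\<Sum>m\<in>M. c m * monomial_fun m x)"
  using hom_rp[OF assms] unfolding is_poly_iff[symmetric] is_poly_def by auto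
 have sc: "monomial_fun m (s *\<^sub>R x) = s ^ sum m UNIV * monomial_fun m x" for m :: "'a => nat" and s x
  by (simp add: monomial_fun_def power_mult_distrib prod.distrib power_sum)
 have "p x = (\<Sum>m\<in>{m\<in>M. sum m UNIV = d}. c m * monomial_fun m x)" for x
 proof -
  define u where "u = (\<Sum>m\<in>M. monom (c m * monomial_fun m x) (sum m UNIV))"
  have "poly u s = poly (monom (p x) d) s" for s
  proof -
   have "poly u s = p (s *\<^sub>R x)" unfolding u_def p(2) by (simp add: poly_sum poly_monom sc mult_ac)
   then show ?thesis using hom_scale[OF assms, of s x] by (simp add: poly_monom mult.commute)
  qed
  then have "u = monom (p x) d" by (simp add: poly_eq_poly_eq_iff[symmetric] fun_eq_iff)
  then have "p x = coeff u d" by simp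
  also have "\<dots> = (\<Sum>m\<in>M. if sum m UNIV = d then c m * monomial_fun m x else 0)"
   unfolding u_def coeff_sum by (intro sum.cong) auto
  finally show ?thesis using p(1) by (simp add: sum.inter_filter)
 qed
 then have "p = (%x. \<Sum>m\<in>{m\<in>M. sum m UNIV = d}. c m * monomial_fun m x)" by blast
 moreover have "finite {m\<in>M. sum m UNIV = d}" using p(1) by simp
 ultimately show ?thesis unfolding homog_poly_def by (intro exI[of _ "{m\<in>M. sum m UNIV = d}"] exI[of _ c]) simp
qed

lemma sum_option: "(\<Sum>k\<in>(UNIV::'n::finite option set). f k) = f None + (\<Sum>i\<in>UNIV. f (Some i))"
 unfolding UNIV_option_conv by (simp add: sum.reindex)

section \<open>Coordinates of the cone\<close>

definition fromc :: "real^('n::finite option) => real \<times> (real^'n)" where "fromc x = (x $ None, \<chi> i. x $ Some i)"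
definition toc :: "real \<times> (real^'n) => real^('n::finite option)" where
 "toc z = (\<chi> k. case k of None => fst z | Some i => snd z $ i)"

lemma linear_fromc: "linear fromc" and linear_toc: "linear toc"
 by (auto intro!: linearI simp: fromc_def toc_def vec_eq_iff split: option.splits)

lemma toc_fromc: "toc (fromc x) = x" and fromc_toc: "fromc (toc z) = z"
 by (auto simp: fromc_def toc_def vec_eq_iff prod_eq_iff split: option.splits)

lemma toc_inner: "(\<Sum>k\<in>UNIV. toc z $ k * f k) = fst z * f None + (\<Sum>i\<in>UNIV. snd z $ i * f (Some i))"
 unfolding sum_option by (simp add: toc_def)

lemma inner_toc: "toc z \<bullet> x = z \<bullet> fromc x"
 unfolding inner_vec_def inner_real_def toc_inner by (cases z) (simp add: fromc_def inner_vec_def)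

lemma cone_arr_toc: "cone_arr P p q = toc ` frm ` (P \<times> {p..q}) \<union> {toc (1, 0)}"
proof -
 have a: "(\<chi> i. case i of None => - of_int k | Some j => \<alpha> $ j) = toc (frm (\<alpha>, k))" for \<alpha> k
  by (simp add: toc_def frm_def vec_eq_iff split: option.split)
 have b: "(\<chi> i. if i = None then 1 else 0) = toc (1, 0)"
  by (simp add: toc_def vec_eq_iff split: option.split)
 have "{toc (frm (\<alpha>, k)) |\<alpha> k. \<alpha> \<in> P & k \<in> {p..q}} = toc ` frm ` (P \<times> {p..q})" unfolding image_image by blast
 then show ?thesis unfolding cone_arr_def a b by (rule arg_cong)
qed

text \<open>The coned basis consists of the Euler derivation and the given derivations, extended by zero along
  the coning variable.\<close>
lemma FB_free:
 fixes P :: "(real^'n) set"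
 assumes np: "npar P" and fP: "finite P" and FB: "FB (P \<times> {p..q}) \<theta> d"
 shows "free_with_exponents (cone_arr P p q) ({#1#} + image_mset d (mset_set UNIV))"
proof -
 let ?A = "P \<times> {p..q}"
 have fA: "finite ?A" "fst ` ?A <= P" using fP by auto
 have th: "\<theta> j \<in> D0 ?A" "vhom (d j) (\<theta> j)" for j using FB by (auto simp: FB_def)
 define \<beta> where "\<beta> k i x = (case k of None => x $ i | Some j => (case i of None => 0 | Some i' => \<theta> j (fromc x) $ i'))"
  for k i :: "'n option" and x :: "real^('n option)"
 define dg where "dg k = (case k of None => 1 | Some j => d j)" for k
 have hb: "hom (dg k) (\<beta> k i)" for k i
 proof (cases k)
  case None
  have "hom 1 (%x::real^('n option). x $ i)" using rp_coord by (simp add: hom_def)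
  then show ?thesis by (simp add: None \<beta>_def[abs_def] dg_def)
 next
  case (Some j)
  show ?thesis
  proof (cases i)
   case None then show ?thesis using Some by (simp add: \<beta>_def[abs_def] dg_def hom_zero)
  next
   case (Some i')
   have "rp (%x. \<theta> j (fromc x) $ i')" using rp_linear_compose[OF _ linear_fromc, of "%z. \<theta> j z $ i'"] th(2)[of j] by (simp add: vhom_def vp_def)
   moreover have "\<theta> j (r *\<^sub>R z) = r ^ d j *\<^sub>R \<theta> j z" for r z using th(2)[of j] unfolding vhom_def by blast
   ultimately have "hom (d j) (%x. \<theta> j (fromc x) $ i')" by (simp add: hom_def linear_cmul[OF linear_fromc])
   then show ?thesis using Some \<open>k = Some j\<close> by (simp add: \<beta>_def[abs_def] dg_def)
  qed
 qed
 have da: "deriv_apply \<delta> (toc z) x = fst z * \<delta> None x + (\<Sum>i\<in>UNIV. snd z $ i * \<delta> (Some i) x)" for \<delta> z x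
  unfolding deriv_apply_def by (rule toc_inner)
 have mem: "\<beta> k \<in> der_module (cone_arr P p q)" for k
 proof -
  have "\<exists>g. rp g & (\<forall>x. deriv_apply (\<beta> k) a x = (a \<bullet> x) * g x)" if a: "a \<in> cone_arr P p q" for a
  proof (cases k)
   case None
   have "deriv_apply (\<beta> k) a x = (a \<bullet> x) * 1" for x by (simp add: None \<beta>_def deriv_apply_def inner_vec_def)
   then show ?thesis by blast
  next
   case (Some j)
   from a consider l where "l \<in> ?A" "a = toc (frm l)" | "a = toc (1, 0)" unfolding cone_arr_toc by blast
   then show ?thesis
   proof cases
    case 1
    have "pdvd (%z. frm l \<bullet> z) (%z. fst l \<bullet> \<theta> j z)"
     by (rule pdvd_linear[OF vp_inner[OF vhom_vp[OF th(2)]] frm_nonzero[OF np]]) (use 1 fA th(1)[of j] in \<open>unfold D0_def, blast+\<close>)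
    then obtain g where g: "rp g" "!!z. fst l \<bullet> \<theta> j z = (frm l \<bullet> z) * g z" by (auto simp: pdvd_def)
    have "deriv_apply (\<beta> k) a x = (a \<bullet> x) * g (fromc x)" for x
     using g(2)[of "fromc x"] unfolding 1 da inner_toc by (simp add: Some \<beta>_def frm_def inner_vec_def)
    then show ?thesis using rp_linear_compose[OF g(1) linear_fromc] by blast
   next
    case 2
    have "deriv_apply (\<beta> k) a x = (a \<bullet> x) * 0" for x unfolding 2 da by (simp add: Some \<beta>_def)
    then show ?thesis by blast
   qed
  qed
  then show ?thesis unfolding der_module_def is_poly_iff using hom_rp[OF hb] by blast
 qed
 have unq: "\<exists>!f. (\<forall>j. is_poly (f j)) & \<delta> = (%i x. \<Sum>j\<in>UNIV. f j x * \<beta> j i x)" if dm: "\<delta> \<in> der_module (cone_arr P p q)" for \<delta>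
 proof -
  have rd: "rp (\<delta> i)" for i using dm by (simp add: der_module_def is_poly_iff)
  have dv: "\<exists>g. rp g & (\<forall>x. deriv_apply \<delta> a x = (a \<bullet> x) * g x)" if "a \<in> cone_arr P p q" for a
   using dm that by (simp add: der_module_def is_poly_iff)
  obtain g where g: "rp g" "!!x. deriv_apply \<delta> (toc (1, 0)) x = (toc (1, 0) \<bullet> x) * g x" using dv[of "toc (1, 0)"] unfolding cone_arr_toc by blast
  have dN: "\<delta> None x = x $ None * g x" for x using g(2)[of x] unfolding da inner_toc by (simp add: fromc_def)
  \<comment> \<open>The condition at infinity makes the first component of \<delta> equal to g times
    the coning variable. Subtracting g times the Euler derivation leaves a field in
    \<open>D0\<close>.\<close>
  define \<Xi> where "\<Xi> z = (\<chi> i. \<delta> (Some i) (toc z) - g (toc z) * toc z $ Some i)" for z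
  have "\<Xi> \<in> D0 ?A"
  proof -
   have "rp (%z. \<delta> (Some i) (toc z) - g (toc z) * toc z $ Some i)" for i
    using rp_linear_compose[OF rd linear_toc] rp_linear_compose[OF g(1) linear_toc] rp_linear_compose[OF rp_coord linear_toc]
    by (intro real_polynomial_function_diff rp_intros(4))
   then have "vp \<Xi>" by (simp add: vp_def \<Xi>_def)
   moreover have "fst l \<bullet> \<Xi> z = 0" if l: "l \<in> ?A" "frm l \<bullet> z = 0" for l z
   proof -
    have "toc (frm l) \<in> cone_arr P p q" unfolding cone_arr_toc using l(1) by blast
    then obtain g' where "!!x. deriv_apply \<delta> (toc (frm l)) x = (toc (frm l) \<bullet> x) * g' x" using dv by blast
    then have "deriv_apply \<delta> (toc (frm l)) (toc z) = 0" using l(2) by (simp add: inner_toc fromc_toc)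
    then have "(\<Sum>i\<in>UNIV. fst l $ i * \<delta> (Some i) (toc z)) = of_int (snd l) * (fst z * g (toc z))"
     unfolding da dN by (simp add: frm_def toc_def)
    moreover have "(\<Sum>i\<in>UNIV. fst l $ i * (g (toc z) * toc z $ Some i)) = g (toc z) * (fst l \<bullet> snd z)"
     by (simp add: toc_def inner_vec_def sum_distrib_left mult_ac)
    moreover have "fst l \<bullet> snd z = of_int (snd l) * fst z" using l(2) by (simp add: frm_inner')
    ultimately show ?thesis by (simp add: \<Xi>_def inner_vec_def[of "fst l"] right_diff_distrib sum_subtractf)
   qed
   ultimately show ?thesis unfolding D0_def by blast
  qed
  then obtain f where f: "!!j. rp (f j)" "!!z. \<Xi> z = (\<Sum>j\<in>UNIV. f j z *\<^sub>R \<theta> j z)" using FB_generates[OF np fA FB] by blast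
  define F where "F k x = (case k of None => g x | Some j => f j (fromc x))" for k x
  have rF: "rp (F k)" for k
   using g(1) rp_linear_compose[OF f(1) linear_fromc] by (cases k) (simp_all add: F_def[abs_def])
  have sumb: "(\<Sum>j\<in>UNIV. G j x * \<beta> j i x) = (case i of None => G None x * x $ None
   | Some i' => G None x * x $ Some i' + (\<Sum>j\<in>UNIV. G (Some j) x * \<theta> j (fromc x) $ i'))" for G i x
   unfolding sum_option by (cases i) (simp_all add: \<beta>_def)
  show ?thesis
  proof (rule ex1I[of _ F])
   have "\<delta> i x = (\<Sum>j\<in>UNIV. F j x * \<beta> j i x)" for i x
   proof (cases i)
    case None then show ?thesis unfolding sumb by (simp add: dN F_def)
   next
    case (Some i')
    have "\<Xi> (fromc x) $ i' = (\<Sum>j\<in>UNIV. f j (fromc x) * \<theta> j (fromc x) $ i')" unfolding f(2) by simp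
    then show ?thesis using Some unfolding sumb by (simp add: F_def \<Xi>_def toc_fromc)
   qed
   then show "(\<forall>j. is_poly (F j)) & \<delta> = (%i x. \<Sum>j\<in>UNIV. F j x * \<beta> j i x)" using rF by (auto simp: is_poly_iff)
  next
   fix G assume G: "(\<forall>j. is_poly (G j)) & \<delta> = (%i x. \<Sum>j\<in>UNIV. G j x * \<beta> j i x)"
   have rG: "rp (G j)" for j using G by (simp add: is_poly_iff)
   have eq: "\<delta> i x = (\<Sum>j\<in>UNIV. G j x * \<beta> j i x)" for i x using G by meson
   have N: "G None x = g x" for x
   proof (rule rp_cancel[OF rG g(1) rp_coord[of None]])
    show "y $ None * G None y = y $ None * g y" for y using eq[of None y] unfolding sumb dN by (auto simp: mult.commute)
    show "\<exists>x::real^('n option). x $ None ~= 0" by (intro exI[of _ "\<chi> _. 1"]) simp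
   qed
   have S: "G (Some j) x = f j (fromc x)" for j x
   proof -
    let ?D = "%z. det (\<chi> i. \<theta> i z)" and ?T = "%j z. G (Some j) (toc z) - f j z"
    have rT: "rp (?T j)" for j
     using real_polynomial_function_diff[OF rp_linear_compose[OF rG linear_toc] f(1)] .
    have z0: "(\<Sum>j\<in>UNIV. ?T j z *\<^sub>R \<theta> j z) = 0" for z
    proof -
     have "(\<Sum>j\<in>UNIV. G (Some j) (toc z) * \<theta> j z $ i) = \<Xi> z $ i" for i
      using eq[of "Some i" "toc z"] unfolding sumb by (simp add: \<Xi>_def N fromc_toc)
     then have "(\<Sum>j\<in>UNIV. G (Some j) (toc z) *\<^sub>R \<theta> j z) = \<Xi> z" by (simp add: vec_eq_iff)
     then show ?thesis by (simp add: scaleR_diff_left sum_subtractf f(2))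
    qed
    have tz: "?T j z * ?D z = 0" for z
    proof (cases "?D z = 0")
     case False
     then show ?thesis using det_nonzero_independent[OF False z0, of j] by simp
    qed simp
    have rD: "rp ?D" by (rule rp_det) (rule vhom_vp[OF th(2)])
    have D0: "\<exists>z. ?D z ~= 0" using FB unfolding FB_def by blast
    have "?T j (fromc x) = 0" by (rule rp_mult_eq_0[OF rT rD tz D0])
    then show ?thesis by (simp add: toc_fromc)
   qed
   have "G k x = F k x" for k x by (cases k) (simp_all add: F_def N S)
   then show "G = F" by blast
  qed
 qed
 have "mset_set (UNIV::'n option set) = add_mset None (image_mset Some (mset_set UNIV))"
  unfolding UNIV_option_conv by (subst mset_set.insert) (auto simp: image_mset_mset_set)
 then have "image_mset dg (mset_set UNIV) = {#1#} + image_mset d (mset_set UNIV)"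
  by (simp add: dg_def image_mset.compositionality o_def)
 then show ?thesis unfolding free_with_exponents_def
  using mem homog_poly_iff_hom[OF hb] unq by (intro exI[of _ \<beta>] exI[of _ dg]) blast
qed

section \<open>Shi and Catalan arrangements\<close>

context roots begin

lemma ex_FB_cat_0: "\<exists>\<theta> d. FB (cat 0) \<theta> d & cat_degrees 0 0 d"
proof (rule shi_to_cat)
 have "shi 0 = {}" by (simp add: shi_def)
 moreover have "(\<chi> i. axis i 1) = (mat 1 :: real^'n^'n)" by (simp add: vec_eq_iff mat_def axis_def)
 ultimately show "FB (shi 0) (%i _. axis i 1) (%_. 0)" by (simp add: FB_def D0_def vhom_def vp_const)
qed simp

text \<open>The hyperplanes with k = 0 do not involve the coning variable, so setting it to 0 keeps
  the determinant a nonzero multiple of the product of the roots.\<close>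

lemma FB_cat_0_restrict:
 assumes "FB (cat 0) \<theta> d"
 shows "\<exists>\<phi> c. (\<forall>i. \<phi> i \<in> D1) & (\<forall>i. vhom (d i) (\<phi> i)) & c ~= 0 & (\<forall>x. det (\<chi> i. \<phi> i x) = c * Qp x) & sum d UNIV = card P"
proof -
 have th: "\<theta> j \<in> D0 (cat 0)" "vhom (d j) (\<theta> j)" for j using assms by (auto simp: FB_def)
 obtain c where c: "c ~= 0" "!!x. det (\<chi> i. \<theta> i x) = c * Qf (cat 0) x" using FB_det[OF npar_P finite_arr(2) fst_arr(2) assms] by blast
 have c0: "cat 0 = (%\<beta>. (\<beta>, 0)) ` P" by (auto simp: cat_def)
 have "inj_on (%\<beta>::real^'n. (\<beta>, 0::int)) P" by (auto intro: inj_onI)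
 then have Q: "Qf (cat 0) (0, y) = Qp y" for y unfolding Qf_def c0 Qp_def by (simp add: prod.reindex frm_inner)
 have cc: "card (cat 0) = card P" by (simp add: cat_def card_cartesian_product)
 have lin: "linear (%y::real^'n. (0::real, y))" by (rule linearI) auto
 have v: "vhom (d i) (%y. \<theta> i (0, y))" for i
 proof -
  have "\<theta> i (0, r *\<^sub>R y) = r ^ d i *\<^sub>R \<theta> i (0, y)" for r y
  proof -
   have "\<theta> i (r *\<^sub>R (0, y)) = r ^ d i *\<^sub>R \<theta> i (0, y)" using th(2)[of i] unfolding vhom_def by blast
   then show ?thesis by simp
  qed
  then show ?thesis using vp_linear_compose[OF vhom_vp[OF th(2)] lin] by (simp add: vhom_def)
 qed
 have "(%y. \<theta> i (0, y)) \<in> D1" for i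
 proof -
  have "\<beta> \<bullet> \<theta> i (0, y) = 0" if "\<beta> \<in> P" "\<beta> \<bullet> y = 0" for \<beta> y
  proof -
   have "(\<beta>, 0) \<in> cat 0" "frm (\<beta>, 0) \<bullet> (0, y) = 0" using that by (auto simp: cat_def frm_inner)
   then show ?thesis using th(1)[of i] unfolding D0_def by (metis (mono_tags, lifting) fst_conv mem_Collect_eq)
  qed
  then show ?thesis using vhom_vp[OF v] by (simp add: D1_def)
 qed
 then show ?thesis using v c Q assms cc
  by (intro exI[of _ "%i y. \<theta> i (0, y)"] exI[of _ c]) (auto simp: FB_def)
qed

end

lemma card_value_set:
 fixes d :: "'a::finite => nat"
 assumes "finite R" shows "card {i. d i \<in> R} = (\<Sum>r\<in>R. card {i. d i = r})"
proof -
 have "{i. d i \<in> R} = (\<Union>r\<in>R. {i. d i = r})" by auto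
 then show ?thesis using card_UN_disjoint[of R "%r. {i. d i = r}"] assms by auto
qed

lemma card_value_diff:
 fixes d :: "'a::finite => nat" shows "card {i. a <= d i} = card {i. d i = a} + card {i. Suc a <= d i}"
proof -
 have "{i. a <= d i} = {i. d i = a} \<union> {i. Suc a <= d i}" by auto
 moreover have "{i. d i = a} \<inter> {i. Suc a <= d i} = {}" by auto
 ultimately show ?thesis using card_Un_disjoint[of "{i. d i = a}" "{i. Suc a <= d i}"] by simp
qed

context coxeter begin

text \<open>Collects everything obtained from the auxiliary choices of invariant basis, eigenvector
  and top index, so that the final induction refers to d alone.\<close>

definition exps :: "('n => nat) => bool" where
 "exps d \<longleftrightarrow> hh = real h & (\<forall>i. 1 <= d i & d i < h) & (\<forall>r\<le>h. card {i. d i = r} = card {i. d i = h - r}) \<and>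
  cat_degrees 0 0 d & (\<forall>M \<delta> e. \<delta> \<in> D0 (cat M) --> vhom e \<delta> --> e < M * h --> (\<forall>x. \<delta> x = 0)) \<and>
  (\<forall>E. (\<forall>e\<in>#E. e < h) --> (\<forall>z. det (mat z - cmat C) = (\<Prod>e\<in>#E. z - exp (2 * of_real pi * \<i> * of_nat e / of_nat h)))
   --> E = image_mset d (mset_set UNIV))"

lemma ex_exps: "\<exists>d. exps d"
proof -
 obtain \<theta> d where td: "FB (cat 0) \<theta> d" "cat_degrees 0 0 d" using ex_FB_cat_0 by blast
 obtain \<phi> c where p: "!!i. \<phi> i \<in> D1" "!!i. vhom (d i) (\<phi> i)" "c ~= 0" "!!x. det (\<chi> i. \<phi> i x) = c * Qp x" "sum d UNIV = card P"
  using FB_cat_0_restrict[OF td(1)] by blast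
 obtain \<psi> c' where q: "!!i. \<psi> i \<in> D1" "!!i. vhom (d i) (\<psi> i)" "!!i. eqv (\<psi> i)" "c' ~= 0" "!!x. det (\<chi> i. \<psi> i x) = c' * Qp x"
  using invariant_basis[OF p] by blast
 obtain v \<omega> where v: "cmat C *v v = \<omega> *s v" "!!\<beta>. \<beta> \<in> \<Phi> ==> cip \<beta> v ~= 0" using regular_eigenvector by blast
 interpret spectral \<Phi> P \<Delta> L C h \<psi> d c' v \<omega> by unfold_locales (use q v p(5) in auto)
 obtain t where t: "d t = h - 1" "!!i. i ~= t ==> d i + 1 < h" using ex_top by blast
 interpret spectral_top \<Phi> P \<Delta> L C h \<psi> d c' v \<omega> t by unfold_locales (use t in auto)
 have "exps d" unfolding exps_def
  using hh_eq degree_bounds degree_duality td(2) low_cat exponents_eq_degrees by (intro conjI) blast+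
 then show ?thesis by blast
qed

lemma hh_eq_h: "hh = real h" using ex_exps unfolding exps_def by blast

lemma free_arrangements:
 "\<exists>d::'n => nat. (\<forall>m. \<exists>\<theta> d'. FB (cat m) \<theta> d' & image_mset d' (mset_set UNIV) = image_mset (%e. e + m * h) (image_mset d (mset_set UNIV))) \<and>
  (\<forall>m. \<exists>\<theta>. FB (shi m) \<theta> (%_. m * h)) \<and>
  (\<forall>E. (\<forall>e\<in>#E. e < h) --> (\<forall>z. det (mat z - cmat C) = (\<Prod>e\<in>#E. z - exp (2 * of_real pi * \<i> * of_nat e / of_nat h)))
   --> E = image_mset d (mset_set UNIV))"
proof -
 obtain d where ed: "exps d" using ex_exps by blast
 note e = ed[unfolded exps_def]
 have hh: "hh = real h" and dl: "!!i. 1 <= d i & d i < h" and dual: "!!r. r <= h ==> card {i. d i = r} = card {i. d i = h - r}"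
  and cd: "cat_degrees 0 0 d" using e by blast+
 have low: "\<forall>\<delta> e. \<delta> \<in> D0 (cat M) --> vhom e \<delta> --> e < M * h --> (\<forall>x. \<delta> x = 0)" for M using e by blast
 have E: "(\<forall>E. (\<forall>e\<in>#E. e < h) --> (\<forall>z. det (mat z - cmat C) = (\<Prod>e\<in>#E. z - exp (2 * of_real pi * \<i> * of_nat e / of_nat h)))
   --> E = image_mset d (mset_set UNIV))" using e by blast
 have lv: "card (lvl s) = card {i. s <= d i}" if "1 <= s" for s using cd that by (simp add: cat_degrees_def)
 have top: "hgt \<beta> < h" if b: "\<beta> \<in> P" for \<beta>
 proof -
  have "\<beta> \<in> lvl (hgt \<beta>)" using b by (simp add: lvl_def)
  then have "card (lvl (hgt \<beta>)) ~= 0" using finite_lvl by (metis card_0_eq empty_iff)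
  then have "{i. hgt \<beta> <= d i} ~= {}" using lv[OF hgt_ge1[OF b]] by auto
  then obtain i where "hgt \<beta> <= d i" by blast
  then show ?thesis using dl[of i] by simp
 qed
 have cl: "\<exists>\<theta> d'. FB (cat m) \<theta> d' & (\<forall>i. m * h <= d' i) & (\<forall>s. card {i. m * h + s <= d' i} = card {i. s <= d i})"
  if s: "FB (shi m) \<theta>0 (%_. m * h)" for m \<theta>0
 proof -
  obtain \<theta> d' where f: "FB (cat m) \<theta> d'" "cat_degrees m (m * h) d'" using shi_to_cat[OF s] hh by auto
  have "card {i. m * h + s <= d' i} = card {i. s <= d i}" for s
  proof (cases "s = 0")
   case True then show ?thesis using f(2) by (simp add: cat_degrees_def)
  next
   case False then show ?thesis using f(2) lv[of s] by (simp add: cat_degrees_def)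
  qed
  then show ?thesis using f unfolding cat_degrees_def by blast
 qed
 have sh: "\<exists>\<theta>. FB (shi m) \<theta> (%_. m * h)" for m
 proof (induction m)
  case 0
  have "shi 0 = {}" by (simp add: shi_def)
  moreover have "(\<chi> i. axis i 1) = (mat 1 :: real^'n^'n)" by (simp add: vec_eq_iff mat_def axis_def)
  ultimately show ?case by (intro exI[of _ "%i _. axis i 1"]) (simp add: FB_def D0_def vhom_def vp_const)
 next
  case (Suc m)
  then obtain \<theta> d' where f: "FB (cat m) \<theta> d'" "!!i. m * h <= d' i" and k: "!!s. card {i. m * h + s <= d' i} = card {i. s <= d i}"
   using cl by blast
  have b: "m * h + 1 <= d' i & d' i < Suc m * h" for i
  proof
   have "{i. 1 <= d i} = UNIV" using dl by auto
   then have "{i. m * h + 1 <= d' i} = UNIV" using k[of 1] by (intro card_subset_eq) auto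
   then show "m * h + 1 <= d' i" by blast
   have "{i. h <= d i} = {}" using dl by (auto simp: not_le)
   then have "{i. m * h + h <= d' i} = {}" using k[of h] by simp
   then show "d' i < Suc m * h" by (auto simp: not_le add.commute)
  qed
  \<comment> \<open>The complement consists of large degrees, which k counts by d. This leaves the
    number of d i at most h - j, by the symmetry of the degrees the number of d i at least j, and
    that is the number of roots of height j.\<close>
  have du: "card {i. d' i <= Suc m * h - j} = card (lvl j)" if j: "1 <= j" "j < h" for j
  proof -
   have "{i. d' i <= Suc m * h - j} = UNIV - {i. m * h + (h - j + 1) <= d' i}" using j by auto
   then have "card {i. d' i <= Suc m * h - j} = CARD('n) - card {i. h - j + 1 <= d i}" using k[of "h - j + 1"] by (simp add: card_Diff_subset)
   also have "\<dots> = card (UNIV - {i. h - j + 1 <= d i})" by (simp add: card_Diff_subset)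
   also have "UNIV - {i. h - j + 1 <= d i} = {i. d i \<in> {0..h - j}}" by auto
   also have "card \<dots> = (\<Sum>r\<in>{0..h - j}. card {i. d i = r})" by (rule card_value_set) simp
   also have "\<dots> = (\<Sum>r\<in>{j..h}. card {i. d i = r})"
    by (rule sum.reindex_bij_witness[of _ "%r. h - r" "%r. h - r"]) (use j in \<open>auto intro: dual[symmetric]\<close>)
   also have "\<dots> = card {i. d i \<in> {j..h}}" by (rule card_value_set[symmetric]) simp
   also have "{i. d i \<in> {j..h}} = {i. j <= d i}" using dl by (auto simp: less_imp_le)
   finally show ?thesis using lv[OF j(1)] by simp
  qed
  show ?case by (rule cat_to_shi[OF f(1) hh b top du low])
 qed
 have ct: "\<exists>\<theta> d'. FB (cat m) \<theta> d' & image_mset d' (mset_set UNIV) = image_mset (%e. e + m * h) (image_mset d (mset_set UNIV))" for m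
 proof -
  obtain \<theta> d' where f: "FB (cat m) \<theta> d'" "!!i. m * h <= d' i" and k: "!!s. card {i. m * h + s <= d' i} = card {i. s <= d i}"
   using cl sh by blast
  have cm: "count (image_mset g (mset_set UNIV)) a = card {i. g i = a}" for g :: "'n => nat" and a
   by (simp add: count_image_mset vimage_def)
  have "card {i. d' i = a} = card {i. d i + m * h = a}" for a
  proof (cases "m * h <= a")
   case True
   then obtain s where a: "a = m * h + s" using le_Suc_ex by blast
   have "card {i. d' i = a} = card {i. d i = s}"
    using card_value_diff[of a d'] card_value_diff[of s d] k[of s] k[of "Suc s"] unfolding a by simp
   moreover have "{i. d i + m * h = a} = {i. d i = s}" unfolding a by auto
   ultimately show ?thesis by simp
  next
   case False
   have "d' i ~= a" "d i + m * h ~= a" for i using False f(2)[of i] by auto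
   then show ?thesis by simp
  qed
  then have "image_mset d' (mset_set UNIV) = image_mset (%i. d i + m * h) (mset_set UNIV)" by (intro multiset_eqI) (simp only: cm)
  then show ?thesis using f(1) by (intro exI[of _ \<theta>] exI[of _ d']) (simp add: image_mset.compositionality o_def)
 qed
 show ?thesis by (rule exI[of _ d], intro conjI) (rule allI, rule ct, rule allI, rule sh, rule E)
qed

end

lemma coxeterI:
 assumes "root_system \<Phi>" "irreducible_rs \<Phi>" "positive_system \<Phi> P" "coxeter_element \<Phi> P C"
  "0 < h" "mat_pow C h = mat 1" "\<forall>k. 0 < k & k < h --> mat_pow C k ~= mat 1"
 obtains \<Delta> L where "coxeter \<Phi> P \<Delta> L C h"
proof -
 obtain \<Delta> L where "simple_system \<Phi> P \<Delta>" "distinct L" "set L = \<Delta>" "C = foldr (%\<alpha> M. refl_mat \<alpha> ** M) L (mat 1)"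
  using assms(4) unfolding coxeter_element_def by blast
 then have "coxeter \<Phi> P \<Delta> L C h" using assms by unfold_locales auto
 then show thesis by (rule that)
qed

theorem mainTheorem9:
  fixes \<Phi> P :: "(real^'n) set" and E :: "nat multiset" and h :: nat
  assumes "root_system \<Phi>" and "irreducible_rs \<Phi>" and "positive_system \<Phi> P"
    and "coxeter_number \<Phi> P h" and "rs_exponents \<Phi> P E"
  shows "(\<forall>m::nat. free_with_exponents (cone_arr P (- int m) (int m))
             ({#1#} + image_mset (\<lambda>e. e + m * h) E))
       \<and> (\<forall>m::nat. m \<ge> 1 \<longrightarrow> free_with_exponents (cone_arr P (1 - int m) (int m))
             ({#1#} + replicate_mset CARD('n) (m * h)))"
proof -
 obtain C' where C': "coxeter_element \<Phi> P C'" "0 < h" "mat_pow C' h = mat 1" "\<forall>k. 0 < k & k < h --> mat_pow C' k ~= mat 1"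
  using assms(4) unfolding coxeter_number_def by blast
 obtain \<Delta>' L' where "coxeter \<Phi> P \<Delta>' L' C' h" by (rule coxeterI[OF assms(1-3) C'])
 then interpret c': coxeter \<Phi> P \<Delta>' L' C' h .
 obtain C k where C: "coxeter_element \<Phi> P C" "0 < k" "mat_pow C k = mat 1" "\<forall>j. 0 < j & j < k --> mat_pow C j ~= mat 1"
  and E: "\<forall>e\<in>#E. e < k" "\<forall>z. det (mat z - cmat C) = (\<Prod>e\<in>#E. z - exp (2 * of_real pi * \<i> * of_nat e / of_nat k))"
  using assms(5) unfolding rs_exponents_def cmat_def by blast
 obtain \<Delta> L where "coxeter \<Phi> P \<Delta> L C k" by (rule coxeterI[OF assms(1-3) C])
 then interpret c: coxeter \<Phi> P \<Delta> L C k .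
 \<comment> \<open>The Coxeter number and the exponents may come from different Coxeter elements and
   simple systems; both orders equal \<open>hh\<close>, which depends on P alone.\<close>
 have "k = h" using c.hh_eq_h c'.hh_eq_h by simp
 obtain d :: "'n => nat" where d: "!!m. \<exists>\<theta> d'. FB (c.cat m) \<theta> d' & image_mset d' (mset_set UNIV) = image_mset (%e. e + m * k) (image_mset d (mset_set UNIV))"
  "!!m. \<exists>\<theta>. FB (c.shi m) \<theta> (%_. m * k)" and Ed: "E = image_mset d (mset_set UNIV)"
  using c.free_arrangements E by blast
 have "free_with_exponents (cone_arr P (- int m) (int m)) ({#1#} + image_mset (%e. e + m * h) E)" for m
 proof -
  obtain \<theta> d' where f: "FB (P \<times> {- int m..int m}) \<theta> d'" "image_mset d' (mset_set UNIV) = image_mset (%e. e + m * h) E"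
   using d(1)[of m] unfolding c.cat_def Ed \<open>k = h\<close> by blast
  show ?thesis using FB_free[OF c.npar_P c.finite_P f(1)] unfolding f(2) .
 qed
 moreover have "free_with_exponents (cone_arr P (1 - int m) (int m)) ({#1#} + replicate_mset CARD('n) (m * h))" for m
 proof -
  obtain \<theta> where f: "FB (P \<times> {1 - int m..int m}) \<theta> (%_. m * h)" using d(2)[of m] unfolding c.shi_def \<open>k = h\<close> by blast
  show ?thesis using FB_free[OF c.npar_P c.finite_P f] by (simp add: image_mset_const_eq)
 qed
 ultimately show ?thesis by blast
qed

end
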